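(* Let $d\ge 4$. For any lattice $L \in \mathcal{L}(d)$, the following hold. (1) The sets $X(L)$ and $A(L)$ are constructible; they are also $G$-invariant and $\mathcal{G}$-invariant. (2) $X(L) \subset X(d,\tau(L))$ and $A(L) \subset A(d,\tau(L))$. (3) The function $mdr : A(L) \to \mathbb{N}$ attains its minimal value on a Zariski closed subset $F$ of $A(L)$; and in general $F \ne A(L)$, i.e. there exist $d$ and $L\in\mathcal{L}(d)$ for which $F\neq A(L)$. (4) For every $k$, the function $m_k : A(L) \to \mathbb{N}$ attains its minimal value on a Zariski open subset $U_k$ of $A(L)$; and in general $U_k \ne A(L)$, i.e. there exist $d$, $L\in\mathcal{L}(d)$ and $k$ for which $U_k\neq A(L)$.
   Context: $S=\mathbb{C}[x,y,z]$, $S_m$ its degree $m$ part. $X(d)\subset\mathbb{P}(S_1)^d$ is the set of $d$-tuples of pairwise distinct classes of linear forms; $\psi(\ell_1,\dots,\ell_d)=\ell_1\cdots\ell_d\in\mathbb{P}(S_d)$; $A(d)=\psi(X(d))$ is the space of arrangements $\mathcal{A}:f=0$ of $d$ distinct lines in $\mathbb{P}^2$. $\mathcal{L}(d)$ is the set of all possible intersection lattices $L(\mathcal{A})$ of arrangements of $d$ distinct lines in $\mathbb{P}^2$, modulo lattice isomorphism. For $L\in\mathcal{L}(d)$, $X(L)$ is the set of $(\ell_1,\dots,\ell_d)\in X(d)$ such that the arrangement of the lines $\ell_1=0,\dots,\ell_d=0$ has intersection lattice isomorphic to $L$, and $A(L)=\psi(X(L))$. $\tau(L)=\sum_p(m_p-1)^2$,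 the sum over the multiple points $p$ encoded by $L$, of multiplicity $m_p\ge2$. $\tau(f)$ is the total Tjurina number of the curve $f=0$; $A(d,\tau_0)=\{f\in A(d):\tau(f)=\tau_0\}$ and $X(d,\tau_0)=\psi^{-1}(A(d,\tau_0))$. $G=\mathrm{Aut}(\mathbb{P}^2)=PGL(3,\mathbb{C})$ acts by coordinate changes on $A(d)$ and diagonally on $X(d)$. $\mathcal{G}$ is the Galois group of $\mathbb{C}$ over $\mathbb{Q}$ (the group of field automorphisms of $\mathbb{C}$), acting on $A(d)$ and $X(d)$ through the coefficients of the defining equations. $mdr(f)$ is the smallest $r\ge 0$ such that there are $a,b,c\in S_r$, not all zero, with $af_x+bf_y+cf_z=0$. $m_k(f)=\dim_{\mathbb{C}} M(f)_k$, where $M(f)=S/(f_x,f_y,f_z)$. *)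

theory Defs
  imports
    "HOL-Analysis.Analysis"
    "HOL-Library.Poly_Mapping"
    "HOL-Computational_Algebra.Fraction_Field"
begin

section \<open>Polynomials over the complex numbers\<close>

type_synonym 'v monom = "'v \<Rightarrow>\<^sub>0 nat"
type_synonym 'v mpol = "'v monom \<Rightarrow>\<^sub>0 complex"

text \<open>The ring $S = \mathbf{C}[x,y,z]$; the variables $x,y,z$ have the indices \<open>1, 2, 3\<close> of type \<open>3\<close>.\<close>

type_synonym S = "3 mpol"

definition Cst :: "complex \<Rightarrow> 'v mpol" where
  "Cst c = Poly_Mapping.single 0 c"

definition Var :: "'v \<Rightarrow> 'v mpol" where
  "Var v = Poly_Mapping.single (Poly_Mapping.single v 1) 1"

text \<open>\<open>mpeval h x F\<close> is the value of \<open>F\<close> at \<open>x\<close>, where the coefficients are sent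
  to the target ring by \<open>h\<close>: the identity for evaluation at a point, \<open>Cst\<close> for substitution.\<close>

definition mpeval :: "(complex \<Rightarrow> 'b::comm_semiring_1) \<Rightarrow> ('v \<Rightarrow> 'b) \<Rightarrow> 'v mpol \<Rightarrow> 'b" where
  "mpeval h x F =
     (\<Sum>m\<in>Poly_Mapping.keys F. h (Poly_Mapping.lookup F m) *
        (\<Prod>v\<in>Poly_Mapping.keys m. x v ^ Poly_Mapping.lookup m v))"

definition pderivative :: "'v \<Rightarrow> 'v mpol \<Rightarrow> 'v mpol" where
  "pderivative v F =
     (\<Sum>m\<in>Poly_Mapping.keys F.
        Poly_Mapping.single (m - Poly_Mapping.single v 1)
          (of_nat (Poly_Mapping.lookup m v) * Poly_Mapping.lookup F m))"

definition mdegree :: "'v monom \<Rightarrow> nat" where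
  "mdegree m = (\<Sum>v\<in>Poly_Mapping.keys m. Poly_Mapping.lookup m v)"

definition homogeneous :: "nat \<Rightarrow> 'v mpol \<Rightarrow> bool" where
  "homogeneous r F \<longleftrightarrow> (\<forall>m\<in>Poly_Mapping.keys F. mdegree m = r)"

definition S_deg :: "nat \<Rightarrow> S set" where
  "S_deg r = {F. homogeneous r F}"


section \<open>Projective spaces and the Zariski topology\<close>

text \<open>A point of $\mathbf{P}(V)$ is a class of nonzero vectors up to nonzero scalars.
  The sets and the numerical invariants of classes defined below through \<open>rep\<close>, an arbitrary
  representative, do not depend on its choice.\<close>

definition rep :: "'a set \<Rightarrow> 'a" where
  "rep P = (SOME x. x \<in> P)"

definition pclass :: "'v mpol \<Rightarrow> 'v mpol set" where
  "pclass F = {Cst c * F | c. c \<noteq> 0}"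

definition PS :: "nat \<Rightarrow> S set set" where
  "PS r = pclass ` (S_deg r - {0})"

type_synonym point = "(complex^3) set"

definition vclass :: "complex^3 \<Rightarrow> point" where
  "vclass v = {c *s v | c. c \<noteq> 0}"

definition P2 :: "point set" where
  "P2 = vclass ` (UNIV - {0})"

text \<open>The Zariski topology on $\mathbf{P}(S_r)$. The homogeneous coordinates of the class of \<open>f\<close>
  are the coefficients of \<open>f\<close>, so they are indexed by the monomials of \<open>S\<close>. The generating sets are
  closed under finite intersections (take products of polynomials), so they are a basis, and
  the closed sets are the zero loci of families of homogeneous polynomials.\<close>

definition zariski_forms :: "nat \<Rightarrow> (S set) topology" where
  "zariski_forms r = topology_generated_by
     {{P \<in> PS r. mpeval id (Poly_Mapping.lookup (rep P)) F \<noteq> 0}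
      | F :: (3 monom) mpol. \<exists>e. homogeneous e F}"

definition tuples :: "nat \<Rightarrow> (S set) list set" where
  "tuples d = {Ls. length Ls = d \<and> set Ls \<subseteq> PS 1}"

text \<open>The Zariski topology on $\mathbf{P}(S_1)^d$, given in the same way by the multihomogeneous
  polynomials in the coordinates \<open>(i, m)\<close>: the coefficient of \<open>m\<close> in the \<open>i\<close>-th linear form.\<close>

definition multihomogeneous :: "(nat \<times> 'v) mpol \<Rightarrow> bool" where
  "multihomogeneous F \<longleftrightarrow>
     (\<forall>i. \<exists>e. \<forall>m\<in>Poly_Mapping.keys F.
        (\<Sum>v\<in>{v \<in> Poly_Mapping.keys m. fst v = i}. Poly_Mapping.lookup m v) = e)"

definition zariski_tuples :: "nat \<Rightarrow> (S set) list topology" where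
  "zariski_tuples d = topology_generated_by
     {{Ls \<in> tuples d. mpeval id (\<lambda>(i, m). if i < d then Poly_Mapping.lookup (rep (Ls ! i)) m
                                          else 0) F \<noteq> 0}
      | F :: (nat \<times> 3 monom) mpol. multihomogeneous F}"

definition constructible_in :: "'a topology \<Rightarrow> 'a set \<Rightarrow> bool" where
  "constructible_in T C \<longleftrightarrow>
     (\<exists>\<C>. finite \<C> \<and> (\<forall>B\<in>\<C>. \<exists>U Z. openin T U \<and> closedin T Z \<and> B = U \<inter> Z) \<and> C = \<Union>\<C>)"


section \<open>Line arrangements and their intersection lattices\<close>

definition X_space :: "nat \<Rightarrow> (S set) list set" where
  "X_space d = {Ls \<in> tuples d. distinct Ls}"

definition psi :: "(S set) list \<Rightarrow> S set" where
  "psi Ls = pclass (prod_list (map rep Ls))"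

definition A_space :: "nat \<Rightarrow> (S set) set" where
  "A_space d = psi ` X_space d"

definition line :: "S set \<Rightarrow> point set" where
  "line P = {q \<in> P2. mpeval id (($) (rep q)) (rep P) = 0}"

text \<open>The intersections of all subfamilies, ordered by reverse inclusion. The minimal element \<open>P2\<close> is the
  intersection of the empty family; the empty set occurs (as the maximal element) exactly when
  the lines have no common point, and corresponds to the origin of $\mathbf{C}^3$.\<close>

type_synonym ilattice = "point set set"

definition intersection_lattice :: "(S set) list \<Rightarrow> ilattice" where
  "intersection_lattice Ls = {P2 \<inter> (\<Inter>P\<in>\<B>. line P) | \<B>. \<B> \<subseteq> set Ls}"

definition lattice_iso :: "ilattice \<Rightarrow> ilattice \<Rightarrow> bool" where
  "lattice_iso \<Lambda> \<Lambda>' \<longleftrightarrow>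
     (\<exists>\<phi>. bij_betw \<phi> \<Lambda> \<Lambda>' \<and> (\<forall>a\<in>\<Lambda>. \<forall>b\<in>\<Lambda>. b \<subseteq> a \<longleftrightarrow> \<phi> b \<subseteq> \<phi> a))"

text \<open>The set $\mathcal{L}(d)$: an element is an isomorphism class of intersection lattices of
  arrangements of \<open>d\<close> distinct lines.\<close>

definition lattices :: "nat \<Rightarrow> ilattice set set" where
  "lattices d =
     (let \<I> = intersection_lattice ` X_space d
      in \<I> // {(\<Lambda>, \<Lambda>'). \<Lambda> \<in> \<I> \<and> \<Lambda>' \<in> \<I> \<and> lattice_iso \<Lambda> \<Lambda>'})"

definition X_lat :: "nat \<Rightarrow> ilattice set \<Rightarrow> (S set) list set" where
  "X_lat d L = {Ls \<in> X_space d. intersection_lattice Ls \<in> L}"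

definition A_lat :: "nat \<Rightarrow> ilattice set \<Rightarrow> (S set) set" where
  "A_lat d L = psi ` X_lat d L"

text \<open>\<open>covers \<Lambda> a b\<close>: \<open>b\<close> covers \<open>a\<close> for reverse inclusion. The multiple points are the elements of
  rank 2, and the multiplicity of such a point is the number of lines (atoms) below it.\<close>

definition covers :: "ilattice \<Rightarrow> point set \<Rightarrow> point set \<Rightarrow> bool" where
  "covers \<Lambda> a b \<longleftrightarrow> a \<in> \<Lambda> \<and> b \<in> \<Lambda> \<and> b \<subset> a \<and> \<not> (\<exists>c\<in>\<Lambda>. b \<subset> c \<and> c \<subset> a)"

definition lat_atoms :: "ilattice \<Rightarrow> point set set" where
  "lat_atoms \<Lambda> = {a. covers \<Lambda> P2 a}"

definition multiple_points :: "ilattice \<Rightarrow> point set set" where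
  "multiple_points \<Lambda> = {p. \<exists>a\<in>lat_atoms \<Lambda>. covers \<Lambda> a p}"

definition point_mult :: "ilattice \<Rightarrow> point set \<Rightarrow> nat" where
  "point_mult \<Lambda> p = card {a \<in> lat_atoms \<Lambda>. p \<subseteq> a}"

definition tau_lat :: "ilattice set \<Rightarrow> nat" where
  "tau_lat L = (\<Sum>p\<in>multiple_points (rep L). (point_mult (rep L) p - 1)\<^sup>2)"


section \<open>Tjurina numbers, syzygies and the Milnor algebra\<close>

text \<open>\<open>quot_dim s V W\<close> is the (finite) dimension of $V/W$ for complex subspaces $W \subseteq V$ with
  scalar multiplication \<open>s\<close>: the size of a subset of \<open>V\<close> that maps bijectively
  to a basis of $V/W$.\<close>

definition quot_dim ::
  "(complex \<Rightarrow> 'a::ab_group_add \<Rightarrow> 'a) \<Rightarrow> 'a set \<Rightarrow> 'a set \<Rightarrow> nat" where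
  "quot_dim s V W = (THE n. \<exists>B. finite B \<and> card B = n \<and> B \<subseteq> V \<and>
     (\<forall>c. (\<Sum>b\<in>B. s (c b) b) \<in> W \<longrightarrow> (\<forall>b\<in>B. c b = 0)) \<and>
     (\<forall>v\<in>V. \<exists>c. v - (\<Sum>b\<in>B. s (c b) b) \<in> W))"

text \<open>An affine equation of $f = 0$ near $q$: $g(u,v) = f(q_0 + u w_1 + v w_2)$, where
  $q_0$ represents $q$ and $q_0, w_1, w_2$ is a basis of $\mathbf{C}^3$; then $q$
  is the origin of the chart with coordinates $u, v$ (the variables \<open>1, 2\<close> of type \<open>2\<close>).\<close>

definition frame :: "point \<Rightarrow> complex^3^3" where
  "frame q = (SOME M. invertible M \<and> column 1 M = rep q)"

definition local_eq :: "S \<Rightarrow> point \<Rightarrow> 2 mpol" where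
  "local_eq f q =
     mpeval Cst (\<lambda>i. Cst (frame q $ i $ 1) + Cst (frame q $ i $ 2) * Var 1
                       + Cst (frame q $ i $ 3) * Var 2) f"

text \<open>The local ring $\mathbf{C}[u,v]_{(u,v)}$ of the plane at the origin of the chart.\<close>

definition local_ring :: "2 mpol fract set" where
  "local_ring = {Fract a b | a b. mpeval id (\<lambda>_. 0) b \<noteq> 0}"

definition tjurina_ideal :: "2 mpol \<Rightarrow> 2 mpol fract set" where
  "tjurina_ideal g =
     {a * Fract g 1 + b * Fract (pderivative 1 g) 1 + c * Fract (pderivative 2 g) 1
      | a b c. a \<in> local_ring \<and> b \<in> local_ring \<and> c \<in> local_ring}"

definition local_tjurina :: "S \<Rightarrow> point \<Rightarrow> nat" where
  "local_tjurina f q =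
     quot_dim (\<lambda>c h. Fract (Cst c) 1 * h) local_ring (tjurina_ideal (local_eq f q))"

definition singular_points :: "S \<Rightarrow> point set" where
  "singular_points f = {q \<in> P2. mpeval id (($) (rep q)) f = 0 \<and>
                                (\<forall>i. mpeval id (($) (rep q)) (pderivative i f) = 0)}"

definition tjurina :: "S \<Rightarrow> nat" where
  "tjurina f = (\<Sum>q\<in>singular_points f. local_tjurina f q)"

definition A_tau :: "nat \<Rightarrow> nat \<Rightarrow> (S set) set" where
  "A_tau d t = {P \<in> A_space d. tjurina (rep P) = t}"

definition X_tau :: "nat \<Rightarrow> nat \<Rightarrow> (S set) list set" where
  "X_tau d t = {Ls \<in> X_space d. psi Ls \<in> A_tau d t}"

definition mdr :: "S \<Rightarrow> nat" where
  "mdr f = (LEAST r. \<exists>a\<in>S_deg r. \<exists>b\<in>S_deg r. \<exists>c\<in>S_deg r. (a, b, c) \<noteq> (0, 0, 0) \<and>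
     a * pderivative 1 f + b * pderivative 2 f + c * pderivative 3 f = 0)"

definition jacobian_ideal :: "S \<Rightarrow> S set" where
  "jacobian_ideal f =
     {a * pderivative 1 f + b * pderivative 2 f + c * pderivative 3 f | a b c. True}"

text \<open>The degree \<open>k\<close> part of $M(f) = S/J$ is the image of $S_k$, that is $S_k/(J \cap S_k)$.\<close>

definition milnor_dim :: "nat \<Rightarrow> S \<Rightarrow> nat" where
  "milnor_dim k f = quot_dim (\<lambda>c h. Cst c * h) (S_deg k) (jacobian_ideal f \<inter> S_deg k)"


section \<open>Group actions\<close>

text \<open>$PGL(3,\mathbf{C})$ acts through representatives in $GL(3,\mathbf{C})$ (the scalar matrices
  act trivially on classes), by $x_i \mapsto \sum_j M_{ij} x_j$.\<close>

definition coord_change :: "complex^3^3 \<Rightarrow> S \<Rightarrow> S" where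
  "coord_change M f = mpeval Cst (\<lambda>i. \<Sum>j\<in>UNIV. Cst (M $ i $ j) * Var j) f"

definition field_automorphism :: "(complex \<Rightarrow> complex) \<Rightarrow> bool" where
  "field_automorphism \<sigma> \<longleftrightarrow> bij \<sigma> \<and> \<sigma> 1 = 1 \<and>
     (\<forall>a b. \<sigma> (a + b) = \<sigma> a + \<sigma> b) \<and> (\<forall>a b. \<sigma> (a * b) = \<sigma> a * \<sigma> b)"

definition galois_act :: "(complex \<Rightarrow> complex) \<Rightarrow> S \<Rightarrow> S" where
  "galois_act \<sigma> f = Poly_Mapping.map \<sigma> f"

text \<open>Both actions send classes to classes, so on points of $\mathbf{P}(S_r)$ they are given by
  taking images.\<close>

definition G_invariant_forms :: "(S set) set \<Rightarrow> bool" where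
  "G_invariant_forms C \<longleftrightarrow> (\<forall>M. invertible M \<longrightarrow> (\<lambda>P. coord_change M ` P) ` C = C)"

definition G_invariant_tuples :: "(S set) list set \<Rightarrow> bool" where
  "G_invariant_tuples C \<longleftrightarrow> (\<forall>M. invertible M \<longrightarrow> map (\<lambda>P. coord_change M ` P) ` C = C)"

definition Galois_invariant_forms :: "(S set) set \<Rightarrow> bool" where
  "Galois_invariant_forms C \<longleftrightarrow>
     (\<forall>\<sigma>. field_automorphism \<sigma> \<longrightarrow> (\<lambda>P. galois_act \<sigma> ` P) ` C = C)"

definition Galois_invariant_tuples :: "(S set) list set \<Rightarrow> bool" where
  "Galois_invariant_tuples C \<longleftrightarrow>
     (\<forall>\<sigma>. field_automorphism \<sigma> \<longrightarrow> map (\<lambda>P. galois_act \<sigma> ` P) ` C = C)"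


section \<open>Loci of minimal value\<close>

definition min_locus :: "('a \<Rightarrow> nat) \<Rightarrow> 'a set \<Rightarrow> 'a set" where
  "min_locus \<phi> C = {P \<in> C. \<forall>Q\<in>C. \<phi> P \<le> \<phi> Q}"

definition mdr_locus :: "nat \<Rightarrow> ilattice set \<Rightarrow> (S set) set" where
  "mdr_locus d L = min_locus (\<lambda>P. mdr (rep P)) (A_lat d L)"

definition milnor_locus :: "nat \<Rightarrow> nat \<Rightarrow> ilattice set \<Rightarrow> (S set) set" where
  "milnor_locus k d L = min_locus (\<lambda>P. milnor_dim k (rep P)) (A_lat d L)"

end

theory Submission
  imports Defs "HOL-Computational_Algebra.Fundamental_Theorem_Algebra"
begin

text \<open>
  \<^bold>\<open>Constructibility and invariance.\<close> The intersection lattice of an arrangement is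
  determined by the set \<open>dep\<close> of the triples of indices whose linear forms have determinant zero
  (\<open>dep_eq_imp_iso\<close>). So \<open>X(L)\<close> is the union of finitely many pieces, one for each possible set \<open>T\<close> of
  dependent triples, and each piece is a difference of two closed sets: all triples of \<open>T\<close> are
  dependent, but no two forms are proportional and at most \<open>card T\<close> triples are dependent
  (\<open>stratum_diff\<close>). Both coordinate changes and field automorphisms keep the vanishing of these
  determinants, whence the invariance (\<open>strata_invariant\<close>).

  For \<open>A(L)\<close> two more facts are used. Unique factorization makes the set that is taken away saturated
  for \<open>\<psi>\<close>, so that \<open>\<psi>\<close> maps the difference to a difference (\<open>psi_stratum\<close>). And \<open>\<psi>\<close> is a closed map
  (\<open>psi_closed\<close>): near a form \<open>f\<close> with \<open>f(p) \<noteq> 0\<close>, a factorization of \<open>g\<close> into lines that do not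
  contain \<open>p\<close> is given by \<open>2 d\<close> numbers, each of them a root of a polynomial of degree \<open>d\<close> whose
  coefficients are linear in \<open>g\<close> and whose leading coefficient \<open>g(p)\<close> is not zero. Such roots
  can be eliminated one after the other (\<open>eliminate_root\<close>) by the argument behind the resultant.

  \<^bold>\<open>Tjurina numbers.\<close> The singular points of an arrangement are its multiple points. At a point of
  multiplicity \<open>m\<close> the local equation is \<open>h e\<close> where \<open>h\<close> is a product of \<open>m\<close> different lines
  through the origin and \<open>e\<close> is a unit. By Euler's relation the Tjurina ideal is generated by
  \<open>h\<^sub>u\<close> and \<open>h\<^sub>v\<close>, two binary forms of degree \<open>m - 1\<close> without a common factor; they split into lines,
  and the additivity of intersection multiplicities gives the colength \<open>(m - 1)\<^sup>2\<close>
  (\<open>local_tjurina_arrangement\<close>).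

  \<^bold>\<open>Semicontinuity.\<close> The forms \<open>m f\<^sub>x, m f\<^sub>y, m f\<^sub>z\<close> for monomials \<open>m\<close> have coefficients that are linear
  in \<open>f\<close>, and to be linearly independent is an open condition on a family of vectors with polynomial
  entries (\<open>lin_indep_near\<close>). There is a syzygy of degree \<open>r\<close> if and only if these forms with
  \<open>m\<close> of degree \<open>r\<close> are dependent, and \<open>m\<^sub>k(f)\<close> is a constant minus the rank of such a family
  (\<open>mdr_min_locus_closed\<close>, \<open>milnor_min_locus_open\<close>).

  \<^bold>\<open>The loci can be proper.\<close> This is Ziegler's pair: nine lines that join the three coordinate
  points to three further points, so that six triple points arise. For a sufficiently general choice
  of these three points the lattice does not depend on them, but there is a syzygy of degree 5 if they are on a conic
  (\<open>conical_syzygy\<close>) and none for a choice that is not on a conic (\<open>generic_no_syzygy\<close>). This changes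
  both \<open>mdr\<close> and \<open>m\<^sub>1\<^sub>3\<close>, since the partial derivatives have degree 8 and \<open>13 = 8 + 5\<close>.
\<close>

section \<open>Evaluation and substitution of polynomials\<close>

abbreviation coef :: "('a \<Rightarrow>\<^sub>0 'b::zero) \<Rightarrow> 'a \<Rightarrow> 'b" where
  "coef F m \<equiv> Poly_Mapping.lookup F m"

abbreviation supp :: "('a \<Rightarrow>\<^sub>0 'b::zero) \<Rightarrow> 'a set" where
  "supp F \<equiv> Poly_Mapping.keys F"

abbreviation term_of :: "'a \<Rightarrow> 'b \<Rightarrow> ('a \<Rightarrow>\<^sub>0 'b::zero)" where
  "term_of m c \<equiv> Poly_Mapping.single m c"

text \<open>The value of a monomial, in any commutative semiring: points, substituted polynomials
  and univariate polynomials are all plugged in through it.\<close>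

definition monom_val :: "('v \<Rightarrow> 'b::comm_semiring_1) \<Rightarrow> 'v monom \<Rightarrow> 'b" where
  "monom_val x m = (\<Prod>v\<in>supp m. x v ^ coef m v)"

lemma monom_val_superset:
  assumes "finite A" "supp m \<subseteq> A"
  shows "monom_val x m = (\<Prod>v\<in>A. x v ^ coef m v)"
  unfolding monom_val_def
  by (rule prod.mono_neutral_left) (use assms in \<open>auto simp: in_keys_iff\<close>)

lemma monom_val_add: "monom_val x (m + n) = monom_val x m * monom_val x n"
proof -
  let ?A = "supp m \<union> supp n"
  have "supp (m + n) \<subseteq> ?A" by (rule Poly_Mapping.keys_add)
  then have "monom_val x (m + n) = (\<Prod>v\<in>?A. x v ^ coef (m + n) v)"
    by (intro monom_val_superset) auto
  also have "\<dots> = (\<Prod>v\<in>?A. x v ^ coef m v) * (\<Prod>v\<in>?A. x v ^ coef n v)"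
    by (simp add: lookup_add power_add prod.distrib)
  finally show ?thesis
    using monom_val_superset[of ?A m x] monom_val_superset[of ?A n x] by simp
qed

lemma monom_val_0 [simp]: "monom_val x 0 = 1"
  by (simp add: monom_val_def)

lemma monom_val_single [simp]: "monom_val x (term_of v k) = x v ^ k"
  by (cases "k = 0") (auto simp: monom_val_def)

lemma monom_val_mult: "monom_val (\<lambda>v. x v * y v) m = monom_val x m * monom_val y m"
  by (simp add: monom_val_def power_mult_distrib prod.distrib)

lemma monom_val_scale: "monom_val (\<lambda>v. c * x v) m = c ^ mdegree m * monom_val x m"
  by (simp add: monom_val_def mdegree_def power_mult_distrib prod.distrib power_sum)

lemma sum_terms: "F = (\<Sum>m\<in>supp F. term_of m (coef F m))"
proof (rule poly_mapping_eqI)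
  fix k
  have "coef (\<Sum>m\<in>supp F. term_of m (coef F m)) k = (\<Sum>m\<in>supp F. coef F m when m = k)"
    by (simp add: lookup_sum lookup_single)
  also have "\<dots> = (\<Sum>m\<in>supp F. if m = k then coef F m else 0)"
    by (simp add: when_def)
  also have "\<dots> = coef F k"
    by (simp add: sum.delta in_keys_iff)
  finally show "coef F k = coef (\<Sum>m\<in>supp F. term_of m (coef F m)) k" ..
qed

lemma mpol_induct [case_names single add]:
  fixes F :: "'a \<Rightarrow>\<^sub>0 'b::comm_monoid_add"
  assumes "\<And>m c. P (term_of m c)" and "\<And>F G. P F \<Longrightarrow> P G \<Longrightarrow> P (F + G)"
  shows "P F"
proof -
  have "P (\<Sum>m\<in>A. term_of m (coef F m))" if "finite A" for A
    using that
  proof induction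
    case empty
    show ?case using assms(1)[of undefined 0] by simp
  qed (auto intro: assms)
  from this[of "supp F"] show ?thesis by (subst sum_terms) simp
qed

lemma term_eq_prod: "term_of m c = Cst c * monom_val Var m"
proof -
  have pow: "Var v ^ k = term_of (term_of v k) 1" for v :: 'v and k
    by (induction k) (auto simp: Var_def mult_single single_add[symmetric])
  have pr: "(\<Prod>v\<in>A. term_of (f v) (1::complex)) = term_of (\<Sum>v\<in>A. f v) 1" if "finite A"
    for A :: "'v set" and f :: "'v \<Rightarrow> 'v monom"
    using that by induction (auto simp: mult_single)
  have "monom_val Var m = (\<Prod>v\<in>supp m. term_of (term_of v (coef m v)) (1::complex))"
    by (simp add: monom_val_def pow)
  also have "\<dots> = term_of m 1"
    by (simp add: pr sum_terms[symmetric])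
  finally show ?thesis by (simp add: Cst_def mult_single)
qed

lemma Cst_0 [simp]: "Cst 0 = 0" by (simp add: Cst_def)
lemma Cst_1 [simp]: "Cst 1 = 1" by (simp add: Cst_def)
lemma Cst_add: "Cst (a + b) = Cst a + Cst b" by (simp add: Cst_def single_add)
lemma Cst_diff: "Cst (a - b) = Cst a - Cst b" by (simp add: Cst_def single_diff)
lemma Cst_minus: "Cst (- b) = - Cst b" by (simp add: Cst_def single_uminus)
lemma Cst_mult: "Cst (a * b) = Cst a * Cst b" by (simp add: Cst_def mult_single)
lemma Cst_sum: "Cst (sum f A) = (\<Sum>a\<in>A. Cst (f a))"
  by (induction A rule: infinite_finite_induct) (auto simp: Cst_add)
lemma Cst_eq_iff [simp]: "Cst a = Cst b \<longleftrightarrow> a = b"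
  by (metis Cst_def lookup_single_eq)
lemma Cst_eq_0_iff [simp]: "Cst a = 0 \<longleftrightarrow> a = 0"
  using Cst_eq_iff[of a 0] by (simp del: Cst_eq_iff)
lemma Cst_numeral: "Cst (numeral n) = numeral n"
  by (simp add: Cst_def)

lemma coef_Cst_mult [simp]: "coef (Cst c * F) m = c * coef F m"
proof (induction F rule: mpol_induct)
  case (single n a)
  then show ?case by (auto simp: Cst_def mult_single lookup_single when_def)
qed (simp add: lookup_add distrib_left)

lemma coef_term_mult: "coef (term_of n c * F) (n + m) = c * coef F m" for c :: complex and n m :: "'v monom"
proof (induction F rule: mpol_induct)
  case (single n a)
  then show ?case by (auto simp: mult_single lookup_single when_def)
qed (simp add: lookup_add distrib_left)

lemma coef_term_mult_eq_0: "\<nexists>k. m = n + k \<Longrightarrow> coef (term_of n c * F) m = 0"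
  for c :: complex and n m :: "'v monom"
proof (induction F rule: mpol_induct)
  case (single n a)
  then show ?case by (auto simp: mult_single lookup_single when_def)
qed (simp add: lookup_add distrib_left)

lemma mpol_ring_induct [case_names Cst Var add mult]:
  fixes F :: "'v mpol"
  assumes C: "\<And>c. P (Cst c)" and V: "\<And>v. P (Var v)"
    and A: "\<And>F G. P F \<Longrightarrow> P G \<Longrightarrow> P (F + G)" and M: "\<And>F G. P F \<Longrightarrow> P G \<Longrightarrow> P (F * G)"
  shows "P F"
proof (induction F rule: mpol_induct)
  case (single m c)
  have pow: "P (Var v ^ k)" for v k
    by (induction k) (use C[of 1] V M in auto)
  have "P (\<Prod>v\<in>A. Var v ^ coef m v)" if "finite A" for A
    using that by induction (use C[of 1] pow M in auto)
  then show ?case by (simp add: term_eq_prod monom_val_def C M)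
qed (rule A)

text \<open>The coefficient maps for which \<open>mpeval\<close> is a ring homomorphism. It is used
  for the values at a point (\<open>id\<close>), for substitution (\<open>Cst\<close>) and for the
  restriction to a curve with polynomial parametrization (\<open>\<lambda>c. [:c:]\<close>).\<close>

locale coeff_hom =
  fixes h :: "complex \<Rightarrow> 'b::comm_semiring_1"
  assumes h0: "h 0 = 0" and h1: "h 1 = 1"
    and h_add: "h (a + b) = h a + h b" and h_mult: "h (a * b) = h a * h b"
begin

lemma superset:
  assumes "finite A" "supp F \<subseteq> A"
  shows "mpeval h x F = (\<Sum>m\<in>A. h (coef F m) * monom_val x m)"
  unfolding mpeval_def monom_val_def
  by (rule sum.mono_neutral_left) (use assms h0 in \<open>auto simp: in_keys_iff\<close>)

lemma single [simp]: "mpeval h x (term_of m c) = h c * monom_val x m"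
  by (subst superset[of "{m}"]) auto

lemma add [simp]: "mpeval h x (F + G) = mpeval h x F + mpeval h x G"
proof -
  let ?A = "supp F \<union> supp G"
  have "supp (F + G) \<subseteq> ?A" by (rule Poly_Mapping.keys_add)
  then show ?thesis
    by (simp add: superset[of ?A] lookup_add h_add distrib_right sum.distrib)
qed

lemma Cst [simp]: "mpeval h x (Cst c) = h c" by (simp add: Cst_def)
lemma Var [simp]: "mpeval h x (Var v) = x v" by (simp add: Var_def h1)
lemma zero [simp]: "mpeval h x 0 = 0" by (simp add: mpeval_def)
lemma one [simp]: "mpeval h x 1 = 1" using Cst[of x 1] by (simp add: h1)

lemma mult [simp]: "mpeval h x (F * G) = mpeval h x F * mpeval h x G"
proof (induction F rule: mpol_induct)
  case (single m c)
  show ?case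
    by (induction G rule: mpol_induct)
      (simp_all add: mult_single monom_val_add h_mult distrib_left distrib_right ac_simps)
qed (simp add: distrib_right)

lemma sum [simp]: "mpeval h x (sum f A) = (\<Sum>a\<in>A. mpeval h x (f a))"
  by (induction A rule: infinite_finite_induct) auto
lemma prod [simp]: "mpeval h x (prod f A) = (\<Prod>a\<in>A. mpeval h x (f a))"
  by (induction A rule: infinite_finite_induct) auto
lemma prod_list [simp]: "mpeval h x (prod_list Fs) = prod_list (map (mpeval h x) Fs)"
  by (induction Fs) auto
lemma power [simp]: "mpeval h x (F ^ n) = mpeval h x F ^ n"
  by (induction n) auto

end

locale coeff_hom_ring = coeff_hom h for h :: "complex \<Rightarrow> 'b::comm_ring_1"
begin
lemma uminus [simp]: "mpeval h x (- F) = - mpeval h x F"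
  by (metis add add.left_inverse eq_neg_iff_add_eq_0 zero)
lemma diff [simp]: "mpeval h x (F - G) = mpeval h x F - mpeval h x G"
  using add[of x F "- G"] by simp
end

interpretation pt: coeff_hom_ring "id :: complex \<Rightarrow> complex" by unfold_locales auto
interpretation sb: coeff_hom_ring "Cst :: complex \<Rightarrow> 'v mpol"
  by unfold_locales (auto simp: Cst_add Cst_mult)
interpretation un: coeff_hom_ring "\<lambda>c :: complex. [:c:]"
  by unfold_locales auto

definition ev :: "('v \<Rightarrow> complex) \<Rightarrow> 'v mpol \<Rightarrow> complex" where
  "ev x F = mpeval id x F"

lemma ev_Cst [simp]: "ev x (Cst c) = c" unfolding ev_def using pt.Cst[of x c] by (metis id_apply)
lemma ev_Var [simp]: "ev x (Var v) = x v" unfolding ev_def by (rule pt.Var)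
lemma ev_0 [simp]: "ev x 0 = 0" unfolding ev_def by (rule pt.zero)
lemma ev_1 [simp]: "ev x 1 = 1" unfolding ev_def by (rule pt.one)
lemma ev_add [simp]: "ev x (F + G) = ev x F + ev x G" unfolding ev_def by (rule pt.add)
lemma ev_diff [simp]: "ev x (F - G) = ev x F - ev x G" unfolding ev_def by (rule pt.diff)
lemma ev_minus [simp]: "ev x (- F) = - ev x F" unfolding ev_def by (rule pt.uminus)
lemma ev_mult [simp]: "ev x (F * G) = ev x F * ev x G" unfolding ev_def by (rule pt.mult)
lemma ev_power [simp]: "ev x (F ^ n) = ev x F ^ n" unfolding ev_def by (rule pt.power)
lemma ev_sum [simp]: "ev x (sum f A) = (\<Sum>a\<in>A. ev x (f a))" unfolding ev_def by (rule pt.sum)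
lemma ev_prod [simp]: "ev x (prod f A) = (\<Prod>a\<in>A. ev x (f a))" unfolding ev_def by (rule pt.prod)
lemma ev_superset:
  "finite A \<Longrightarrow> supp F \<subseteq> A \<Longrightarrow> ev x F = (\<Sum>m\<in>A. coef F m * monom_val x m)"
  unfolding ev_def using pt.superset[of A F x] by (metis (no_types, lifting) id_apply sum.cong)
lemma ev_numeral [simp]: "ev x (numeral n) = numeral n"
  by (metis Cst_numeral ev_Cst)

lemma ev_subst: "ev x (mpeval Cst y F) = ev (\<lambda>v. ev x (y v)) F"
  by (induction F rule: mpol_ring_induct) auto

lemma subst_Var [simp]: "mpeval Cst Var F = F"
  by (induction F rule: mpol_ring_induct) auto

lemma subst_subst: "mpeval Cst x (mpeval Cst y F) = mpeval Cst (\<lambda>v. mpeval Cst x (y v)) F"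
  by (induction F rule: mpol_ring_induct) auto

text \<open>Distinct monomials are distinct characters of the multiplicative monoid of all points, and
  distinct characters are linearly independent (Dedekind); hence a polynomial is determined by its
  values, whatever the number of variables.\<close>

lemma monomials_independent:
  assumes "finite K" "\<And>x :: 'v \<Rightarrow> complex. (\<Sum>m\<in>K. c m * monom_val x m) = 0" "m \<in> K"
  shows "c m = 0"
  using assms
proof (induction K arbitrary: c m rule: finite_induct)
  case (insert m0 K)
  have rel: "c m0 * monom_val x m0 + (\<Sum>m\<in>K. c m * monom_val x m) = 0" for x
    using insert.prems(1)[of x] insert.hyps by simp
  have *: "c n = 0" if n: "n \<in> K" for n
  proof -
    have "n \<noteq> m0" using n insert.hyps by auto
    then obtain v where v: "coef n v \<noteq> coef m0 v" by (metis poly_mapping_eqI)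
    define y where "y = (\<lambda>w. if w = v then 2 else 1 :: complex)"
    have my: "monom_val y k = 2 ^ coef k v" for k
      by (cases "v \<in> supp k") (auto simp: monom_val_def y_def if_distrib[of "\<lambda>z. z ^ _"]
          prod.delta in_keys_iff cong: if_cong)
    have ne: "monom_val y n \<noteq> monom_val y m0"
      using v unfolding my by (metis norm_numeral norm_power numeral_eq_one_iff
          one_less_numeral_iff power_inject_exp semiring_norm(76))
    have "(\<Sum>m\<in>K. (c m * (monom_val y m - monom_val y m0)) * monom_val x m) = 0" for x
    proof -
      have "(\<Sum>m\<in>K. (c m * (monom_val y m - monom_val y m0)) * monom_val x m)
          = (\<Sum>m\<in>K. c m * monom_val (\<lambda>v. y v * x v) m) - monom_val y m0 * (\<Sum>m\<in>K. c m * monom_val x m)"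
        by (simp add: monom_val_mult sum_distrib_left sum_subtractf[symmetric] algebra_simps)
      also have "\<dots> = 0"
        using rel[of x] rel[of "\<lambda>v. y v * x v"]
        by (simp add: monom_val_mult add_eq_0_iff algebra_simps)
      finally show ?thesis .
    qed
    from insert.IH[OF this n] ne show "c n = 0" by simp
  qed
  moreover have "c m0 = 0"
    using rel[of "\<lambda>_. 1"] * by (simp add: monom_val_def)
  ultimately show ?case using insert.prems(2) by auto
qed simp

lemma mpol_eq_0I:
  assumes "\<And>x. ev x F = 0"
  shows "F = 0"
proof (rule poly_mapping_eqI)
  fix m
  have "coef F m = 0" if "m \<in> supp F"
    using monomials_independent[of "supp F" "coef F" m] assms that
    by (simp add: ev_superset[of "supp F"])
  then show "coef F m = coef 0 m" by (auto simp: in_keys_iff)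
qed

lemma mpol_eqI: "(\<And>x. ev x F = ev x G) \<Longrightarrow> F = G"
  using mpol_eq_0I[of "F - G"] by simp

text \<open>For any two points \<open>x\<close>, \<open>y\<close> of a ring, \<open>F(x) - F(y)\<close> is in the ideal of
  the differences; here all differences are multiples of one element.\<close>

lemma diff_subst_dvd:
  fixes l :: "'w mpol"
  assumes "\<And>v. l dvd x v - y v"
  shows "l dvd mpeval Cst x F - mpeval Cst y F"
proof (induction F rule: mpol_ring_induct)
  case (add F G)
  have "mpeval Cst x (F + G) - mpeval Cst y (F + G)
      = (mpeval Cst x F - mpeval Cst y F) + (mpeval Cst x G - mpeval Cst y G)" by simp
  then show ?case using add by (metis dvd_add)
next
  case (mult F G)
  have "mpeval Cst x (F * G) - mpeval Cst y (F * G)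
      = (mpeval Cst x F - mpeval Cst y F) * mpeval Cst x G
        + mpeval Cst y F * (mpeval Cst x G - mpeval Cst y G)" by (simp add: algebra_simps)
  then show ?case using mult by (metis dvd_add dvd_mult dvd_mult2)
qed (auto simp: assms)

definition linform :: "('v::finite \<Rightarrow> complex) \<Rightarrow> 'v mpol" where
  "linform a = (\<Sum>v\<in>UNIV. Cst (a v) * Var v)"

lemma ev_linform [simp]: "ev x (linform a) = (\<Sum>v\<in>UNIV. a v * x v)"
  by (simp add: linform_def)

lemma subst_linform: "mpeval Cst y (linform a) = (\<Sum>v\<in>UNIV. Cst (a v) * y v)"
  by (simp add: linform_def)

text \<open>Factor theorem for a linear form \<open>l\<close>: solving \<open>l = 0\<close> for a
  variable with nonzero coefficient gives a substitution \<open>y\<close> that differs from the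
  identity by multiples of \<open>l\<close> and has its values on the hyperplane. So
  \<open>F\<close> is congruent to \<open>F(y)\<close>, which vanishes at all points.\<close>

lemma linform_dvd_iff:
  fixes F :: "'v::finite mpol"
  assumes "a v0 \<noteq> 0"
  shows "linform a dvd F \<longleftrightarrow> (\<forall>x. (\<Sum>v\<in>UNIV. a v * x v) = 0 \<longrightarrow> ev x F = 0)"
proof safe
  fix x assume "linform a dvd F" "(\<Sum>v\<in>UNIV. a v * x v) = 0"
  then show "ev x F = 0" by (auto elim!: dvdE)
next
  assume *: "\<forall>x. (\<Sum>v\<in>UNIV. a v * x v) = 0 \<longrightarrow> ev x F = 0"
  define y where "y = (\<lambda>v. if v = v0 then Var v0 - Cst (1 / a v0) * linform a else Var v)"
  have "linform a dvd mpeval Cst Var F - mpeval Cst y F"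
    by (rule diff_subst_dvd) (auto simp: y_def)
  moreover have "mpeval Cst y F = 0"
  proof (rule mpol_eq_0I)
    fix x
    have "(\<Sum>v\<in>UNIV. a v * ev x (y v)) = a v0 * ev x (y v0) + (\<Sum>v\<in>UNIV-{v0}. a v * ev x (y v))"
      by (subst sum.remove[of _ v0]) auto
    also have "\<dots> = a v0 * (x v0 - 1 / a v0 * (\<Sum>v\<in>UNIV. a v * x v)) + (\<Sum>v\<in>UNIV-{v0}. a v * x v)"
      by (simp add: y_def)
    also have "(\<Sum>v\<in>UNIV. a v * x v) = a v0 * x v0 + (\<Sum>v\<in>UNIV-{v0}. a v * x v)"
      by (subst sum.remove[of _ v0]) auto
    also have "a v0 * (x v0 - 1 / a v0 * (a v0 * x v0 + (\<Sum>v\<in>UNIV-{v0}. a v * x v))) +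
       (\<Sum>v\<in>UNIV-{v0}. a v * x v) = 0" using assms by (simp add: field_simps)
    finally show "ev x (mpeval Cst y F) = 0" using * by (simp add: ev_subst)
  qed
  ultimately show "linform a dvd F" by simp
qed

lemma linform_eq_0_iff: "linform a = 0 \<longleftrightarrow> (\<forall>v. a v = 0)"
proof
  assume "linform a = 0"
  then have "ev (\<lambda>w. if w = v then 1 else 0) (linform a) = 0" for v by simp
  then show "\<forall>v. a v = 0" by (simp add: if_distrib cong: if_cong)
qed (simp add: linform_def)

section \<open>Gradings and homogeneous components\<close>

lemma mdegree_superset:
  assumes "finite A" "supp m \<subseteq> A"
  shows "mdegree m = (\<Sum>v\<in>A. coef m v)"
  unfolding mdegree_def
  by (rule sum.mono_neutral_left) (use assms in \<open>auto simp: in_keys_iff\<close>)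

lemma mdegree_add: "mdegree (m + n) = mdegree m + mdegree n"
proof -
  let ?A = "supp m \<union> supp n"
  have "supp (m + n) \<subseteq> ?A" by (rule Poly_Mapping.keys_add)
  then show ?thesis
    using mdegree_superset[of ?A "m + n"] mdegree_superset[of ?A m] mdegree_superset[of ?A n]
    by (simp add: lookup_add sum.distrib)
qed

lemma mdegree_0 [simp]: "mdegree 0 = 0" by (simp add: mdegree_def)
lemma mdegree_single [simp]: "mdegree (term_of v k) = k"
  by (cases "k = 0") (auto simp: mdegree_def)
lemma mdegree_UNIV: "mdegree m = (\<Sum>v\<in>UNIV. coef m v)" for m :: "'v::finite monom"
  by (rule mdegree_superset) auto

text \<open>One notion for all gradings of the polynomial ring: \<open>w\<close> is the total degree
  for homogeneous polynomials and the degree in one block of variables for multihomogeneous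
  ones.\<close>

definition graded :: "('v monom \<Rightarrow> nat) \<Rightarrow> nat \<Rightarrow> 'v mpol \<Rightarrow> bool" where
  "graded w e F \<longleftrightarrow> (\<forall>m\<in>supp F. w m = e)"

lemma homogeneous_graded: "homogeneous = graded mdegree"
  by (simp add: fun_eq_iff homogeneous_def graded_def)

lemma graded_0 [simp]: "graded w e 0" by (simp add: graded_def)

lemma graded_add: "graded w e F \<Longrightarrow> graded w e G \<Longrightarrow> graded w e (F + G)"
  using Poly_Mapping.keys_add[of F G] by (auto simp: graded_def)

lemma graded_minus: "graded w e F \<Longrightarrow> graded w e (- F)"
  by (simp add: graded_def in_keys_iff)

lemma graded_diff: "graded w e F \<Longrightarrow> graded w e G \<Longrightarrow> graded w e (F - G)"
  using graded_add[of w e F "- G"] graded_minus[of w e G] by simp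

lemma graded_sum: "(\<And>a. a \<in> A \<Longrightarrow> graded w e (f a)) \<Longrightarrow> graded w e (sum f A)"
  by (induction A rule: infinite_finite_induct) (auto intro: graded_add)

lemma graded_mult:
  assumes "\<And>m n. w (m + n) = w m + w n" "graded w d F" "graded w e G"
  shows "graded w (d + e) (F * G)"
  using Poly_Mapping.keys_mult[of F G] assms by (fastforce simp: graded_def)

lemma graded_single: "w m = e \<Longrightarrow> graded w e (term_of m c)"
  by (cases "c = 0") (auto simp: graded_def)

definition part :: "('v monom \<Rightarrow> nat) \<Rightarrow> nat \<Rightarrow> 'v mpol \<Rightarrow> 'v mpol" where
  "part w e F = (\<Sum>m\<in>{m \<in> supp F. w m = e}. term_of m (coef F m))"

lemma graded_part: "graded w e (part w e F)"
  unfolding part_def by (intro graded_sum graded_single) auto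

lemma coef_part: "coef (part w e F) m = (if w m = e then coef F m else 0)"
proof -
  have "coef (part w e F) m = (\<Sum>n\<in>{n \<in> supp F. w n = e}. if n = m then coef F n else 0)"
    by (simp add: part_def lookup_sum lookup_single when_def)
  also have "\<dots> = (if m \<in> {n \<in> supp F. w n = e} then coef F m else 0)"
    by (subst sum.delta) auto
  finally show ?thesis by (auto simp: in_keys_iff)
qed

lemma part_0 [simp]: "part w e 0 = 0" by (simp add: part_def)

lemma part_add: "part w e (F + G) = part w e F + part w e G"
  by (rule poly_mapping_eqI) (simp add: coef_part lookup_add)

lemma part_graded: "graded w d F \<Longrightarrow> part w e F = (if d = e then F else 0)"
  by (rule poly_mapping_eqI) (auto simp: coef_part graded_def in_keys_iff)

lemma sum_parts: "F = (\<Sum>e\<in>w ` supp F. part w e F)"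
proof (rule poly_mapping_eqI)
  fix m
  show "coef F m = coef (\<Sum>e\<in>w ` supp F. part w e F) m"
    by (cases "m \<in> supp F") (auto simp: lookup_sum coef_part sum.delta' in_keys_iff)
qed

lemma part_mult:
  assumes w: "\<And>m n. w (m + n) = w m + w n" and G: "graded w k G"
  shows "part w (e + k) (F * G) = part w e F * G"
proof (induction F rule: mpol_induct)
  case (single m c)
  have g: "graded w (w m + k) (term_of m c * G)"
    by (intro graded_mult w graded_single G) auto
  have "graded w (w m) (term_of m c)" by (intro graded_single) auto
  then show ?case
    by (auto simp: part_graded[OF g] part_graded[of w "w m" "term_of m c"])
qed (simp add: part_add distrib_right)

lemma hom_0 [simp]: "homogeneous r 0"
  and hom_add: "homogeneous r F \<Longrightarrow> homogeneous r G \<Longrightarrow> homogeneous r (F + G)"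
  and hom_diff: "homogeneous r F \<Longrightarrow> homogeneous r G \<Longrightarrow> homogeneous r (F - G)"
  and hom_sum: "(\<And>a. a \<in> A \<Longrightarrow> homogeneous r (f a)) \<Longrightarrow> homogeneous r (sum f A)"
  and hom_mult: "homogeneous r F \<Longrightarrow> homogeneous s G \<Longrightarrow> homogeneous (r + s) (F * G)"
  and hom_single: "mdegree m = r \<Longrightarrow> homogeneous r (term_of m c)"
  unfolding homogeneous_graded
  by (auto intro!: graded_add graded_diff graded_sum graded_mult graded_single simp: mdegree_add)

lemma hom_Cst: "homogeneous 0 (Cst c)" unfolding Cst_def by (rule hom_single) simp
lemma hom_Var: "homogeneous 1 (Var v)" unfolding Var_def by (rule hom_single) simp
lemma hom_1: "homogeneous 0 1" using hom_Cst[of 1] by simp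
lemma hom_Cst_mult: "homogeneous r F \<Longrightarrow> homogeneous r (Cst c * F)"
  using hom_mult[OF hom_Cst, of r F] by simp
lemma hom_power: "homogeneous r F \<Longrightarrow> homogeneous (n * r) (F ^ n)"
  by (induction n) (auto intro: hom_1 hom_mult)
lemma hom_linform: "homogeneous 1 (linform a)"
  unfolding linform_def by (intro hom_sum hom_Cst_mult hom_Var)
lemma hom_prod_list: "(\<And>F. F \<in> set Fs \<Longrightarrow> homogeneous 1 F) \<Longrightarrow> homogeneous (length Fs) (prod_list Fs)"
proof (induction Fs)
  case (Cons F Fs)
  then show ?case using hom_mult[of 1 F "length Fs" "prod_list Fs"] by simp
qed (simp add: hom_1)

lemma hom_ev_scale:
  assumes "homogeneous r F"
  shows "ev (\<lambda>v. c * x v) F = c ^ r * ev x F"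
  using assms by (simp add: ev_superset[of "supp F"] monom_val_scale homogeneous_def
      sum_distrib_left mult_ac)

section \<open>Partial derivatives\<close>

lemma pderivative_superset:
  assumes "finite A" "supp F \<subseteq> A"
  shows "pderivative v F
    = (\<Sum>m\<in>A. term_of (m - term_of v 1) (of_nat (coef m v) * coef F m))"
  unfolding pderivative_def
  by (rule sum.mono_neutral_left) (use assms in \<open>auto simp: in_keys_iff\<close>)

lemma pd_single: "pderivative v (term_of m c) = term_of (m - term_of v 1) (of_nat (coef m v) * c)"
  by (subst pderivative_superset[of "{m}"]) auto

lemma pd_add: "pderivative v (F + G) = pderivative v F + pderivative v G"
proof -
  let ?A = "supp F \<union> supp G"
  have "supp (F + G) \<subseteq> ?A" by (rule Poly_Mapping.keys_add)
  then show ?thesis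
    by (simp add: pderivative_superset[of ?A] lookup_add distrib_left single_add sum.distrib)
qed

lemma pd_0 [simp]: "pderivative v 0 = 0" by (simp add: pderivative_def)
lemma pd_Cst [simp]: "pderivative v (Cst c) = 0" by (simp add: Cst_def pd_single)
lemma pd_1 [simp]: "pderivative v 1 = 0" using pd_Cst[of v 1] by simp
lemma pd_Var: "pderivative v (Var w) = (if v = w then 1 else 0)"
  by (auto simp: Var_def pd_single lookup_single when_def)

lemma pd_mult: "pderivative v (F * G) = pderivative v F * G + F * pderivative v G"
proof (induction F rule: mpol_induct)
  case (single m a)
  show ?case
  proof (induction G rule: mpol_induct)
    case (single n b)
    have l: "term_of (m + n - term_of v 1) (of_nat (coef m v) * (a * b))
        = pderivative v (term_of m a) * term_of n b"
    proof (cases "coef m v = 0")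
      case False
      then have "m + n - term_of v 1 = (m - term_of v 1) + n"
        by (intro poly_mapping_eqI) (auto simp: lookup_add lookup_minus lookup_single when_def)
      then show ?thesis by (simp add: pd_single mult_single ac_simps)
    qed (simp add: pd_single)
    have r: "term_of (m + n - term_of v 1) (of_nat (coef n v) * (a * b))
        = term_of m a * pderivative v (term_of n b)"
    proof (cases "coef n v = 0")
      case False
      then have "m + n - term_of v 1 = m + (n - term_of v 1)"
        by (intro poly_mapping_eqI) (auto simp: lookup_add lookup_minus lookup_single when_def)
      then show ?thesis by (simp add: pd_single mult_single ac_simps)
    qed (simp add: pd_single)
    show ?case
      by (simp only: l[symmetric] r[symmetric])
        (simp add: mult_single pd_single lookup_add distrib_right single_add)
  qed (simp add: pd_add distrib_left)
qed (simp add: pd_add distrib_right)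

lemma pd_Cst_mult: "pderivative v (Cst c * F) = Cst c * pderivative v F"
  by (simp add: pd_mult)
lemma pd_sum: "pderivative v (sum f A) = (\<Sum>a\<in>A. pderivative v (f a))"
  by (induction A rule: infinite_finite_induct) (auto simp: pd_add)
lemma pd_linform: "pderivative v (linform a) = Cst (a v)"
  by (simp add: linform_def pd_sum pd_mult pd_Var if_distrib cong: if_cong)

lemma mdegree_minus_single:
  assumes "coef m v \<noteq> 0"
  shows "m = (m - term_of v 1) + term_of v 1" "mdegree (m - term_of v 1) = mdegree m - 1"
proof -
  show *: "m = (m - term_of v 1) + term_of v 1"
    using assms by (intro poly_mapping_eqI) (auto simp: lookup_add lookup_minus lookup_single when_def)
  show "mdegree (m - term_of v 1) = mdegree m - 1"
    by (subst (2) *) (simp add: mdegree_add)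
qed

lemma hom_pd: "homogeneous r F \<Longrightarrow> homogeneous (r - 1) (pderivative v F)"
proof -
  assume F: "homogeneous r F"
  have "homogeneous (r - 1) (term_of (m - term_of v 1) (of_nat (coef m v) * coef F m))"
    if "m \<in> supp F" for m
  proof (cases "coef m v = 0")
    case False
    then show ?thesis using F that by (intro hom_single) (auto simp: mdegree_minus_single homogeneous_def simp del: One_nat_def)
  qed auto
  then show ?thesis unfolding pderivative_def by (rule hom_sum)
qed

lemma euler:
  fixes F :: "'v::finite mpol"
  assumes "homogeneous r F"
  shows "(\<Sum>v\<in>UNIV. Var v * pderivative v F) = of_nat r * F"
proof -
  have one: "(\<Sum>v\<in>UNIV. Var v * pderivative v (term_of m c)) = of_nat (mdegree m) * term_of m c"
    for m :: "'v monom" and c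
  proof -
    have "Var v * pderivative v (term_of m c) = of_nat (coef m v) * term_of m c" for v
    proof (cases "coef m v = 0")
      case False
      then show ?thesis
        using mdegree_minus_single(1)[OF False]
        by (auto simp: pd_single Var_def mult_single add.commute of_nat_single simp del: single_of_nat)
    qed (simp add: pd_single)
    then show ?thesis by (simp add: mdegree_UNIV sum_distrib_right)
  qed
  have "(\<Sum>v\<in>UNIV. Var v * pderivative v F)
      = (\<Sum>m\<in>supp F. \<Sum>v\<in>UNIV. Var v * pderivative v (term_of m (coef F m)))"
    by (subst (1) sum_terms, subst sum.swap) (simp add: pd_sum sum_distrib_left)
  also have "\<dots> = (\<Sum>m\<in>supp F. of_nat r * term_of m (coef F m))"
    using assms by (simp add: one homogeneous_def)
  also have "\<dots> = of_nat r * F"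
    by (simp add: sum_distrib_left[symmetric] sum_terms[symmetric])
  finally show ?thesis .
qed

section \<open>Monomials of a given degree\<close>

definition Mon :: "nat \<Rightarrow> 'v monom set" where
  "Mon r = {m. mdegree m = r}"

lemma finite_Mon [simp]: "finite (Mon r :: 'v::finite monom set)"
proof -
  have "inj_on (Poly_Mapping.lookup :: 'v monom \<Rightarrow> _) (Mon r)"
    by (auto intro: inj_onI poly_mapping_eqI)
  moreover have "Poly_Mapping.lookup ` (Mon r :: 'v monom set) \<subseteq> (PiE UNIV (\<lambda>_. {..r}))"
  proof
    fix f assume "f \<in> Poly_Mapping.lookup ` (Mon r :: 'v monom set)"
    then obtain m :: "'v monom" where m: "f = coef m" "mdegree m = r" by (auto simp: Mon_def)
    have "coef m v \<le> r" for v
      using member_le_sum[of v UNIV "coef m"] m(2) by (simp add: mdegree_UNIV)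
    then show "f \<in> PiE UNIV (\<lambda>_. {..r})" using m by auto
  qed
  moreover have "finite (PiE (UNIV :: 'v set) (\<lambda>_. {..r}))" by (rule finite_PiE) auto
  ultimately show ?thesis by (meson finite_imageD finite_subset)
qed

lemma S_deg_supp: "F \<in> S_deg r \<longleftrightarrow> supp F \<subseteq> Mon r"
  by (auto simp: S_deg_def homogeneous_def Mon_def)

lemma prod_list_eq_0_iff': "prod_list xs = 0 \<longleftrightarrow> 0 \<in> set xs" for xs :: "'a::idom list"
  by (induction xs) auto

section \<open>Linear independence in polynomial families\<close>

text \<open>Gauss elimination of one equation: solve it for an unknown with nonzero coefficient and
  substitute.\<close>

lemma nontrivial_solution:
  fixes a :: "'i \<Rightarrow> 'k \<Rightarrow> 'f::field"
  assumes "finite K" "finite I" "card K < card I"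
  shows "\<exists>c. (\<exists>i\<in>I. c i \<noteq> 0) \<and> (\<forall>k\<in>K. (\<Sum>i\<in>I. c i * a i k) = 0)"
  using assms
proof (induction K arbitrary: I a rule: finite_induct)
  case empty
  then have "I \<noteq> {}" by auto
  then show ?case by (intro exI[of _ "\<lambda>_. 1"]) auto
next
  case (insert k K)
  show ?case
  proof (cases "\<forall>i\<in>I. a i k = 0")
    case True
    have "card K < card I" using insert by simp
    from insert.IH[OF insert.prems(1) this, of a] True show ?thesis by auto
  next
    case False
    then obtain i0 where i0: "i0 \<in> I" "a i0 k \<noteq> 0" by auto
    define I' where "I' = I - {i0}"
    have I': "finite I'" "card K < card I'" "i0 \<notin> I'" "I = insert i0 I'"
      using insert i0 by (auto simp: I'_def)
    obtain c where c: "\<exists>i\<in>I'. c i \<noteq> 0"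
      "\<And>l. l \<in> K \<Longrightarrow> (\<Sum>i\<in>I'. c i * (a i l - a i k / a i0 k * a i0 l)) = 0"
      using insert.IH[OF I'(1,2), of "\<lambda>i l. a i l - a i k / a i0 k * a i0 l"] by auto
    define c' where "c' = c(i0 := - (\<Sum>i\<in>I'. c i * a i k) / a i0 k)"
    have s: "(\<Sum>i\<in>I. c' i * a i l) = c' i0 * a i0 l + (\<Sum>i\<in>I'. c i * a i l)" for l
      using I' by (auto simp: c'_def intro!: sum.cong)
    have "(\<Sum>i\<in>I. c' i * a i l) = 0" if "l \<in> insert k K" for l
    proof (cases "l = k")
      case True
      then show ?thesis using i0 by (simp only: s True) (simp add: c'_def)
    next
      case False
      then have "0 = (\<Sum>i\<in>I'. c i * a i l) - (\<Sum>i\<in>I'. c i * a i k) / a i0 k * a i0 l"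
        using c(2)[of l] that
        by (simp add: algebra_simps sum_subtractf sum_distrib_left sum_distrib_right sum_divide_distrib)
      then show ?thesis by (simp only: s) (simp add: c'_def)
    qed
    moreover have "\<exists>i\<in>I. c' i \<noteq> 0" using c(1) I' by (auto simp: c'_def)
    ultimately show ?thesis by blast
  qed
qed

definition lin_indep :: "'j set \<Rightarrow> ('j \<Rightarrow> 'k \<Rightarrow> complex) \<Rightarrow> bool" where
  "lin_indep J a \<longleftrightarrow> (\<forall>c. (\<forall>k. (\<Sum>j\<in>J. c j * a j k) = 0) \<longrightarrow> (\<forall>j\<in>J. c j = 0))"

text \<open>The polynomial functions in the coordinates \<open>X i\<close> on a set of parameters.
  Closure under the operations is all that is needed of them until a polynomial is extracted
  (\<open>pfun_mpol\<close>); the number of coordinates may be infinite, as for the coefficients of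
  a form of arbitrary degree.\<close>

inductive pfun :: "('i \<Rightarrow> 's \<Rightarrow> complex) \<Rightarrow> ('s \<Rightarrow> complex) \<Rightarrow> bool" for X where
  pfun_const [intro!, simp]: "pfun X (\<lambda>s. c)"
| pfun_coord [intro!, simp]: "pfun X (X i)"
| pfun_add [intro!]: "pfun X f \<Longrightarrow> pfun X g \<Longrightarrow> pfun X (\<lambda>s. f s + g s)"
| pfun_mult [intro!]: "pfun X f \<Longrightarrow> pfun X g \<Longrightarrow> pfun X (\<lambda>s. f s * g s)"

lemma pfun_diff [intro!]:
  assumes "pfun X f" "pfun X g" shows "pfun X (\<lambda>s. f s - g s)"
  using pfun_add[OF assms(1) pfun_mult[OF pfun_const[of X "-1"] assms(2)]] by simp

lemma pfun_sum [intro!]: "(\<And>a. a \<in> A \<Longrightarrow> pfun X (f a)) \<Longrightarrow> pfun X (\<lambda>s. \<Sum>a\<in>A. f a s)"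
  by (induction A rule: infinite_finite_induct) auto

lemma pfun_prod [intro!]: "(\<And>a. a \<in> A \<Longrightarrow> pfun X (f a)) \<Longrightarrow> pfun X (\<lambda>s. \<Prod>a\<in>A. f a s)"
  by (induction A rule: infinite_finite_induct) auto

text \<open>Fraction-free Gauss elimination: pick an entry that is nonzero at \<open>s0\<close> as
  the pivot. The product of all pivots is a polynomial function, and where it does not vanish the
  elimination succeeds. So it serves as a minor that does not vanish at \<open>s0\<close>.\<close>

lemma lin_indep_near:
  assumes "finite J" "\<And>j k. j \<in> J \<Longrightarrow> pfun X (a j k)" "lin_indep J (\<lambda>j k. a j k s0)"
  obtains D where "pfun X D" "D s0 \<noteq> 0" "\<And>s. D s \<noteq> 0 \<Longrightarrow> lin_indep J (\<lambda>j k. a j k s)"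
proof -
  have "\<exists>D. pfun X D \<and> D s0 \<noteq> 0 \<and> (\<forall>s. D s \<noteq> 0 \<longrightarrow> lin_indep J (\<lambda>j k. a j k s))"
    using assms
  proof (induction J arbitrary: a rule: finite_induct)
    case empty
    show ?case by (intro exI[of _ "\<lambda>_. 1"]) (auto simp: lin_indep_def)
  next
    case (insert i J)
    have sum_ins: "(\<Sum>j\<in>insert i J. c j * b j) = c i * b i + (\<Sum>j\<in>J. c j * b j)" for c b :: "'a \<Rightarrow> complex"
      using insert.hyps by simp
    have "\<exists>k. a i k s0 \<noteq> 0"
    proof (rule ccontr)
      assume "\<not> ?thesis"
      then have "(\<Sum>j\<in>insert i J. (if j = i then 1 else 0) * a j k s0) = 0" for k
        using insert.hyps by (subst sum_ins) (auto intro!: sum.neutral)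
      then have "\<forall>j\<in>insert i J. (if j = i then 1 else 0) = (0::complex)"
        using insert.prems(2)[unfolded lin_indep_def, THEN spec, of "\<lambda>j. if j = i then 1 else 0"]
        by blast
      then show False by simp
    qed
    then obtain n where n: "a i n s0 \<noteq> 0" by auto
    \<comment> \<open>Elimination step with the pivot \<open>a i n\<close>; multiplying instead of
      dividing keeps the entries polynomial.\<close>
    define a' where "a' = (\<lambda>j k s. a i n s * a j k s - a j n s * a i k s)"
    have key: "(\<Sum>j\<in>J. c j * a' j k s)
        = a i n s * (\<Sum>j\<in>insert i J. c j * a j k s) - (\<Sum>j\<in>insert i J. c j * a j n s) * a i k s" for c k s
      unfolding sum_ins
      by (simp add: a'_def algebra_simps sum_subtractf sum_distrib_left sum_distrib_right)
    have "lin_indep J (\<lambda>j k. a' j k s0)"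
      unfolding lin_indep_def
    proof (intro allI impI)
      fix c assume c: "\<forall>k. (\<Sum>j\<in>J. c j * a' j k s0) = 0"
      define c' where "c' = (\<lambda>j. if j = i then - (\<Sum>j\<in>J. c j * a j n s0) else a i n s0 * c j)"
      have "(\<Sum>j\<in>insert i J. c' j * a j k s0) = (\<Sum>j\<in>J. c j * a' j k s0)" for k
      proof -
        have "(\<Sum>j\<in>J. c' j * a j k s0) = (\<Sum>j\<in>J. a i n s0 * c j * a j k s0)"
          using insert.hyps by (auto simp: c'_def intro!: sum.cong)
        then show ?thesis unfolding sum_ins
          by (simp add: c'_def a'_def algebra_simps sum_subtractf sum_distrib_left sum_distrib_right)
      qed
      then have "\<forall>k. (\<Sum>j\<in>insert i J. c' j * a j k s0) = 0" using c by simp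
      then have "\<forall>j\<in>insert i J. c' j = 0" using insert.prems(2) unfolding lin_indep_def by blast
      then show "\<forall>j\<in>J. c j = 0" using n insert.hyps by (auto simp: c'_def split: if_splits)
    qed
    moreover have "pfun X (a' j k)" if "j \<in> J" for j k
      unfolding a'_def using insert.prems(1) that by auto
    ultimately obtain D where D: "pfun X D" "D s0 \<noteq> 0"
      "\<And>s. D s \<noteq> 0 \<Longrightarrow> lin_indep J (\<lambda>j k. a' j k s)"
      using insert.IH[of a'] by blast
    have "lin_indep (insert i J) (\<lambda>j k. a j k s)" if s: "D s * a i n s \<noteq> 0" for s
      unfolding lin_indep_def
    proof (intro allI impI)
      fix c assume c: "\<forall>k. (\<Sum>j\<in>insert i J. c j * a j k s) = 0"
      then have "\<forall>k. (\<Sum>j\<in>J. c j * a' j k s) = 0" by (simp add: key)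
      then have *: "\<forall>j\<in>J. c j = 0" using D(3)[of s] s unfolding lin_indep_def by auto
      moreover have "c i * a i n s = 0" using c[rule_format, of n] * unfolding sum_ins by simp
      ultimately show "\<forall>j\<in>insert i J. c j = 0" using s by auto
    qed
    moreover have "pfun X (\<lambda>s. D s * a i n s)" using D(1) insert.prems(1) by auto
    ultimately show ?case using D(2) n by (intro exI[of _ "\<lambda>s. D s * a i n s"]) auto
  qed
  then show ?thesis using that by blast
qed

section \<open>Codimension of subspaces\<close>

definition indep_mod :: "(complex \<Rightarrow> 'a::ab_group_add \<Rightarrow> 'a) \<Rightarrow> 'a set \<Rightarrow> 'a set \<Rightarrow> bool" where
  "indep_mod s W B \<longleftrightarrow> (\<forall>c. (\<Sum>b\<in>B. s (c b) b) \<in> W \<longrightarrow> (\<forall>b\<in>B. c b = 0))"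

definition spans_mod :: "(complex \<Rightarrow> 'a::ab_group_add \<Rightarrow> 'a) \<Rightarrow> 'a set \<Rightarrow> 'a set \<Rightarrow> 'a set \<Rightarrow> bool" where
  "spans_mod s V W B \<longleftrightarrow> (\<forall>v\<in>V. \<exists>c. v - (\<Sum>b\<in>B. s (c b) b) \<in> W)"

text \<open>The relation behind \<open>quot_dim\<close>. It has the advantage over a function that
  it implies finiteness.\<close>

definition has_codim :: "(complex \<Rightarrow> 'a::ab_group_add \<Rightarrow> 'a) \<Rightarrow> 'a set \<Rightarrow> 'a set \<Rightarrow> nat \<Rightarrow> bool" where
  "has_codim s V W n \<longleftrightarrow> (\<exists>B. finite B \<and> card B = n \<and> B \<subseteq> V \<and> indep_mod s W B \<and> spans_mod s V W B)"

locale cvs = vector_space s for s :: "complex \<Rightarrow> 'a::ab_group_add \<Rightarrow> 'a"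
begin

text \<open>More vectors than the size of a spanning set satisfy a linear relation, as the
  homogeneous system for its coefficients has more unknowns than equations.\<close>

lemma indep_le_spans:
  assumes W: "subspace W" and B: "finite B" "spans_mod s V W B"
    and C: "finite C" "C \<subseteq> V" "indep_mod s W C"
  shows "card C \<le> card B"
proof (rule ccontr)
  assume "\<not> card C \<le> card B"
  then have lt: "card B < card C" by simp
  obtain a where a: "\<And>v. v \<in> C \<Longrightarrow> v - (\<Sum>b\<in>B. s (a v b) b) \<in> W"
    using B(2) C(2) unfolding spans_mod_def by (metis subsetD)
  obtain c where c: "\<exists>v\<in>C. c v \<noteq> 0" "\<forall>b\<in>B. (\<Sum>v\<in>C. c v * a v b) = 0"
    using nontrivial_solution[OF B(1) C(1) lt] by blast
  have "(\<Sum>v\<in>C. s (c v) (v - (\<Sum>b\<in>B. s (a v b) b))) \<in> W"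
    by (intro subspace_sum[OF W] subspace_scale[OF W] a)
  also have "(\<Sum>v\<in>C. s (c v) (v - (\<Sum>b\<in>B. s (a v b) b)))
      = (\<Sum>v\<in>C. s (c v) v) - (\<Sum>b\<in>B. s (\<Sum>v\<in>C. c v * a v b) b)"
    by (simp add: scale_right_diff_distrib sum_subtractf scale_sum_right scale_sum_left
        sum.swap[of _ B C])
  also have "\<dots> = (\<Sum>v\<in>C. s (c v) v)" using c(2) by simp
  finally show False using C(3) c(1) unfolding indep_mod_def by blast
qed

lemma has_codim_unique:
  assumes "subspace W" "has_codim s V W n" "has_codim s V W m"
  shows "n = m"
proof -
  have "m \<le> n" if "has_codim s V W n" "has_codim s V W m" for n m
    using that indep_le_spans[OF assms(1)] unfolding has_codim_def by blast
  then show ?thesis using assms(2,3) by (metis order_antisym)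
qed

lemma quot_dim_eqI:
  assumes "subspace W" "has_codim s V W n"
  shows "quot_dim s V W = n"
proof -
  have "quot_dim s V W = (THE n. has_codim s V W n)"
    unfolding quot_dim_def has_codim_def indep_mod_def spans_mod_def ..
  also have "\<dots> = n"
    by (rule the_equality) (use assms has_codim_unique in blast)+
  finally show ?thesis .
qed

lemma has_codim_refl: "subspace W \<Longrightarrow> has_codim s W W 0"
  unfolding has_codim_def by (rule exI[of _ "{}"]) (auto simp: indep_mod_def spans_mod_def)

text \<open>Dimensions add up along \<open>W \<subseteq> U \<subseteq> V\<close>: the union of a
  basis of \<open>V/U\<close> and one of \<open>U/W\<close> is a basis of
  \<open>V/W\<close>.\<close>

lemma has_codim_trans:
  assumes UW: "W \<subseteq> U" "U \<subseteq> V" "subspace W" "subspace U"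
    and "has_codim s V U m" "has_codim s U W n"
  shows "has_codim s V W (m + n)"
proof -
  obtain B where B: "finite B" "card B = m" "B \<subseteq> V" "indep_mod s U B" "spans_mod s V U B"
    using assms(5) by (auto simp: has_codim_def)
  obtain C where C: "finite C" "card C = n" "C \<subseteq> U" "indep_mod s W C" "spans_mod s U W C"
    using assms(6) by (auto simp: has_codim_def)
  have disj: "B \<inter> C = {}"
  proof (rule ccontr)
    assume "B \<inter> C \<noteq> {}"
    then obtain b where b: "b \<in> B" "b \<in> U" using C by auto
    have "(\<Sum>x\<in>B. s (if x = b then 1 else 0) x) = b"
      using B(1) b by (simp add: if_distrib[of "\<lambda>c. s c _"] cong: if_cong)
    then show False
      using B(4)[unfolded indep_mod_def, THEN spec, of "\<lambda>x. if x = b then 1 else 0"] b by auto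
  qed
  have su: "(\<Sum>x\<in>B \<union> C. s (c x) x) = (\<Sum>x\<in>B. s (c x) x) + (\<Sum>x\<in>C. s (c x) x)" for c
    using B(1) C(1) disj by (simp add: sum.union_disjoint)
  have CU: "(\<Sum>x\<in>C. s (c x) x) \<in> U" for c
    by (intro subspace_sum[OF UW(4)] subspace_scale[OF UW(4)]) (use C in auto)
  have "indep_mod s W (B \<union> C)"
    unfolding indep_mod_def
  proof (intro allI impI)
    fix c assume c: "(\<Sum>x\<in>B \<union> C. s (c x) x) \<in> W"
    then have "(\<Sum>x\<in>B. s (c x) x) + (\<Sum>x\<in>C. s (c x) x) \<in> U" using su UW(1) by auto
    then have "(\<Sum>x\<in>B. s (c x) x) \<in> U"
      using CU[of c] UW(4) by (metis add_diff_cancel_right' subspace_diff)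
    then have b: "\<forall>b\<in>B. c b = 0" using B(4) unfolding indep_mod_def by blast
    then have "(\<Sum>x\<in>C. s (c x) x) \<in> W" using c su by simp
    then show "\<forall>b\<in>B \<union> C. c b = 0" using b C(4) unfolding indep_mod_def by blast
  qed
  moreover have "spans_mod s V W (B \<union> C)"
    unfolding spans_mod_def
  proof
    fix v assume "v \<in> V"
    then obtain c where c: "v - (\<Sum>x\<in>B. s (c x) x) \<in> U" using B(5) unfolding spans_mod_def by blast
    then obtain e where e: "v - (\<Sum>x\<in>B. s (c x) x) - (\<Sum>x\<in>C. s (e x) x) \<in> W"
      using C(5) unfolding spans_mod_def by blast
    define g where "g x = (if x \<in> B then c x else e x)" for x
    have "(\<Sum>x\<in>B. s (g x) x) = (\<Sum>x\<in>B. s (c x) x)" "(\<Sum>x\<in>C. s (g x) x) = (\<Sum>x\<in>C. s (e x) x)"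
      using disj by (auto simp: g_def intro!: sum.cong)
    then show "\<exists>c. v - (\<Sum>x\<in>B \<union> C. s (c x) x) \<in> W"
      using e by (intro exI[of _ g]) (simp add: su diff_diff_eq)
  qed
  ultimately show ?thesis
    unfolding has_codim_def using B C UW disj
    by (intro exI[of _ "B \<union> C"]) (auto simp: card_Un_disjoint)
qed

text \<open>If \<open>T\<close> induces an isomorphism from \<open>V/W'\<close> to
  \<open>U/W\<close> then it maps a basis of the first space to one of the second.\<close>

lemma has_codim_image:
  assumes add: "\<And>x y. T (x + y) = T x + T y" and scale: "\<And>c x. T (s c x) = s c (T x)"
    and W: "subspace W" "W \<subseteq> U" "subspace V" and TV: "T ` V \<subseteq> U"
    and onto: "\<And>u. u \<in> U \<Longrightarrow> \<exists>v\<in>V. u - T v \<in> W"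
    and ker: "\<And>v. v \<in> V \<Longrightarrow> T v \<in> W \<longleftrightarrow> v \<in> W'"
    and "has_codim s V W' n"
  shows "has_codim s U W n"
proof -
  obtain B where B: "finite B" "card B = n" "B \<subseteq> V" "indep_mod s W' B" "spans_mod s V W' B"
    using assms(9) by (auto simp: has_codim_def)
  have T0: "T 0 = 0" using add[of 0 0] by simp
  have Tm: "T (- x) = - T x" for x using add[of x "- x"] T0 by (simp add: eq_neg_iff_add_eq_0 add.commute)
  have Td: "T (x - y) = T x - T y" for x y using add[of x "- y"] Tm by simp
  have Ts: "T (\<Sum>b\<in>B. s (c b) b) = (\<Sum>b\<in>B. s (c b) (T b))" for c
    using B(1) by induction (auto simp: T0 add scale)
  have inV: "(\<Sum>b\<in>B. s (c b) b) \<in> V" for c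
    by (intro subspace_sum[OF W(3)] subspace_scale[OF W(3)]) (use B in auto)
  have inj: "inj_on T B"
  proof (rule inj_onI, rule ccontr)
    fix x y assume xy: "x \<in> B" "y \<in> B" "T x = T y" "x \<noteq> y"
    define c where "c b = (if b = x then 1 else 0) + (if b = y then -1 else 0 :: complex)" for b
    have "(\<Sum>b\<in>B. s (c b) b) = x - y"
      using B(1) xy by (simp add: c_def scale_left_distrib sum.distrib if_distrib[of "\<lambda>c. s c _"] cong: if_cong)
    moreover have "x - y \<in> W'"
      using ker[of "x - y"] subspace_diff[OF W(3), of x y] xy B(3) subspace_0[OF W(1)]
      by (auto simp: Td)
    ultimately have "c x = 0" using B(4)[unfolded indep_mod_def, THEN spec, of c] xy by auto
    then show False using xy by (simp add: c_def)
  qed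
  have si: "(\<Sum>b\<in>T ` B. s (c b) b) = T (\<Sum>b\<in>B. s (c (T b)) b)" for c
    by (simp add: sum.reindex[OF inj] Ts)
  have "indep_mod s W (T ` B)"
    using B(4) ker[OF inV] unfolding indep_mod_def si by auto
  moreover have "spans_mod s U W (T ` B)"
    unfolding spans_mod_def
  proof
    fix u assume "u \<in> U"
    then obtain v where v: "v \<in> V" "u - T v \<in> W" using onto by blast
    obtain c where c: "v - (\<Sum>b\<in>B. s (c b) b) \<in> W'" using B(5) v unfolding spans_mod_def by blast
    then have "T (v - (\<Sum>b\<in>B. s (c b) b)) \<in> W"
      using ker[of "v - (\<Sum>b\<in>B. s (c b) b)"] v W inV by (auto simp: subspace_diff)
    then have *: "u - T (\<Sum>b\<in>B. s (c b) b) \<in> W"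
      using subspace_add[OF W(1) v(2)] by (fastforce simp: Td)
    define c' where "c' = c \<circ> inv_into B T"
    have "(\<Sum>b\<in>T ` B. s (c' b) b) = T (\<Sum>b\<in>B. s (c b) b)"
      unfolding si by (intro arg_cong[of _ _ T] sum.cong) (auto simp: c'_def inj)
    then show "\<exists>c. u - (\<Sum>b\<in>T ` B. s (c b) b) \<in> W" using * by (intro exI[of _ c']) simp
  qed
  ultimately show ?thesis
    unfolding has_codim_def using B TV inj by (intro exI[of _ "T ` B"]) (auto simp: card_image)
qed

lemma indep_mod_mono: "W \<subseteq> W' \<Longrightarrow> indep_mod s W' B \<Longrightarrow> indep_mod s W B"
  unfolding indep_mod_def by blast

lemma maximal_indep_spans:
  assumes W: "subspace W" and B: "finite B" "indep_mod s W B"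
    and v: "v \<in> B \<or> \<not> indep_mod s W (insert v B)"
  shows "\<exists>c. v - (\<Sum>b\<in>B. s (c b) b) \<in> W"
proof (cases "v \<in> B")
  case True
  have "(\<Sum>b\<in>B. s (if b = v then 1 else 0) b) = v"
    using B(1) True by (simp add: if_distrib[of "\<lambda>c. s c _"] cong: if_cong)
  then show ?thesis
    using W by (intro exI[of _ "\<lambda>b. if b = v then 1 else 0"]) (simp add: subspace_0)
next
  case False
  then obtain c where c: "(\<Sum>b\<in>insert v B. s (c b) b) \<in> W" "\<exists>b\<in>insert v B. c b \<noteq> 0"
    using v unfolding indep_mod_def by blast
  have sv: "(\<Sum>b\<in>insert v B. s (c b) b) = s (c v) v + (\<Sum>b\<in>B. s (c b) b)"
    using B(1) False by simp
  have cv: "c v \<noteq> 0"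
  proof
    assume "c v = 0"
    then have "(\<Sum>b\<in>B. s (c b) b) \<in> W" using c(1) sv by simp
    then show False using B(2) c(2) \<open>c v = 0\<close> unfolding indep_mod_def by blast
  qed
  have "s (1 / c v) (s (c v) v + (\<Sum>b\<in>B. s (c b) b)) \<in> W"
    using c(1) sv W by (metis subspace_scale)
  then have "v - (\<Sum>b\<in>B. s (- c b / c v) b) \<in> W"
    using cv by (simp add: scale_right_distrib scale_sum_right sum_negf)
  then show ?thesis by (intro exI[of _ "\<lambda>b. - c b / c v"])
qed

text \<open>A maximal independent subset of the generators spans them; it exists because sizes of
  independent subsets are bounded by the dimension of \<open>V\<close>.\<close>

lemma basis_from_generators:
  assumes V: "has_codim s V {0} N" and G: "G \<subseteq> V"
  obtains B where "finite B" "B \<subseteq> G" "indep_mod s {0} B" "\<And>g. g \<in> G \<Longrightarrow> \<exists>c. g = (\<Sum>b\<in>B. s (c b) b)"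
proof -
  obtain E where E: "finite E" "card E = N" "spans_mod s V {0} E"
    using V unfolding has_codim_def by auto
  define P where "P k = (\<exists>B. finite B \<and> card B = k \<and> B \<subseteq> G \<and> indep_mod s {0} B)" for k
  have bd: "k \<le> N" if "P k" for k
    using that indep_le_spans[OF subspace_single_0 E(1,3)] G E(2) unfolding P_def by blast
  have "P 0" unfolding P_def by (rule exI[of _ "{}"]) (auto simp: indep_mod_def)
  then obtain k where k: "P k" "\<And>l. P l \<Longrightarrow> l \<le> k"
    using Greatest_le_nat[of P] GreatestI_nat[of P] bd by blast
  then obtain B where B: "finite B" "card B = k" "B \<subseteq> G" "indep_mod s {0} B"
    unfolding P_def by blast
  have "\<exists>c. g = (\<Sum>b\<in>B. s (c b) b)" if g: "g \<in> G" for g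
  proof -
    have "g \<in> B \<or> \<not> indep_mod s {0} (insert g B)"
    proof (rule ccontr)
      assume "\<not> ?thesis"
      then have "P (Suc k)" unfolding P_def using B g by (intro exI[of _ "insert g B"]) auto
      then show False using k(2) by fastforce
    qed
    from maximal_indep_spans[OF subspace_single_0 B(1,4) this] show ?thesis by auto
  qed
  with B that show thesis by blast
qed

text \<open>Vectors that are independent modulo \<open>W\<close> are independent in
  \<open>V\<close>, so there is a maximal such set.\<close>

lemma has_codim_exists:
  assumes V: "has_codim s V {0} N" and W: "subspace W"
  obtains n where "has_codim s V W n"
proof -
  obtain E where E: "finite E" "card E = N" "spans_mod s V {0} E"
    using V unfolding has_codim_def by auto
  define P where "P k = (\<exists>B. finite B \<and> card B = k \<and> B \<subseteq> V \<and> indep_mod s W B)" for k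
  have bd: "k \<le> N" if "P k" for k
  proof -
    obtain B where B: "finite B" "card B = k" "B \<subseteq> V" "indep_mod s W B"
      using \<open>P k\<close> unfolding P_def by auto
    moreover have "indep_mod s {0} B" using B(4) subspace_0[OF W] by (auto intro: indep_mod_mono)
    ultimately show ?thesis using indep_le_spans[OF subspace_single_0 E(1,3)] E(2) by metis
  qed
  have "P 0" unfolding P_def by (rule exI[of _ "{}"]) (auto simp: indep_mod_def)
  then obtain k where k: "P k" "\<And>l. P l \<Longrightarrow> l \<le> k"
    using Greatest_le_nat[of P] GreatestI_nat[of P] bd by blast
  then obtain B where B: "finite B" "card B = k" "B \<subseteq> V" "indep_mod s W B"
    unfolding P_def by blast
  have "\<exists>c. v - (\<Sum>b\<in>B. s (c b) b) \<in> W" if v: "v \<in> V" for v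
  proof -
    have "v \<in> B \<or> \<not> indep_mod s W (insert v B)"
    proof (rule ccontr)
      assume "\<not> ?thesis"
      then have "P (Suc k)" unfolding P_def using B v by (intro exI[of _ "insert v B"]) auto
      then show False using k(2) by fastforce
    qed
    from maximal_indep_spans[OF W B(1,4) this] show ?thesis .
  qed
  then have "has_codim s V W k" unfolding has_codim_def spans_mod_def using B by blast
  then show thesis by (rule that)
qed

end

section \<open>Projective classes and the Zariski topology on forms\<close>

lemma pclass_self: "F \<in> pclass F"
  unfolding pclass_def by (rule CollectI, rule exI[of _ 1]) simp

lemma rep_pclass: obtains c where "c \<noteq> 0" "rep (pclass F) = Cst c * F"
proof -
  have "rep (pclass F) \<in> pclass F" unfolding rep_def using pclass_self by (rule someI)
  then show thesis using that by (auto simp: pclass_def)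
qed

lemma Cst_mult_cancel: "c \<noteq> 0 \<Longrightarrow> Cst (1 / c) * (Cst c * F) = F"
  by (simp add: Cst_mult[symmetric] mult.assoc[symmetric])

lemma pclass_scale: "c \<noteq> 0 \<Longrightarrow> pclass (Cst c * F) = pclass F"
proof -
  assume c: "c \<noteq> 0"
  have "Cst e * F = Cst (e / c) * (Cst c * F)" for e
    using c by (simp add: Cst_mult[symmetric] mult.assoc[symmetric])
  moreover have "Cst e * (Cst c * F) = Cst (e * c) * F" for e
    by (simp add: Cst_mult mult.assoc)
  ultimately show ?thesis using c unfolding pclass_def
    by (metis (no_types, opaque_lifting) divide_eq_0_iff mult_eq_0_iff)
qed

lemma S_deg_scale: "F \<in> S_deg r \<Longrightarrow> Cst c * F \<in> S_deg r"
  by (simp add: S_deg_def hom_Cst_mult)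

lemma PS_rep:
  assumes "P \<in> PS r"
  shows "rep P \<in> S_deg r" "rep P \<noteq> 0" "pclass (rep P) = P"
proof -
  obtain F where F: "F \<in> S_deg r" "F \<noteq> 0" "P = pclass F" using assms by (auto simp: PS_def)
  obtain c where "c \<noteq> 0" "rep (pclass F) = Cst c * F" by (rule rep_pclass)
  then show "rep P \<in> S_deg r" "rep P \<noteq> 0" "pclass (rep P) = P"
    using F by (auto simp: S_deg_scale pclass_scale)
qed

lemma pclass_PS: "F \<in> S_deg r \<Longrightarrow> F \<noteq> 0 \<Longrightarrow> pclass F \<in> PS r"
  by (auto simp: PS_def)

abbreviation Xc :: "'m \<Rightarrow> ('m \<Rightarrow>\<^sub>0 complex) \<Rightarrow> complex" where "Xc \<equiv> \<lambda>m f. coef f m"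

lemma pfun_mpol:
  assumes "pfun X g"
  obtains F where "\<And>s. g s = ev (\<lambda>i. X i s) F"
proof -
  from assms have "\<exists>F. \<forall>s. g s = ev (\<lambda>i. X i s) F"
  proof induction
    case (pfun_const c) then show ?case by (intro exI[of _ "Cst c"]) simp
  next
    case (pfun_coord i) then show ?case by (intro exI[of _ "Var i"]) simp
  next
    case (pfun_add f g)
    then obtain F G where "\<forall>s. f s = ev (\<lambda>i. X i s) F" "\<forall>s. g s = ev (\<lambda>i. X i s) G" by blast
    then show ?case by (intro exI[of _ "F + G"]) simp
  next
    case (pfun_mult f g)
    then obtain F G where "\<forall>s. f s = ev (\<lambda>i. X i s) F" "\<forall>s. g s = ev (\<lambda>i. X i s) G" by blast
    then show ?case by (intro exI[of _ "F * G"]) simp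
  qed
  then show ?thesis using that by blast
qed

lemma vanishing_power_sum:
  assumes "finite E" "\<And>c. c \<noteq> 0 \<Longrightarrow> (\<Sum>e\<in>E. a e * c ^ e) = (0::complex)" "e \<in> E"
  shows "a e = 0"
proof -
  define p where "p = (\<Sum>e\<in>E. monom (a e) e)"
  have "poly p c = 0" if "c \<noteq> 0" for c
    using assms(2)[OF that] by (simp add: p_def poly_sum poly_monom)
  then have "UNIV - {0} \<subseteq> {c. poly p c = 0}" by auto
  moreover have "infinite (UNIV - {0::complex})" by (simp add: infinite_UNIV_char_0)
  ultimately have "p = 0" using poly_roots_finite infinite_super by blast
  then have "coeff p e = 0" by simp
  then show ?thesis using assms(1,3) by (simp add: p_def coeff_sum if_distrib sum.delta cong: if_cong)
qed

lemma zariski_open_basic: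
  "homogeneous e F \<Longrightarrow> openin (zariski_forms r) {P \<in> PS r. ev (coef (rep P)) F \<noteq> 0}"
  unfolding zariski_forms_def ev_def by (rule topology_generated_by_Basis) blast

lemma topspace_zariski_forms [simp]: "topspace (zariski_forms r) = PS r"
proof -
  have "{P \<in> PS r. mpeval id (coef (rep P)) 1 \<noteq> 0} = PS r" by simp
  then show ?thesis
    unfolding zariski_forms_def topology_generated_by_topspace using hom_1
    by (auto 4 4)
qed

text \<open>A polynomial function that vanishes on a cone can be replaced by one of its homogeneous
  components. So closed subsets of $\mathbf{P}(S_r)$ may be cut out by inhomogeneous
  equations.\<close>

lemma cone_complement_open:
  fixes K :: "S \<Rightarrow> bool"
  assumes cone: "\<And>f c. K f \<Longrightarrow> c \<noteq> 0 \<Longrightarrow> K (Cst c * f)"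
    and D: "pfun Xc D" "\<And>f. K f \<Longrightarrow> D f = 0" and P0: "P0 \<in> PS r" "D (rep P0) \<noteq> 0"
  obtains U where "openin (zariski_forms r) U" "P0 \<in> U" "\<And>P. P \<in> U \<Longrightarrow> P \<in> PS r \<and> \<not> K (rep P)"
proof -
  obtain F where F: "D f = ev (coef f) F" for f using pfun_mpol[OF D(1)] by auto
  define E where "E = mdegree ` supp F"
  have E: "finite E" by (simp add: E_def)
  have parts: "ev x F = (\<Sum>e\<in>E. ev x (part mdegree e F))" for x
    using arg_cong[OF sum_parts[of F mdegree], of "ev x"] unfolding E_def by simp
  have hom: "homogeneous e (part mdegree e F)" for e
    unfolding homogeneous_graded by (rule graded_part)
  obtain e where e: "e \<in> E" "ev (coef (rep P0)) (part mdegree e F) \<noteq> 0"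
    using P0(2) unfolding F parts by (metis sum.neutral)
  show thesis
  proof
    show "openin (zariski_forms r) {P \<in> PS r. ev (coef (rep P)) (part mdegree e F) \<noteq> 0}"
      by (rule zariski_open_basic[OF hom])
    show "P0 \<in> {P \<in> PS r. ev (coef (rep P)) (part mdegree e F) \<noteq> 0}" using P0 e by simp
    fix P assume P: "P \<in> {P \<in> PS r. ev (coef (rep P)) (part mdegree e F) \<noteq> 0}"
    have "\<not> K (rep P)"
    proof
      assume K: "K (rep P)"
      have "(\<Sum>e\<in>E. ev (coef (rep P)) (part mdegree e F) * c ^ e) = 0" if "c \<noteq> 0" for c
      proof -
        have "coef (Cst c * rep P) = (\<lambda>v. c * coef (rep P) v)" by auto
        moreover have "0 = ev (coef (Cst c * rep P)) F"
          using D(2)[OF cone[OF K that]] unfolding F by (rule sym)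
        ultimately have "0 = ev (\<lambda>v. c * coef (rep P) v) F" by (simp only:)
        then show ?thesis unfolding parts by (simp add: hom_ev_scale[OF hom] mult.commute)
      qed
      \<comment> \<open>\<open>D\<close> vanishes on all multiples of \<open>rep P\<close>, and a
        polynomial in the scalar with infinitely many zeros has no nonzero coefficient.\<close>
      from vanishing_power_sum[OF E this e(1)] P show False by simp
    qed
    then show "P \<in> PS r \<and> \<not> K (rep P)" using P by simp
  qed
qed

lemma closedin_zariski_forms:
  fixes K :: "S \<Rightarrow> bool"
  assumes cone: "\<And>f c. K f \<Longrightarrow> c \<noteq> 0 \<Longrightarrow> K (Cst c * f)"
    and D: "\<And>f. f \<in> S_deg r \<Longrightarrow> f \<noteq> 0 \<Longrightarrow> \<not> K f
        \<Longrightarrow> \<exists>D. pfun Xc D \<and> D f \<noteq> 0 \<and> (\<forall>g. K g \<longrightarrow> D g = 0)"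
  shows "closedin (zariski_forms r) {P \<in> PS r. K (rep P)}"
proof -
  have "openin (zariski_forms r) (PS r - {P \<in> PS r. K (rep P)})"
  proof (subst openin_subopen, intro ballI)
    fix P assume "P \<in> PS r - {P \<in> PS r. K (rep P)}"
    then have P: "P \<in> PS r" "\<not> K (rep P)" by auto
    then obtain D where D': "pfun Xc D" "D (rep P) \<noteq> 0" "\<forall>g. K g \<longrightarrow> D g = 0"
      using D[of "rep P"] PS_rep[OF P(1)] by blast
    obtain U where "openin (zariski_forms r) U" "P \<in> U" "\<And>P. P \<in> U \<Longrightarrow> P \<in> PS r \<and> \<not> K (rep P)"
      using cone_complement_open[of K D P r] cone D' P(1) by blast
    then show "\<exists>T. openin (zariski_forms r) T \<and> P \<in> T \<and> T \<subseteq> PS r - {P \<in> PS r. K (rep P)}"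
      by (intro exI[of _ U]) auto
  qed
  then show ?thesis unfolding closedin_def by auto
qed

section \<open>Semicontinuity of syzygies and of the Milnor algebra\<close>

lemma coef_pd: "coef (pderivative v F) n = of_nat (coef n v + 1) * coef F (n + term_of v 1)"
proof (induction F rule: mpol_induct)
  case (single m c)
  show ?case
  proof (cases "coef m v = 0")
    case True
    then have "m \<noteq> n + term_of v 1" by (auto simp: lookup_add)
    then show ?thesis using True by (simp add: pd_single lookup_single)
  next
    case False
    have "m - term_of v 1 = n \<longleftrightarrow> m = n + term_of v 1"
      using mdegree_minus_single(1)[OF False] by auto
    then show ?thesis by (auto simp: pd_single lookup_single when_def lookup_add)
  qed
qed (simp add: pd_add lookup_add distrib_left)

text \<open>The multiples \<open>m f\<^sub>i\<close> of the partial derivatives. They depend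
  linearly on \<open>f\<close>, and both \<open>mdr\<close> and \<open>milnor_dim\<close> are read
  off from linear relations between them.\<close>

definition jgen :: "S \<Rightarrow> 3 \<times> 3 monom \<Rightarrow> S" where
  "jgen f = (\<lambda>(i, m). term_of m 1 * pderivative i f)"

lemma pfun_jgen: "pfun Xc (\<lambda>f. coef (jgen f j) n)"
proof -
  obtain i m where j: "j = (i, m)" by force
  show ?thesis
  proof (cases "\<exists>k. n = m + k")
    case True
    then obtain k where "n = m + k" by auto
    then show ?thesis by (auto simp: j jgen_def coef_term_mult coef_pd)
  next
    case False
    then show ?thesis by (simp add: j jgen_def coef_term_mult_eq_0)
  qed
qed

definition jindep :: "(3 \<times> 3 monom) set \<Rightarrow> S \<Rightarrow> bool" where
  "jindep J f \<longleftrightarrow> (\<forall>c. (\<Sum>j\<in>J. Cst (c j) * jgen f j) = 0 \<longrightarrow> (\<forall>j\<in>J. c j = 0))"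

lemma jindep_lin_indep: "jindep J f \<longleftrightarrow> lin_indep J (\<lambda>j n. coef (jgen f j) n)"
  unfolding jindep_def lin_indep_def
  by (simp add: poly_mapping_eq_iff fun_eq_iff lookup_sum)

lemma jgen_scale: "jgen (Cst c * f) j = Cst c * jgen f j"
  by (cases j) (simp add: jgen_def pd_Cst_mult mult.left_commute)

lemma jindep_scale:
  assumes "c \<noteq> 0" shows "jindep J (Cst c * f) \<longleftrightarrow> jindep J f"
proof -
  have "(\<Sum>j\<in>J. Cst (b j) * jgen (Cst c * f) j) = Cst c * (\<Sum>j\<in>J. Cst (b j) * jgen f j)" for b
    by (simp add: jgen_scale sum_distrib_left mult.left_commute)
  then show ?thesis using assms by (simp add: jindep_def)
qed

lemma jindep_open:
  assumes "finite J" "P0 \<in> PS r" "jindep J (rep P0)"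
  obtains U where "openin (zariski_forms r) U" "P0 \<in> U" "\<And>P. P \<in> U \<Longrightarrow> P \<in> PS r \<and> jindep J (rep P)"
proof -
  obtain D where D: "pfun Xc D" "D (rep P0) \<noteq> 0"
     "\<And>f. D f \<noteq> 0 \<Longrightarrow> lin_indep J (\<lambda>j n. coef (jgen f j) n)"
    using lin_indep_near[OF assms(1), of Xc "\<lambda>j n f. coef (jgen f j) n" "rep P0"] pfun_jgen
      assms(3) unfolding jindep_lin_indep by blast
  have D3: "D f \<noteq> 0 \<Longrightarrow> jindep J f" for f using D(3) jindep_lin_indep by blast
  obtain U where "openin (zariski_forms r) U" "P0 \<in> U" "\<And>P. P \<in> U \<Longrightarrow> P \<in> PS r \<and> \<not> \<not> jindep J (rep P)"
    by (rule cone_complement_open[of "\<lambda>f. \<not> jindep J f" D P0 r])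
      (use D(1,2) D3 assms(2) in \<open>auto simp: jindep_scale\<close>)
  then show ?thesis using that by blast
qed

definition syz :: "nat \<Rightarrow> S \<Rightarrow> bool" where
  "syz r f \<longleftrightarrow> (\<exists>a\<in>S_deg r. \<exists>b\<in>S_deg r. \<exists>c\<in>S_deg r. (a, b, c) \<noteq> (0, 0, 0) \<and>
     a * pderivative 1 f + b * pderivative 2 f + c * pderivative 3 f = 0)"

lemma mdr_Least: "mdr f = (LEAST r. syz r f)"
  by (simp add: mdr_def syz_def)

lemma sum_jgen:
  assumes "finite M" 
  shows "(\<Sum>j\<in>UNIV \<times> M. Cst (c j) * jgen f j)
    = (\<Sum>i\<in>UNIV. (\<Sum>m\<in>M. term_of m (c (i, m))) * pderivative i f)"
proof -
  have "Cst (c (i, m)) * jgen f (i, m) = term_of m (c (i, m)) * pderivative i f" for i m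
    by (simp add: jgen_def Cst_def mult_single mult.assoc[symmetric])
  then show ?thesis
    by (simp add: sum.cartesian_product' sum_distrib_right)
qed

lemma coef_sum_terms: "finite M \<Longrightarrow> coef (\<Sum>m\<in>M. term_of m (c m)) n = (if n \<in> M then c n else 0)"
  by (simp add: lookup_sum lookup_single when_def)

lemma S_deg_sum_terms: "F \<in> S_deg r \<Longrightarrow> (\<Sum>m\<in>Mon r. term_of m (coef F m)) = F"
  by (rule poly_mapping_eqI) (auto simp: coef_sum_terms S_deg_supp in_keys_iff)

lemma sum_terms_S_deg: "M \<subseteq> Mon r \<Longrightarrow> (\<Sum>m\<in>M. term_of m (c m)) \<in> S_deg r"
  by (auto simp: S_deg_def Mon_def intro!: hom_sum hom_single)

text \<open>A syzygy \<open>(a, b, c)\<close> is the same as a linear relation between the forms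
  \<open>m f\<^sub>i\<close>: its coefficients are those of \<open>a\<close>, \<open>b\<close> and
  \<open>c\<close>.\<close>

lemma syz_iff: "syz r f \<longleftrightarrow> \<not> jindep (UNIV \<times> Mon r) f"
proof
  assume "syz r f"
  then obtain a b c where abc: "a \<in> S_deg r" "b \<in> S_deg r" "c \<in> S_deg r" "(a, b, c) \<noteq> (0, 0, 0)"
     "a * pderivative 1 f + b * pderivative 2 f + c * pderivative 3 f = 0" unfolding syz_def by blast
  define A where "A = (\<lambda>i :: 3. if i = 1 then a else if i = 2 then b else c)"
  have A: "A i \<in> S_deg r" for i using abc by (simp add: A_def)
  have "(\<Sum>j\<in>UNIV \<times> Mon r. Cst (coef (A (fst j)) (snd j)) * jgen f j) = 0"
    by (simp add: sum_jgen S_deg_sum_terms[OF A] sum_3) (use abc in \<open>simp add: A_def\<close>)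
  moreover have "\<exists>j\<in>UNIV \<times> Mon r. coef (A (fst j)) (snd j) \<noteq> 0"
  proof -
    have "A 1 = a" "A 2 = b" "A 3 = c" by (auto simp: A_def)
    then obtain i where "A i \<noteq> 0" using abc(4) by auto
    then obtain m where m: "coef (A i) m \<noteq> 0" by (metis lookup_zero poly_mapping_eqI)
    then have "m \<in> Mon r" using A[of i] by (auto simp: S_deg_supp in_keys_iff)
    with m show ?thesis by (intro bexI[of _ "(i, m)"]) auto
  qed
  ultimately show "\<not> jindep (UNIV \<times> Mon r) f" unfolding jindep_def
    by (intro notI) (drule spec[of _ "\<lambda>j. coef (A (fst j)) (snd j)"], blast)
next
  assume "\<not> jindep (UNIV \<times> Mon r) f"
  then obtain c i m where c: "(\<Sum>j\<in>UNIV \<times> Mon r. Cst (c j) * jgen f j) = 0"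
    "m \<in> Mon r" "c (i, m) \<noteq> 0" unfolding jindep_def by auto
  define A where "A = (\<lambda>i :: 3. \<Sum>m\<in>Mon r. term_of m (c (i, m)))"
  have A: "A i \<in> S_deg r" for i unfolding A_def by (rule sum_terms_S_deg) auto
  have "coef (A i) m \<noteq> 0" using c by (simp add: A_def coef_sum_terms)
  then have "A i \<noteq> 0" by auto
  then have "(A 1, A 2, A 3) \<noteq> (0, 0, 0)" using exhaust_3[of i] by auto
  moreover have "A 1 * pderivative 1 f + A 2 * pderivative 2 f + A 3 * pderivative 3 f = 0"
    using c(1) by (simp add: sum_jgen sum_3 A_def)
  ultimately show "syz r f" unfolding syz_def using A by blast
qed

text \<open>The Koszul relation \<open>f\<^sub>y f\<^sub>x - f\<^sub>x f\<^sub>y = 0\<close> is a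
  syzygy unless \<open>f\<^sub>x\<close> and \<open>f\<^sub>y\<close> vanish, and then \<open>(1, 0,
  0)\<close> is one. So the minimum in the definition of \<open>mdr\<close> is attained.\<close>

lemma syz_exists:
  assumes "f \<in> S_deg d" shows "\<exists>r. syz r f"
proof (cases "pderivative 1 f = 0 \<and> pderivative 2 f = 0")
  case True
  have "1 \<in> S_deg 0" using hom_1 by (simp add: S_deg_def)
  then have "syz 0 f" unfolding syz_def using True
    by (intro bexI[of _ 1] bexI[of _ 0]) (auto simp: S_deg_def)
  then show ?thesis ..
next
  case False
  have *: "pderivative i f \<in> S_deg (d - 1)" for i using assms hom_pd by (auto simp: S_deg_def)
  have "- pderivative 1 f \<in> S_deg (d - 1)"
    using *[of 1] hom_diff[of "d - 1" 0] by (fastforce simp: S_deg_def)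
  then have "syz (d - 1) f" unfolding syz_def using False *
    by (intro bexI[of _ "pderivative 2 f"] bexI[of _ "- pderivative 1 f"] bexI[of _ 0])
      (auto simp: S_deg_def)
  then show ?thesis ..
qed

lemma min_locus_nonempty: "C \<noteq> {} \<Longrightarrow> min_locus \<phi> C \<noteq> {}"
  using ex_has_least_nat[of "\<lambda>P. P \<in> C" _ \<phi>] unfolding min_locus_def by blast

text \<open>Let \<open>r\<close> be the minimal value. Then the locus consists of the forms with a
  syzygy of degree \<open>r\<close>, and the absence of a syzygy is an open condition.\<close>

lemma mdr_min_locus_closed:
  assumes C: "C \<subseteq> PS d"
  shows "closedin (subtopology (zariski_forms d) C) (min_locus (\<lambda>P. mdr (rep P)) C)"
proof -
  let ?M = "min_locus (\<lambda>P. mdr (rep P)) C"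
  have "openin (subtopology (zariski_forms d) C) (C - ?M)"
  proof (cases "C = {}")
    case False
    then obtain Q where Q: "Q \<in> ?M" using min_locus_nonempty by blast
    define r where "r = mdr (rep Q)"
    have M: "P \<in> ?M \<longleftrightarrow> syz r (rep P)" if P: "P \<in> C" for P
    proof -
      have f: "rep P \<in> S_deg d" using P C PS_rep by blast
      have "r \<le> mdr (rep P)" using Q P by (auto simp: r_def min_locus_def)
      moreover have "syz (mdr (rep P)) (rep P)"
        unfolding mdr_Least using syz_exists[OF f] by (meson LeastI_ex)
      moreover have "syz r (rep P) \<Longrightarrow> mdr (rep P) \<le> r" unfolding mdr_Least by (rule Least_le)
      moreover have "P \<in> ?M \<longleftrightarrow> mdr (rep P) \<le> r"
        using P Q by (auto simp: min_locus_def r_def intro: order_trans)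
      ultimately show ?thesis by (metis antisym)
    qed
    show ?thesis
    proof (subst openin_subopen, intro ballI)
      fix P assume P: "P \<in> C - ?M"
      then have "jindep (UNIV \<times> Mon r) (rep P)" using M syz_iff by blast
      then obtain U where U: "openin (zariski_forms d) U" "P \<in> U"
        "\<And>P. P \<in> U \<Longrightarrow> P \<in> PS d \<and> jindep (UNIV \<times> Mon r) (rep P)"
        using jindep_open[of "UNIV \<times> Mon r" P d] P C by auto
      have "U \<inter> C \<subseteq> C - ?M" using U(3) M syz_iff by blast
      then show "\<exists>T. openin (subtopology (zariski_forms d) C) T \<and> P \<in> T \<and> T \<subseteq> C - ?M"
        using U P by (intro exI[of _ "U \<inter> C"]) (auto simp: openin_subtopology_Int)
    qed
  qed simp
  moreover have "?M \<subseteq> C" by (auto simp: min_locus_def)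
  ultimately show ?thesis using C unfolding closedin_def by (simp add: Int_absorb1)
qed

interpretation cv: cvs "\<lambda>c (h :: 'v mpol). Cst c * h"
  by unfold_locales (auto simp: Cst_add Cst_mult distrib_left distrib_right mult.assoc)

text \<open>The indices of the forms \<open>m f\<^sub>i\<close> of degree \<open>k\<close>. The
  equation avoids the truncated subtraction \<open>k - (d - 1)\<close>, so that the set is empty for
  \<open>k < d - 1\<close>.\<close>

definition Jset :: "nat \<Rightarrow> nat \<Rightarrow> (3 \<times> 3 monom) set" where
  "Jset d k = UNIV \<times> {m. mdegree m + (d - 1) = k}"

lemma finite_Jset [simp]: "finite (Jset d k)"
proof -
  have "{m :: 3 monom. mdegree m + (d - 1) = k} \<subseteq> Mon (k - (d - 1))" by (auto simp: Mon_def)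
  then have "finite {m :: 3 monom. mdegree m + (d - 1) = k}" by (rule finite_subset) simp
  then show ?thesis unfolding Jset_def by (intro finite_cartesian_product) simp_all
qed

lemma S_deg_codim: "has_codim (\<lambda>c h. Cst c * h) (S_deg k) {0} (card (Mon k :: 3 monom set))"
proof -
  define B :: "S set" where "B = (\<lambda>m. term_of m 1) ` Mon k"
  have inj: "inj_on (\<lambda>m. term_of m (1::complex)) (Mon k :: 3 monom set)"
    by (rule inj_onI) (metis lookup_single_eq lookup_single_not_eq zero_neq_one)
  have s: "(\<Sum>b\<in>B. Cst (c b) * b) = (\<Sum>m\<in>Mon k. term_of m (c (term_of m 1)))" for c :: "S \<Rightarrow> complex"
    unfolding B_def by (subst sum.reindex[OF inj]) (simp add: Cst_def mult_single)
  have "indep_mod (\<lambda>c h. Cst c * h) {0} B" unfolding indep_mod_def s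
  proof (intro allI impI ballI)
    fix c :: "S \<Rightarrow> complex" and b
    assume *: "(\<Sum>m\<in>Mon k. term_of m (c (term_of m 1))) \<in> {0 :: S}" and "b \<in> B"
    then obtain m where m: "m \<in> Mon k" "b = term_of m 1" by (auto simp: B_def)
    have "coef (\<Sum>m\<in>Mon k. term_of m (c (term_of m 1))) m = 0" using * by simp
    then show "c b = 0" using m by (simp add: coef_sum_terms)
  qed
  moreover have "spans_mod (\<lambda>c h. Cst c * h) (S_deg k) {0} B"
    unfolding spans_mod_def s
  proof
    fix v :: S assume v: "v \<in> S_deg k"
    define c where "c b = coef v (SOME m. b = term_of m (1::complex))" for b :: S
    have "c (term_of m 1) = coef v m" for m
    proof -
      have "(SOME n. term_of m (1::complex) = term_of n 1) = m"
        by (rule some_equality) (metis lookup_single_eq lookup_single_not_eq zero_neq_one)+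
      then show ?thesis by (simp add: c_def)
    qed
    then show "\<exists>c :: S \<Rightarrow> complex. v - (\<Sum>m\<in>Mon k. term_of m (c (term_of m 1))) \<in> {0}"
      using S_deg_sum_terms[OF v] by (intro exI[of _ c]) simp
  qed
  moreover have "B \<subseteq> S_deg k" by (auto simp: B_def S_deg_def Mon_def intro: hom_single)
  ultimately show ?thesis
    unfolding has_codim_def using card_image[OF inj] by (intro exI[of _ B]) (auto simp: B_def)
qed

lemma part_mult_low:
  assumes "graded mdegree k G" "e < k" shows "part mdegree e (F * G) = 0"
proof (induction F rule: mpol_induct)
  case (single m c)
  have "graded mdegree (mdegree m + k) (term_of m c * G)"
    by (intro graded_mult mdegree_add graded_single assms) auto
  then show ?case using assms(2) by (simp add: part_graded)
qed (simp add: part_add distrib_right)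

text \<open>The ideal is homogeneous: taking components of degree \<open>k\<close> in \<open>a
  f\<^sub>x + b f\<^sub>y + c f\<^sub>z\<close> leaves only components of \<open>a, b, c\<close> of
  degree \<open>k - (d - 1)\<close>.\<close>

lemma jacobian_degree_part:
  assumes f: "f \<in> S_deg d"
  shows "jacobian_ideal f \<inter> S_deg k = {\<Sum>j\<in>Jset d k. Cst (c j) * jgen f j | c. True}" (is "?L = ?R")
proof
  define M :: "3 monom set" where "M = {m. mdegree m + (d - 1) = k}"
  have J: "Jset d k = UNIV \<times> M" by (simp add: Jset_def M_def)
  have M: "finite M" using finite_Jset[of d k] unfolding J by (rule finite_cartesian_productD2) simp
  have pd: "homogeneous (d - 1) (pderivative i f)" for i using f hom_pd by (auto simp: S_deg_def)
  show "?R \<subseteq> ?L"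
  proof safe
    fix c :: "3 \<times> 3 monom \<Rightarrow> complex"
    show "(\<Sum>j\<in>Jset d k. Cst (c j) * jgen f j) \<in> jacobian_ideal f"
      unfolding J sum_jgen[OF M] jacobian_ideal_def sum_3 by blast
    have "homogeneous k (term_of m (c (i, m)) * pderivative i f)" if "m \<in> M" for m i
      using hom_mult[OF hom_single[OF refl] pd] that by (force simp: M_def)
    then show "(\<Sum>j\<in>Jset d k. Cst (c j) * jgen f j) \<in> S_deg k"
      unfolding J sum_jgen[OF M] S_deg_def mem_Collect_eq
      by (intro hom_sum) (simp add: sum_distrib_right hom_sum)
  qed
  show "?L \<subseteq> ?R"
  proof
    fix h assume h: "h \<in> ?L"
    then obtain a b c where abc: "h = a * pderivative 1 f + b * pderivative 2 f + c * pderivative 3 f"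
      by (auto simp: jacobian_ideal_def)
    define A where "A = (\<lambda>i :: 3. if i = 1 then a else if i = 2 then b else c)"
    have hA: "h = (\<Sum>i\<in>UNIV. A i * pderivative i f)" by (simp add: sum_3 abc A_def)
    define e where "e = (\<lambda>j :: 3 \<times> 3 monom. coef (A (fst j)) (snd j))"
    have "part mdegree k (A i * pderivative i f) = (\<Sum>m\<in>M. term_of m (e (i, m))) * pderivative i f" for i
    proof (cases "k < d - 1")
      case True
      then have "M = {}" by (auto simp: M_def)
      then show ?thesis using part_mult_low[of "d - 1" "pderivative i f" k "A i"] pd True
        by (simp add: homogeneous_graded)
    next
      case False
      then have k: "k = (k - (d - 1)) + (d - 1)" by simp
      have "part mdegree k (A i * pderivative i f) = part mdegree (k - (d - 1)) (A i) * pderivative i f"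
        by (subst k) (rule part_mult, auto simp: mdegree_add pd[unfolded homogeneous_graded, simplified])
      moreover have "part mdegree (k - (d - 1)) (A i) = (\<Sum>m\<in>M. term_of m (e (i, m)))"
      proof -
        have "n \<in> M \<longleftrightarrow> mdegree n = k - (d - 1)" for n using False by (auto simp: M_def)
        then show ?thesis by (intro poly_mapping_eqI) (simp add: coef_part coef_sum_terms[OF M] e_def)
      qed
      ultimately show ?thesis by simp
    qed
    moreover have "part mdegree k h = h"
      using h by (intro poly_mapping_eqI) (auto simp: coef_part S_deg_def homogeneous_def in_keys_iff)
    moreover have "part mdegree k (sum g A) = (\<Sum>a\<in>A. part mdegree k (g a))" for g :: "3 \<Rightarrow> S" and A
      by (induction A rule: infinite_finite_induct) (auto simp: part_add)
    ultimately have "h = (\<Sum>i\<in>UNIV. (\<Sum>m\<in>M. term_of m (e (i, m))) * pderivative i f)"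
      using hA by simp
    then have "h = (\<Sum>j\<in>Jset d k. Cst (e j) * jgen f j)"
      unfolding J sum_jgen[OF M] .
    then show "h \<in> ?R" by blast
  qed
qed

text \<open>The dimension of $M(f)_k$ is $\dim S_k$ minus the rank of the family of the forms
  \<open>m f\<^sub>i\<close> of degree \<open>k\<close>. The rank is stated as the size of a largest
  independent subfamily, since independence of a given subfamily is what persists nearby.\<close>

lemma milnor_dim_rank:
  assumes f: "f \<in> S_deg d"
  shows "\<exists>J0. J0 \<subseteq> Jset d k \<and> jindep J0 f
    \<and> milnor_dim k f + card J0 = card (Mon k :: 3 monom set)
    \<and> (\<forall>J. J \<subseteq> Jset d k \<longrightarrow> jindep J f \<longrightarrow> card J \<le> card J0)"
proof -
  let ?s = "\<lambda>c (h::S). Cst c * h"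
  define W where "W = jacobian_ideal f \<inter> S_deg k"
  have W: "W = {\<Sum>j\<in>Jset d k. Cst (c j) * jgen f j | c. True}"
    unfolding W_def by (rule jacobian_degree_part[OF f])
  have sub: "cv.subspace W"
  proof (rule cv.subspaceI)
    show "0 \<in> W" unfolding W by (rule CollectI, rule exI[of _ "\<lambda>_. 0"]) simp
    fix x y assume "x \<in> W" "y \<in> W"
    then obtain a b where "x = (\<Sum>j\<in>Jset d k. Cst (a j) * jgen f j)"
      "y = (\<Sum>j\<in>Jset d k. Cst (b j) * jgen f j)" unfolding W by auto
    then have "x + y = (\<Sum>j\<in>Jset d k. Cst (a j + b j) * jgen f j)"
      by (simp add: Cst_add distrib_right sum.distrib)
    then show "x + y \<in> W" unfolding W by (intro CollectI exI[of _ "\<lambda>j. a j + b j"]) simp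
  next
    fix c x assume "x \<in> W"
    then obtain a where "x = (\<Sum>j\<in>Jset d k. Cst (a j) * jgen f j)" unfolding W by auto
    then have "Cst c * x = (\<Sum>j\<in>Jset d k. Cst (c * a j) * jgen f j)"
      by (simp only: Cst_mult sum_distrib_left mult.assoc)
    then show "Cst c * x \<in> W" unfolding W by (intro CollectI exI[of _ "\<lambda>j. c * a j"]) simp
  qed
  have genW: "jgen f j \<in> W" if "j \<in> Jset d k" for j
  proof -
    have "jgen f j = (\<Sum>i\<in>Jset d k. Cst (if i = j then 1 else 0) * jgen f i)"
      using that by (simp add: if_distrib[of Cst] if_distrib[of "\<lambda>c. c * _"] cong: if_cong)
    then show ?thesis unfolding W by (intro CollectI exI[of _ "\<lambda>i. if i = j then 1 else 0"]) simp
  qed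
  have WV: "W \<subseteq> S_deg k" by (simp add: W_def)
  have V: "has_codim ?s (S_deg k) {0} (card (Mon k :: 3 monom set))" by (rule S_deg_codim)
  obtain B where B: "finite B" "B \<subseteq> jgen f ` Jset d k" "indep_mod ?s {0} B"
    "\<And>g. g \<in> jgen f ` Jset d k \<Longrightarrow> \<exists>c. g = (\<Sum>b\<in>B. Cst (c b) * b)"
    using cv.basis_from_generators[OF V, of "jgen f ` Jset d k"] genW WV by blast
  have spB: "spans_mod ?s W {0} B"
    unfolding spans_mod_def
  proof
    fix v assume "v \<in> W"
    then obtain a where a: "v = (\<Sum>j\<in>Jset d k. Cst (a j) * jgen f j)" unfolding W by auto
    have "\<forall>j\<in>Jset d k. \<exists>c. jgen f j = (\<Sum>b\<in>B. Cst (c b) * b)" using B(4) by blast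
    from bchoice[OF this] obtain c
      where c: "\<And>j. j \<in> Jset d k \<Longrightarrow> jgen f j = (\<Sum>b\<in>B. Cst (c j b) * b)" by blast
    have "v = (\<Sum>j\<in>Jset d k. \<Sum>b\<in>B. Cst (a j * c j b) * b)"
      unfolding a by (intro sum.cong refl) (simp only: c sum_distrib_left Cst_mult mult.assoc)
    also have "\<dots> = (\<Sum>b\<in>B. Cst (\<Sum>j\<in>Jset d k. a j * c j b) * b)"
      by (subst sum.swap) (simp only: Cst_sum sum_distrib_right)
    finally show "\<exists>c. v - (\<Sum>b\<in>B. Cst (c b) * b) \<in> {0}"
      by (intro exI[of _ "\<lambda>b. \<Sum>j\<in>Jset d k. a j * c j b"]) simp
  qed
  have cW: "has_codim ?s W {0} (card B)"
    unfolding has_codim_def using B spB genW by (intro exI[of _ B]) auto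
  obtain n where n: "has_codim ?s (S_deg k) W n" using cv.has_codim_exists[OF V sub] .
  have "n + card B = card (Mon k :: 3 monom set)"
    using cv.has_codim_trans[OF _ WV cv.subspace_single_0 sub n cW] cv.subspace_0[OF sub]
      cv.has_codim_unique[OF cv.subspace_single_0 _ V] by simp
  moreover have "milnor_dim k f = n"
    unfolding milnor_dim_def W_def[symmetric] by (rule cv.quot_dim_eqI[OF sub n])
  moreover obtain J0 where J0: "J0 \<subseteq> Jset d k" "inj_on (jgen f) J0" "B = jgen f ` J0"
    using B(2) unfolding subset_image_inj by blast
  moreover have "jindep J0 f"
    unfolding jindep_def
  proof (intro allI impI)
    fix c assume c: "(\<Sum>j\<in>J0. Cst (c j) * jgen f j) = 0"
    define c' where "c' = c \<circ> inv_into J0 (jgen f)"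
    have "(\<Sum>b\<in>B. Cst (c' b) * b) = (\<Sum>j\<in>J0. Cst (c j) * jgen f j)"
      unfolding J0(3) by (subst sum.reindex[OF J0(2)]) (simp add: c'_def J0(2))
    then have "\<forall>b\<in>B. c' b = 0" using B(3) c unfolding indep_mod_def by simp
    then show "\<forall>j\<in>J0. c j = 0" unfolding J0(3) by (simp add: c'_def J0(2))
  qed
  moreover have "card J \<le> card B" if J: "J \<subseteq> Jset d k" "jindep J f" for J
  proof -
    have fJ: "finite J" by (rule finite_subset[OF J(1) finite_Jset])
    have inj: "inj_on (jgen f) J"
    proof (rule inj_onI, rule ccontr)
      fix x y assume xy: "x \<in> J" "y \<in> J" "jgen f x = jgen f y" "x \<noteq> y"
      define c where "c j = (if j = x then 1 else 0) - (if j = y then 1 else 0 :: complex)" for j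
      have "(\<Sum>j\<in>J. Cst (c j) * jgen f j) = jgen f x - jgen f y"
        using fJ xy(1,2)
        by (simp add: c_def Cst_diff left_diff_distrib sum_subtractf if_distrib[of Cst]
            if_distrib[of "\<lambda>c. c * _"] cong: if_cong)
      then have "c x = 0" using J(2) xy unfolding jindep_def by simp
      then show False using xy by (simp add: c_def)
    qed
    have "indep_mod ?s {0} (jgen f ` J)"
      unfolding indep_mod_def
    proof (intro allI impI)
      fix c assume "(\<Sum>b\<in>jgen f ` J. Cst (c b) * b) \<in> {0}"
      then have "(\<Sum>j\<in>J. Cst ((c \<circ> jgen f) j) * jgen f j) = 0" by (simp add: sum.reindex[OF inj])
      then have "\<forall>j\<in>J. (c \<circ> jgen f) j = 0" using J(2) unfolding jindep_def by blast
      then show "\<forall>b\<in>jgen f ` J. c b = 0" by simp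
    qed
    then have "card (jgen f ` J) \<le> card B"
      by (intro cv.indep_le_spans[OF cv.subspace_single_0 B(1) spB]) (use fJ J genW in auto)
    then show ?thesis by (simp add: card_image[OF inj])
  qed
  ultimately show ?thesis by (intro exI[of _ J0]) (auto simp: card_image)
qed

text \<open>A largest independent subfamily at \<open>P\<close> stays independent near
  \<open>P\<close>, so the rank cannot drop there.\<close>

lemma milnor_min_locus_open:
  assumes C: "C \<subseteq> PS d"
  shows "openin (subtopology (zariski_forms d) C) (min_locus (\<lambda>P. milnor_dim k (rep P)) C)"
proof (subst openin_subopen, intro ballI)
  let ?M = "min_locus (\<lambda>P. milnor_dim k (rep P)) C"
  fix P assume P: "P \<in> ?M"
  then have PC: "P \<in> C" "P \<in> PS d" using C by (auto simp: min_locus_def)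
  obtain J0 where J0: "J0 \<subseteq> Jset d k" "jindep J0 (rep P)"
    "milnor_dim k (rep P) + card J0 = card (Mon k :: 3 monom set)"
    using milnor_dim_rank[OF PS_rep(1)[OF PC(2)], of k] by blast
  have "finite J0" by (rule finite_subset[OF J0(1) finite_Jset])
  from jindep_open[OF this PC(2) J0(2)] obtain U where U: "openin (zariski_forms d) U" "P \<in> U"
    "\<And>P. P \<in> U \<Longrightarrow> P \<in> PS d \<and> jindep J0 (rep P)" by blast
  have "Q \<in> ?M" if Q: "Q \<in> U \<inter> C" for Q
  proof -
    have "Q \<in> PS d" "jindep J0 (rep Q)" using Q U(3) by auto
    moreover obtain J1 where "J1 \<subseteq> Jset d k" "jindep J1 (rep Q)"
      "milnor_dim k (rep Q) + card J1 = card (Mon k :: 3 monom set)"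
      "\<And>J. J \<subseteq> Jset d k \<Longrightarrow> jindep J (rep Q) \<Longrightarrow> card J \<le> card J1"
      using milnor_dim_rank[OF PS_rep(1)[OF \<open>Q \<in> PS d\<close>], of k] by blast
    ultimately have "milnor_dim k (rep Q) \<le> milnor_dim k (rep P)"
      using J0(1,3) by (metis add_le_imp_le_right add_left_mono)
    then show ?thesis using P Q by (auto simp: min_locus_def intro: order_trans)
  qed
  then show "\<exists>T. openin (subtopology (zariski_forms d) C) T \<and> P \<in> T \<and> T \<subseteq> ?M"
    using U PC by (intro exI[of _ "U \<inter> C"]) (auto simp: openin_subtopology_Int)
qed

declare One_nat_def [simp del]

section \<open>Lines in the projective plane\<close>

text \<open>Coordinates of the line, as a function; \<open>pl\<close> goes back from coordinates to
  classes.\<close>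

definition lf :: "S set \<Rightarrow> 3 \<Rightarrow> complex" where
  "lf P v = coef (rep P) (term_of v 1)"

lemma hom_0_Cst:
  assumes "homogeneous 0 G" shows "G = Cst (coef G 0)"
proof (rule poly_mapping_eqI)
  fix m
  have "m = 0" if "m \<in> supp G"
  proof (rule poly_mapping_eqI)
    fix v
    have "mdegree m = 0" using assms that by (simp add: homogeneous_def)
    then have "\<forall>v\<in>supp m. coef m v = 0" by (simp add: mdegree_def)
    then show "coef m v = coef 0 v" by (auto simp: in_keys_iff)
  qed
  then show "coef G m = coef (Cst (coef G 0)) m"
    by (cases "m = 0") (auto simp: Cst_def in_keys_iff lookup_single)
qed

lemma S_deg_1_linform:
  fixes F :: "'v::finite mpol"
  assumes "homogeneous 1 F" shows "F = linform (\<lambda>v. coef F (term_of v 1))"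
proof -
  have "homogeneous 0 (pderivative v F)" for v using hom_pd[OF assms] by simp
  from hom_0_Cst[OF this] have "pderivative v F = Cst (coef F (term_of v 1))" for v
    by (simp add: coef_pd)
  then show ?thesis using euler[OF assms] by (simp add: linform_def mult.commute)
qed

lemma rep_linform: "P \<in> PS 1 \<Longrightarrow> rep P = linform (lf P)"
  using PS_rep[of P 1] S_deg_1_linform[of "rep P"] unfolding lf_def S_deg_def by auto

lemma lf_nonzero: "P \<in> PS 1 \<Longrightarrow> \<exists>v. lf P v \<noteq> 0"
  using PS_rep(2)[of P 1] rep_linform[of P] by (auto simp: linform_eq_0_iff)

definition pl :: "(3 \<Rightarrow> complex) \<Rightarrow> S set" where
  "pl a = pclass (linform a)"

lemma linform_inj: "linform a = linform b \<Longrightarrow> a = b"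
proof
  fix v assume "linform a = linform b"
  then have "pderivative v (linform a) = pderivative v (linform b)" by simp
  then show "a v = b v" by (simp add: pd_linform)
qed

lemma linform_scale: "linform (\<lambda>v. c * a v) = Cst c * linform a"
  by (simp only: linform_def Cst_mult sum_distrib_left mult.assoc)

lemma pl_lf: "P \<in> PS 1 \<Longrightarrow> pl (lf P) = P"
  using rep_linform[of P] PS_rep(3)[of P 1] by (simp add: pl_def)

lemma pl_PS: "\<exists>v. a v \<noteq> 0 \<Longrightarrow> pl a \<in> PS 1"
  unfolding pl_def by (intro pclass_PS) (auto simp: S_deg_def hom_linform linform_eq_0_iff)

lemma lf_pl:
  assumes "\<exists>v. a v \<noteq> 0"
  obtains c where "c \<noteq> 0" "lf (pl a) = (\<lambda>v. c * a v)"
proof -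
  obtain c where c: "c \<noteq> 0" "rep (pl a) = Cst c * linform a"
    unfolding pl_def by (rule rep_pclass)
  then have "linform (lf (pl a)) = linform (\<lambda>v. c * a v)"
    using rep_linform[OF pl_PS[OF assms]] by (simp add: linform_scale)
  with c that show thesis using linform_inj by blast
qed

lemma pl_eqI: "c \<noteq> 0 \<Longrightarrow> (\<And>v. b v = c * a v) \<Longrightarrow> pl b = pl a"
proof -
  assume c: "c \<noteq> 0" "\<And>v. b v = c * a v"
  then have "b = (\<lambda>v. c * a v)" by auto
  then show ?thesis by (simp add: pl_def linform_scale pclass_scale c)
qed

lemma vclass_self: "x \<in> vclass x" unfolding vclass_def by (intro CollectI exI[of _ 1]) simp

lemma rep_vclass: obtains c where "c \<noteq> 0" "rep (vclass x) = c *s x"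
proof -
  have "rep (vclass x) \<in> vclass x" unfolding rep_def using vclass_self by (rule someI)
  then show thesis using that by (auto simp: vclass_def)
qed

lemma vclass_scale:
  assumes c: "c \<noteq> 0" shows "vclass (c *s x) = vclass x"
proof -
  have "e *s x = (e / c) *s (c *s x)" "e *s (c *s x) = (e * c) *s x" for e
    using c by (simp_all add: vector_smult_assoc)
  then show ?thesis using c unfolding vclass_def
    by (metis (no_types, opaque_lifting) divide_eq_0_iff mult_eq_0_iff)
qed

lemma P2_rep:
  assumes "q \<in> P2" shows "rep q \<noteq> 0" "vclass (rep q) = q"
proof -
  obtain x where x: "x \<noteq> 0" "q = vclass x" using assms by (auto simp: P2_def)
  obtain c where "c \<noteq> 0" "rep (vclass x) = c *s x" by (rule rep_vclass)
  then show "vclass (rep q) = q" using x vclass_scale by metis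
  show "rep q \<noteq> 0" using x \<open>c \<noteq> 0\<close> \<open>rep (vclass x) = c *s x\<close> by (auto simp: vec_eq_iff)
qed

lemma vclass_P2: "x \<noteq> 0 \<Longrightarrow> vclass x \<in> P2" by (auto simp: P2_def)

definition dot3 :: "(3 \<Rightarrow> complex) \<Rightarrow> (3 \<Rightarrow> complex) \<Rightarrow> complex" where
  "dot3 a x = a 1 * x 1 + a 2 * x 2 + a 3 * x 3"

definition crossp :: "(3 \<Rightarrow> complex) \<Rightarrow> (3 \<Rightarrow> complex) \<Rightarrow> 3 \<Rightarrow> complex" where
  "crossp a b = (\<lambda>i. if i = 1 then a 2 * b 3 - a 3 * b 2
     else if i = 2 then a 3 * b 1 - a 1 * b 3 else a 1 * b 2 - a 2 * b 1)"

definition det3 :: "(3 \<Rightarrow> complex) \<Rightarrow> (3 \<Rightarrow> complex) \<Rightarrow> (3 \<Rightarrow> complex) \<Rightarrow> complex" where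
  "det3 a b c = a 1 * (b 2 * c 3 - b 3 * c 2) + a 2 * (b 3 * c 1 - b 1 * c 3) + a 3 * (b 1 * c 2 - b 2 * c 1)"

lemma crossp_simps [simp]:
  "crossp a b 1 = a 2 * b 3 - a 3 * b 2" "crossp a b 2 = a 3 * b 1 - a 1 * b 3"
  "crossp a b 3 = a 1 * b 2 - a 2 * b 1"
  by (simp_all add: crossp_def)

lemma crossp_eq_0_prop:
  assumes "\<And>v. crossp a b v = 0" "b w \<noteq> 0"
  obtains t where "\<And>v. a v = t * b v"
proof -
  have 1: "a 2 * b 3 = a 3 * b 2" "a 3 * b 1 = a 1 * b 3" "a 1 * b 2 = a 2 * b 1"
    using assms(1)[of 1] assms(1)[of 2] assms(1)[of 3] by simp_all
  have "a v * b w = a w * b v" for v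
    using exhaust_3[of v] exhaust_3[of w] 1 by auto
  then have "a v = a w / b w * b v" for v using assms(2) by (simp add: field_simps)
  then show thesis by (rule that)
qed

lemma crossp_nonzero:
  assumes "P \<in> PS 1" "Q \<in> PS 1" "P \<noteq> Q"
  shows "\<exists>v. crossp (lf P) (lf Q) v \<noteq> 0"
proof (rule ccontr)
  assume "\<not> ?thesis"
  moreover obtain w where "lf Q w \<noteq> 0" using lf_nonzero[OF assms(2)] by auto
  ultimately obtain t where t: "\<And>v. lf P v = t * lf Q v" using crossp_eq_0_prop[of "lf P" "lf Q" w] by blast
  then have "t \<noteq> 0" using lf_nonzero[OF assms(1)] by auto
  from pl_eqI[OF this t] show False using pl_lf[OF assms(1)] pl_lf[OF assms(2)] assms(3) by simp
qed

lemma line_iff: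
  assumes "P \<in> PS 1"
  shows "q \<in> line P \<longleftrightarrow> q \<in> P2 \<and> dot3 (lf P) (($) (rep q)) = 0"
  unfolding line_def ev_def[symmetric] rep_linform[OF assms] by (simp add: sum_3 dot3_def)

lemma line_vclass:
  assumes "P \<in> PS 1" "x \<noteq> 0"
  shows "vclass x \<in> line P \<longleftrightarrow> dot3 (lf P) (($) x) = 0"
proof -
  obtain c where c: "c \<noteq> 0" "rep (vclass x) = c *s x" by (rule rep_vclass)
  have "dot3 (lf P) (($) (c *s x)) = c * dot3 (lf P) (($) x)"
    by (simp add: dot3_def algebra_simps)
  then show ?thesis using c assms by (simp add: line_iff vclass_P2)
qed

text \<open>The intersection point is the cross product of the coordinates.\<close>

lemma two_lines_meet:
  assumes "P \<in> PS 1" "Q \<in> PS 1" "P \<noteq> Q"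
  defines "x \<equiv> (\<chi> v. crossp (lf P) (lf Q) v) :: complex^3"
  shows "x \<noteq> 0" "line P \<inter> line Q = {vclass x}"
proof -
  obtain w where w: "crossp (lf P) (lf Q) w \<noteq> 0" using crossp_nonzero[OF assms(1-3)] by auto
  show x: "x \<noteq> 0"
  proof
    assume "x = 0" then have "x $ w = 0" by simp
    then show False using w by (simp add: x_def)
  qed
  have "dot3 (lf P) (($) x) = 0" "dot3 (lf Q) (($) x) = 0"
    by (simp_all add: dot3_def x_def algebra_simps)
  then have "vclass x \<in> line P" "vclass x \<in> line Q" using assms x by (auto simp: line_vclass)
  moreover have "q = vclass x" if q: "q \<in> line P" "q \<in> line Q" for q
  proof -
    have qP: "q \<in> P2" and e: "dot3 (lf P) (($) (rep q)) = 0" "dot3 (lf Q) (($) (rep q)) = 0"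
      using q line_iff[OF assms(1)] line_iff[OF assms(2)] by auto
    let ?a = "lf P" and ?b = "lf Q" and ?y = "rep q"
    have "crossp (($) ?y) (crossp ?a ?b) v = ?a v * dot3 ?b (($) ?y) - ?b v * dot3 ?a (($) ?y)" for v
      using exhaust_3[of v] by (auto simp: dot3_def algebra_simps)
    then have "crossp (($) ?y) (crossp ?a ?b) v = 0" for v using e by simp
    from crossp_eq_0_prop[OF this w] obtain t where t: "\<And>v. ?y $ v = t * crossp ?a ?b v" by blast
    then have y: "?y = t *s x" by (simp add: vec_eq_iff x_def)
    then have "t \<noteq> 0" using P2_rep(1)[OF qP] by auto
    then show ?thesis using P2_rep(2)[OF qP] y by (metis vclass_scale)
  qed
  ultimately show "line P \<inter> line Q = {vclass x}" by blast
qed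

lemma three_lines_meet:
  assumes "P \<in> PS 1" "Q \<in> PS 1" "P \<noteq> Q" "R \<in> PS 1"
  shows "line P \<inter> line Q \<subseteq> line R \<longleftrightarrow> det3 (lf P) (lf Q) (lf R) = 0"
proof -
  note m = two_lines_meet[OF assms(1-3)]
  have "dot3 (lf R) (crossp (lf P) (lf Q)) = det3 (lf P) (lf Q) (lf R)"
    by (simp add: dot3_def det3_def algebra_simps)
  then show ?thesis using m assms(4) by (simp add: line_vclass vec_lambda_inverse)
qed

lemma line_sub_P2: "line P \<subseteq> P2" by (auto simp: line_def)

text \<open>A line has two points: it meets two of the three coordinate lines in different points.\<close>

lemma line_two_points:
  assumes "P \<in> PS 1"
  obtains q q' where "q \<in> line P" "q' \<in> line P" "q \<noteq> q'"
proof -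
  define a where "a = lf P"
  obtain w where "a w \<noteq> 0" unfolding a_def using lf_nonzero[OF assms] by auto
  define x y :: "complex^3" where
    "x = (if w = 1 then vector [- a 2, a 1, 0] else if w = 2 then vector [a 2, - a 1, 0] else vector [a 3, 0, - a 1])" and
    "y = (if w = 1 then vector [- a 3, 0, a 1] else if w = 2 then vector [0, a 3, - a 2] else vector [0, a 3, - a 2])"
  have "dot3 a (($) x) = 0" "dot3 a (($) y) = 0"
    by (simp_all add: x_def y_def dot3_def vector_3)
  moreover have xy: "x \<noteq> 0" "y \<noteq> 0" "\<And>c. x \<noteq> c *s y"
    using \<open>a w \<noteq> 0\<close> exhaust_3[of w] by (auto simp: x_def y_def vec_eq_iff forall_3 vector_3)
  ultimately have "vclass x \<in> line P" "vclass y \<in> line P" using assms by (auto simp: line_vclass a_def)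
  moreover have "vclass x \<noteq> vclass y"
    using xy(3) vclass_self[of x] by (auto simp: vclass_def)
  ultimately show thesis by (rule that)
qed

lemma line_psubset_P2: "P \<in> PS 1 \<Longrightarrow> line P \<subset> P2"
proof -
  assume P: "P \<in> PS 1"
  obtain w where w: "lf P w \<noteq> 0" using lf_nonzero[OF P] by auto
  have x: "axis w 1 \<noteq> (0 :: complex^3)" by simp
  have "dot3 (lf P) (($) (axis w 1)) = lf P w"
    using exhaust_3[of w] by (auto simp: dot3_def axis_def)
  then have "vclass (axis w 1) \<notin> line P" using line_vclass[OF P x] w by simp
  then show ?thesis using line_sub_P2 vclass_P2[OF x] by blast
qed

lemma line_subset_imp_eq:
  assumes "P \<in> PS 1" "Q \<in> PS 1" "line P \<subseteq> line Q"
  shows "P = Q"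
proof (rule ccontr)
  assume "P \<noteq> Q"
  from two_lines_meet(2)[OF assms(1,2) this] line_two_points[OF assms(1)] assms(3)
  show False by (metis Int_absorb2 singletonD)
qed

lemma inj_line: "inj_on line (PS 1)"
  by (rule inj_onI) (simp add: line_subset_imp_eq)

section \<open>The intersection lattice\<close>

lemma X_spaceD:
  assumes "Ls \<in> X_space d"
  shows "length Ls = d" "set Ls \<subseteq> PS 1" "distinct Ls" "card (set Ls) = d"
  using assms by (auto simp: X_space_def tuples_def distinct_card)

definition meet :: "S set set \<Rightarrow> point set" where
  "meet B = P2 \<inter> (\<Inter>P\<in>B. line P)"

lemma intersection_lattice_meet: "intersection_lattice Ls = meet ` Pow (set Ls)"
  by (auto simp: intersection_lattice_def meet_def)

lemma meet_sub_line: "P \<in> B \<Longrightarrow> meet B \<subseteq> line P" by (auto simp: meet_def)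
lemma meet_empty [simp]: "meet {} = P2" by (simp add: meet_def)
lemma meet_single [simp]: "meet {P} = line P" using line_sub_P2 by (auto simp: meet_def)
lemma meet_two [simp]: "meet {P, Q} = line P \<inter> line Q" using line_sub_P2 by (auto simp: meet_def)

lemma atoms_lines:
  assumes "set Ls \<subseteq> PS 1"
  shows "lat_atoms (intersection_lattice Ls) = line ` set Ls"
proof -
  let ?L = "intersection_lattice Ls"
  have P2: "P2 \<in> ?L" unfolding intersection_lattice_meet using meet_empty by blast
  have below: "\<exists>P\<in>set Ls. c \<subseteq> line P" if c: "c \<in> ?L" "c \<subset> P2" for c
  proof -
    obtain B where B: "B \<subseteq> set Ls" "c = meet B" using c(1) unfolding intersection_lattice_meet by blast
    then have "B \<noteq> {}" using c(2) by auto
    then obtain P where "P \<in> B" by blast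
    then show ?thesis using B meet_sub_line[of P B] by blast
  qed
  have inL: "line P \<in> ?L" if "P \<in> set Ls" for P
    unfolding intersection_lattice_meet using that meet_single by blast
  show ?thesis
  proof (intro equalityI subsetI)
    fix a assume "a \<in> lat_atoms ?L"
    then have a: "a \<in> ?L" "a \<subset> P2" "\<not> (\<exists>c\<in>?L. a \<subset> c \<and> c \<subset> P2)"
      by (auto simp: lat_atoms_def covers_def)
    then obtain P where P: "P \<in> set Ls" "a \<subseteq> line P" using below[OF a(1,2)] by blast
    then have "line P \<subset> P2" using line_psubset_P2[of P] assms by blast
    then have "a = line P" using a(3) inL[OF P(1)] P(2) by blast
    then show "a \<in> line ` set Ls" using P by blast
  next
    fix a assume "a \<in> line ` set Ls"
    then obtain P where P: "P \<in> set Ls" "a = line P" by auto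
    have "\<not> (line P \<subset> c \<and> c \<subset> P2)" if c: "c \<in> ?L" for c
    proof
      assume *: "line P \<subset> c \<and> c \<subset> P2"
      then obtain Q where Q: "Q \<in> set Ls" "c \<subseteq> line Q" using below[OF c] by blast
      have "line P \<subseteq> line Q" using * Q(2) by blast
      then have "P = Q" using line_subset_imp_eq[of P Q] P(1) Q(1) assms by blast
      then show False using * Q(2) by blast
    qed
    moreover have "line P \<subset> P2" using line_psubset_P2[of P] P(1) assms by blast
    ultimately have "covers ?L P2 a" using P(2) P2 inL[OF P(1)] unfolding covers_def by blast
    then show "a \<in> lat_atoms ?L" by (simp add: lat_atoms_def)
  qed
qed

lemma multiple_points_eq:
  assumes L: "set Ls \<subseteq> PS 1" and two: "card (set Ls) \<ge> 2"
  shows "multiple_points (intersection_lattice Ls)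
    = {{q} | q. \<exists>P\<in>set Ls. \<exists>Q\<in>set Ls. P \<noteq> Q \<and> q \<in> line P \<and> q \<in> line Q}"
proof -
  let ?L = "intersection_lattice Ls"
  have inL: "line P \<in> ?L" "line P \<inter> line Q \<in> ?L" if "P \<in> set Ls" "Q \<in> set Ls" for P Q
    unfolding intersection_lattice_meet using that meet_single meet_two
    by (metis (no_types, lifting) PowI empty_subsetI image_eqI insert_subset)+
  have below: "\<exists>Q\<in>set Ls. P \<noteq> Q \<and> c \<subseteq> line P \<inter> line Q" if c: "P \<in> set Ls" "c \<in> ?L" "c \<subset> line P" for c P
  proof -
    obtain B where B: "B \<subseteq> set Ls" "c = meet B" using c(2) unfolding intersection_lattice_meet by blast
    have "c \<noteq> P2" "c \<noteq> line P" using c(3) line_sub_P2[of P] by blast+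
    then have "B \<noteq> {}" "B \<noteq> {P}" using B(2) by auto
    then obtain Q where Q: "Q \<in> B" "P \<noteq> Q" by blast
    then have "c \<subseteq> line P \<inter> line Q" using B(2) meet_sub_line[of Q B] c(3) by blast
    then show ?thesis using Q B(1) by blast
  qed
  have single: "\<exists>q. line P \<inter> line Q = {q}" if "P \<in> set Ls" "Q \<in> set Ls" "P \<noteq> Q" for P Q
    using two_lines_meet(2)[OF _ _ that(3)] that(1,2) L by (meson subsetD)
  have proper: "{q} \<subset> line P" if q: "q \<in> line P" "P \<in> set Ls" for q P
  proof -
    have "P \<in> PS 1" using q(2) L by blast
    then obtain a b where "a \<in> line P" "b \<in> line P" "a \<noteq> b" by (rule line_two_points)
    then show ?thesis using q(1) by blast
  qed
  show ?thesis
  proof (intro equalityI subsetI)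
    fix p assume "p \<in> multiple_points ?L"
    then obtain P where P: "P \<in> set Ls" "covers ?L (line P) p"
      unfolding multiple_points_def atoms_lines[OF L] by blast
    then have p: "p \<in> ?L" "p \<subset> line P" "\<not> (\<exists>c\<in>?L. p \<subset> c \<and> c \<subset> line P)"
      by (auto simp: covers_def)
    obtain Q where Q: "Q \<in> set Ls" "P \<noteq> Q" "p \<subseteq> line P \<inter> line Q"
      using below[OF P(1) p(1,2)] by blast
    obtain q where q: "line P \<inter> line Q = {q}" using single[OF P(1) Q(1,2)] by blast
    then have "q \<in> line P" by blast
    then have "line P \<inter> line Q \<subset> line P" unfolding q by (rule proper[OF _ P(1)])
    then have "p = line P \<inter> line Q" using p(3) inL(2)[OF P(1) Q(1)] Q(3) by blast
    then show "p \<in> {{q} | q. \<exists>P\<in>set Ls. \<exists>Q\<in>set Ls. P \<noteq> Q \<and> q \<in> line P \<and> q \<in> line Q}"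
      using P(1) Q(1,2) q by (intro CollectI exI[of _ q]) blast
  next
    fix p assume "p \<in> {{q} | q. \<exists>P\<in>set Ls. \<exists>Q\<in>set Ls. P \<noteq> Q \<and> q \<in> line P \<and> q \<in> line Q}"
    then obtain q P Q where pq: "p = {q}" "P \<in> set Ls" "Q \<in> set Ls" "P \<noteq> Q" "q \<in> line P" "q \<in> line Q"
      by blast
    have p: "p = line P \<inter> line Q" using single[OF pq(2-4)] pq by blast
    have "\<not> (p \<subset> c \<and> c \<subset> line P)" if c: "c \<in> ?L" for c
    proof
      assume *: "p \<subset> c \<and> c \<subset> line P"
      then obtain R where R: "R \<in> set Ls" "P \<noteq> R" "c \<subseteq> line P \<inter> line R" using below[OF pq(2) c] by blast
      obtain r where r: "line P \<inter> line R = {r}" using single[OF pq(2) R(1,2)] by blast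
      have "c \<subseteq> {r}" using R(3) unfolding r .
      moreover have "{q} \<subset> c" using * unfolding pq(1) by blast
      ultimately show False by blast
    qed
    moreover have "p \<in> ?L" using p inL(2)[OF pq(2,3)] by simp
    moreover have "p \<subset> line P" unfolding pq(1) by (rule proper[OF pq(5,2)])
    ultimately have "covers ?L (line P) p" using inL(1)[OF pq(2) pq(2)] unfolding covers_def by blast
    then show "p \<in> multiple_points ?L"
      using pq(2) unfolding multiple_points_def atoms_lines[OF L] by blast
  qed
qed

lemma point_mult_eq:
  assumes L: "set Ls \<subseteq> PS 1"
  shows "point_mult (intersection_lattice Ls) {q} = card {P \<in> set Ls. q \<in> line P}"
proof -
  have "{a \<in> lat_atoms (intersection_lattice Ls). {q} \<subseteq> a} = line ` {P \<in> set Ls. q \<in> line P}"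
    by (auto simp: atoms_lines[OF L])
  moreover have "inj_on line {P \<in> set Ls. q \<in> line P}"
    by (rule inj_on_subset[OF inj_line]) (use L in auto)
  ultimately show ?thesis by (simp add: point_mult_def card_image)
qed

definition lat_tau :: "ilattice \<Rightarrow> nat" where
  "lat_tau \<Lambda> = (\<Sum>p\<in>multiple_points \<Lambda>. (point_mult \<Lambda> p - 1)\<^sup>2)"

text \<open>Atoms, elements of rank two and multiplicities are defined in terms of the order and of
  the largest set \<open>P2\<close>, and an isomorphism maps largest elements to each other.\<close>

lemma lat_tau_iso:
  assumes iso: "lattice_iso A B" and A: "P2 \<in> A" "\<And>a. a \<in> A \<Longrightarrow> a \<subseteq> P2"
    and B: "P2 \<in> B" "\<And>b. b \<in> B \<Longrightarrow> b \<subseteq> P2"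
  shows "lat_tau A = lat_tau B"
proof -
  from iso[unfolded lattice_iso_def] obtain \<phi>
    where \<phi>: "bij_betw \<phi> A B \<and> (\<forall>a\<in>A. \<forall>b\<in>A. b \<subseteq> a \<longleftrightarrow> \<phi> b \<subseteq> \<phi> a)" ..
  then have bij: "bij_betw \<phi> A B" ..
  have ord: "b \<subseteq> a \<longleftrightarrow> \<phi> b \<subseteq> \<phi> a" if "a \<in> A" "b \<in> A" for a b
    by (rule bspec[OF bspec[OF conjunct2[OF \<phi>] that(1)] that(2)])
  have im: "\<phi> ` A = B" and inj: "inj_on \<phi> A" using bij by (auto simp: bij_betw_def)
  have st: "b \<subset> a \<longleftrightarrow> \<phi> b \<subset> \<phi> a" if "a \<in> A" "b \<in> A" for a b
    using ord[OF that] ord[OF that(2,1)] by auto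
  have top: "\<phi> P2 = P2"
  proof -
    obtain x where "x \<in> A" "\<phi> x = P2" using im B(1) by (metis imageE)
    then have "P2 \<subseteq> \<phi> P2" using ord[OF A(1) \<open>x \<in> A\<close>] A(2) by auto
    moreover have "\<phi> P2 \<in> B" using im A(1) by blast
    ultimately show ?thesis using B(2) by blast
  qed
  have cov: "covers A a b \<longleftrightarrow> covers B (\<phi> a) (\<phi> b)" if ab: "a \<in> A" "b \<in> A" for a b
  proof -
    have "(\<exists>c\<in>B. \<phi> b \<subset> c \<and> c \<subset> \<phi> a) \<longleftrightarrow> (\<exists>c\<in>A. \<phi> b \<subset> \<phi> c \<and> \<phi> c \<subset> \<phi> a)" using im by blast
    also have "\<dots> \<longleftrightarrow> (\<exists>c\<in>A. b \<subset> c \<and> c \<subset> a)"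
      by (rule bex_cong[OF refl]) (simp only: st[OF _ ab(2)] st[OF ab(1)])
    finally have "(\<exists>c\<in>B. \<phi> b \<subset> c \<and> c \<subset> \<phi> a) \<longleftrightarrow> (\<exists>c\<in>A. b \<subset> c \<and> c \<subset> a)" .
    moreover have "\<phi> a \<in> B" "\<phi> b \<in> B" using im ab by auto
    ultimately show ?thesis by (simp only: covers_def ab st[OF ab] simp_thms)
  qed
  have atA: "lat_atoms A \<subseteq> A" "lat_atoms B \<subseteq> B" by (auto simp: lat_atoms_def covers_def)
  have at: "\<phi> ` lat_atoms A = lat_atoms B"
  proof (intro equalityI subsetI)
    fix b assume "b \<in> lat_atoms B"
    moreover then obtain a where "a \<in> A" "b = \<phi> a" using atA im by blast
    ultimately show "b \<in> \<phi> ` lat_atoms A" using cov[OF A(1)] top by (auto simp: lat_atoms_def)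
  qed (use cov[OF A(1)] top atA in \<open>auto simp: lat_atoms_def\<close>)
  have mpA: "multiple_points A \<subseteq> A" "multiple_points B \<subseteq> B"
    by (auto simp: multiple_points_def covers_def)
  have mp: "\<phi> ` multiple_points A = multiple_points B"
  proof (intro equalityI subsetI)
    fix b assume b: "b \<in> multiple_points B"
    then obtain a' where a': "a' \<in> lat_atoms B" "covers B a' b" by (auto simp: multiple_points_def)
    obtain a where a: "a \<in> A" "b = \<phi> a" using b mpA(2) im by blast
    obtain c where c: "c \<in> lat_atoms A" "a' = \<phi> c" using a'(1) at by blast
    have "covers A c a" using a'(2) cov[of c a] atA a c by auto
    then show "b \<in> \<phi> ` multiple_points A" using a c unfolding multiple_points_def by blast
  next
    fix b assume "b \<in> \<phi> ` multiple_points A"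
    then obtain a c where "a \<in> A" "b = \<phi> a" "c \<in> lat_atoms A" "covers A c a"
      using mpA by (auto simp: multiple_points_def)
    then show "b \<in> multiple_points B" using at cov atA unfolding multiple_points_def by blast
  qed
  have mult: "point_mult B (\<phi> p) = point_mult A p" if p: "p \<in> A" for p
  proof -
    have "{a \<in> lat_atoms B. \<phi> p \<subseteq> a} = \<phi> ` {a \<in> lat_atoms A. p \<subseteq> a}"
      using ord[OF _ p] atA(1) unfolding at[symmetric] by auto
    moreover have "inj_on \<phi> {a \<in> lat_atoms A. p \<subseteq> a}" by (rule inj_on_subset[OF inj]) (use atA in auto)
    ultimately show ?thesis by (simp add: point_mult_def card_image)
  qed
  have "lat_tau B = (\<Sum>p\<in>\<phi> ` multiple_points A. (point_mult B p - 1)\<^sup>2)" by (simp add: lat_tau_def mp)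
  also have "\<dots> = (\<Sum>p\<in>multiple_points A. (point_mult B (\<phi> p) - 1)\<^sup>2)"
    by (subst sum.reindex) (auto intro: inj_on_subset[OF inj mpA(1)])
  also have "\<dots> = lat_tau A" unfolding lat_tau_def using mult mpA by (intro sum.cong) auto
  finally show ?thesis ..
qed

definition dep :: "S set list \<Rightarrow> (nat \<times> nat \<times> nat) set" where
  "dep Ls = {(i, j, k). i < length Ls \<and> j < length Ls \<and> k < length Ls
     \<and> det3 (lf (Ls ! i)) (lf (Ls ! j)) (lf (Ls ! k)) = 0}"

text \<open>As soon as \<open>B\<close> contains two different indices \<open>i, k\<close>, the
  lines \<open>i\<close> and \<open>k\<close> meet in one point, and whether this point is on a
  further line is the dependence of a triple. So all inclusions between intersections and lines are
  encoded in \<open>dep Ls\<close>.\<close>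

lemma meet_sub_line_iff:
  assumes X: "Ls \<in> X_space d" and B: "B \<subseteq> {..<d}" and j: "j < d"
  shows "meet ((!) Ls ` B) \<subseteq> line (Ls ! j) \<longleftrightarrow>
     j \<in> B \<or> (\<exists>i\<in>B. \<exists>k\<in>B. i \<noteq> k \<and> ((\<exists>b\<in>B. (i, k, b) \<notin> dep Ls) \<or> (i, k, j) \<in> dep Ls))"
proof -
  have len: "length Ls = d" and PS: "\<And>i. i < d \<Longrightarrow> Ls ! i \<in> PS 1"
    and ne: "\<And>i j. i < d \<Longrightarrow> j < d \<Longrightarrow> Ls ! i = Ls ! j \<longleftrightarrow> i = j"
    using X_spaceD[OF X] by (auto simp: nth_eq_iff_index_eq)
  have dep: "(i, k, b) \<in> dep Ls \<longleftrightarrow> line (Ls ! i) \<inter> line (Ls ! k) \<subseteq> line (Ls ! b)"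
    if "i < d" "k < d" "b < d" "i \<noteq> k" for i k b
    using three_lines_meet[of "Ls ! i" "Ls ! k" "Ls ! b"] that PS ne by (simp add: dep_def len)
  show ?thesis
  proof (cases "\<exists>i\<in>B. \<exists>k\<in>B. i \<noteq> k")
    case True
    have eq: "((\<exists>b\<in>B. (i, k, b) \<notin> dep Ls) \<or> (i, k, j) \<in> dep Ls) \<longleftrightarrow> meet ((!) Ls ` B) \<subseteq> line (Ls ! j)"
      if ik: "i \<in> B" "k \<in> B" "i \<noteq> k" for i k
    proof -
      obtain q where q: "line (Ls ! i) \<inter> line (Ls ! k) = {q}"
      proof -
        have "Ls ! i \<in> PS 1" "Ls ! k \<in> PS 1" "Ls ! i \<noteq> Ls ! k"
          using ik B PS[of i] PS[of k] ne[of i k] by auto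
        from two_lines_meet(2)[OF this] show thesis by (rule that)
      qed
      have d: "(i, k, b) \<in> dep Ls \<longleftrightarrow> q \<in> line (Ls ! b)" if "b < d" for b
        using dep[of i k b] ik B that q by auto
      have sub: "meet ((!) Ls ` B) \<subseteq> {q}"
        using meet_sub_line[of "Ls ! i" "(!) Ls ` B"] meet_sub_line[of "Ls ! k" "(!) Ls ` B"] ik q by blast
      have "q \<in> meet ((!) Ls ` B) \<longleftrightarrow> (\<forall>b\<in>B. q \<in> line (Ls ! b))"
        using q line_sub_P2 by (auto simp: meet_def)
      then have "q \<in> meet ((!) Ls ` B) \<longleftrightarrow> (\<forall>b\<in>B. (i, k, b) \<in> dep Ls)"
        using d B by blast
      then show ?thesis using sub d[OF j] by blast
    qed
    have "j \<in> B \<Longrightarrow> meet ((!) Ls ` B) \<subseteq> line (Ls ! j)" by (rule meet_sub_line) auto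
    then show ?thesis using True eq by blast
  next
    case False
    then consider "B = {}" | b where "B = {b}" by blast
    then show ?thesis
    proof cases
      case 1
      then show ?thesis using line_psubset_P2[OF PS[OF j]] by auto
    next
      case 2
      then have "b < d" using B by auto
      then show ?thesis using 2 line_subset_imp_eq[of "Ls ! b" "Ls ! j"] PS j ne by auto
    qed
  qed
qed

text \<open>Both lattices are images of the subsets of the set of indices, and by
  \<open>meet_sub_line_iff\<close> the images have the same order relation. Sending the intersection
  of the lines in \<open>B\<close> to the one for the other arrangement is therefore well defined
  and an isomorphism.\<close>

lemma dep_eq_imp_iso:
  assumes X: "Ls \<in> X_space d" "Ls' \<in> X_space d" and dep: "dep Ls = dep Ls'"
  shows "lattice_iso (intersection_lattice Ls) (intersection_lattice Ls')"
proof -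
  define I I' where "I B = meet ((!) Ls ` B)" and "I' B = meet ((!) Ls' ` B)" for B
  have lat: "intersection_lattice Ls = I ` Pow {..<d}" "intersection_lattice Ls' = I' ` Pow {..<d}"
  proof -
    have "set Ls = (!) Ls ` {..<d}" "set Ls' = (!) Ls' ` {..<d}"
      using X_spaceD(1)[OF X(1)] X_spaceD(1)[OF X(2)] by (auto simp: set_conv_nth)
    then show "intersection_lattice Ls = I ` Pow {..<d}" "intersection_lattice Ls' = I' ` Pow {..<d}"
      unfolding intersection_lattice_meet I_def I'_def by (simp_all add: image_Pow_surj[symmetric] image_image)
  qed
  have H: "I B \<subseteq> line (Ls ! j) \<longleftrightarrow> I' B \<subseteq> line (Ls' ! j)" if "B \<subseteq> {..<d}" "j < d" for B j
    unfolding I_def I'_def meet_sub_line_iff[OF X(1) that] meet_sub_line_iff[OF X(2) that] dep ..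
  have sub: "I B \<subseteq> I C \<longleftrightarrow> (\<forall>j\<in>C. I B \<subseteq> line (Ls ! j))"
    "I' B \<subseteq> I' C \<longleftrightarrow> (\<forall>j\<in>C. I' B \<subseteq> line (Ls' ! j))" for B C
    by (auto simp: I_def I'_def meet_def)
  have ord: "I B \<subseteq> I C \<longleftrightarrow> I' B \<subseteq> I' C" if "B \<subseteq> {..<d}" "C \<subseteq> {..<d}" for B C
    unfolding sub using H that by (meson lessThan_iff subsetD)
  \<comment> \<open>Any index set \<open>B\<close> that represents \<open>a\<close> will do, by
    \<open>ord\<close>.\<close>
  define \<phi> where "\<phi> a = I' (SOME B. B \<subseteq> {..<d} \<and> a = I B)" for a
  have phi: "\<phi> (I B) = I' B" if B: "B \<subseteq> {..<d}" for B
  proof -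
    define C where "C = (SOME C. C \<subseteq> {..<d} \<and> I B = I C)"
    have "C \<subseteq> {..<d} \<and> I B = I C" unfolding C_def by (rule someI[of _ B]) (use B in auto)
    then have "I' C = I' B" using ord B by (metis subset_antisym subset_refl)
    then show ?thesis by (simp add: \<phi>_def C_def)
  qed
  have "bij_betw \<phi> (I ` Pow {..<d}) (I' ` Pow {..<d})"
    unfolding bij_betw_def
  proof
    show "inj_on \<phi> (I ` Pow {..<d})"
    proof (rule inj_onI)
      fix x y assume "x \<in> I ` Pow {..<d}" "y \<in> I ` Pow {..<d}" and eq: "\<phi> x = \<phi> y"
      then obtain B C where BC: "B \<subseteq> {..<d}" "C \<subseteq> {..<d}" "x = I B" "y = I C" by blast
      then have "I' B = I' C" using eq phi by simp
      then show "x = y" using ord[OF BC(1,2)] ord[OF BC(2,1)] BC(3,4) by simp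
    qed
    show "\<phi> ` I ` Pow {..<d} = I' ` Pow {..<d}"
      unfolding image_image by (intro image_cong) (auto simp: phi)
  qed
  moreover have "\<forall>a\<in>I ` Pow {..<d}. \<forall>b\<in>I ` Pow {..<d}. b \<subseteq> a \<longleftrightarrow> \<phi> b \<subseteq> \<phi> a"
    using ord by (auto simp: phi)
  ultimately show ?thesis unfolding lattice_iso_def lat by blast
qed

lemma lattice_iso_sym: assumes "lattice_iso A B" shows "lattice_iso B A"
proof -
  obtain \<phi> where bij: "bij_betw \<phi> A B" and ord: "\<forall>a\<in>A. \<forall>b\<in>A. b \<subseteq> a \<longleftrightarrow> \<phi> b \<subseteq> \<phi> a"
    using assms unfolding lattice_iso_def by blast
  have "bij_betw (inv_into A \<phi>) B A" by (rule bij_betw_inv_into[OF bij])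
  moreover have "inv_into A \<phi> b \<in> A \<and> \<phi> (inv_into A \<phi> b) = b" if "b \<in> B" for b
    using bij that by (metis bij_betw_def f_inv_into_f inv_into_into)
  ultimately show ?thesis unfolding lattice_iso_def using ord by (intro exI[of _ "inv_into A \<phi>"]) auto
qed

lemma lattice_iso_trans: assumes "lattice_iso A B" "lattice_iso B C" shows "lattice_iso A C"
proof -
  obtain \<phi> where 1: "bij_betw \<phi> A B" "\<forall>a\<in>A. \<forall>b\<in>A. b \<subseteq> a \<longleftrightarrow> \<phi> b \<subseteq> \<phi> a"
    using assms unfolding lattice_iso_def by blast
  obtain \<psi> where 2: "bij_betw \<psi> B C" "\<forall>a\<in>B. \<forall>b\<in>B. b \<subseteq> a \<longleftrightarrow> \<psi> b \<subseteq> \<psi> a"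
    using assms unfolding lattice_iso_def by blast
  have "\<phi> a \<in> B" if "a \<in> A" for a using 1 that by (auto simp: bij_betw_def)
  then show ?thesis unfolding lattice_iso_def using 1 2 bij_betw_trans[OF 1(1) 2(1)]
    by (intro exI[of _ "\<psi> \<circ> \<phi>"]) auto
qed

lemma lattice_iso_refl: "lattice_iso A A"
  unfolding lattice_iso_def by (rule exI[of _ id]) auto

lemma lattices_cases:
  assumes "L \<in> lattices d"
  obtains Ls where "Ls \<in> X_space d" "L = {\<Lambda> \<in> intersection_lattice ` X_space d. lattice_iso (intersection_lattice Ls) \<Lambda>}"
  using assms unfolding lattices_def Let_def quotient_def Image_def by auto

lemma lattice_class_in_lattices:
  assumes "Ls \<in> X_space d"
  shows "{\<Lambda> \<in> intersection_lattice ` X_space d. lattice_iso (intersection_lattice Ls) \<Lambda>} \<in> lattices d"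
  unfolding lattices_def Let_def quotient_def Image_def using assms by auto

lemma X_lat_eq:
  assumes "L \<in> lattices d" "Ls \<in> X_lat d L"
  shows "X_lat d L = {Ms \<in> X_space d. lattice_iso (intersection_lattice Ls) (intersection_lattice Ms)}"
proof -
  obtain Ks where K: "Ks \<in> X_space d"
    "L = {\<Lambda> \<in> intersection_lattice ` X_space d. lattice_iso (intersection_lattice Ks) \<Lambda>}"
    using lattices_cases[OF assms(1)] by blast
  have KL: "lattice_iso (intersection_lattice Ks) (intersection_lattice Ls)"
    using assms(2) unfolding X_lat_def K(2) by simp
  have "lattice_iso (intersection_lattice Ks) \<Lambda> \<longleftrightarrow> lattice_iso (intersection_lattice Ls) \<Lambda>" for \<Lambda>
    using lattice_iso_trans[OF KL] lattice_iso_trans[OF lattice_iso_sym[OF KL]] by blast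
  then show ?thesis unfolding X_lat_def K(2) by auto
qed

lemma X_lat_nonempty: "L \<in> lattices d \<Longrightarrow> X_lat d L \<noteq> {}"
  by (erule lattices_cases) (auto simp: X_lat_def lattice_iso_refl)

lemma tau_lat_eq:
  assumes "L \<in> lattices d" "Ls \<in> X_lat d L"
  shows "tau_lat L = lat_tau (intersection_lattice Ls)"
proof -
  obtain Ks where K: "Ks \<in> X_space d"
    "L = {\<Lambda> \<in> intersection_lattice ` X_space d. lattice_iso (intersection_lattice Ks) \<Lambda>}"
    using lattices_cases[OF assms(1)] by blast
  have "intersection_lattice Ks \<in> L" using K lattice_iso_refl by blast
  then have "rep L \<in> L" unfolding rep_def by (rule someI)
  then obtain Ms where M: "Ms \<in> X_space d" "rep L = intersection_lattice Ms"
    "lattice_iso (intersection_lattice Ks) (intersection_lattice Ms)" by (auto simp: K)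
  have KL: "lattice_iso (intersection_lattice Ks) (intersection_lattice Ls)"
    using assms(2) unfolding X_lat_def K(2) by simp
  have "lattice_iso (intersection_lattice Ms) (intersection_lattice Ls)"
    by (rule lattice_iso_trans[OF lattice_iso_sym[OF M(3)] KL])
  moreover have "P2 \<in> intersection_lattice Ns" "a \<in> intersection_lattice Ns \<Longrightarrow> a \<subseteq> P2" for Ns a
    unfolding intersection_lattice_meet using meet_empty by (blast, auto simp: meet_def)
  ultimately have "lat_tau (intersection_lattice Ms) = lat_tau (intersection_lattice Ls)"
    by (intro lat_tau_iso)
  then show ?thesis by (simp add: tau_lat_def lat_tau_def M(2))
qed

section \<open>Elimination of roots\<close>

text \<open>A condition \<open>C\<close> on the parameters is closed relative to the open set
  \<open>O'\<close>: every point of \<open>O'\<close> outside of \<open>C\<close> is separated from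
  \<open>C\<close> by one polynomial function. The function has to vanish on all of
  \<open>C\<close>, also outside of \<open>O'\<close>. This pointwise form avoids ideals and their
  generators.\<close>

definition vclosed :: "('i \<Rightarrow> 's \<Rightarrow> complex) \<Rightarrow> ('s \<Rightarrow> bool) \<Rightarrow> ('s \<Rightarrow> bool) \<Rightarrow> bool" where
  "vclosed X O' C \<longleftrightarrow>
     (\<forall>s. O' s \<longrightarrow> \<not> C s \<longrightarrow> (\<exists>D. pfun X D \<and> D s \<noteq> 0 \<and> (\<forall>t. C t \<longrightarrow> D t = 0)))"

lemma pfun_subst:
  assumes "pfun X D" "\<And>i. pfun Y (\<lambda>s. X i (h s))"
  shows "pfun Y (\<lambda>s. D (h s))"
  using assms by induction auto

lemma vclosed_eq: "pfun X f \<Longrightarrow> vclosed X O' (\<lambda>s. f s = 0)"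
  unfolding vclosed_def by blast

lemma vclosed_All: "(\<And>a. a \<in> A \<Longrightarrow> vclosed X O' (C a)) \<Longrightarrow> vclosed X O' (\<lambda>s. \<forall>a\<in>A. C a s)"
  unfolding vclosed_def by (metis (no_types, lifting))

lemma vclosed_conj: "vclosed X O' C \<Longrightarrow> vclosed X O' C' \<Longrightarrow> vclosed X O' (\<lambda>s. C s \<and> C' s)"
  unfolding vclosed_def by (metis (no_types, lifting))

lemma vclosed_disj:
  assumes "vclosed X O' C" "vclosed X O' C'"
  shows "vclosed X O' (\<lambda>s. C s \<or> C' s)"
  unfolding vclosed_def
proof (intro allI impI)
  fix s assume s: "O' s" "\<not> (C s \<or> C' s)"
  then obtain D where D: "pfun X D" "D s \<noteq> 0" "\<forall>t. C t \<longrightarrow> D t = 0"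
    using assms(1) unfolding vclosed_def by blast
  obtain E where E: "pfun X E" "E s \<noteq> 0" "\<forall>t. C' t \<longrightarrow> E t = 0"
    using s assms(2) unfolding vclosed_def by blast
  show "\<exists>D. pfun X D \<and> D s \<noteq> 0 \<and> (\<forall>t. C t \<or> C' t \<longrightarrow> D t = 0)"
    by (rule exI[of _ "\<lambda>s. D s * E s"]) (use D E in auto)
qed

lemma vclosed_False: "vclosed X O' (\<lambda>s. False)"
  unfolding vclosed_def by (intro allI impI exI[of _ "\<lambda>_. 1"]) auto

lemma vclosed_Ex:
  assumes "finite A" "\<And>a. a \<in> A \<Longrightarrow> vclosed X O' (C a)"
  shows "vclosed X O' (\<lambda>s. \<exists>a\<in>A. C a s)"
  using assms
proof (induction A rule: finite_induct)
  case empty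
  then show ?case using vclosed_False by simp
next
  case (insert a A)
  have "vclosed X O' (\<lambda>s. C a s \<or> (\<exists>a\<in>A. C a s))"
    by (rule vclosed_disj) (use insert in auto)
  then show ?case by simp
qed

lemma vclosed_subst:
  assumes "vclosed X O' C" "\<And>i. pfun Y (\<lambda>s. X i (h s))" "\<And>s. O'' s \<Longrightarrow> O' (h s)"
  shows "vclosed Y O'' (\<lambda>s. C (h s))"
  unfolding vclosed_def
proof (intro allI impI)
  fix s assume "O'' s" "\<not> C (h s)"
  then obtain D where D: "pfun X D" "D (h s) \<noteq> 0" "\<forall>t. C t \<longrightarrow> D t = 0"
    using assms(1,3) unfolding vclosed_def by blast
  then show "\<exists>D. pfun Y D \<and> D s \<noteq> 0 \<and> (\<forall>t. C (h t) \<longrightarrow> D t = 0)"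
    using pfun_subst[OF D(1) assms(2)] by (intro exI[of _ "\<lambda>s. D (h s)"]) auto
qed

text \<open>Remove the roots of \<open>p\<close> one at a time.\<close>

lemma coprime_dvd_poly:
  fixes p e :: "complex poly"
  assumes "p \<noteq> 0" "\<And>t. poly p t = 0 \<Longrightarrow> poly e t \<noteq> 0" "p dvd B * e"
  shows "p dvd B"
  using assms
proof (induction "degree p" arbitrary: p B)
  case 0
  then obtain c where "p = [:c:]" "c \<noteq> 0" by (metis degree_eq_zeroE pCons_0_0)
  then show ?case by (simp add: const_poly_dvd_iff) (metis dvd_field_iff)
next
  case (Suc n)
  have "\<not> constant (poly p)" using Suc(2) by (simp add: constant_degree)
  then obtain r where r: "poly p r = 0" using fundamental_theorem_of_algebra by blast
  then obtain p' where p': "p = [:- r, 1:] * p'" by (auto simp: poly_eq_0_iff_dvd elim: dvdE)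
  then have ne: "p' \<noteq> 0" using Suc(3) by auto
  have "degree p = Suc (degree p')" using ne by (subst p', subst degree_mult_eq) auto
  then have deg: "n = degree p'" using Suc(2) by simp
  have "poly (B * e) r = 0" using Suc(5) r by (metis dvd_trans poly_eq_0_iff_dvd)
  then have "poly B r = 0" using Suc(4)[OF r] by simp
  then obtain B' where B': "B = [:- r, 1:] * B'" by (auto simp: poly_eq_0_iff_dvd elim: dvdE)
  have "[:- r, 1:] * p' dvd [:- r, 1:] * (B' * e)" using Suc(5) unfolding p' B' by (simp only: mult.assoc)
  then have dvd: "p' dvd B' * e" by (simp only: dvd_mult_cancel_left) auto
  have nr: "poly e t \<noteq> 0" if "poly p' t = 0" for t
    by (rule Suc(4)) (simp only: p' poly_mult that mult_zero_right)
  have "p' dvd B'" by (rule Suc(1)[OF deg ne nr dvd])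
  then show ?case unfolding p' B' by (rule mult_dvd_mono[OF dvd_refl])
qed

lemma poly_sum_coeff:
  fixes p :: "complex poly"
  assumes "degree p < M" shows "poly p x = (\<Sum>k<M. coeff p k * x ^ k)"
  unfolding poly_altdef
  by (rule sum.mono_neutral_left) (use assms in \<open>auto simp: coeff_eq_0\<close>)

text \<open>Coordinates on pairs \<open>(s, t)\<close>: those of \<open>s\<close> and the number
  \<open>t\<close> as the additional coordinate \<open>None\<close>.\<close>

definition Yc :: "('i \<Rightarrow> 's \<Rightarrow> complex) \<Rightarrow> 'i option \<Rightarrow> 's \<times> complex \<Rightarrow> complex" where
  "Yc X = (\<lambda>i st. case i of None \<Rightarrow> snd st | Some i \<Rightarrow> X i (fst st))"

lemma pfun_as_poly:
  assumes "pfun (Yc X) E"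
  obtains N e where "\<And>k. pfun X (\<lambda>s. coeff (e s) k)" "\<And>s. degree (e s) \<le> N"
    "\<And>s t. poly (e s) t = E (s, t)"
proof -
  from assms have "\<exists>N e. (\<forall>k. pfun X (\<lambda>s. coeff (e s) k)) \<and> (\<forall>s. degree (e s) \<le> N)
    \<and> (\<forall>s t. poly (e s) t = E (s, t))"
  proof induction
    case (pfun_const c)
    have "pfun X (\<lambda>s. coeff [:c:] k)" for k by simp
    then show ?case by (intro exI[of _ 0] exI[of _ "\<lambda>_. [:c:]"]) auto
  next
    case (pfun_coord i)
    show ?case
    proof (cases i)
      case None
      have "pfun X (\<lambda>s. coeff [:0, 1:] k)" for k by simp
      then show ?thesis using None
        by (intro exI[of _ 1] exI[of _ "\<lambda>_. [:0, 1:]"]) (auto simp: Yc_def)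
    next
      case (Some j)
      have "pfun X (\<lambda>s. coeff [:X j s:] k)" for k by (cases k) auto
      then show ?thesis using Some
        by (intro exI[of _ 0] exI[of _ "\<lambda>s. [:X j s:]"]) (auto simp: Yc_def)
    qed
  next
    case (pfun_add f g)
    then obtain N e M h where
      "\<forall>k. pfun X (\<lambda>s. coeff (e s) k)" "\<forall>s. degree (e s) \<le> N" "\<forall>s t. poly (e s) t = f (s, t)"
      "\<forall>k. pfun X (\<lambda>s. coeff (h s) k)" "\<forall>s. degree (h s) \<le> M" "\<forall>s t. poly (h s) t = g (s, t)" by metis
    then show ?case
      by (intro exI[of _ "max N M"] exI[of _ "\<lambda>s. e s + h s"])
        (auto intro!: degree_add_le
          intro: order_trans[OF _ max.cobounded1] order_trans[OF _ max.cobounded2])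
  next
    case (pfun_mult f g)
    then obtain N e M h where
      "\<forall>k. pfun X (\<lambda>s. coeff (e s) k)" "\<forall>s. degree (e s) \<le> N" "\<forall>s t. poly (e s) t = f (s, t)"
      "\<forall>k. pfun X (\<lambda>s. coeff (h s) k)" "\<forall>s. degree (h s) \<le> M" "\<forall>s t. poly (h s) t = g (s, t)" by metis
    then show ?case
      by (intro exI[of _ "N + M"] exI[of _ "\<lambda>s. e s * h s"])
        (auto simp: coeff_mult intro!: order_trans[OF degree_mult_le] add_mono)
  qed
  then show ?thesis using that by blast
qed

text \<open>The resultant without determinants. Suppose that no root of \<open>p(s0)\<close>
  satisfies \<open>C\<close>. A combination \<open>EE\<close> of the separating functions at the
  finitely many roots vanishes on \<open>C\<close> and at no root of \<open>p(s0)\<close>; regard it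
  as a polynomial \<open>e(s)\<close> in \<open>t\<close>. Then \<open>p(s0)\<close> and
  \<open>e(s0)\<close> are coprime, so the Sylvester vectors \<open>t\<^sup>j p\<close> and
  \<open>t\<^sup>j e\<close> are linearly independent at \<open>s0\<close>, and hence wherever some
  polynomial function \<open>D\<close> with \<open>D(s0) \<noteq> 0\<close> does not vanish. If
  \<open>p(s)\<close> has a root \<open>t\<close> with \<open>C(s, t)\<close>, then \<open>t\<close>
  is a common root of \<open>p(s)\<close> and \<open>e(s)\<close>, so the Sylvester vectors are in a
  hyperplane and \<open>D(s) = 0\<close>.\<close>

lemma eliminate_root:
  fixes X :: "'i \<Rightarrow> 's \<Rightarrow> complex" and p :: "'s \<Rightarrow> complex poly"
  assumes p: "\<And>k. pfun X (\<lambda>s. coeff (p s) k)" "\<And>s. degree (p s) \<le> n" "\<And>s. O' s \<Longrightarrow> coeff (p s) n \<noteq> 0"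
    and C: "vclosed (Yc X) (\<lambda>st. O' (fst st)) C"
  shows "vclosed X O' (\<lambda>s. \<exists>t. poly (p s) t = 0 \<and> C (s, t))"
  unfolding vclosed_def
proof (intro allI impI)
  fix s0 assume O: "O' s0" and no: "\<not> (\<exists>t. poly (p s0) t = 0 \<and> C (s0, t))"
  have pn: "coeff (p s0) n \<noteq> 0" "degree (p s0) = n" "p s0 \<noteq> 0"
    using p(3)[OF O] p(2)[of s0] by (auto simp: le_antisym le_degree)
  define R where "R = {t. poly (p s0) t = 0}"
  have R: "finite R" unfolding R_def by (rule poly_roots_finite[OF pn(3)])
  have "\<forall>r\<in>R. \<exists>E. pfun (Yc X) E \<and> E (s0, r) \<noteq> 0 \<and> (\<forall>st. C st \<longrightarrow> E st = 0)"
    using C no O unfolding vclosed_def R_def by auto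
  from bchoice[OF this] obtain E where E: "\<And>r. r \<in> R \<Longrightarrow> pfun (Yc X) (E r)"
    "\<And>r. r \<in> R \<Longrightarrow> E r (s0, r) \<noteq> 0" "\<And>r st. r \<in> R \<Longrightarrow> C st \<Longrightarrow> E r st = 0" by blast
  \<comment> \<open>Interpolation: at a root \<open>r\<close> only the term of \<open>r\<close>
    survives.\<close>
  define EE where "EE st = (\<Sum>r\<in>R. E r st * (\<Prod>r'\<in>R - {r}. snd st - r'))" for st
  have sndY: "pfun (Yc X) (\<lambda>st. snd st - c)" for c
    using pfun_diff[OF pfun_coord[of "Yc X" None] pfun_const[of "Yc X" c]] by (simp add: Yc_def)
  have EEp: "pfun (Yc X) EE"
    unfolding EE_def by (intro pfun_sum pfun_mult pfun_prod sndY E(1))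
  have EE0: "EE st = 0" if "C st" for st using E(3) that by (simp add: EE_def)
  have EE1: "EE (s0, r) \<noteq> 0" if r: "r \<in> R" for r
  proof -
    have "EE (s0, r) = E r (s0, r) * (\<Prod>r'\<in>R - {r}. r - r')
        + (\<Sum>q\<in>R - {r}. E q (s0, r) * (\<Prod>r'\<in>R - {q}. r - r'))"
      unfolding EE_def using r R by (subst sum.remove[of _ r]) auto
    also have "(\<Sum>q\<in>R - {r}. E q (s0, r) * (\<Prod>r'\<in>R - {q}. r - r')) = 0"
      by (rule sum.neutral) (use r R in auto)
    finally show ?thesis using E(2)[OF r] R by simp
  qed
  obtain N0 e where e: "\<And>k. pfun X (\<lambda>s. coeff (e s) k)" "\<And>s. degree (e s) \<le> N0"
    "\<And>s t. poly (e s) t = EE (s, t)" using pfun_as_poly[OF EEp] by metis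
  \<comment> \<open>The bound on the degree of \<open>e\<close> is raised to a positive number, so
    that there is at least one Sylvester vector.\<close>
  define N where "N = Suc N0"
  define M where "M = N + n"
  define v where "v j s = (if j < N then monom 1 j * p s else monom 1 (j - N) * e s)" for j s
  have vp: "pfun X (\<lambda>s. coeff (v j s) k)" for j k
    by (cases "j < N"; cases "j \<le> k"; cases "j - N \<le> k") (simp_all add: v_def coeff_monom_mult p e)
  have vdeg: "degree (v j s) < M" if "j < M" for j s
  proof (cases "j < N")
    case True
    have "degree (v j s) \<le> j + degree (p s)"
      unfolding v_def using True degree_mult_le[of "monom 1 j" "p s"] by (simp add: degree_monom_eq)
    then show ?thesis using True p(2)[of s] by (simp add: M_def)
  next
    case False
    have "degree (v j s) \<le> (j - N) + degree (e s)"
      unfolding v_def using False degree_mult_le[of "monom 1 (j - N)" "e s"] by (simp add: degree_monom_eq)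
    then show ?thesis using False that e(2)[of s] by (simp add: M_def N_def)
  qed
  have "lin_indep {..<M} (\<lambda>j k. coeff (v j s0) k)"
    unfolding lin_indep_def
  proof (intro allI impI)
    fix c assume c: "\<forall>k. (\<Sum>j<M. c j * coeff (v j s0) k) = 0"
    define A where "A = (\<Sum>j<N. monom (c j) j)"
    define B where "B = (\<Sum>j<n. monom (c (N + j)) j)"
    have cA: "coeff A j = (if j < N then c j else 0)" for j
      by (auto simp: A_def coeff_sum if_distrib sum.delta' cong: if_cong)
    have cB: "coeff B j = (if j < n then c (N + j) else 0)" for j
      by (auto simp: B_def coeff_sum if_distrib sum.delta' cong: if_cong)
    have sm: "smult a (monom 1 j * q) = monom a j * q" for a j and q :: "complex poly"
      by (metis mult.right_neutral mult_smult_left smult_monom)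
    have "(\<Sum>j<M. smult (c j) (v j s0)) = 0"
      using c by (intro poly_eqI) (simp add: coeff_sum)
    also have "(\<Sum>j<M. smult (c j) (v j s0)) = (\<Sum>j<N. smult (c j) (v j s0)) + (\<Sum>j<n. smult (c (N + j)) (v (N + j) s0))"
      unfolding M_def by (simp add: sum.nat_group[symmetric] lessThan_atLeast0 sum.atLeastLessThan_concat[symmetric, of 0 N "N + n"]
         sum.atLeastLessThan_shift_0[of _ N "N + n"] add.commute)
    also have "\<dots> = A * p s0 + B * e s0"
      by (simp add: v_def A_def B_def sm sum_distrib_right)
    finally have eq: "A * p s0 + B * e s0 = 0" .
    then have "B * e s0 = - A * p s0" by (simp add: eq_neg_iff_add_eq_0 add.commute)
    then have "p s0 dvd B * e s0" by simp
    moreover have "poly (e s0) t \<noteq> 0" if "poly (p s0) t = 0" for t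
      using EE1[of t] that e(3) by (simp add: R_def)
    ultimately have dvd: "p s0 dvd B" using coprime_dvd_poly[OF pn(3)] by blast
    \<comment> \<open>\<open>B\<close> is a multiple of \<open>p(s0)\<close>, which has degree
      \<open>n\<close>, but has degree less than \<open>n\<close>.\<close>
    have "B = 0"
    proof (rule ccontr)
      assume "B \<noteq> 0"
      then have "n \<le> degree B" using dvd_imp_degree_le[OF dvd] pn by simp
      moreover have "coeff B (degree B) \<noteq> 0" using \<open>B \<noteq> 0\<close> by simp
      ultimately show False by (simp add: cB)
    qed
    moreover from this eq pn(3) have "A = 0" by simp
    ultimately have z: "coeff A j = 0" "coeff B j = 0" for j by simp_all
    show "\<forall>j\<in>{..<M}. c j = 0"
    proof
      fix j assume "j \<in> {..<M}"
      then show "c j = 0" using z(1)[of j] z(2)[of "j - N"] by (cases "j < N") (auto simp: cA cB M_def split: if_splits)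
    qed
  qed
  then obtain D where D: "pfun X D" "D s0 \<noteq> 0"
    "\<And>s. D s \<noteq> 0 \<Longrightarrow> lin_indep {..<M} (\<lambda>j k. coeff (v j s) k)"
    using lin_indep_near[of "{..<M}" X "\<lambda>j k s. coeff (v j s) k" s0] vp by auto
  have "D s = 0" if "poly (p s) t = 0" "C (s, t)" for s t
  proof (rule ccontr)
    assume "D s \<noteq> 0"
    note ind = D(3)[OF this]
    have root: "poly (v j s) t = 0" for j using that e(3) EE0 by (simp add: v_def)
    \<comment> \<open>A relation between the coefficients of positive degree also holds for the
      constant ones, because \<open>t\<close> is a root of all the vectors.\<close>
    have "card {1..<M} < card {..<M}" by (simp add: M_def N_def)
    then obtain c where c: "\<exists>j\<in>{..<M}. c j \<noteq> 0"
      "\<forall>k\<in>{1..<M}. (\<Sum>j<M. c j * coeff (v j s) k) = 0"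
      using nontrivial_solution[of "{1..<M}" "{..<M}" "\<lambda>j k. coeff (v j s) k"] by blast
    have "(\<Sum>j<M. c j * coeff (v j s) k) = 0" for k
    proof -
      consider "k \<in> {1..<M}" | "k \<ge> M" | "k = 0" by fastforce
      then show ?thesis
      proof cases
        case 2
        then have "coeff (v j s) k = 0" if "j < M" for j
          using vdeg[OF that, of s] by (intro coeff_eq_0) simp
        then show ?thesis by simp
      next
        case 3
        have "0 = (\<Sum>j<M. c j * poly (v j s) t)" by (simp add: root)
        also have "\<dots> = (\<Sum>j<M. \<Sum>k<M. c j * coeff (v j s) k * t ^ k)"
          by (intro sum.cong refl) (simp add: poly_sum_coeff[OF vdeg] sum_distrib_left mult.assoc)
        also have "\<dots> = (\<Sum>k<M. (\<Sum>j<M. c j * coeff (v j s) k) * t ^ k)"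
          by (subst sum.swap) (simp add: sum_distrib_right)
        also have "\<dots> = (\<Sum>k\<in>{0}. (\<Sum>j<M. c j * coeff (v j s) k) * t ^ k)"
          by (rule sum.mono_neutral_right) (use c(2) in \<open>auto simp: M_def N_def\<close>)
        finally show ?thesis using 3 by simp
      qed (use c(2) in auto)
    qed
    then have "\<forall>j\<in>{..<M}. c j = 0" using ind unfolding lin_indep_def by blast
    then show False using c(1) by blast
  qed
  then show "\<exists>D. pfun X D \<and> D s0 \<noteq> 0 \<and> (\<forall>s. (\<exists>t. poly (p s) t = 0 \<and> C (s, t)) \<longrightarrow> D s = 0)"
    using D(1,2) by (intro exI[of _ D]) blast
qed

text \<open>Coordinates on pairs \<open>(s, g)\<close> where only the first \<open>K\<close> entries
  of the sequence \<open>g\<close> count.\<close>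

definition Zc :: "('i \<Rightarrow> 's \<Rightarrow> complex) \<Rightarrow> nat \<Rightarrow> 'i + nat \<Rightarrow> 's \<times> (nat \<Rightarrow> complex) \<Rightarrow> complex" where
  "Zc X K = (\<lambda>i st. case i of Inl i \<Rightarrow> X i (fst st) | Inr k \<Rightarrow> if k < K then snd st k else 0)"

lemma pfun_Zc_cong:
  assumes "pfun (Zc X K) D" "\<And>k. k < K \<Longrightarrow> g k = g' k"
  shows "D (s, g) = D (s, g')"
  using assms by induction (auto simp: Zc_def split: sum.split)

lemma eliminate_roots:
  fixes X :: "'i \<Rightarrow> 's \<Rightarrow> complex" and p :: "nat \<Rightarrow> 's \<Rightarrow> complex poly"
  assumes p: "\<And>j k. pfun X (\<lambda>s. coeff (p j s) k)" "\<And>j s. degree (p j s) \<le> n"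
      "\<And>j s. O' s \<Longrightarrow> coeff (p j s) n \<noteq> 0"
    and C: "vclosed (Zc X K) (\<lambda>st. O' (fst st)) C"
  shows "vclosed X O' (\<lambda>s. \<exists>g. (\<forall>k<K. poly (p k s) (g k) = 0) \<and> C (s, g))"
  using C
proof (induction K arbitrary: C)
  case 0
  show ?case unfolding vclosed_def
  proof (intro allI impI)
    fix s assume s: "O' s" "\<not> (\<exists>g. (\<forall>k<0. poly (p k s) (g k) = 0) \<and> C (s, g))"
    then have "\<not> C (s, \<lambda>_. 0)" by blast
    then obtain D where D: "pfun (Zc X 0) D" "D (s, \<lambda>_. 0) \<noteq> 0" "\<forall>t. C t \<longrightarrow> D t = 0"
      using 0[unfolded vclosed_def, THEN spec, of "(s, \<lambda>_. 0)"] s(1) by auto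
    have "pfun X (\<lambda>s. Zc X 0 i (s, \<lambda>_. 0))" for i
      by (cases i) (simp_all add: Zc_def)
    then have "pfun X (\<lambda>s. D (s, \<lambda>_. 0))" by (rule pfun_subst[OF D(1)])
    moreover have "D (t, \<lambda>_. 0) = 0" if "C (t, g)" for t g
      using D(3) that pfun_Zc_cong[OF D(1), of "\<lambda>_. 0" g t] by simp
    ultimately show "\<exists>D. pfun X D \<and> D s \<noteq> 0 \<and> (\<forall>t. (\<exists>g. (\<forall>k<0. poly (p k t) (g k) = 0) \<and> C (t, g)) \<longrightarrow> D t = 0)"
      using D(2) by (intro exI[of _ "\<lambda>s. D (s, \<lambda>_. 0)"]) auto
  qed
next
  case (Suc K)
  define C1 where "C1 = (\<lambda>sg. \<exists>t. poly (p K (fst sg)) t = 0 \<and> C (fst sg, (snd sg)(K := t)))"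
  have "vclosed (Zc X K) (\<lambda>st. O' (fst st))
      (\<lambda>sg. \<exists>t. poly (p K (fst sg)) t = 0 \<and> (\<lambda>x. C (fst (fst x), (snd (fst x))(K := snd x))) (sg, t))"
  proof (rule eliminate_root[where n = n])
    show "pfun (Zc X K) (\<lambda>sg. coeff (p K (fst sg)) k)" for k
    proof (rule pfun_subst[OF p(1)])
      show "pfun (Zc X K) (\<lambda>sg. X i (fst sg))" for i
        using pfun_coord[of "Zc X K" "Inl i"] by (simp add: Zc_def)
    qed
    show "vclosed (Yc (Zc X K)) (\<lambda>st. O' (fst (fst st))) (\<lambda>x. C (fst (fst x), (snd (fst x))(K := snd x)))"
    proof (rule vclosed_subst[OF Suc.prems])
      fix i
      show "pfun (Yc (Zc X K)) (\<lambda>x. Zc X (Suc K) i (fst (fst x), (snd (fst x))(K := snd x)))"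
      proof (cases i)
        case (Inl j)
        then show ?thesis using pfun_coord[of "Yc (Zc X K)" "Some (Inl j)"] by (simp add: Zc_def Yc_def)
      next
        case (Inr k)
        consider "k < K" | "k = K" | "k > K" by linarith
        then show ?thesis
        proof cases
          case 1
          then show ?thesis using pfun_coord[of "Yc (Zc X K)" "Some (Inr k)"] Inr by (simp add: Zc_def Yc_def)
        next
          case 2
          then show ?thesis using pfun_coord[of "Yc (Zc X K)" "None"] Inr by (simp add: Zc_def Yc_def)
        next
          case 3
          then show ?thesis using Inr by (simp add: Zc_def)
        qed
      qed
    qed auto
  qed (use p in auto)
  then have "vclosed (Zc X K) (\<lambda>st. O' (fst st)) C1" by (simp add: C1_def)
  from Suc.IH[OF this]
  have "vclosed X O' (\<lambda>s. \<exists>g. (\<forall>k<K. poly (p k s) (g k) = 0) \<and> C1 (s, g))" .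
  also have "(\<lambda>s. \<exists>g. (\<forall>k<K. poly (p k s) (g k) = 0) \<and> C1 (s, g))
      = (\<lambda>s. \<exists>g. (\<forall>k<Suc K. poly (p k s) (g k) = 0) \<and> C (s, g))"
  proof (rule ext, rule iffI)
    fix s assume "\<exists>g. (\<forall>k<K. poly (p k s) (g k) = 0) \<and> C1 (s, g)"
    then obtain g t where "\<forall>k<K. poly (p k s) (g k) = 0" "poly (p K s) t = 0" "C (s, g(K := t))"
      by (auto simp: C1_def)
    then show "\<exists>g. (\<forall>k<Suc K. poly (p k s) (g k) = 0) \<and> C (s, g)"
      by (intro exI[of _ "g(K := t)"]) (auto simp: less_Suc_eq)
  next
    fix s assume "\<exists>g. (\<forall>k<Suc K. poly (p k s) (g k) = 0) \<and> C (s, g)"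
    then obtain g where "\<forall>k<Suc K. poly (p k s) (g k) = 0" "C (s, g)" by blast
    then show "\<exists>g. (\<forall>k<K. poly (p k s) (g k) = 0) \<and> C1 (s, g)"
      by (intro exI[of _ g]) (auto simp: C1_def intro!: exI[of _ "g K"])
  qed
  finally show ?case .
qed

section \<open>Invariance under coordinate changes and field automorphisms\<close>

lemma det3_scale:
  "det3 (\<lambda>v. x * a v) (\<lambda>v. y * b v) (\<lambda>v. z * c v) = x * y * z * det3 a b c"
  by (simp add: det3_def algebra_simps)

lemma pclass_prod_list:
  assumes "list_all2 (\<lambda>F G. \<exists>c. c \<noteq> 0 \<and> F = Cst c * G) Fs Gs"
  shows "\<exists>c. c \<noteq> 0 \<and> prod_list Fs = Cst c * prod_list Gs"
  using assms
proof induction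
  case Nil
  show ?case by (intro exI[of _ 1]) simp
next
  case (Cons F Fs G Gs)
  then obtain c e where "c \<noteq> 0" "F = Cst c * G" "e \<noteq> 0" "prod_list Fs = Cst e * prod_list Gs" by blast
  then have "prod_list (F # Fs) = Cst (c * e) * prod_list (G # Gs)"
    by (simp only: prod_list.Cons Cst_mult mult_ac)
  then show ?case using \<open>c \<noteq> 0\<close> \<open>e \<noteq> 0\<close> by (intro exI[of _ "c * e"]) simp
qed

lemma psi_pclass: "psi (map pclass Fs) = pclass (prod_list Fs)"
proof -
  have "list_all2 (\<lambda>F G. \<exists>c. c \<noteq> 0 \<and> F = Cst c * G) (map rep (map pclass Fs)) Fs"
    unfolding list_all2_conv_all_nth using rep_pclass
    by (metis length_map nth_map)
  from pclass_prod_list[OF this] show ?thesis unfolding psi_def by (metis pclass_scale)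
qed

lemma psi_PS:
  assumes "Ls \<in> tuples d" shows "psi Ls \<in> PS d"
proof -
  have PS: "\<And>P. P \<in> set Ls \<Longrightarrow> P \<in> PS 1" and len: "length Ls = d" using assms by (auto simp: tuples_def)
  have "homogeneous (length (map rep Ls)) (prod_list (map rep Ls))"
    using PS_rep(1)[OF PS] by (intro hom_prod_list) (auto simp: S_deg_def)
  moreover have "prod_list (map rep Ls) \<noteq> 0"
    using PS_rep(2)[OF PS] by (auto simp: prod_list_eq_0_iff')
  ultimately show ?thesis unfolding psi_def using len by (intro pclass_PS) (auto simp: S_deg_def)
qed

lemma X_space_tuples: "X_space d \<subseteq> tuples d" by (auto simp: X_space_def)

lemma A_lat_PS: "A_lat d L \<subseteq> PS d"
  using psi_PS X_space_tuples by (fastforce simp: A_lat_def X_lat_def)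

text \<open>What coordinate changes and field automorphisms have in common on products of linear
  forms: they are multiplicative and semilinear for a bijection \<open>\<tau>\<close> of the
  scalars.\<close>

locale arrangement_action =
  fixes \<phi> :: "S \<Rightarrow> S" and \<tau> :: "complex \<Rightarrow> complex"
  assumes \<tau>: "bij \<tau>" "\<tau> 0 = 0"
    and \<phi>_scale: "\<phi> (Cst c * F) = Cst (\<tau> c) * \<phi> F"
    and \<phi>_prod_list: "\<phi> (prod_list Fs) = prod_list (map \<phi> Fs)"
begin

lemma \<tau>_nz: "\<tau> c \<noteq> 0 \<longleftrightarrow> c \<noteq> 0"
  using \<tau> by (metis bij_def injD)

lemma image_pclass: "\<phi> ` pclass F = pclass (\<phi> F)"
proof (intro equalityI subsetI)
  fix G assume "G \<in> pclass (\<phi> F)"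
  then obtain c where c: "c \<noteq> 0" "G = Cst c * \<phi> F" by (auto simp: pclass_def)
  obtain e where "\<tau> e = c" using \<tau>(1) by (metis bij_pointE)
  then show "G \<in> \<phi> ` pclass F"
    using c \<tau>_nz by (intro image_eqI[of _ _ "Cst e * F"]) (auto simp: \<phi>_scale pclass_def)
next
  fix G assume "G \<in> \<phi> ` pclass F"
  then obtain c where c: "c \<noteq> 0" "G = \<phi> (Cst c * F)" by (auto simp: pclass_def)
  then have "G = Cst (\<tau> c) * \<phi> F" "\<tau> c \<noteq> 0" by (simp_all add: \<phi>_scale \<tau>_nz)
  then show "G \<in> pclass (\<phi> F)" unfolding pclass_def by blast
qed

lemma psi_image: "\<phi> ` psi Ls = psi (map ((`) \<phi>) (map pclass (map rep Ls)))"
proof -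
  have "map ((`) \<phi>) (map pclass (map rep Ls)) = map pclass (map \<phi> (map rep Ls))"
    by (simp add: image_pclass)
  moreover have "\<phi> ` psi Ls = pclass (prod_list (map \<phi> (map rep Ls)))"
    by (simp only: psi_def image_pclass \<phi>_prod_list)
  ultimately show ?thesis by (simp only: psi_pclass)
qed

end

text \<open>Such an action does not change the set of dependent triples if it preserves the
  vanishing of determinants, hence it preserves the isomorphism class of the lattice.\<close>

lemma strata_invariant:
  assumes "arrangement_action \<phi> \<tau>"
    and T: "\<And>P. P \<in> PS 1 \<Longrightarrow> \<phi> ` P \<in> PS 1"  "\<And>P. P \<in> PS 1 \<Longrightarrow> \<phi>' ` P \<in> PS 1"
    and inv: "\<And>F. \<phi>' (\<phi> F) = F" "\<And>F. \<phi> (\<phi>' F) = F"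
    and det: "\<And>P Q R. P \<in> PS 1 \<Longrightarrow> Q \<in> PS 1 \<Longrightarrow> R \<in> PS 1 \<Longrightarrow>
        det3 (lf (\<phi> ` P)) (lf (\<phi> ` Q)) (lf (\<phi> ` R)) = 0 \<longleftrightarrow> det3 (lf P) (lf Q) (lf R) = 0"
    and L: "L \<in> lattices d"
  shows "map ((`) \<phi>) ` X_lat d L = X_lat d L" "(`) \<phi> ` A_lat d L = A_lat d L"
proof -
  interpret arrangement_action \<phi> \<tau> by fact
  have inv': "\<phi>' ` \<phi> ` P = P" "\<phi> ` \<phi>' ` P = P" for P using inv by (simp_all add: image_image)
  have step: "map T Ls \<in> X_lat d L"
    if Ls: "Ls \<in> X_lat d L" and TP: "\<And>P. P \<in> PS 1 \<Longrightarrow> T P \<in> PS 1" and inj: "inj T"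
      and det: "\<And>P Q R. P \<in> PS 1 \<Longrightarrow> Q \<in> PS 1 \<Longrightarrow> R \<in> PS 1 \<Longrightarrow>
        det3 (lf (T P)) (lf (T Q)) (lf (T R)) = 0 \<longleftrightarrow> det3 (lf P) (lf Q) (lf R) = 0" for T Ls
  proof -
    have X: "Ls \<in> X_space d" using Ls by (simp add: X_lat_def)
    then have X': "map T Ls \<in> X_space d"
      using TP inj by (auto simp: X_space_def tuples_def distinct_map intro: inj_on_subset)
    have nth: "\<And>i. i < length Ls \<Longrightarrow> Ls ! i \<in> PS 1" using X_spaceD(2)[OF X] by auto
    have "dep Ls = dep (map T Ls)" unfolding dep_def using det nth by auto
    then have "lattice_iso (intersection_lattice Ls) (intersection_lattice (map T Ls))"
      by (rule dep_eq_imp_iso[OF X X'])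
    then show ?thesis unfolding X_lat_eq[OF L Ls] using X' by simp
  qed
  have det': "det3 (lf (\<phi>' ` P)) (lf (\<phi>' ` Q)) (lf (\<phi>' ` R)) = 0 \<longleftrightarrow> det3 (lf P) (lf Q) (lf R) = 0"
    if "P \<in> PS 1" "Q \<in> PS 1" "R \<in> PS 1" for P Q R
    using det[OF T(2) T(2) T(2), OF that] by (simp add: inv')
  have inj: "inj ((`) \<phi>)" "inj ((`) \<phi>')" using inv' by (metis injI)+
  show X: "map ((`) \<phi>) ` X_lat d L = X_lat d L"
  proof (intro equalityI subsetI)
    fix Ls assume "Ls \<in> map ((`) \<phi>) ` X_lat d L"
    then show "Ls \<in> X_lat d L" using step[of _ "(`) \<phi>"] T(1) inj(1) det by blast
  next
    fix Ls assume "Ls \<in> X_lat d L"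
    then have "map ((`) \<phi>') Ls \<in> X_lat d L" using step[of _ "(`) \<phi>'"] T(2) inj(2) det' by blast
    moreover have "Ls = map ((`) \<phi>) (map ((`) \<phi>') Ls)"
      by (simp add: comp_def inv' del: image_image)
    ultimately show "Ls \<in> map ((`) \<phi>) ` X_lat d L" by blast
  qed
  have psi: "\<phi> ` psi Ls = psi (map ((`) \<phi>) Ls)" if "Ls \<in> X_lat d L" for Ls
  proof -
    have "set Ls \<subseteq> PS 1" using that X_spaceD(2) by (auto simp: X_lat_def)
    then have "pclass (rep P) = P" if "P \<in> set Ls" for P using PS_rep(3)[of P 1] that by blast
    then have "map pclass (map rep Ls) = Ls" by (simp add: map_idI)
    then show ?thesis using psi_image[of Ls] by simp
  qed
  have "(`) \<phi> ` A_lat d L = (\<lambda>Ls. \<phi> ` psi Ls) ` X_lat d L" by (simp add: A_lat_def image_image)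
  also have "\<dots> = (\<lambda>Ls. psi (map ((`) \<phi>) Ls)) ` X_lat d L" by (rule image_cong) (simp_all add: psi)
  also have "\<dots> = psi ` (map ((`) \<phi>) ` X_lat d L)" by (simp add: image_image)
  finally show "(`) \<phi> ` A_lat d L = A_lat d L" unfolding X by (simp add: A_lat_def)
qed

lemma coord_change_comp: "coord_change M (coord_change N F) = coord_change (N ** M) F"
proof -
  have "(\<Sum>j\<in>UNIV. Cst (N $ v $ j) * (\<Sum>k\<in>UNIV. Cst (M $ j $ k) * Var k))
      = (\<Sum>k\<in>UNIV. Cst ((N ** M) $ v $ k) * Var k)" for v
    by (simp only: matrix_matrix_mult_def vec_lambda_beta Cst_sum Cst_mult sum_distrib_left
        sum_distrib_right mult.assoc) (rule sum.swap)
  then show ?thesis unfolding coord_change_def subst_subst by simp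
qed

lemma coord_change_id: "coord_change (mat 1) F = F"
proof -
  have "(\<lambda>i. \<Sum>j\<in>UNIV. Cst ((mat 1 :: complex^3^3) $ i $ j) * Var j) = Var"
    by (rule ext) (simp add: mat_def if_distrib[of Cst] if_distrib[of "\<lambda>c. c * _"] cong: if_cong)
  then show ?thesis by (simp add: coord_change_def)
qed

lemma coord_change_linform:
  "coord_change M (linform a) = linform (\<lambda>j. \<Sum>i\<in>UNIV. a i * M $ i $ j)"
  unfolding coord_change_def subst_linform
  unfolding linform_def
  by (simp only: Cst_sum Cst_mult sum_distrib_left sum_distrib_right mult.assoc) (rule sum.swap)

lemma det3_mult:
  "det3 (\<lambda>j. \<Sum>i\<in>UNIV. a i * M $ i $ j) (\<lambda>j. \<Sum>i\<in>UNIV. b i * M $ i $ j) (\<lambda>j. \<Sum>i\<in>UNIV. c i * M $ i $ j)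
    = det3 a b c * det M" for M :: "complex^3^3"
  by (simp add: det_3 det3_def sum_3) algebra

lemma lf_action:
  assumes "arrangement_action \<phi> \<tau>" "P \<in> PS 1" "\<phi> (linform (lf P)) = linform b" "\<exists>v. b v \<noteq> 0"
  obtains c where "c \<noteq> 0" "lf (\<phi> ` P) = (\<lambda>v. c * b v)" "\<phi> ` P \<in> PS 1"
proof -
  interpret arrangement_action \<phi> \<tau> by fact
  have "\<phi> ` P = pl b"
    using pl_lf[OF assms(2)] image_pclass[of "linform (lf P)"] assms(3) by (simp add: pl_def)
  then show thesis using lf_pl[OF assms(4)] pl_PS[OF assms(4)] that by metis
qed

lemma coord_change_strata:
  assumes M: "invertible M" and L: "L \<in> lattices d"
  shows "map ((`) (coord_change M)) ` X_lat d L = X_lat d L"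
    "(`) (coord_change M) ` A_lat d L = A_lat d L"
proof -
  obtain N where N: "M ** N = mat 1" "N ** M = mat 1" using M by (auto simp: invertible_def)
  have act: "arrangement_action (coord_change K) id" for K
    by unfold_locales (simp_all add: coord_change_def[abs_def])
  have key: "\<phi> ` P \<in> PS 1 \<and> (\<exists>c. c \<noteq> 0 \<and> lf (\<phi> ` P) = (\<lambda>j. c * (\<Sum>i\<in>UNIV. lf P i * K $ i $ j)))"
    if K: "\<phi> = coord_change K" "K ** K' = mat 1" "P \<in> PS 1" for \<phi> K K' P
  proof -
    have "coord_change K' (coord_change K F) = F" for F
      using K(2) by (simp add: coord_change_comp coord_change_id)
    moreover have "linform (lf P) \<noteq> 0" using PS_rep(2)[OF K(3)] rep_linform[OF K(3)] by simp
    moreover have "coord_change K' 0 = 0" by (simp add: coord_change_def)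
    ultimately have "coord_change K (linform (lf P)) \<noteq> 0" by metis
    then have "\<exists>v. (\<Sum>i\<in>UNIV. lf P i * K $ i $ v) \<noteq> 0"
      unfolding coord_change_linform linform_eq_0_iff by blast
    then obtain c where "c \<noteq> 0" "coord_change K ` P \<in> PS 1"
      "lf (coord_change K ` P) = (\<lambda>v. c * (\<Sum>i\<in>UNIV. lf P i * K $ i $ v))"
      using lf_action[OF act K(3) coord_change_linform] by blast
    then show ?thesis using K(1) by blast
  qed
  note kM = key[OF refl N(1)] and kN = key[OF refl N(2)]
  have detM: "det M \<noteq> 0" using M by (simp add: invertible_det_nz)
  have det: "det3 (lf (coord_change M ` P)) (lf (coord_change M ` Q)) (lf (coord_change M ` R)) = 0
      \<longleftrightarrow> det3 (lf P) (lf Q) (lf R) = 0" if PQR: "P \<in> PS 1" "Q \<in> PS 1" "R \<in> PS 1" for P Q R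
  proof -
    obtain x where x: "x \<noteq> 0" "lf (coord_change M ` P) = (\<lambda>j. x * (\<Sum>i\<in>UNIV. lf P i * M $ i $ j))"
      using kM[OF PQR(1)] by blast
    obtain y where y: "y \<noteq> 0" "lf (coord_change M ` Q) = (\<lambda>j. y * (\<Sum>i\<in>UNIV. lf Q i * M $ i $ j))"
      using kM[OF PQR(2)] by blast
    obtain z where z: "z \<noteq> 0" "lf (coord_change M ` R) = (\<lambda>j. z * (\<Sum>i\<in>UNIV. lf R i * M $ i $ j))"
      using kM[OF PQR(3)] by blast
    show ?thesis unfolding x(2) y(2) z(2) det3_scale det3_mult using x(1) y(1) z(1) detM by simp
  qed
  have inv: "coord_change N (coord_change M F) = F" "coord_change M (coord_change N F) = F" for F
    by (simp_all add: coord_change_comp coord_change_id N)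
  note * = strata_invariant[OF act, of M "coord_change N" L d, OF _ _ inv _ L]
  show "map ((`) (coord_change M)) ` X_lat d L = X_lat d L" by (rule *(1)) (use kM kN det in auto)
  show "(`) (coord_change M) ` A_lat d L = A_lat d L" by (rule *(2)) (use kM kN det in auto)
qed

lemma galois_strata:
  assumes \<sigma>: "field_automorphism \<sigma>" and L: "L \<in> lattices d"
  shows "map ((`) (galois_act \<sigma>)) ` X_lat d L = X_lat d L"
    "(`) (galois_act \<sigma>) ` A_lat d L = A_lat d L"
proof -
  have sig0: "\<rho> 0 = 0" if "field_automorphism \<rho>" for \<rho>
    using that unfolding field_automorphism_def by (metis add_cancel_right_left)
  have coefg: "coef (galois_act \<rho> F) m = \<rho> (coef F m)" if "field_automorphism \<rho>" for \<rho> F m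
    using sig0[OF that] by (simp add: galois_act_def map.rep_eq when_def)
  have eq: "galois_act \<rho> F = mpeval (\<lambda>c. Cst (\<rho> c)) Var F" and hom: "coeff_hom (\<lambda>c. Cst (\<rho> c) :: S)"
    if \<rho>: "field_automorphism \<rho>" for \<rho> F
  proof -
    show hom: "coeff_hom (\<lambda>c. Cst (\<rho> c) :: S)"
      using \<rho> sig0[OF \<rho>] by unfold_locales (auto simp: field_automorphism_def Cst_add Cst_mult)
    then interpret coeff_hom "\<lambda>c. Cst (\<rho> c) :: S" .
    show "galois_act \<rho> F = mpeval (\<lambda>c. Cst (\<rho> c)) Var F"
    proof (induction F rule: mpol_induct)
      case (single m c)
      have "galois_act \<rho> (term_of m c) = term_of m (\<rho> c)"
        by (rule poly_mapping_eqI) (simp add: coefg[OF \<rho>] lookup_single when_def sig0[OF \<rho>])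
      then show ?case by (simp add: term_eq_prod[symmetric])
    next
      case (add F G)
      have "galois_act \<rho> (F + G) = galois_act \<rho> F + galois_act \<rho> G"
        using \<rho> by (intro poly_mapping_eqI) (simp add: coefg[OF \<rho>] lookup_add field_automorphism_def)
      then show ?case by (simp add: add)
    qed
  qed
  have act: "arrangement_action (galois_act \<rho>) \<rho>" if \<rho>: "field_automorphism \<rho>" for \<rho>
  proof -
    interpret coeff_hom "\<lambda>c. Cst (\<rho> c) :: S" by (rule hom[OF \<rho>])
    have "galois_act \<rho> = mpeval (\<lambda>c. Cst (\<rho> c)) Var" by (rule ext) (rule eq[OF \<rho>])
    then show ?thesis using \<rho> sig0[OF \<rho>]
      by unfold_locales (auto simp: field_automorphism_def)
  qed
  have lin: "galois_act \<rho> (linform a) = linform (\<lambda>v. \<rho> (a v))" if \<rho>: "field_automorphism \<rho>" for \<rho> a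
  proof -
    interpret coeff_hom "\<lambda>c. Cst (\<rho> c) :: S" by (rule hom[OF \<rho>])
    show ?thesis by (simp add: eq[OF \<rho>] linform_def)
  qed
  have key: "galois_act \<rho> ` P \<in> PS 1 \<and> (\<exists>c. c \<noteq> 0 \<and> lf (galois_act \<rho> ` P) = (\<lambda>j. c * \<rho> (lf P j)))"
    if \<rho>: "field_automorphism \<rho>" and P: "P \<in> PS 1" for \<rho> P
  proof -
    have "inj \<rho>" using \<rho> by (simp add: field_automorphism_def bij_def)
    then have "\<exists>v. \<rho> (lf P v) \<noteq> 0" using lf_nonzero[OF P] sig0[OF \<rho>] by (metis injD)
    then obtain c where "c \<noteq> 0" "galois_act \<rho> ` P \<in> PS 1"
      "lf (galois_act \<rho> ` P) = (\<lambda>v. c * \<rho> (lf P v))"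
      using lf_action[OF act[OF \<rho>] P lin[OF \<rho>]] by blast
    then show ?thesis by blast
  qed
  have \<sigma>': "field_automorphism (inv \<sigma>)"
  proof -
    have b: "bij \<sigma>" and a: "\<sigma> 1 = 1" "\<And>a b. \<sigma> (a + b) = \<sigma> a + \<sigma> b" "\<And>a b. \<sigma> (a * b) = \<sigma> a * \<sigma> b"
      using \<sigma> by (auto simp: field_automorphism_def)
    have i: "inv \<sigma> (\<sigma> x) = x" "\<sigma> (inv \<sigma> x) = x" for x
      using b by (simp_all add: bij_def surj_f_inv_f)
    show ?thesis unfolding field_automorphism_def
      using bij_imp_bij_inv[OF b] a i by metis
  qed
  have i: "inv \<sigma> (\<sigma> x) = x" "\<sigma> (inv \<sigma> x) = x" for x
    using \<sigma> by (simp_all add: field_automorphism_def bij_def surj_f_inv_f)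
  have inv: "galois_act (inv \<sigma>) (galois_act \<sigma> F) = F" "galois_act \<sigma> (galois_act (inv \<sigma>) F) = F" for F
    by (rule poly_mapping_eqI, simp add: coefg \<sigma> \<sigma>' i)+
  have dets: "det3 (\<lambda>v. \<sigma> (a v)) (\<lambda>v. \<sigma> (b v)) (\<lambda>v. \<sigma> (c v)) = \<sigma> (det3 a b c)" for a b c
  proof -
    have m: "\<sigma> (x - y) = \<sigma> x - \<sigma> y" for x y
      using \<sigma> unfolding field_automorphism_def by (metis add_diff_cancel_right' diff_add_cancel)
    show ?thesis using \<sigma> unfolding field_automorphism_def det3_def by (simp add: m)
  qed
  have det: "det3 (lf (galois_act \<sigma> ` P)) (lf (galois_act \<sigma> ` Q)) (lf (galois_act \<sigma> ` R)) = 0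
      \<longleftrightarrow> det3 (lf P) (lf Q) (lf R) = 0" if PQR: "P \<in> PS 1" "Q \<in> PS 1" "R \<in> PS 1" for P Q R
  proof -
    obtain x where x: "x \<noteq> 0" "lf (galois_act \<sigma> ` P) = (\<lambda>j. x * \<sigma> (lf P j))"
      using key[OF \<sigma> PQR(1)] by blast
    obtain y where y: "y \<noteq> 0" "lf (galois_act \<sigma> ` Q) = (\<lambda>j. y * \<sigma> (lf Q j))"
      using key[OF \<sigma> PQR(2)] by blast
    obtain z where z: "z \<noteq> 0" "lf (galois_act \<sigma> ` R) = (\<lambda>j. z * \<sigma> (lf R j))"
      using key[OF \<sigma> PQR(3)] by blast
    have "\<sigma> w = 0 \<longleftrightarrow> w = 0" for w using i(1) sig0[OF \<sigma>] sig0[OF \<sigma>'] by metis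
    then show ?thesis unfolding x(2) y(2) z(2) det3_scale dets using x(1) y(1) z(1) by simp
  qed
  note * = strata_invariant[OF act[OF \<sigma>], of "galois_act (inv \<sigma>)" L d, OF _ _ inv _ L]
  show "map ((`) (galois_act \<sigma>)) ` X_lat d L = X_lat d L" by (rule *(1)) (use key \<sigma> \<sigma>' det in auto)
  show "(`) (galois_act \<sigma>) ` A_lat d L = A_lat d L" by (rule *(2)) (use key \<sigma> \<sigma>' det in auto)
qed

lemma strata_group_invariant:
  assumes "L \<in> lattices d"
  shows "G_invariant_tuples (X_lat d L)" "G_invariant_forms (A_lat d L)"
    "Galois_invariant_tuples (X_lat d L)" "Galois_invariant_forms (A_lat d L)"
  using coord_change_strata[OF _ assms] galois_strata[OF _ assms]
  unfolding G_invariant_tuples_def G_invariant_forms_def Galois_invariant_tuples_def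
    Galois_invariant_forms_def by auto

section \<open>Intersection multiplicities in the local ring\<close>

type_synonym K = "2 mpol fract"

abbreviation emb :: "2 mpol \<Rightarrow> K" where "emb F \<equiv> Fract F 1"

definition ev0 :: "2 mpol \<Rightarrow> complex" where "ev0 F = ev (\<lambda>_. 0) F"

lemma ev0_simps [simp]:
  "ev0 (F + G) = ev0 F + ev0 G" "ev0 (F - G) = ev0 F - ev0 G" "ev0 (F * G) = ev0 F * ev0 G"
  "ev0 (Cst c) = c" "ev0 (Var v) = 0" "ev0 0 = 0" "ev0 1 = 1" "ev0 (- F) = - ev0 F"
  by (simp_all add: ev0_def)

lemma local_ring_iff: "x \<in> local_ring \<longleftrightarrow> (\<exists>a b. x = Fract a b \<and> ev0 b \<noteq> 0)"
  unfolding local_ring_def ev0_def ev_def by auto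

lemma ev0_nz: "ev0 b \<noteq> 0 \<Longrightarrow> b \<noteq> 0" by auto

lemma emb_add: "emb (F + G) = emb F + emb G" by simp
lemma emb_mult: "emb (F * G) = emb F * emb G" by simp
lemma emb_0: "emb 0 = 0" by (simp add: Zero_fract_def)
lemma emb_1: "emb 1 = 1" by (simp add: One_fract_def)
lemma emb_inj: "emb F = emb G \<longleftrightarrow> F = G" by (simp add: eq_fract)

lemma local_add: assumes "x \<in> local_ring" "y \<in> local_ring" shows "x + y \<in> local_ring"
proof -
  obtain a b c e where "x = Fract a b" "ev0 b \<noteq> 0" "y = Fract c e" "ev0 e \<noteq> 0"
    using assms local_ring_iff by auto
  then show ?thesis unfolding local_ring_iff
    by (intro exI[of _ "a * e + c * b"] exI[of _ "b * e"]) (auto simp: ev0_nz)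
qed

lemma local_mult: assumes "x \<in> local_ring" "y \<in> local_ring" shows "x * y \<in> local_ring"
proof -
  obtain a b c e where "x = Fract a b" "ev0 b \<noteq> 0" "y = Fract c e" "ev0 e \<noteq> 0"
    using assms local_ring_iff by auto
  then show ?thesis unfolding local_ring_iff
    by (intro exI[of _ "a * c"] exI[of _ "b * e"]) auto
qed

lemma local_emb: "emb F \<in> local_ring" unfolding local_ring_iff by (intro exI[of _ F] exI[of _ 1]) simp
lemma local_0: "0 \<in> local_ring" using local_emb[of 0] by (simp add: emb_0)
lemma local_1: "1 \<in> local_ring" using local_emb[of 1] by (simp add: emb_1)
lemma local_minus: assumes "x \<in> local_ring" shows "- x \<in> local_ring"
proof -
  have "emb (- 1) = (- 1 :: K)" by (simp add: One_fract_def)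
  then show ?thesis using local_mult[OF local_emb[of "- 1"] assms] by simp
qed
lemma local_diff: "x \<in> local_ring \<Longrightarrow> y \<in> local_ring \<Longrightarrow> x - y \<in> local_ring"
  using local_add[OF _ local_minus, of x y] by simp
lemma local_inverse: assumes "ev0 e \<noteq> 0" shows "Fract 1 e \<in> local_ring" "Fract 1 e * emb e = 1"
  using assms by (auto simp: local_ring_iff One_fract_def eq_fract ev0_nz)

interpretation lv: cvs "\<lambda>c (h :: K). emb (Cst c) * h"
  by unfold_locales (simp_all only: distrib_left distrib_right Cst_add Cst_mult Cst_1 emb_add emb_1
      emb_mult mult.assoc mult_1_left)

definition id2 :: "K \<Rightarrow> K \<Rightarrow> K set" where
  "id2 p q = {a * p + b * q | a b. a \<in> local_ring \<and> b \<in> local_ring}"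

lemma id2I: "a \<in> local_ring \<Longrightarrow> b \<in> local_ring \<Longrightarrow> a * p + b * q \<in> id2 p q" by (auto simp: id2_def)

lemma id2_add: assumes "x \<in> id2 p q" "y \<in> id2 p q" shows "x + y \<in> id2 p q"
proof -
  obtain a b c e where *: "x = a * p + b * q" "y = c * p + e * q"
    "a \<in> local_ring" "b \<in> local_ring" "c \<in> local_ring" "e \<in> local_ring"
    using assms by (auto simp: id2_def)
  have "x + y = (a + c) * p + (b + e) * q" by (simp add: * algebra_simps)
  then show ?thesis using * by (auto intro: id2I local_add)
qed

lemma id2_mult: assumes "x \<in> id2 p q" "r \<in> local_ring" shows "r * x \<in> id2 p q"
proof -
  obtain a b where *: "x = a * p + b * q" "a \<in> local_ring" "b \<in> local_ring"
    using assms by (auto simp: id2_def)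
  have "r * x = (r * a) * p + (r * b) * q" by (simp add: * algebra_simps)
  then show ?thesis using * assms by (auto intro: id2I local_mult)
qed

lemma id2_left: "p \<in> id2 p q" using id2I[OF local_1 local_0, of p q] by simp
lemma id2_right: "q \<in> id2 p q" using id2I[OF local_0 local_1, of p q] by simp
lemma id2_sub_local: "p \<in> local_ring \<Longrightarrow> q \<in> local_ring \<Longrightarrow> id2 p q \<subseteq> local_ring"
  by (auto simp: id2_def intro: local_add local_mult)

lemma id2_subspace: "lv.subspace (id2 p q)"
  by (rule lv.subspaceI)
    (use id2_mult[OF id2_left local_0, of p q] in \<open>auto intro: id2_add id2_mult local_emb\<close>)

lemma local_subspace: "lv.subspace local_ring"
  by (rule lv.subspaceI) (auto intro: local_add local_mult local_emb local_0)

lemma id2_subset: "p \<in> id2 p' q' \<Longrightarrow> q \<in> id2 p' q' \<Longrightarrow> id2 p q \<subseteq> id2 p' q'"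
  unfolding id2_def[of p q] by (auto intro: id2_add id2_mult)

text \<open>The intersection multiplicity at the origin of the curves \<open>p = 0\<close> and
  \<open>q = 0\<close>.\<close>

definition codim2 :: "K \<Rightarrow> K \<Rightarrow> nat \<Rightarrow> bool" where
  "codim2 p q n \<longleftrightarrow> has_codim (\<lambda>c h. emb (Cst c) * h) local_ring (id2 p q) n"

text \<open>Intersection multiplicities are additive: if \<open>l\<close> is not a zero divisor modulo \<open>q\<close>, then
  multiplication by \<open>l\<close> identifies $R/(p,q)$ with $(l,q)/(lp,q)$.\<close>

lemma codim2_mult:
  assumes L: "l \<in> local_ring" "p \<in> local_ring" "q \<in> local_ring"
    and nzd: "\<And>x b. x \<in> local_ring \<Longrightarrow> b \<in> local_ring \<Longrightarrow> l * x = q * b \<Longrightarrow> \<exists>b'\<in>local_ring. b = l * b'"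
    and l: "l \<noteq> 0" and 1: "codim2 l q m" and 2: "codim2 p q n"
  shows "codim2 (l * p) q (m + n)"
proof -
  have "has_codim (\<lambda>c h. emb (Cst c) * h) (id2 l q) (id2 (l * p) q) n"
  proof (rule lv.has_codim_image[where T = "\<lambda>x. l * x" and V = local_ring and W' = "id2 p q"])
    show "l * (x + y) = l * x + l * y" for x y by (simp add: distrib_left)
    show "l * (emb (Cst c) * x) = emb (Cst c) * (l * x)" for c x by (simp only: ac_simps)
    show "lv.subspace (id2 (l * p) q)" by (rule id2_subspace)
    have "p * l \<in> id2 l q" by (rule id2_mult[OF id2_left L(2)])
    then show "id2 (l * p) q \<subseteq> id2 l q"
      by (intro id2_subset id2_right) (simp only: mult.commute)
    show "lv.subspace local_ring" by (rule local_subspace)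
    show "(\<lambda>x. l * x) ` local_ring \<subseteq> id2 l q"
      using id2_mult[OF id2_left, of _ l q] by (auto simp: mult.commute)
    show "\<exists>v\<in>local_ring. u - l * v \<in> id2 (l * p) q" if "u \<in> id2 l q" for u
    proof -
      obtain a b where *: "u = a * l + b * q" "a \<in> local_ring" "b \<in> local_ring"
        using \<open>u \<in> id2 l q\<close> unfolding id2_def by blast
      have "u - l * a = b * q" by (simp add: * mult.commute)
      then have "u - l * a \<in> id2 (l * p) q" using id2_mult[OF id2_right *(3)] by metis
      then show ?thesis using *(2) by blast
    qed
    show "l * v \<in> id2 (l * p) q \<longleftrightarrow> v \<in> id2 p q" if v: "v \<in> local_ring" for v
    proof
      assume "v \<in> id2 p q"
      then obtain a b where *: "v = a * p + b * q" "a \<in> local_ring" "b \<in> local_ring"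
        unfolding id2_def by blast
      have "l * v = a * (l * p) + (l * b) * q" by (simp add: * algebra_simps)
      then show "l * v \<in> id2 (l * p) q" using id2I[OF *(2) local_mult[OF L(1) *(3)], of "l * p" q] by metis
    next
      assume "l * v \<in> id2 (l * p) q"
      then obtain a b where *: "l * v = a * (l * p) + b * q" "a \<in> local_ring" "b \<in> local_ring"
        unfolding id2_def by blast
      then have "l * (v - a * p) = q * b" by (simp add: algebra_simps)
      then obtain b' where b': "b' \<in> local_ring" "b = l * b'"
        using nzd[of "v - a * p" b] v * L by (auto intro: local_diff local_mult)
      have "l * v = l * (a * p + b' * q)" using *(1) b'(2) by (simp add: algebra_simps)
      then have "v = a * p + b' * q" using l by simp
      then show "v \<in> id2 p q" using id2I[OF *(2) b'(1), of p q] by metis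
    qed
    show "has_codim (\<lambda>c h. emb (Cst c) * h) local_ring (id2 p q) n" using 2 by (simp add: codim2_def)
  qed
  moreover have "p * l \<in> id2 l q" by (rule id2_mult[OF id2_left L(2)])
  then have "id2 (l * p) q \<subseteq> id2 l q" by (intro id2_subset id2_right) (simp only: mult.commute)
  moreover have "id2 l q \<subseteq> local_ring" using L by (intro id2_sub_local)
  ultimately show ?thesis
    using 1 unfolding codim2_def by (intro lv.has_codim_trans[OF _ _ id2_subspace id2_subspace])
qed

lemma id2_commute: "id2 p q = id2 q p"
  by (intro equalityI id2_subset id2_left id2_right)

lemma codim2_commute: "codim2 p q n \<longleftrightarrow> codim2 q p n"
  by (simp add: codim2_def id2_commute)

lemma codim2_unit:
  assumes "ev0 e \<noteq> 0" "q \<in> local_ring" shows "codim2 (emb e) q 0"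
proof -
  have "1 \<in> id2 (emb e) q" using id2_mult[OF id2_left local_inverse(1)[OF assms(1)]] local_inverse(2)[OF assms(1)] by metis
  then have "id2 (emb e) q = local_ring"
    using id2_mult[of 1] id2_sub_local[OF local_emb assms(2)] by fastforce
  then show ?thesis unfolding codim2_def using lv.has_codim_refl[OF local_subspace] by simp
qed

section \<open>Linear forms in two variables\<close>

definition bin :: "complex \<Rightarrow> complex \<Rightarrow> 2 mpol" where
  "bin a b = linform (\<lambda>v. if v = 1 then a else b)"

lemma ev_bin [simp]: "ev x (bin a b) = a * x 1 + b * x 2"
  by (simp add: bin_def sum_2)

lemma bin_dvd_iff:
  assumes "a \<noteq> 0 \<or> b \<noteq> 0"
  shows "bin a b dvd F \<longleftrightarrow> (\<forall>t. ev (\<lambda>v. if v = 1 then t * b else - t * a) F = 0)"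
proof -
  obtain w :: 2 where w: "(if w = 1 then a else b) \<noteq> 0"
    using assms by (metis (full_types) zero_neq_one one_neq_zero exhaust_2 num1_eq1 forall_2)
  have "bin a b dvd F \<longleftrightarrow> (\<forall>x. a * x 1 + b * x 2 = 0 \<longrightarrow> ev x F = 0)"
    unfolding bin_def linform_dvd_iff[of "\<lambda>v. if v = 1 then a else b" w, OF w] by (simp add: sum_2)
  also have "\<dots> \<longleftrightarrow> (\<forall>t. ev (\<lambda>v. if v = 1 then t * b else - t * a) F = 0)"
  proof (intro iffI allI impI)
    fix x :: "2 \<Rightarrow> complex"
    assume *: "\<forall>t. ev (\<lambda>v. if v = 1 then t * b else - t * a) F = 0" and x: "a * x 1 + b * x 2 = 0"
    define t where "t = (if b \<noteq> 0 then x 1 / b else - x 2 / a)"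
    have "x 1 = t * b" "x 2 = - t * a"
      using assms x by (auto simp: t_def field_simps add_eq_0_iff)
    then have "x = (\<lambda>v. if v = 1 then t * b else - t * a)" using exhaust_2 by fastforce
    then show "ev x F = 0" using * by metis
  next
    fix t assume "\<forall>x. a * x 1 + b * x 2 = 0 \<longrightarrow> ev x F = 0"
    then show "ev (\<lambda>v. if v = 1 then t * b else - t * a) F = 0" by simp
  qed
  finally show ?thesis .
qed

text \<open>The restriction to the line \<open>bin a b = 0\<close>, parametrized by \<open>t
  \<mapsto> (t b, - t a)\<close>. Its kernel consists of the multiples of \<open>bin a b\<close>, so
  that \<open>bin a b\<close> is prime.\<close>

definition res :: "complex \<Rightarrow> complex \<Rightarrow> 2 mpol \<Rightarrow> complex poly" where
  "res a b F = mpeval (\<lambda>c. [:c:]) (\<lambda>v. if v = 1 then [:0, b:] else [:0, - a:]) F"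

lemma poly_res: "poly (res a b F) t = ev (\<lambda>v. if v = 1 then t * b else - t * a) F"
  unfolding res_def by (induction F rule: mpol_ring_induct) auto

lemma bin_dvd_res: "a \<noteq> 0 \<or> b \<noteq> 0 \<Longrightarrow> bin a b dvd F \<longleftrightarrow> res a b F = 0"
  unfolding bin_dvd_iff poly_res[symmetric] by (simp add: poly_all_0_iff_0)

lemma res_mult: "res a b (F * G) = res a b F * res a b G" by (simp add: res_def)

lemma bin_prime:
  assumes "a \<noteq> 0 \<or> b \<noteq> 0" "bin a b dvd F * G" shows "bin a b dvd F \<or> bin a b dvd G"
  using assms by (simp add: bin_dvd_res res_mult)

lemma bin_not_dvd_unit:
  assumes "a \<noteq> 0 \<or> b \<noteq> 0" "ev0 e \<noteq> 0" shows "\<not> bin a b dvd e"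
proof
  assume "bin a b dvd e"
  then obtain k where "e = bin a b * k" by (elim dvdE)
  then have "ev0 e = 0" by (simp add: ev0_def)
  then show False using assms by simp
qed

text \<open>A linear form through the origin stays prime in the local ring: denominators do not
  vanish at the origin and so are not divisible by it.\<close>

lemma local_bin_nzd:
  assumes ab: "a \<noteq> 0 \<or> b \<noteq> 0" and Q: "\<not> bin a b dvd Q"
    and x: "x \<in> local_ring" "y \<in> local_ring" and eq: "emb (bin a b) * x = emb Q * y"
  shows "\<exists>y'\<in>local_ring. y = emb (bin a b) * y'"
proof -
  obtain X s Y t where *: "x = Fract X s" "ev0 s \<noteq> 0" "y = Fract Y t" "ev0 t \<noteq> 0"
    using x unfolding local_ring_iff by blast
  have "s \<noteq> 0" "t \<noteq> 0" using * ev0_nz by auto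
  then have "bin a b * X * t = Q * Y * s" using eq unfolding * by (simp add: eq_fract)
  then have "bin a b dvd Q * Y * s" by (metis dvd_triv_left dvd_mult2)
  then have "bin a b dvd Y" using bin_prime[OF ab] Q bin_not_dvd_unit[OF ab *(2)] by blast
  then obtain Z where "Y = bin a b * Z" by (elim dvdE)
  then have "y = emb (bin a b) * Fract Z t" by (simp add: *)
  moreover have "Fract Z t \<in> local_ring" using * local_ring_iff by blast
  ultimately show ?thesis by blast
qed

lemma bin_nonzero: "a \<noteq> 0 \<or> b \<noteq> 0 \<Longrightarrow> bin a b \<noteq> 0"
proof
  assume ab: "a \<noteq> 0 \<or> b \<noteq> 0" and "bin a b = 0"
  then have "ev x (bin a b) = 0" for x by simp
  from this[of "\<lambda>v. if v = 1 then 1 else 0"] this[of "\<lambda>v. if v = 1 then 0 else 1"]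
  show False using ab by simp
qed

text \<open>Two different lines generate the maximal ideal, since \<open>u\<close> and
  \<open>v\<close> are linear combinations of their equations; the residue field is spanned by
  \<open>1\<close>.\<close>

lemma codim2_lines:
  assumes "a * e \<noteq> b * c" shows "codim2 (emb (bin a b)) (emb (bin c e)) 1"
proof -
  define D where "D = a * e - b * c"
  have D: "D \<noteq> 0" using assms by (simp add: D_def)
  let ?I = "id2 (emb (bin a b)) (emb (bin c e))"
  have v1: "Var 1 = Cst (e / D) * bin a b + Cst (- b / D) * bin c e"
    and v2: "Var 2 = Cst (- c / D) * bin a b + Cst (a / D) * bin c e"
    by (rule mpol_eqI, simp add: field_simps D, simp add: D_def algebra_simps)+
  have V: "emb (Var v) \<in> ?I" for v
  proof -
    have "emb (Var 1) \<in> ?I" unfolding v1 emb_add emb_mult by (intro id2I local_emb)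
    moreover have "emb (Var 2) \<in> ?I" unfolding v2 emb_add emb_mult by (intro id2I local_emb)
    ultimately show ?thesis using exhaust_2[of v] by auto
  qed
  have poly: "emb (F - Cst (ev0 F)) \<in> ?I" for F
  proof (induction F rule: mpol_ring_induct)
    case (Cst c)
    then show ?case using id2_mult[OF id2_left local_0] by (simp add: emb_0)
  next
    case (Var v)
    then show ?case using V by simp
  next
    case (add F G)
    have "F + G - Cst (ev0 (F + G)) = (F - Cst (ev0 F)) + (G - Cst (ev0 G))" by (simp add: Cst_add)
    then show ?case using id2_add[OF add] by (simp only: emb_add)
  next
    case (mult F G)
    have "F * G - Cst (ev0 (F * G)) = G * (F - Cst (ev0 F)) + Cst (ev0 F) * (G - Cst (ev0 G))"
      by (simp add: Cst_mult algebra_simps)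
    then show ?case using id2_add[OF id2_mult[OF mult(1) local_emb] id2_mult[OF mult(2) local_emb]]
      by (simp only: emb_add emb_mult)
  qed
  have proper: "1 \<notin> ?I"
  proof
    assume "1 \<in> ?I"
    then obtain x y where xy: "1 = x * emb (bin a b) + y * emb (bin c e)" "x \<in> local_ring" "y \<in> local_ring"
      unfolding id2_def by blast
    obtain X s Y t where *: "x = Fract X s" "ev0 s \<noteq> 0" "y = Fract Y t" "ev0 t \<noteq> 0"
      using xy unfolding local_ring_iff by blast
    have "s \<noteq> 0" "t \<noteq> 0" using * ev0_nz by auto
    then have "s * t = X * bin a b * t + Y * bin c e * s"
      using xy(1) unfolding * by (simp add: One_fract_def eq_fract)
    then have "ev0 (s * t) = 0" by (simp add: ev0_def)
    then show False using * by simp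
  qed
  have c: "emb (Cst k) \<in> ?I \<Longrightarrow> k = 0" for k
  proof (rule ccontr)
    assume k: "emb (Cst k) \<in> ?I" "k \<noteq> 0"
    have "emb (Cst (1 / k)) * emb (Cst k) \<in> ?I" by (rule id2_mult[OF k(1) local_emb])
    also have "emb (Cst (1 / k)) * emb (Cst k) = 1"
      using k(2) by (simp only: emb_mult[symmetric] Cst_mult[symmetric]) (simp add: emb_1)
    finally show False using proper by simp
  qed
  have span: "\<exists>k. x - emb (Cst k) \<in> ?I" if x: "x \<in> local_ring" for x
  proof -
    obtain X s where *: "x = Fract X s" "ev0 s \<noteq> 0" using x unfolding local_ring_iff by blast
    define k where "k = ev0 X / ev0 s"
    have "emb (X - Cst k * s) \<in> ?I"
    proof -
      have "X - Cst k * s = (X - Cst (ev0 X)) + (- Cst k) * (s - Cst (ev0 s))"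
        using *(2) by (simp add: k_def algebra_simps Cst_mult[symmetric])
      then show ?thesis using id2_add[OF poly[of X] id2_mult[OF poly[of s] local_emb[of "- Cst k"]]]
        by (simp only: emb_add emb_mult)
    qed
    then have "Fract 1 s * emb (X - Cst k * s) \<in> ?I" by (rule id2_mult[OF _ local_inverse(1)[OF *(2)]])
    also have "Fract 1 s * emb (X - Cst k * s) = x - emb (Cst k)"
      using ev0_nz[OF *(2)] by (simp add: * eq_fract mult.commute)
    finally show ?thesis by blast
  qed
  show ?thesis unfolding codim2_def has_codim_def
  proof (intro exI[of _ "{1}"] conjI)
    show "indep_mod (\<lambda>c h. emb (Cst c) * h) ?I {1}" using c by (auto simp: indep_mod_def)
    show "spans_mod (\<lambda>c h. emb (Cst c) * h) local_ring ?I {1}"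
      unfolding spans_mod_def
    proof
      fix v assume "v \<in> local_ring"
      then obtain k where "v - emb (Cst k) \<in> ?I" using span by blast
      then show "\<exists>c. v - (\<Sum>b\<in>{1}. emb (Cst (c b)) * b) \<in> ?I" by (intro exI[of _ "\<lambda>_. k"]) simp
    qed
  qed (auto simp: local_1)
qed

definition bins :: "(complex \<times> complex) list \<Rightarrow> 2 mpol" where
  "bins ps = prod_list (map (\<lambda>(a, b). bin a b) ps)"

lemma bins_simps [simp]: "bins [] = 1" "bins (p # ps) = bin (fst p) (snd p) * bins ps"
  by (simp_all add: bins_def split_beta)

definition prop2 :: "complex \<times> complex \<Rightarrow> complex \<times> complex \<Rightarrow> bool" where
  "prop2 p q \<longleftrightarrow> fst p * snd q = snd p * fst q"

lemma bin_dvd_bin: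
  assumes "a \<noteq> 0 \<or> b \<noteq> 0"
  shows "bin a b dvd bin c e \<longleftrightarrow> a * e = b * c"
  unfolding bin_dvd_iff[OF assms]
proof
  assume "\<forall>t. ev (\<lambda>v. if v = 1 then t * b else - t * a) (bin c e) = 0"
  from this[rule_format, of 1] show "a * e = b * c" by (simp add: algebra_simps)
qed (simp add: algebra_simps)

lemma bin_dvd_bins:
  assumes "a \<noteq> 0 \<or> b \<noteq> 0" "bin a b dvd bins ps" shows "\<exists>p\<in>set ps. prop2 (a, b) p"
  using assms(2)
proof (induction ps)
  case Nil
  then show ?case using bin_not_dvd_unit[OF assms(1), of 1] by simp
next
  case (Cons p ps)
  then have "bin a b dvd bin (fst p) (snd p) \<or> bin a b dvd bins ps" using bin_prime[OF assms(1)] by simp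
  then show ?case using Cons.IH bin_dvd_bin[OF assms(1)] by (auto simp: prop2_def)
qed

text \<open>Induction by \<open>codim2_mult\<close>, adding the multiplicity one of a further line
  in each step.\<close>

lemma codim2_line_bins:
  assumes ab: "a \<noteq> 0 \<or> b \<noteq> 0" and qs: "\<And>q. q \<in> set qs \<Longrightarrow> q \<noteq> (0, 0) \<and> \<not> prop2 (a, b) q"
  shows "codim2 (emb (bin a b)) (emb (bins qs)) (length qs)"
  using qs
proof (induction qs)
  case Nil
  have "codim2 (emb 1) (emb (bin a b)) 0" by (rule codim2_unit) (simp_all add: local_emb)
  then show ?case by (simp add: codim2_commute)
next
  case (Cons q qs)
  obtain c e where q: "q = (c, e)" by force
  have ce: "c \<noteq> 0 \<or> e \<noteq> 0" and np: "a * e \<noteq> b * c" using Cons.prems[of q] by (auto simp: q prop2_def)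
  have nd: "\<not> bin c e dvd bin a b" using bin_dvd_bin[OF ce] np by (auto simp: mult.commute)
  have "codim2 (emb (bin c e) * emb (bins qs)) (emb (bin a b)) (1 + length qs)"
  proof (rule codim2_mult[OF local_emb local_emb local_emb])
    show "codim2 (emb (bin c e)) (emb (bin a b)) 1" using codim2_lines[OF np] by (simp add: codim2_commute)
    show "codim2 (emb (bins qs)) (emb (bin a b)) (length qs)" using Cons by (simp add: codim2_commute)
    show "emb (bin c e) \<noteq> 0" using bin_nonzero[OF ce] by (metis emb_0 emb_inj)
  qed (rule local_bin_nzd[OF ce nd])
  then show ?case by (simp add: q codim2_commute plus_1_eq_Suc)
qed

lemma codim2_bins:
  assumes "\<And>p. p \<in> set ps \<Longrightarrow> p \<noteq> (0, 0)" "\<And>q. q \<in> set qs \<Longrightarrow> q \<noteq> (0, 0)"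
    "\<And>p q. p \<in> set ps \<Longrightarrow> q \<in> set qs \<Longrightarrow> \<not> prop2 p q"
  shows "codim2 (emb (bins ps)) (emb (bins qs)) (length ps * length qs)"
  using assms
proof (induction ps)
  case Nil
  have "codim2 (emb 1) (emb (bins qs)) 0" by (rule codim2_unit) (simp_all add: local_emb)
  then show ?case by simp
next
  case (Cons p ps)
  obtain a b where p: "p = (a, b)" by force
  have ab: "a \<noteq> 0 \<or> b \<noteq> 0" using Cons.prems(1)[of p] by (auto simp: p)
  have nd: "\<not> bin a b dvd bins qs"
  proof
    assume "bin a b dvd bins qs"
    then obtain q where "q \<in> set qs" "prop2 (a, b) q" using bin_dvd_bins[OF ab] by blast
    then show False using Cons.prems(3)[of p q] p by simp
  qed
  have "codim2 (emb (bin a b) * emb (bins ps)) (emb (bins qs)) (length qs + length ps * length qs)"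
  proof (rule codim2_mult[OF local_emb local_emb local_emb])
    show "codim2 (emb (bin a b)) (emb (bins qs)) (length qs)"
      by (rule codim2_line_bins[OF ab]) (use Cons.prems p in auto)
    show "codim2 (emb (bins ps)) (emb (bins qs)) (length ps * length qs)"
      by (rule Cons.IH) (use Cons.prems in auto)
    show "emb (bin a b) \<noteq> 0" using bin_nonzero[OF ab] by (metis emb_0 emb_inj)
  qed (rule local_bin_nzd[OF ab nd])
  then show ?case by (simp add: p)
qed

text \<open>A zero with \<open>v \<noteq> 0\<close> is a root of \<open>F(t, 1)\<close>. If this
  polynomial is constant then \<open>F\<close> is a multiple of a positive power of
  \<open>v\<close>, so that \<open>(1, 0)\<close> is a zero.\<close>

lemma binary_form_zero:
  fixes F :: "2 mpol"
  assumes F: "homogeneous (Suc n) F"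
  obtains a b where "a \<noteq> 0 \<or> b \<noteq> 0" "bin a b dvd F"
proof -
  have ex: "\<exists>x. (x 1 \<noteq> 0 \<or> x 2 \<noteq> 0) \<and> ev x F = 0"
  proof (cases "ev (\<lambda>v. if v = 1 then 1 else 0) F = 0")
    case True
    then show ?thesis by (intro exI[of _ "\<lambda>v. if v = 1 then 1 else 0"]) auto
  next
    case False
    define p where "p = mpeval (\<lambda>c. [:c:]) (\<lambda>v::2. if v = 1 then [:0, 1:] else [:1:]) F"
    have p: "poly p t = ev (\<lambda>v. if v = 1 then t else 1) F" for t
      unfolding p_def by (induction F rule: mpol_ring_induct) auto
    have hom: "ev (\<lambda>v. if v = 1 then 1 else t) F = t ^ Suc n * ev (\<lambda>v. if v = 1 then 1 / t else 1) F" if "t \<noteq> 0" for t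
    proof -
      have "(\<lambda>v::2. if v = 1 then 1 else t) = (\<lambda>v. t * (if v = 1 then 1 / t else 1))" using that by auto
      then show ?thesis using hom_ev_scale[OF F] by metis
    qed
    have "\<not> constant (poly p)"
    proof
      assume c: "constant (poly p)"
      define q where "q = mpeval (\<lambda>c. [:c:]) (\<lambda>v::2. if v = 1 then [:1:] else [:0, 1:]) F"
      have q: "poly q t = ev (\<lambda>v. if v = 1 then 1 else t) F" for t
        unfolding q_def by (induction F rule: mpol_ring_induct) auto
      have pc: "poly p t = poly p 0" for t using c unfolding constant_def by blast
      have "poly q t = t ^ Suc n * poly p 0" if "t \<noteq> 0" for t
      proof -
        have "poly q t = t ^ Suc n * poly p (1 / t)" unfolding p q by (rule hom[OF that])
        then show ?thesis by (simp only: pc[of "1 / t"])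
      qed
      then have "poly (q - monom (poly p 0) (Suc n)) t = 0" if "t \<noteq> 0" for t
        using that by (simp add: poly_monom)
      then have "UNIV - {0} \<subseteq> {t. poly (q - monom (poly p 0) (Suc n)) t = 0}" by auto
      moreover have "infinite (UNIV - {0::complex})" by (simp add: infinite_UNIV_char_0)
      ultimately have "q - monom (poly p 0) (Suc n) = 0" using poly_roots_finite infinite_super by blast
      then have "poly q 0 = 0" by (simp add: poly_monom)
      then show False using False unfolding q by (metis (mono_tags, lifting))
    qed
    then obtain t where "poly p t = 0" using fundamental_theorem_of_algebra by blast
    then show ?thesis by (intro exI[of _ "\<lambda>v. if v = 1 then t else 1"]) (simp add: p)
  qed
  then obtain x where x: "x 1 \<noteq> 0 \<or> x 2 \<noteq> 0" "ev x F = 0" by blast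
  have ab: "x 2 \<noteq> 0 \<or> - x 1 \<noteq> 0" using x(1) by auto
  have "ev (\<lambda>v. if v = 1 then t * - x 1 else - t * x 2) F = 0" for t
  proof -
    have "(\<lambda>v. if v = 1 then t * - x 1 else - t * x 2) = (\<lambda>v. - t * x v)" using exhaust_2 by fastforce
    then show ?thesis using hom_ev_scale[OF F, of "- t" x] x(2) by simp
  qed
  then have "bin (x 2) (- x 1) dvd F" using bin_dvd_iff[OF ab] by blast
  with ab show thesis by (rule that)
qed

lemma binary_form_splits:
  fixes F :: "2 mpol"
  assumes "homogeneous n F" "F \<noteq> 0"
  obtains c ps where "c \<noteq> 0" "length ps = n" "\<And>p. p \<in> set ps \<Longrightarrow> p \<noteq> (0, 0)" "F = Cst c * bins ps"
proof -
  have "\<exists>c ps. c \<noteq> 0 \<and> length ps = n \<and> (\<forall>p\<in>set ps. p \<noteq> (0, 0)) \<and> F = Cst c * bins ps"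
    using assms
  proof (induction n arbitrary: F)
    case 0
    then have "F = Cst (coef F 0)" using hom_0_Cst by blast
    then show ?case using 0(2) by (intro exI[of _ "coef F 0"] exI[of _ "[]"]) auto
  next
    case (Suc n)
    obtain a b where ab: "a \<noteq> 0 \<or> b \<noteq> 0" "bin a b dvd F" by (rule binary_form_zero[OF Suc.prems(1)])
    obtain G where G: "F = bin a b * G" using ab(2) by (elim dvdE)
    have hb: "homogeneous 1 (bin a b)" unfolding bin_def by (rule hom_linform)
    have G0: "G \<noteq> 0" using G Suc.prems(2) by auto
    have "homogeneous n G"
    proof -
      have "part mdegree (e + 1) F = part mdegree e G * bin a b" for e
        unfolding G mult.commute[of "bin a b"]
        by (rule part_mult) (use hb in \<open>simp_all add: mdegree_add homogeneous_graded\<close>)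
      moreover have "part mdegree (e + 1) F = (if Suc n = e + 1 then F else 0)" for e
        using part_graded Suc.prems(1) unfolding homogeneous_graded by blast
      ultimately have z: "part mdegree e G = 0" if "e \<noteq> n" for e
        using that bin_nonzero[OF ab(1)] by (metis Suc_eq_plus1 mult_eq_0_iff nat.inject)
      show ?thesis unfolding homogeneous_def
      proof
        fix m assume m: "m \<in> supp G"
        show "mdegree m = n"
        proof (rule ccontr)
          assume "mdegree m \<noteq> n"
          from z[OF this] have "coef (part mdegree (mdegree m) G) m = 0" by simp
          then show False using m by (simp add: coef_part in_keys_iff)
        qed
      qed
    qed
    then obtain c ps where "c \<noteq> 0" "length ps = n" "\<forall>p\<in>set ps. p \<noteq> (0, 0)" "G = Cst c * bins ps"
      using Suc.IH G0 by blast
    then show ?case using ab(1) G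
      by (intro exI[of _ c] exI[of _ "(a, b) # ps"]) (auto simp: mult.left_commute)
  qed
  then show thesis using that by blast
qed

section \<open>Singular points of an arrangement\<close>

lemma pd_prod:
  assumes "finite A"
  shows "pderivative v (\<Prod>i\<in>A. F i) = (\<Sum>j\<in>A. pderivative v (F j) * (\<Prod>i\<in>A - {j}. F i))"
  using assms
proof (induction A rule: finite_induct)
  case (insert k A)
  have "(\<Prod>i\<in>insert k A - {j}. F i) = F k * (\<Prod>i\<in>A - {j}. F i)" if "j \<in> A" for j
  proof -
    have "insert k A - {j} = insert k (A - {j})" using that insert.hyps by auto
    then show ?thesis using insert.hyps by simp
  qed
  then have "(\<Sum>j\<in>A. pderivative v (F j) * (\<Prod>i\<in>insert k A - {j}. F i))
      = F k * (\<Sum>j\<in>A. pderivative v (F j) * (\<Prod>i\<in>A - {j}. F i))"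
    by (simp only: sum_distrib_left) (rule sum.cong, simp_all only: ac_simps)
  then show ?case using insert by (simp add: pd_mult)
qed simp

lemma rep_psi:
  assumes "Ls \<in> tuples d"
  obtains c where "c \<noteq> 0" "rep (psi Ls) = Cst c * (\<Prod>i<d. linform (lf (Ls ! i)))"
proof -
  have len: "length Ls = d" and PS: "\<And>i. i < d \<Longrightarrow> Ls ! i \<in> PS 1"
    using assms by (auto simp: tuples_def)
  obtain c where c: "c \<noteq> 0" "rep (psi Ls) = Cst c * prod_list (map rep Ls)"
    unfolding psi_def by (rule rep_pclass)
  have "prod_list (map rep Ls) = (\<Prod>i=0..<d. rep (Ls ! i))"
    unfolding prod.list_conv_set_nth using len by (intro prod.cong) auto
  also have "\<dots> = (\<Prod>i<d. linform (lf (Ls ! i)))"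
    by (intro prod.cong) (auto simp: rep_linform[OF PS] atLeast0LessThan)
  finally show thesis using c that by simp
qed

text \<open>By the product rule, at a point of exactly one line \<open>l\<close> the gradient is a
  nonzero multiple of the coordinates of \<open>l\<close>, and at a point of two lines all terms
  vanish.\<close>

lemma singular_points_arrangement:
  assumes X: "Ls \<in> X_space d"
  shows "singular_points (rep (psi Ls))
    = {q. \<exists>P\<in>set Ls. \<exists>Q\<in>set Ls. P \<noteq> Q \<and> q \<in> line P \<and> q \<in> line Q}" (is "?S = ?T")
proof -
  have tup: "Ls \<in> tuples d" using X by (simp add: X_space_def)
  have len: "length Ls = d" and PS: "\<And>i. i < d \<Longrightarrow> Ls ! i \<in> PS 1"
    and ne: "\<And>i j. i < d \<Longrightarrow> j < d \<Longrightarrow> Ls ! i = Ls ! j \<longleftrightarrow> i = j"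
    using X_spaceD[OF X] by (auto simp: nth_eq_iff_index_eq)
  obtain c where c: "c \<noteq> 0" "rep (psi Ls) = Cst c * (\<Prod>i<d. linform (lf (Ls ! i)))"
    by (rule rep_psi[OF tup])
  define s where "s q i = dot3 (lf (Ls ! i)) (($) (rep q))" for q :: point and i
  have evl: "ev (($) (rep q)) (linform (lf (Ls ! i))) = s q i" for q i
    by (simp add: s_def dot3_def sum_3)
  have ln: "q \<in> line (Ls ! i) \<longleftrightarrow> q \<in> P2 \<and> s q i = 0" if "i < d" for q i
    using line_iff[OF PS[OF that]] by (simp add: s_def)
  have evf: "ev (($) (rep q)) (rep (psi Ls)) = c * (\<Prod>i<d. s q i)" for q
    by (simp only: c(2) ev_mult ev_Cst ev_prod evl)
  have evd: "ev (($) (rep q)) (pderivative v (rep (psi Ls)))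
      = c * (\<Sum>j<d. lf (Ls ! j) v * (\<Prod>i\<in>{..<d} - {j}. s q i))" for q v
    by (simp only: c(2) pd_Cst_mult pd_prod[OF finite_lessThan] pd_linform ev_mult ev_Cst ev_sum ev_prod evl)
  have T: "q \<in> ?T \<longleftrightarrow> (\<exists>i<d. \<exists>j<d. i \<noteq> j \<and> q \<in> line (Ls ! i) \<and> q \<in> line (Ls ! j))" for q
  proof
    assume "q \<in> ?T"
    then obtain P Q where "P \<in> set Ls" "Q \<in> set Ls" "P \<noteq> Q" "q \<in> line P" "q \<in> line Q" by blast
    moreover obtain i j where "i < d" "P = Ls ! i" "j < d" "Q = Ls ! j"
      using calculation(1,2) len by (metis in_set_conv_nth)
    ultimately show "\<exists>i<d. \<exists>j<d. i \<noteq> j \<and> q \<in> line (Ls ! i) \<and> q \<in> line (Ls ! j)" by blast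
  next
    assume "\<exists>i<d. \<exists>j<d. i \<noteq> j \<and> q \<in> line (Ls ! i) \<and> q \<in> line (Ls ! j)"
    then obtain i j where ij: "i < d" "j < d" "i \<noteq> j" "q \<in> line (Ls ! i)" "q \<in> line (Ls ! j)" by blast
    have "Ls ! i \<in> set Ls" "Ls ! j \<in> set Ls" "Ls ! i \<noteq> Ls ! j" using ij len ne[of i j] by auto
    then show "q \<in> ?T" using ij by blast
  qed
  show ?thesis
  proof (intro equalityI subsetI)
    fix q assume "q \<in> ?T"
    then obtain i j where ij: "i < d" "j < d" "i \<noteq> j" "q \<in> line (Ls ! i)" "q \<in> line (Ls ! j)"
      using T by blast
    then have q: "q \<in> P2" "s q i = 0" "s q j = 0" using ln by auto
    have "(\<Prod>i<d. s q i) = 0" using q ij by auto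
    then have f0: "ev (($) (rep q)) (rep (psi Ls)) = 0" by (simp only: evf mult_zero_right)
    have "(\<Prod>i\<in>{..<d} - {k}. s q i) = 0" for k
      using q ij by (cases "k = i") auto
    then have "\<forall>v. ev (($) (rep q)) (pderivative v (rep (psi Ls))) = 0"
      by (simp only: evd mult_zero_right sum.neutral_const simp_thms)
    with f0 q(1) show "q \<in> ?S" unfolding singular_points_def ev_def[symmetric] by blast
  next
    fix q assume "q \<in> ?S"
    then have q: "q \<in> P2" "(\<Prod>i<d. s q i) = 0"
      and dv: "\<And>v. (\<Sum>j<d. lf (Ls ! j) v * (\<Prod>i\<in>{..<d} - {j}. s q i)) = 0"
      unfolding singular_points_def ev_def[symmetric] using c(1) by (auto simp: evf evd)
    obtain i where i: "i < d" "s q i = 0" using q(2) by auto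
    have "\<exists>j<d. j \<noteq> i \<and> s q j = 0"
    proof (rule ccontr)
      assume "\<not> ?thesis"
      then have nz: "(\<Prod>k\<in>{..<d} - {i}. s q k) \<noteq> 0" by auto
      have "(\<Sum>j<d. lf (Ls ! j) v * (\<Prod>k\<in>{..<d} - {j}. s q k)) = lf (Ls ! i) v * (\<Prod>k\<in>{..<d} - {i}. s q k)" for v
      proof -
        have "(\<Sum>j\<in>{..<d} - {i}. lf (Ls ! j) v * (\<Prod>k\<in>{..<d} - {j}. s q k)) = 0"
          by (rule sum.neutral) (use i in auto)
        then show ?thesis using i(1) by (subst sum.remove[of _ i]) auto
      qed
      then have "lf (Ls ! i) v = 0" for v using dv[of v] nz by simp
      then show False using lf_nonzero[OF PS[OF i(1)]] by simp
    qed
    then obtain j where j: "j < d" "j \<noteq> i" "s q j = 0" by blast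
    have "q \<in> line (Ls ! i)" "q \<in> line (Ls ! j)" using ln i j q(1) by auto
    then show "q \<in> ?T" using i(1) j(1,2)
      by (simp only: T) (intro exI[of _ i] exI[of _ j] conjI, simp_all)
  qed
qed

section \<open>The Tjurina algebra of concurrent lines\<close>

lemma bins_homogeneous: "homogeneous (length ps) (bins ps)"
proof (induction ps)
  case (Cons p ps)
  have "homogeneous 1 (bin (fst p) (snd p))" unfolding bin_def by (rule hom_linform)
  from hom_mult[OF this Cons] show ?case by (simp add: plus_1_eq_Suc)
qed (simp add: hom_1)

lemma bin_dvd_bins_mem: "p \<in> set ps \<Longrightarrow> bin (fst p) (snd p) dvd bins ps"
  by (induction ps) auto

lemma bins_remove: "p \<in> set ps \<Longrightarrow> bins ps = bin (fst p) (snd p) * bins (remove1 p ps)"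
  by (induction ps) (auto simp: mult.left_commute)

lemma euler2: "homogeneous r F \<Longrightarrow> Var 1 * pderivative 1 F + Var 2 * pderivative 2 F = of_nat r * F"
  for F :: "2 mpol"
  using euler[of r F] by (simp add: sum_2)

lemma of_nat_Cst: "of_nat n = Cst (of_nat n)"
  by (induction n) (simp_all add: Cst_add)

text \<open>The partial derivatives of a reduced binary form have no common factor: it would divide the
  form by Euler's relation, and then it would divide the form twice.\<close>

lemma partials_coprime:
  assumes nz: "\<And>p. p \<in> set ps \<Longrightarrow> p \<noteq> (0, 0)" and dist: "distinct ps"
    and np: "\<And>p q. p \<in> set ps \<Longrightarrow> q \<in> set ps \<Longrightarrow> p \<noteq> q \<Longrightarrow> \<not> prop2 p q"
    and len: "ps \<noteq> []" and ab: "a \<noteq> 0 \<or> b \<noteq> 0"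
  shows "\<not> (bin a b dvd pderivative 1 (bins ps) \<and> bin a b dvd pderivative 2 (bins ps))"
proof
  assume d: "bin a b dvd pderivative 1 (bins ps) \<and> bin a b dvd pderivative 2 (bins ps)"
  let ?l = "bin a b"
  have canc: "?l dvd F" if "?l dvd Cst c * F" "c \<noteq> 0" for c F
  proof -
    have "?l dvd Cst (1 / c) * (Cst c * F)" by (rule dvd_mult[OF that(1)])
    then show ?thesis by (simp only: Cst_mult_cancel[OF that(2)])
  qed
  have "?l dvd of_nat (length ps) * bins ps"
    unfolding euler2[OF bins_homogeneous, symmetric] using d by simp
  then have "?l dvd bins ps" unfolding of_nat_Cst by (rule canc) (use len in simp)
  then obtain p where p: "p \<in> set ps" "prop2 (a, b) p" using bin_dvd_bins[OF ab] by blast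
  define k where "k = bins (remove1 p ps)"
  have h: "bins ps = bin (fst p) (snd p) * k" unfolding k_def by (rule bins_remove[OF p(1)])
  have lp: "?l dvd bin (fst p) (snd p)" using bin_dvd_bin[OF ab] p(2) by (auto simp: prop2_def)
  have pd: "pderivative v (bins ps) = Cst (if v = 1 then fst p else snd p) * k + bin (fst p) (snd p) * pderivative v k" for v
    unfolding h by (simp add: pd_mult) (simp add: bin_def pd_linform)
  have c: "?l dvd Cst (if v = 1 then fst p else snd p) * k" if "?l dvd pderivative v (bins ps)" for v
    using that lp unfolding pd by (simp add: dvd_add_left_iff)
  have "?l dvd k"
  proof (cases "fst p = 0")
    case True
    then have "snd p \<noteq> 0" using nz[OF p(1)] by (auto simp: prod_eq_iff)
    moreover have "?l dvd Cst (snd p) * k" using c[of 2] d by simp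
    ultimately show ?thesis using canc by blast
  next
    case False
    moreover have "?l dvd Cst (fst p) * k" using c[of 1] d by simp
    ultimately show ?thesis using canc by blast
  qed
  then obtain q where q: "q \<in> set (remove1 p ps)" "prop2 (a, b) q"
    unfolding k_def using bin_dvd_bins[OF ab] by blast
  then have "q \<in> set ps" "q \<noteq> p" using dist by (auto simp: set_remove1_eq)
  moreover have "prop2 p q"
  proof -
    have e: "a * snd p = b * fst p" "a * snd q = b * fst q" using p(2) q(2) by (auto simp: prop2_def)
    have "a * (fst p * snd q) = a * (snd p * fst q)" "b * (fst p * snd q) = b * (snd p * fst q)"
      using e by algebra+
    then show ?thesis using ab by (auto simp: prop2_def)
  qed
  ultimately show False using np[OF p(1)] by blast
qed

lemma id2_Cst:
  assumes "c \<noteq> 0" "e \<noteq> 0" shows "id2 (emb (Cst c * F)) (emb (Cst e * G)) = id2 (emb F) (emb G)"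
proof -
  have "emb (Cst c * F) \<in> id2 (emb F) (emb G)" "emb (Cst e * G) \<in> id2 (emb F) (emb G)"
    unfolding emb_mult by (intro id2_mult id2_left id2_right local_emb)+
  moreover have "emb (Cst (1 / c) * (Cst c * F)) \<in> id2 (emb (Cst c * F)) (emb (Cst e * G))"
    "emb (Cst (1 / e) * (Cst e * G)) \<in> id2 (emb (Cst c * F)) (emb (Cst e * G))"
    unfolding emb_mult[of "Cst (1 / _)"] by (intro id2_mult id2_left id2_right local_emb)+
  then have "emb F \<in> id2 (emb (Cst c * F)) (emb (Cst e * G))" "emb G \<in> id2 (emb (Cst c * F)) (emb (Cst e * G))"
    by (simp_all only: Cst_mult_cancel[OF assms(1)] Cst_mult_cancel[OF assms(2)])
  ultimately show ?thesis by (intro equalityI id2_subset)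
qed

text \<open>Both partial derivatives split into \<open>m - 1\<close> lines and have no line in
  common.\<close>

lemma codim2_partials:
  assumes nz: "\<And>p. p \<in> set ps \<Longrightarrow> p \<noteq> (0, 0)" and dist: "distinct ps"
    and np: "\<And>p q. p \<in> set ps \<Longrightarrow> q \<in> set ps \<Longrightarrow> p \<noteq> q \<Longrightarrow> \<not> prop2 p q"
    and len: "length ps \<ge> 2"
  shows "codim2 (emb (pderivative 1 (bins ps))) (emb (pderivative 2 (bins ps))) ((length ps - 1)\<^sup>2)"
proof -
  define n where "n = length ps - 2"
  have n: "length ps - 1 = Suc n" using len by (simp add: n_def)
  have ps: "ps \<noteq> []" using len by auto
  have cop: "\<not> (bin a b dvd pderivative 1 (bins ps) \<and> bin a b dvd pderivative 2 (bins ps))"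
    if "a \<noteq> 0 \<or> b \<noteq> 0" for a b
    by (rule partials_coprime[OF nz dist np ps that])
  have hom: "homogeneous (Suc n) (pderivative v (bins ps))" for v
    using hom_pd[OF bins_homogeneous[of ps]] unfolding n by simp
  have "pderivative 1 (bins ps) \<noteq> 0"
  proof
    assume z: "pderivative 1 (bins ps) = 0"
    obtain a b where "a \<noteq> 0 \<or> b \<noteq> 0" "bin a b dvd pderivative 2 (bins ps)" by (rule binary_form_zero[OF hom])
    then show False using cop[of a b] z by simp
  qed
  from binary_form_splits[OF hom this] obtain c ps1
    where 1: "c \<noteq> 0" "length ps1 = Suc n" "\<And>p. p \<in> set ps1 \<Longrightarrow> p \<noteq> (0, 0)" "pderivative 1 (bins ps) = Cst c * bins ps1"
    by blast
  have "pderivative 2 (bins ps) \<noteq> 0"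
  proof
    assume z: "pderivative 2 (bins ps) = 0"
    obtain a b where "a \<noteq> 0 \<or> b \<noteq> 0" "bin a b dvd pderivative 1 (bins ps)" by (rule binary_form_zero[OF hom])
    then show False using cop[of a b] z by simp
  qed
  from binary_form_splits[OF hom this] obtain e ps2
    where 2: "e \<noteq> 0" "length ps2 = Suc n" "\<And>p. p \<in> set ps2 \<Longrightarrow> p \<noteq> (0, 0)" "pderivative 2 (bins ps) = Cst e * bins ps2"
    by blast
  have "\<not> prop2 p q" if pq: "p \<in> set ps1" "q \<in> set ps2" for p q
  proof
    assume pr: "prop2 p q"
    have ab: "fst p \<noteq> 0 \<or> snd p \<noteq> 0" using 1(3)[OF pq(1)] by (auto simp: prod_eq_iff)
    have "bin (fst p) (snd p) dvd bin (fst q) (snd q)" using bin_dvd_bin[OF ab] pr by (simp add: prop2_def)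
    then have "bin (fst p) (snd p) dvd bins ps2" using bin_dvd_bins_mem[OF pq(2)] by (rule dvd_trans)
    moreover have "bin (fst p) (snd p) dvd bins ps1" by (rule bin_dvd_bins_mem[OF pq(1)])
    ultimately show False using cop[OF ab] unfolding 1(4) 2(4) by simp
  qed
  then have "codim2 (emb (bins ps1)) (emb (bins ps2)) (length ps1 * length ps2)"
    using 1(3) 2(3) by (intro codim2_bins)
  then show ?thesis
    unfolding codim2_def 1(4) 2(4) id2_Cst[OF 1(1) 2(1)] n by (simp add: 1(2) 2(2) power2_eq_square)
qed

text \<open>The unit \<open>e\<close> can be dropped because the ideal of \<open>g, g\<^sub>u,
  g\<^sub>v\<close> does not change when \<open>g\<close> is multiplied by a unit, and the
  homogeneous generator \<open>h\<close> is in the ideal of its derivatives by Euler's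
  relation.\<close>

lemma tjurina_ideal_unit:
  assumes h: "homogeneous (length ps) (bins ps)" "ps \<noteq> []" and e: "ev0 e \<noteq> 0"
  shows "tjurina_ideal (bins ps * e) = id2 (emb (pderivative 1 (bins ps))) (emb (pderivative 2 (bins ps)))"
proof -
  let ?h = "bins ps" and ?g = "bins ps * e"
  let ?I = "id2 (emb (pderivative 1 ?h)) (emb (pderivative 2 ?h))"
  let ?T = "tjurina_ideal ?g"
  have gd: "pderivative v ?g = pderivative v ?h * e + ?h * pderivative v e" for v by (rule pd_mult)
  have hI: "emb ?h \<in> ?I"
  proof -
    have "Cst (of_nat (length ps)) * ?h = Var 1 * pderivative 1 ?h + Var 2 * pderivative 2 ?h"
      using euler2[OF h(1)] by (simp add: of_nat_Cst)
    then have "?h = Cst (1 / of_nat (length ps)) * (Var 1 * pderivative 1 ?h + Var 2 * pderivative 2 ?h)"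
      using Cst_mult_cancel[of "of_nat (length ps)" ?h] h(2) by simp
    moreover have "emb (Var 1 * pderivative 1 ?h + Var 2 * pderivative 2 ?h) \<in> ?I"
      unfolding emb_add emb_mult by (intro id2I local_emb)
    ultimately show ?thesis using id2_mult[OF _ local_emb] by (metis emb_mult)
  qed
  have pdI: "emb (pderivative v ?h) \<in> ?I" for v using exhaust_2[of v] id2_left id2_right by auto
  have gI: "emb ?g \<in> ?I" "emb (pderivative v ?g) \<in> ?I" for v
    unfolding gd emb_add emb_mult
    using id2_mult[OF hI local_emb[of e]]
      id2_add[OF id2_mult[OF pdI[of v] local_emb[of e]] id2_mult[OF hI local_emb[of "pderivative v e"]]]
    by (simp_all only: mult.commute)
  have Tadd: "x + y \<in> ?T" if "x \<in> ?T" "y \<in> ?T" for x y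
  proof -
    obtain a b c a' b' c' where *: "x = a * emb ?g + b * emb (pderivative 1 ?g) + c * emb (pderivative 2 ?g)"
      "y = a' * emb ?g + b' * emb (pderivative 1 ?g) + c' * emb (pderivative 2 ?g)"
      "a \<in> local_ring" "b \<in> local_ring" "c \<in> local_ring" "a' \<in> local_ring" "b' \<in> local_ring" "c' \<in> local_ring"
      using \<open>x \<in> ?T\<close> \<open>y \<in> ?T\<close> unfolding tjurina_ideal_def by blast
    have "x + y = (a + a') * emb ?g + (b + b') * emb (pderivative 1 ?g) + (c + c') * emb (pderivative 2 ?g)"
      unfolding *(1,2) distrib_right by (simp only: ac_simps)
    then show ?thesis unfolding tjurina_ideal_def using * local_add by blast
  qed
  have Tmult: "r * x \<in> ?T" if "x \<in> ?T" "r \<in> local_ring" for x r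
  proof -
    obtain a b c where *: "x = a * emb ?g + b * emb (pderivative 1 ?g) + c * emb (pderivative 2 ?g)"
      "a \<in> local_ring" "b \<in> local_ring" "c \<in> local_ring"
      using \<open>x \<in> ?T\<close> unfolding tjurina_ideal_def by blast
    have "r * x = (r * a) * emb ?g + (r * b) * emb (pderivative 1 ?g) + (r * c) * emb (pderivative 2 ?g)"
      unfolding *(1) distrib_left by (simp only: ac_simps)
    then show ?thesis unfolding tjurina_ideal_def using * local_mult that(2) by blast
  qed
  have T0: "emb ?g \<in> ?T" "emb (pderivative v ?g) \<in> ?T" for v
  proof -
    have "emb ?g = 1 * emb ?g + 0 * emb (pderivative 1 ?g) + 0 * emb (pderivative 2 ?g)" by simp
    then show "emb ?g \<in> ?T" unfolding tjurina_ideal_def using local_0 local_1 by blast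
    have "emb (pderivative 1 ?g) = 0 * emb ?g + 1 * emb (pderivative 1 ?g) + 0 * emb (pderivative 2 ?g)"
      "emb (pderivative 2 ?g) = 0 * emb ?g + 0 * emb (pderivative 1 ?g) + 1 * emb (pderivative 2 ?g)" by simp_all
    then have "emb (pderivative 1 ?g) \<in> ?T" "emb (pderivative 2 ?g) \<in> ?T"
      unfolding tjurina_ideal_def using local_0 local_1 by blast+
    then show "emb (pderivative v ?g) \<in> ?T" using exhaust_2[of v] by auto
  qed
  note inv = local_inverse[OF e]
  have hT: "emb ?h \<in> ?T"
  proof -
    have "emb ?h = Fract 1 e * emb ?g" 
      by (simp only: emb_mult mult.left_commute[of "Fract 1 e" "emb (bins ps)"] inv(2) mult_1_right)
    then show ?thesis using Tmult[OF T0(1) inv(1)] by metis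
  qed
  have pT: "emb (pderivative v ?h) \<in> ?T" for v
  proof -
    have "emb (pderivative v ?h) = Fract 1 e * (emb (pderivative v ?g) + (- emb (pderivative v e)) * emb ?h)"
    proof -
      have "A * E + H * D + (- D) * H = A * E" for A E H D :: K by (simp add: algebra_simps)
      then have *: "emb (pderivative v ?g) + (- emb (pderivative v e)) * emb ?h = emb (pderivative v ?h) * emb e"
        unfolding gd emb_add emb_mult .
      show ?thesis unfolding *
        by (simp only: mult.left_commute[of "Fract 1 e" "emb (pderivative v (bins ps))"] inv(2) mult_1_right)
    qed
    moreover have "emb (pderivative v ?g) + (- emb (pderivative v e)) * emb ?h \<in> ?T"
      by (rule Tadd[OF T0(2) Tmult[OF hT local_minus[OF local_emb]]])
    ultimately show ?thesis using Tmult[OF _ inv(1)] by metis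
  qed
  show ?thesis
  proof (intro equalityI subsetI)
    fix x assume "x \<in> ?T"
    then obtain a b c where *: "x = a * emb ?g + b * emb (pderivative 1 ?g) + c * emb (pderivative 2 ?g)"
      "a \<in> local_ring" "b \<in> local_ring" "c \<in> local_ring" unfolding tjurina_ideal_def by blast
    show "x \<in> ?I" unfolding *(1) by (intro id2_add id2_mult gI *)
  next
    fix x assume "x \<in> ?I"
    then obtain a b where *: "x = a * emb (pderivative 1 ?h) + b * emb (pderivative 2 ?h)"
      "a \<in> local_ring" "b \<in> local_ring" unfolding id2_def by blast
    show "x \<in> ?T" unfolding *(1) by (intro Tadd Tmult pT *)
  qed
qed

text \<open>If the entry \<open>k\<close> of \<open>w\<close> is not zero, then \<open>w\<close> and
  the unit vectors other than the one of index \<open>k\<close> form a basis. So the choice in the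
  definition of \<open>frame\<close> has the property by which it is described.\<close>

lemma complete_frame:
  assumes "w \<noteq> (0 :: complex^3)"
  shows "\<exists>M :: complex^3^3. invertible M \<and> column 1 M = w"
proof -
  obtain k where k: "w $ k \<noteq> 0" using assms by (auto simp: vec_eq_iff)
  define M :: "complex^3^3" where
    "M = (\<chi> i j. if j = 1 then w $ i
       else if k = 1 then (if i = j then 1 else 0)
       else if k = 2 then (if (j = 2 \<and> i = 1) \<or> (j = 3 \<and> i = 3) then 1 else 0)
       else (if (j = 2 \<and> i = 1) \<or> (j = 3 \<and> i = 2) then 1 else 0))"
  have "det M \<noteq> 0" using k exhaust_3[of k] by (auto simp: det_3 M_def)
  then have "invertible M" by (simp add: invertible_det_nz)
  moreover have "column 1 M = w" by (simp add: column_def M_def vec_eq_iff)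
  ultimately show ?thesis by blast
qed

text \<open>In the chart the line \<open>i\<close> has the equation \<open>g\<^sub>1 + g\<^sub>2 u +
  g\<^sub>3 v\<close> with \<open>g\<^sub>1 = 0\<close> if and only if it contains \<open>q\<close>.
  So the lines through \<open>q\<close> become the linear forms of a reduced binary form and the
  others are units. The inverse \<open>N\<close> of the frame recovers a line from its equation in
  the chart, which shows that different lines stay different.\<close>

lemma local_tjurina_arrangement:
  assumes X: "Ls \<in> X_space d" and q: "q \<in> P2" and m: "card {P \<in> set Ls. q \<in> line P} \<ge> 2"
  shows "local_tjurina (rep (psi Ls)) q = (card {P \<in> set Ls. q \<in> line P} - 1)\<^sup>2"
proof -
  have tup: "Ls \<in> tuples d" using X by (simp add: X_space_def)
  have len: "length Ls = d" and PS: "\<And>i. i < d \<Longrightarrow> Ls ! i \<in> PS 1"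
    and ne: "\<And>i j. i < d \<Longrightarrow> j < d \<Longrightarrow> Ls ! i = Ls ! j \<longleftrightarrow> i = j"
    using X_spaceD[OF X] by (auto simp: nth_eq_iff_index_eq)
  obtain c where c: "c \<noteq> 0" "rep (psi Ls) = Cst c * (\<Prod>i<d. linform (lf (Ls ! i)))"
    by (rule rep_psi[OF tup])
  define M where "M = frame q"
  have M: "invertible M" "column 1 M = rep q"
    using someI_ex[OF complete_frame[OF P2_rep(1)[OF q]]] unfolding M_def frame_def by auto
  obtain N where N: "M ** N = mat 1" using M(1) by (auto simp: invertible_def)
  have M1: "M $ i $ 1 = rep q $ i" for i using arg_cong[OF M(2), of "\<lambda>v. v $ i"] by (simp add: column_def)
  define g where "g k i = (\<Sum>v\<in>UNIV. lf (Ls ! i) v * M $ v $ k)" for k i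
  have bk: "lf (Ls ! i) v = (\<Sum>k\<in>UNIV. g k i * N $ k $ v)" for i v
  proof -
    have "(\<Sum>k\<in>UNIV. g k i * N $ k $ v) = (\<Sum>w\<in>UNIV. lf (Ls ! i) w * (M ** N) $ w $ v)"
      unfolding g_def matrix_matrix_mult_def
      by (simp only: vec_lambda_beta sum_distrib_left sum_distrib_right mult.assoc) (rule sum.swap)
    also have "\<dots> = lf (Ls ! i) v"
      unfolding N by (simp add: mat_def if_distrib[of "\<lambda>c. _ * c"] cong: if_cong)
    finally show ?thesis ..
  qed
  have g1: "g 1 i = 0 \<longleftrightarrow> q \<in> line (Ls ! i)" if "i < d" for i
    using line_iff[OF PS[OF that]] q by (simp add: g_def M1 sum_3 dot3_def)
  define y where "y = (\<lambda>i. Cst (M $ i $ 1) + Cst (M $ i $ 2) * Var 1 + Cst (M $ i $ 3) * (Var 2 :: 2 mpol))"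
  have loc: "mpeval Cst y (linform (lf (Ls ! i))) = Cst (g 1 i) + bin (g 2 i) (g 3 i)" for i
    unfolding subst_linform
    by (rule mpol_eqI) (simp add: y_def g_def sum_3 algebra_simps)
  define I0 where "I0 = {i. i < d \<and> q \<in> line (Ls ! i)}"
  have fin: "finite I0" by (simp add: I0_def)
  have cardI: "card I0 = card {P \<in> set Ls. q \<in> line P}"
  proof -
    have "{P \<in> set Ls. q \<in> line P} = (!) Ls ` I0" using len by (auto simp: I0_def in_set_conv_nth)
    moreover have "inj_on ((!) Ls) I0" using ne by (auto simp: I0_def inj_on_def)
    ultimately show ?thesis by (simp add: card_image)
  qed
  define pr where "pr i = (g 2 i, g 3 i)" for i
  have lfI: "lf (Ls ! i) v = g 2 i * N $ 2 $ v + g 3 i * N $ 3 $ v" if "i \<in> I0" for i v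
    using g1[of i] that bk[of i v] by (simp add: I0_def sum_3)
  have nzI: "pr i \<noteq> (0, 0)" if "i \<in> I0" for i
  proof
    assume "pr i = (0, 0)"
    then have "lf (Ls ! i) v = 0" for v using lfI[OF that] by (simp add: pr_def)
    then show False using lf_nonzero[OF PS, of i] that by (auto simp: I0_def)
  qed
  have npI: "\<not> prop2 (pr i) (pr j)" if ij: "i \<in> I0" "j \<in> I0" "i \<noteq> j" for i j
  proof
    assume "prop2 (pr i) (pr j)"
    then have e: "g 2 i * g 3 j = g 3 i * g 2 j" by (simp add: prop2_def pr_def)
    have "crossp (lf (Ls ! i)) (lf (Ls ! j)) v = (g 2 i * g 3 j - g 3 i * g 2 j) * crossp (($) (N $ 2)) (($) (N $ 3)) v" for v
      using exhaust_3[of v] by (auto simp: lfI[OF ij(1)] lfI[OF ij(2)] algebra_simps)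
    then have "crossp (lf (Ls ! i)) (lf (Ls ! j)) v = 0" for v using e by simp
    moreover have "Ls ! i \<noteq> Ls ! j" using ij ne by (auto simp: I0_def)
    ultimately show False using crossp_nonzero[of "Ls ! i" "Ls ! j"] PS ij by (auto simp: I0_def)
  qed
  have injpr: "inj_on pr I0"
    by (rule inj_onI) (metis npI mult.commute prop2_def)
  define ps where "ps = map pr (sorted_list_of_set I0)"
  have ps: "set ps = pr ` I0" "distinct ps" "length ps = card I0"
    using fin injpr by (simp_all add: ps_def distinct_map)
  have bps: "bins ps = (\<Prod>i\<in>I0. bin (g 2 i) (g 3 i))"
  proof -
    have "bins ps = prod_list (map (\<lambda>i. bin (g 2 i) (g 3 i)) (sorted_list_of_set I0))"
      by (simp add: bins_def ps_def comp_def pr_def)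
    also have "\<dots> = (\<Prod>i\<in>I0. bin (g 2 i) (g 3 i))"
      using fin by (subst prod.distinct_set_conv_list[symmetric]) simp_all
    finally show ?thesis .
  qed
  define e where "e = Cst c * (\<Prod>i\<in>{..<d} - I0. Cst (g 1 i) + bin (g 2 i) (g 3 i))"
  have "ev0 (bin a b) = 0" for a b by (simp add: ev0_def)
  then have "ev0 e = c * (\<Prod>i\<in>{..<d} - I0. g 1 i)"
    unfolding e_def by (simp add: ev0_def)
  then have e0: "ev0 e \<noteq> 0" using c(1) g1 by (auto simp: I0_def)
  have sub: "I0 \<subseteq> {..<d}" by (auto simp: I0_def)
  have z: "Cst (g 1 i) + bin (g 2 i) (g 3 i) = bin (g 2 i) (g 3 i)" if "i \<in> I0" for i
    using g1[of i] that by (simp add: I0_def)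
  have "local_eq (rep (psi Ls)) q = Cst c * (\<Prod>i<d. Cst (g 1 i) + bin (g 2 i) (g 3 i))"
    unfolding local_eq_def M_def[symmetric] y_def[symmetric] c(2)
    by (simp only: sb.mult sb.Cst sb.prod loc)
  also have "(\<Prod>i<d. Cst (g 1 i) + bin (g 2 i) (g 3 i))
      = (\<Prod>i\<in>{..<d} - I0. Cst (g 1 i) + bin (g 2 i) (g 3 i)) * (\<Prod>i\<in>I0. Cst (g 1 i) + bin (g 2 i) (g 3 i))"
    by (rule prod.subset_diff[OF sub]) simp
  also have "(\<Prod>i\<in>I0. Cst (g 1 i) + bin (g 2 i) (g 3 i)) = bins ps"
    unfolding bps by (rule prod.cong[OF refl z])
  finally have eq: "local_eq (rep (psi Ls)) q = bins ps * e"
    unfolding e_def by (simp only: ac_simps)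
  have len2: "length ps \<ge> 2" using m cardI ps(3) by simp
  have nzp: "p \<noteq> (0, 0)" if "p \<in> set ps" for p using that nzI unfolding ps(1) by (metis imageE)
  have npp: "\<not> prop2 p r" if "p \<in> set ps" "r \<in> set ps" "p \<noteq> r" for p r
    using that npI unfolding ps(1) by (metis imageE)
  have "codim2 (emb (pderivative 1 (bins ps))) (emb (pderivative 2 (bins ps))) ((length ps - 1)\<^sup>2)"
    by (rule codim2_partials[OF nzp ps(2) npp len2])
  then have "has_codim (\<lambda>c h. emb (Cst c) * h) local_ring (tjurina_ideal (local_eq (rep (psi Ls)) q)) ((length ps - 1)\<^sup>2)"
    unfolding eq tjurina_ideal_unit[OF bins_homogeneous _ e0, of ps] codim2_def using len2
    by (subst tjurina_ideal_unit[OF bins_homogeneous _ e0]) auto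
  moreover have "lv.subspace (tjurina_ideal (local_eq (rep (psi Ls)) q))"
    unfolding eq by (subst tjurina_ideal_unit[OF bins_homogeneous _ e0]) (use len2 id2_subspace in auto)
  ultimately have "local_tjurina (rep (psi Ls)) q = (length ps - 1)\<^sup>2"
    unfolding local_tjurina_def by (intro lv.quot_dim_eqI)
  then show ?thesis using ps(3) cardI by simp
qed

lemma tjurina_arrangement:
  assumes X: "Ls \<in> X_space d" and d: "d \<ge> 2"
  shows "tjurina (rep (psi Ls)) = lat_tau (intersection_lattice Ls)"
proof -
  have L: "set Ls \<subseteq> PS 1" "card (set Ls) \<ge> 2" using X_spaceD[OF X] d by auto
  let ?T = "{q. \<exists>P\<in>set Ls. \<exists>Q\<in>set Ls. P \<noteq> Q \<and> q \<in> line P \<and> q \<in> line Q}"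
  have S: "singular_points (rep (psi Ls)) = ?T" by (rule singular_points_arrangement[OF X])
  have mp: "multiple_points (intersection_lattice Ls) = (\<lambda>q. {q}) ` ?T"
    unfolding multiple_points_eq[OF L] by blast
  have loc: "local_tjurina (rep (psi Ls)) q = (card {P \<in> set Ls. q \<in> line P} - 1)\<^sup>2" if q: "q \<in> ?T" for q
  proof (rule local_tjurina_arrangement[OF X])
    obtain P Q where PQ: "P \<in> set Ls" "Q \<in> set Ls" "P \<noteq> Q" "q \<in> line P" "q \<in> line Q" using q by blast
    show "q \<in> P2" using PQ line_sub_P2 by blast
    have "card {P, Q} \<le> card {P \<in> set Ls. q \<in> line P}" by (rule card_mono) (use PQ in auto)
    then show "2 \<le> card {P \<in> set Ls. q \<in> line P}" using PQ by simp
  qed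
  have "lat_tau (intersection_lattice Ls) = (\<Sum>q\<in>?T. (point_mult (intersection_lattice Ls) {q} - 1)\<^sup>2)"
    unfolding lat_tau_def mp by (subst sum.reindex) (auto simp: inj_on_def)
  also have "\<dots> = (\<Sum>q\<in>?T. local_tjurina (rep (psi Ls)) q)"
    by (rule sum.cong[OF refl]) (simp only: loc point_mult_eq[OF L(1)])
  finally show ?thesis unfolding tjurina_def S by simp
qed

lemma strata_tau:
  assumes L: "L \<in> lattices d" and d: "d \<ge> 2"
  shows "X_lat d L \<subseteq> X_tau d (tau_lat L)" "A_lat d L \<subseteq> A_tau d (tau_lat L)"
proof -
  have "psi Ls \<in> A_tau d (tau_lat L)" if "Ls \<in> X_lat d L" for Ls
    using that tjurina_arrangement[of Ls d] tau_lat_eq[OF L that] d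
    by (auto simp: A_tau_def A_space_def X_lat_def)
  then show "X_lat d L \<subseteq> X_tau d (tau_lat L)" "A_lat d L \<subseteq> A_tau d (tau_lat L)"
    by (auto simp: X_tau_def A_lat_def X_lat_def)
qed

section \<open>The product map is closed\<close>

lemma coef_mult_linform:
  fixes F :: "'v::finite mpol"
  shows "coef (F * linform a) m = (\<Sum>v\<in>UNIV. a v * (if coef m v \<noteq> 0 then coef F (m - term_of v 1) else 0))"
proof -
  have "coef (Var v * F) m = (if coef m v \<noteq> 0 then coef F (m - term_of v 1) else 0)" for v
  proof (cases "coef m v = 0")
    case True
    have "\<nexists>k. m = term_of v 1 + k"
    proof
      assume "\<exists>k. m = term_of v 1 + k"
      then obtain k where "m = term_of v 1 + k" ..
      then have "coef m v = 1 + coef k v" by (simp add: lookup_add)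
      then show False using True by simp
    qed
    then show ?thesis using True by (simp add: Var_def coef_term_mult_eq_0)
  next
    case False
    have "m = term_of v 1 + (m - term_of v 1)" using mdegree_minus_single(1)[OF False] by (simp add: add.commute)
    then have "coef (Var v * F) m = 1 * coef F (m - term_of v 1)" unfolding Var_def by (metis coef_term_mult)
    then show ?thesis using False by simp
  qed
  moreover have "F * linform a = (\<Sum>v\<in>UNIV. Cst (a v) * (Var v * F))"
    unfolding linform_def by (simp only: sum_distrib_left ac_simps)
  ultimately show ?thesis by (simp add: lookup_sum)
qed

lemma pfun_prod_linform:
  fixes n :: nat
  assumes "\<And>i v. i < n \<Longrightarrow> pfun X (\<lambda>s. l i s v)"
  shows "pfun X (\<lambda>s. coef (\<Prod>i<n. linform (l i s)) (m :: 'v::finite monom))"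
  using assms
proof (induction n arbitrary: m)
  case 0
  then show ?case by simp
next
  case (Suc n)
  have IH: "pfun X (\<lambda>s. coef (\<Prod>i<n. linform (l i s)) m)" for m by (rule Suc) (use Suc.prems in auto)
  have "pfun X (\<lambda>s. if coef m v \<noteq> 0 then coef (\<Prod>i<n. linform (l i s)) (m - term_of v 1) else 0)" for v
    using IH by (cases "coef m v = 0") simp_all
  then show ?case unfolding prod.lessThan_Suc coef_mult_linform
    using Suc.prems by (intro pfun_sum pfun_mult) auto
qed

lemma coeff_mult_top:
  fixes p q :: "complex poly"
  assumes "degree p \<le> m" "degree q \<le> n"
  shows "degree (p * q) \<le> m + n \<and> coeff (p * q) (m + n) = coeff p m * coeff q n"
proof
  show "degree (p * q) \<le> m + n" using degree_mult_le[of p q] assms by linarith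
  show "coeff (p * q) (m + n) = coeff p m * coeff q n"
  proof (cases "degree p = m \<and> degree q = n")
    case True
    then show ?thesis using coeff_mult_degree_sum[of p q] by simp
  next
    case False
    then have "degree (p * q) < m + n" using degree_mult_le[of p q] assms by linarith
    moreover have "coeff p m = 0 \<or> coeff q n = 0" using False assms by (metis coeff_eq_0 le_neq_implies_less)
    ultimately show ?thesis by (auto simp: coeff_eq_0)
  qed
qed

text \<open>The top coefficient in \<open>t\<close> of a monomial at \<open>e + t x\<close> is its
  value at \<open>x\<close>.\<close>

lemma monom_poly_top:
  fixes e x :: "'v \<Rightarrow> complex"
  shows "degree (monom_val (\<lambda>v. [:e v, x v:]) m) \<le> mdegree m
    \<and> coeff (monom_val (\<lambda>v. [:e v, x v:]) m) (mdegree m) = monom_val x m"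
proof -
  have pow: "degree ([:a, b:] ^ k) \<le> k \<and> coeff ([:a, b:] ^ k) k = b ^ k" for a b :: complex and k
  proof (induction k)
    case (Suc k)
    have "degree [:a, b:] \<le> 1" "coeff [:a, b:] 1 = b" by (simp_all add: One_nat_def)
    then show ?case
      using coeff_mult_top[of "[:a, b:]" 1 "[:a, b:] ^ k" k] Suc by (simp only: power_Suc plus_1_eq_Suc)
  qed simp
  have "degree (\<Prod>v\<in>A. [:e v, x v:] ^ coef m v) \<le> (\<Sum>v\<in>A. coef m v)
    \<and> coeff (\<Prod>v\<in>A. [:e v, x v:] ^ coef m v) (\<Sum>v\<in>A. coef m v) = (\<Prod>v\<in>A. x v ^ coef m v)"
    if "finite A" for A
    using that
  proof induction
    case (insert v A)
    then show ?case
      using coeff_mult_top[of "[:e v, x v:] ^ coef m v" "coef m v"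
          "\<Prod>v\<in>A. [:e v, x v:] ^ coef m v" "\<Sum>v\<in>A. coef m v"] pow[of "e v" "x v" "coef m v"] by simp
  qed simp
  then show ?thesis by (simp add: monom_val_def mdegree_def)
qed

text \<open>The restriction \<open>t \<mapsto> g(e + t x)\<close> of a form of degree
  \<open>d\<close>. The sum is over all monomials of degree \<open>d\<close>, so that the
  coefficients are linear in the coefficients of an arbitrary \<open>g\<close>.\<close>

definition restr :: "nat \<Rightarrow> ('v::finite \<Rightarrow> complex) \<Rightarrow> ('v \<Rightarrow> complex) \<Rightarrow> 'v mpol \<Rightarrow> complex poly" where
  "restr d e x g = (\<Sum>m\<in>Mon d. smult (coef g m) (monom_val (\<lambda>v. [:e v, x v:]) m))"

lemma poly_restr:
  assumes "homogeneous d g"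
  shows "poly (restr d e x g) t = ev (\<lambda>v. e v + t * x v) g"
proof -
  have "supp g \<subseteq> Mon d" using assms by (auto simp: homogeneous_def Mon_def)
  moreover have "poly (monom_val (\<lambda>v. [:e v, x v:]) m) t = monom_val (\<lambda>v. e v + t * x v) m" for m
    by (simp add: monom_val_def poly_prod)
  ultimately show ?thesis by (simp add: restr_def poly_sum ev_superset[of "Mon d"])
qed

lemma restr_coeff: "pfun Xc (\<lambda>g. coeff (restr d e x g) k)"
  unfolding restr_def coeff_sum coeff_smult by (intro pfun_sum pfun_mult pfun_coord pfun_const)

lemma restr_top:
  "degree (restr d e x g) \<le> d" "coeff (restr d e x g) d = (\<Sum>m\<in>Mon d. coef g m * monom_val x m)"
proof -
  have "degree (smult (coef g m) (monom_val (\<lambda>v. [:e v, x v:]) m)) \<le> d" if "m \<in> Mon d" for m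
    using monom_poly_top[of e x m] that degree_smult_le order_trans unfolding Mon_def by blast
  then show "degree (restr d e x g) \<le> d" unfolding restr_def by (intro degree_sum_le) auto
  have "coeff (monom_val (\<lambda>v. [:e v, x v:]) m) d = monom_val x m" if "m \<in> Mon d" for m
    using monom_poly_top[of e x m] that by (simp add: Mon_def)
  then show "coeff (restr d e x g) d = (\<Sum>m\<in>Mon d. coef g m * monom_val x m)"
    by (simp add: restr_def coeff_sum)
qed

text \<open>Coordinates on sequences of linear forms of which only the first \<open>d\<close>
  count.\<close>

definition Lc :: "nat \<Rightarrow> nat \<times> 3 \<Rightarrow> (nat \<Rightarrow> 3 \<Rightarrow> complex) \<Rightarrow> complex" where
  "Lc d = (\<lambda>iv l. if fst iv < d then l (fst iv) (snd iv) else 0)"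

lemma vclosed_Lc_cong:
  assumes "vclosed (Lc d) (\<lambda>_. True) \<Phi>" "\<Phi> l" "\<And>i. i < d \<Longrightarrow> l i = l' i"
  shows "\<Phi> l'"
proof (rule ccontr)
  assume "\<not> \<Phi> l'"
  then obtain D where D: "pfun (Lc d) D" "D l' \<noteq> 0" "\<forall>l. \<Phi> l \<longrightarrow> D l = 0"
    using assms(1) unfolding vclosed_def by blast
  from D(1) have "D l = D l'" by induction (use assms(3) in \<open>auto simp: Lc_def\<close>)
  then show False using D assms(2) by auto
qed

text \<open>The affine cone over the image under \<open>\<psi>\<close> of the closed set given by
  \<open>\<Phi>\<close>.\<close>

definition split_cone :: "nat \<Rightarrow> ((nat \<Rightarrow> 3 \<Rightarrow> complex) \<Rightarrow> bool) \<Rightarrow> S \<Rightarrow> bool" where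
  "split_cone d \<Phi> g \<longleftrightarrow> (\<exists>l c. (\<forall>i<d. \<exists>v. l i v \<noteq> 0) \<and> \<Phi> l \<and> c \<noteq> 0 \<and> g = Cst c * (\<Prod>i<d. linform (l i)))"

lemma psi_image_split_cone:
  assumes cong: "\<And>l l'. \<Phi> l \<Longrightarrow> (\<And>i. i < d \<Longrightarrow> l i = l' i) \<Longrightarrow> \<Phi> l'"
    and scale: "\<And>l c. \<Phi> l \<Longrightarrow> (\<And>i. i < d \<Longrightarrow> c i \<noteq> 0) \<Longrightarrow> \<Phi> (\<lambda>i v. c i * l i v)"
  shows "psi ` {Ls \<in> tuples d. \<Phi> (\<lambda>i. lf (Ls ! i))} = {P \<in> PS d. split_cone d \<Phi> (rep P)}"
proof (intro equalityI subsetI)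
  fix P assume "P \<in> psi ` {Ls \<in> tuples d. \<Phi> (\<lambda>i. lf (Ls ! i))}"
  then obtain Ls where Ls: "Ls \<in> tuples d" "\<Phi> (\<lambda>i. lf (Ls ! i))" "P = psi Ls" by blast
  obtain c where c: "c \<noteq> 0" "rep (psi Ls) = Cst c * (\<Prod>i<d. linform (lf (Ls ! i)))"
    by (rule rep_psi[OF Ls(1)])
  have "\<exists>v. lf (Ls ! i) v \<noteq> 0" if "i < d" for i
    using Ls(1) that by (intro lf_nonzero) (auto simp: tuples_def)
  then have "split_cone d \<Phi> (rep P)"
    unfolding split_cone_def using Ls c
    by (intro exI[of _ "\<lambda>i. lf (Ls ! i)"] exI[of _ c]) simp
  then show "P \<in> {P \<in> PS d. split_cone d \<Phi> (rep P)}" using psi_PS[OF Ls(1)] Ls(3) by simp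
next
  fix P assume "P \<in> {P \<in> PS d. split_cone d \<Phi> (rep P)}"
  then obtain l c where P: "P \<in> PS d" and l: "\<forall>i<d. \<exists>v. l i v \<noteq> 0" "\<Phi> l" "c \<noteq> 0"
    "rep P = Cst c * (\<Prod>i<d. linform (l i))" unfolding split_cone_def by blast
  define Ls where "Ls = map (\<lambda>i. pl (l i)) [0..<d]"
  have Lsi: "Ls ! i = pl (l i)" if "i < d" for i using that by (simp add: Ls_def)
  have tup: "Ls \<in> tuples d" using l(1) pl_PS by (auto simp: Ls_def tuples_def)
  have "Ls = map pclass (map (\<lambda>i. linform (l i)) [0..<d])" by (simp add: Ls_def pl_def)
  then have "psi Ls = pclass (prod_list (map (\<lambda>i. linform (l i)) [0..<d]))"
    by (simp only: psi_pclass)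
  also have "prod_list (map (\<lambda>i. linform (l i)) [0..<d]) = (\<Prod>i<d. linform (l i))"
    by (simp add: prod.list_conv_set_nth atLeast0LessThan)
  also have "pclass (\<Prod>i<d. linform (l i)) = P"
    using PS_rep(3)[OF P] l(3,4) by (metis pclass_scale)
  finally have psi: "psi Ls = P" .
  have "\<forall>i. \<exists>c. i < d \<longrightarrow> c \<noteq> 0 \<and> lf (pl (l i)) = (\<lambda>v. c * l i v)" using l(1) lf_pl by metis
  from choice[OF this] obtain b where b: "\<And>i. i < d \<Longrightarrow> b i \<noteq> 0"
    "\<And>i. i < d \<Longrightarrow> lf (pl (l i)) = (\<lambda>v. b i * l i v)" by blast
  have "\<Phi> (\<lambda>i v. b i * l i v)" by (rule scale[OF l(2) b(1)])
  then have "\<Phi> (\<lambda>i. lf (Ls ! i))" by (rule cong) (simp add: Lsi b(2))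
  then show "P \<in> psi ` {Ls \<in> tuples d. \<Phi> (\<lambda>i. lf (Ls ! i))}" using tup psi by blast
qed

text \<open>Choose a point \<open>x\<close> with \<open>f0(x) \<noteq> 0\<close> and third
  coordinate \<open>x\<^sub>3 \<noteq> 0\<close>. If \<open>g(x) \<noteq> 0\<close> then no line of
  a factorization of \<open>g\<close> contains \<open>x\<close>, and every linear form can be scaled
  to the value \<open>-1\<close> at \<open>x\<close>. Such a form \<open>l\<close> has only two free
  coefficients \<open>a, b\<close>, those of the first two variables, and \<open>l(e\<^sub>1 + a x)
  = a - a = 0\<close> shows that \<open>a\<close> is a root of \<open>g(e\<^sub>1 + t x)\<close>; in
  the same way \<open>b\<close> is a root of \<open>g(e\<^sub>2 + t x)\<close>. Both polynomials
  have the leading coefficient \<open>g(x)\<close>, so \<open>eliminate_roots\<close> applies to the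
  closed condition that the linear forms with these coefficients satisfy \<open>\<Phi>\<close> and
  have the product \<open>g\<close> up to the scalar \<open>(-1)\<^sup>d g(x)\<close>.\<close>

lemma split_cone_closed_at:
  assumes \<Phi>: "vclosed (Lc d) (\<lambda>_. True) \<Phi>"
    and scale: "\<And>l c. \<Phi> l \<Longrightarrow> (\<And>i. i < d \<Longrightarrow> c i \<noteq> 0) \<Longrightarrow> \<Phi> (\<lambda>i v. c i * l i v)"
    and f0: "f0 \<in> S_deg d" "f0 \<noteq> 0" "\<not> split_cone d \<Phi> f0"
  shows "\<exists>D. pfun Xc D \<and> D f0 \<noteq> 0 \<and> (\<forall>g. split_cone d \<Phi> g \<longrightarrow> D g = 0)"
proof -
  have "Var 3 \<noteq> (0 :: S)" by (simp add: Var_def) (metis lookup_single_eq lookup_zero zero_neq_one)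
  then have "f0 * Var 3 \<noteq> 0" using f0(2) by simp
  then obtain x where x: "ev x (f0 * Var 3) \<noteq> 0" using mpol_eq_0I by blast
  then have x3: "x 3 \<noteq> 0" and fx: "ev x f0 \<noteq> 0" by simp_all
  define e where "e j = (\<lambda>v::3. if (j < d \<and> v = 1) \<or> (\<not> j < d \<and> v = 2) then 1 else 0 :: complex)" for j :: nat
  \<comment> \<open>The value \<open>g(x)\<close> if \<open>g\<close> has degree \<open>d\<close>,
    but polynomial in the coefficients of all \<open>g\<close>.\<close>
  define G where "G g = (\<Sum>m\<in>Mon d. coef g m * monom_val x m)" for g :: S
  have Gev: "G g = ev x g" if "homogeneous d g" for g
    using that by (subst ev_superset[OF finite_Mon[of d]]) (auto simp: G_def homogeneous_def Mon_def)
  have Gp: "pfun Xc G" unfolding G_def by (intro pfun_sum pfun_mult pfun_coord pfun_const)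
  \<comment> \<open>The linear form with the coefficients \<open>a, b\<close> of the first two
    variables and the value \<open>-1\<close> at \<open>x\<close>.\<close>
  define lab where "lab a b = (\<lambda>v::3. if v = 1 then a else if v = 2 then b else (-1 / x 3) * (1 + a * x 1 + b * x 2))" for a b
  define l where "l g i = lab (g i) (g (d + i))" for g :: "nat \<Rightarrow> complex" and i
  define C where "C = (\<lambda>sg. \<Phi> (l (snd sg)) \<and>
     (\<forall>m\<in>UNIV. coef (fst sg) m - (-1) ^ d * G (fst sg) * coef (\<Prod>i<d. linform (l (snd sg) i)) m = 0))"
  have lp: "pfun (Zc Xc (2 * d)) (\<lambda>sg. l (snd sg) i v)" if "i < d" for i v
  proof -
    have sndp: "pfun (Zc Xc (2 * d)) (\<lambda>sg. snd sg k)" if "k < 2 * d" for k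
      using pfun_coord[of "Zc Xc (2 * d)" "Inr k"] that by (simp add: Zc_def)
    have g: "pfun (Zc Xc (2 * d)) (\<lambda>sg. snd sg i)" "pfun (Zc Xc (2 * d)) (\<lambda>sg. snd sg (d + i))"
      using sndp[of i] sndp[of "d + i"] that by simp_all
    have "pfun (Zc Xc (2 * d)) (\<lambda>sg. (-1 / x 3) * (1 + snd sg i * x 1 + snd sg (d + i) * x 2))"
      using g by (intro pfun_mult pfun_add pfun_const)
    then show ?thesis using g by (cases "v = 1"; cases "v = 2") (simp_all add: l_def lab_def)
  qed
  have fstp: "pfun (Zc Xc (2 * d)) (\<lambda>sg. coef (fst sg) m)" for m
    using pfun_coord[of "Zc Xc (2 * d)" "Inl m"] by (simp add: Zc_def)
  have C: "vclosed (Zc Xc (2 * d)) (\<lambda>sg. G (fst sg) \<noteq> 0) C"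
    unfolding C_def
  proof (rule vclosed_conj)
    show "vclosed (Zc Xc (2 * d)) (\<lambda>sg. G (fst sg) \<noteq> 0) (\<lambda>sg. \<Phi> (l (snd sg)))"
    proof (rule vclosed_subst[OF \<Phi>])
      show "pfun (Zc Xc (2 * d)) (\<lambda>sg. Lc d i (l (snd sg)))" for i
        using lp by (cases "fst i < d") (simp_all add: Lc_def)
    qed simp
    show "vclosed (Zc Xc (2 * d)) (\<lambda>sg. G (fst sg) \<noteq> 0)
       (\<lambda>sg. \<forall>m\<in>UNIV. coef (fst sg) m - (-1) ^ d * G (fst sg) * coef (\<Prod>i<d. linform (l (snd sg) i)) m = 0)"
      by (intro vclosed_All vclosed_eq pfun_diff pfun_mult pfun_const fstp pfun_subst[OF Gp]
          pfun_prod_linform lp)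
  qed
  define p where "p k g = restr d (e k) x g" for k g
  have "vclosed Xc (\<lambda>g. G g \<noteq> 0) (\<lambda>g. \<exists>\<gamma>. (\<forall>k<2 * d. poly (p k g) (\<gamma> k) = 0) \<and> C (g, \<gamma>))"
    by (rule eliminate_roots[where n = d]) (use C in \<open>auto simp: p_def restr_coeff restr_top G_def\<close>)
  moreover have "\<not> (\<exists>\<gamma>. (\<forall>k<2 * d. poly (p k f0) (\<gamma> k) = 0) \<and> C (f0, \<gamma>))"
  proof
    assume "\<exists>\<gamma>. (\<forall>k<2 * d. poly (p k f0) (\<gamma> k) = 0) \<and> C (f0, \<gamma>)"
    then obtain \<gamma> where \<gamma>: "\<Phi> (l \<gamma>)" "\<And>m. coef f0 m = (-1) ^ d * G f0 * coef (\<Prod>i<d. linform (l \<gamma> i)) m"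
      by (auto simp: C_def)
    have "f0 = Cst ((-1) ^ d * G f0) * (\<Prod>i<d. linform (l \<gamma> i))"
      by (rule poly_mapping_eqI) (simp add: \<gamma>(2))
    moreover have "(-1) ^ d * G f0 \<noteq> 0" using fx Gev[of f0] f0(1) by (simp add: S_deg_def)
    moreover have "\<exists>v. l \<gamma> i v \<noteq> 0" for i
    proof (rule ccontr)
      assume "\<nexists>v. l \<gamma> i v \<noteq> 0"
      then have "l \<gamma> i 1 = 0" "l \<gamma> i 2 = 0" "l \<gamma> i 3 = 0" by blast+
      then show False using x3 by (simp add: l_def lab_def)
    qed
    ultimately have "split_cone d \<Phi> f0" unfolding split_cone_def using \<gamma>(1) by blast
    then show False using f0(3) by blast
  qed
  moreover have G0: "G f0 \<noteq> 0" using fx Gev[of f0] f0(1) by (simp add: S_deg_def)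
  ultimately obtain D where D: "pfun Xc D" "D f0 \<noteq> 0"
    "\<forall>g. (\<exists>\<gamma>. (\<forall>k<2 * d. poly (p k g) (\<gamma> k) = 0) \<and> C (g, \<gamma>)) \<longrightarrow> D g = 0"
    unfolding vclosed_def by blast
  \<comment> \<open>The factor \<open>G\<close> takes care of the forms that vanish at
    \<open>x\<close>, about which the elimination says nothing.\<close>
  have "D g * G g = 0" if g: "split_cone d \<Phi> g" for g
  proof (cases "G g = 0")
    case False
    obtain a c where a: "\<forall>i<d. \<exists>v. a i v \<noteq> 0" "\<Phi> a" "c \<noteq> 0" "g = Cst c * (\<Prod>i<d. linform (a i))"
      using g unfolding split_cone_def by blast
    have "homogeneous d (\<Prod>i<d. linform (a i))" for d
    proof (induction d)
      case (Suc d)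
      show ?case unfolding prod.lessThan_Suc
        unfolding Suc_eq_plus1 by (rule hom_mult[OF Suc hom_linform])
    qed (simp add: hom_1)
    then have hom: "homogeneous d g" unfolding a(4) by (intro hom_Cst_mult)
    define ax where "ax i = (\<Sum>v\<in>UNIV. a i v * x v)" for i
    have Gg: "G g = c * (\<Prod>i<d. ax i)" unfolding Gev[OF hom] by (simp add: a(4) ax_def)
    then have ax: "ax i \<noteq> 0" if "i < d" for i using False that by auto
    define a' where "a' i = (\<lambda>v. (-1 / ax i) * a i v)" for i
    define \<gamma> where "\<gamma> k = (if k < d then a' k 1 else a' (k - d) 2)" for k
    have la: "l \<gamma> i = a' i" if i: "i < d" for i
    proof
      fix v
      have s: "a' i 1 * x 1 + a' i 2 * x 2 + a' i 3 * x 3 = -1"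
      proof -
        have axs: "ax i = a i 1 * x 1 + a i 2 * x 2 + a i 3 * x 3" by (simp add: ax_def sum_3)
        have "a' i 1 * x 1 + a' i 2 * x 2 + a' i 3 * x 3 = (-1 / ax i) * (a i 1 * x 1 + a i 2 * x 2 + a i 3 * x 3)"
          by (simp only: a'_def distrib_left mult.assoc)
        also have "\<dots> = -1" unfolding axs[symmetric] using ax[OF i] by simp
        finally show ?thesis .
      qed
      have "a' i 3 = (-1 / x 3) * (1 + a' i 1 * x 1 + a' i 2 * x 2)"
      proof -
        have "a' i 3 * x 3 = - (1 + a' i 1 * x 1 + a' i 2 * x 2)" using s by algebra
        then show ?thesis using x3 by (simp add: field_simps)
      qed
      then show "l \<gamma> i v = a' i v" using i exhaust_3[of v] by (auto simp: l_def lab_def \<gamma>_def)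
    qed
    have "\<Phi> a'" unfolding a'_def by (rule scale[OF a(2)]) (use ax in auto)
    then have "\<Phi> (l \<gamma>)" by (rule vclosed_Lc_cong[OF \<Phi>]) (simp add: la)
    moreover have "(\<Prod>i<d. linform (l \<gamma> i)) = Cst (\<Prod>i<d. -1 / ax i) * (\<Prod>i<d. linform (a i))"
    proof -
      have cp: "Cst (\<Prod>i<k. h i) = (\<Prod>i<k. Cst (h i))" for h :: "nat \<Rightarrow> complex" and k
        by (induction k) (simp_all add: Cst_mult)
      have "(\<Prod>i<d. linform (l \<gamma> i)) = (\<Prod>i<d. Cst (-1 / ax i) * linform (a i))"
        by (rule prod.cong[OF refl]) (simp only: la lessThan_iff a'_def linform_scale)
      then show ?thesis by (simp only: prod.distrib cp)
    qed
    moreover have "(-1) ^ d * G g * (\<Prod>i<d. -1 / ax i) = c"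
    proof -
      have "(\<Prod>i<d. ax i) * (\<Prod>i<d. -1 / ax i) = (\<Prod>i<d. -1)"
        unfolding prod.distrib[symmetric] by (rule prod.cong) (use ax in auto)
      then have E: "(\<Prod>i<d. ax i) * (\<Prod>i<d. -1 / ax i) = (-1) ^ d" by simp
      have pm: "(-1 :: complex) ^ d * (-1) ^ d = 1" by (simp add: power_mult_distrib[symmetric])
      have "(-1) ^ d * (c * A) * B = c * ((-1) ^ d * (A * B))" for A B by (simp only: ac_simps)
      then show ?thesis unfolding Gg by (simp only: E pm mult_1_right)
    qed
    ultimately have "C (g, \<gamma>)" unfolding C_def
      by (auto simp: a(4) mult.assoc[symmetric])
    moreover have "poly (p k g) (\<gamma> k) = 0" if k: "k < 2 * d" for k
    proof -
      define i where "i = (if k < d then k else k - d)"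
      have i: "i < d" using k by (auto simp: i_def)
      have "(\<Sum>v\<in>UNIV. a i v * (e k v + \<gamma> k * x v)) = (\<Sum>v\<in>UNIV. a i v * e k v) + \<gamma> k * ax i"
        by (simp add: ax_def sum_distrib_left sum.distrib algebra_simps)
      also have "\<dots> = 0" using ax[OF i] by (auto simp: \<gamma>_def a'_def e_def i_def sum_3)
      finally have "(\<Prod>i<d. \<Sum>v\<in>UNIV. a i v * (e k v + \<gamma> k * x v)) = 0" using i by auto
      then show ?thesis unfolding p_def poly_restr[OF hom] by (simp add: a(4))
    qed
    ultimately show ?thesis using D(3) by auto
  qed simp
  then show ?thesis using D(1,2) G0 Gp by (intro exI[of _ "\<lambda>g. D g * G g"]) auto
qed

text \<open>By \<open>split_cone_closed_at\<close> and \<open>closedin_zariski_forms\<close>. The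
  scaling hypothesis says that \<open>\<Phi>\<close> is a condition on classes of linear
  forms.\<close>

lemma psi_closed:
  assumes \<Phi>: "vclosed (Lc d) (\<lambda>_. True) \<Phi>"
    and scale: "\<And>l c. \<Phi> l \<Longrightarrow> (\<And>i. i < d \<Longrightarrow> c i \<noteq> 0) \<Longrightarrow> \<Phi> (\<lambda>i v. c i * l i v)"
  shows "closedin (zariski_forms d) (psi ` {Ls \<in> tuples d. \<Phi> (\<lambda>i. lf (Ls ! i))})"
proof -
  have "psi ` {Ls \<in> tuples d. \<Phi> (\<lambda>i. lf (Ls ! i))} = {P \<in> PS d. split_cone d \<Phi> (rep P)}"
    by (rule psi_image_split_cone) (use vclosed_Lc_cong[OF \<Phi>] scale in blast)+
  moreover have "closedin (zariski_forms d) {P \<in> PS d. split_cone d \<Phi> (rep P)}"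
  proof (rule closedin_zariski_forms)
    fix f c assume "split_cone d \<Phi> f" "c \<noteq> (0::complex)"
    then obtain l b where "\<forall>i<d. \<exists>v. l i v \<noteq> 0" "\<Phi> l" "b \<noteq> 0" "f = Cst b * (\<Prod>i<d. linform (l i))"
      unfolding split_cone_def by blast
    moreover from this have "Cst c * f = Cst (c * b) * (\<Prod>i<d. linform (l i))"
      by (simp only: Cst_mult mult.assoc)
    moreover have "c * b \<noteq> 0" using calculation(3) \<open>c \<noteq> 0\<close> by simp
    ultimately show "split_cone d \<Phi> (Cst c * f)" unfolding split_cone_def by blast
  qed (use split_cone_closed_at[OF \<Phi> scale] in blast)
  ultimately show ?thesis by simp
qed

section \<open>Recovering the lines from their product\<close>

text \<open>The substitution that solves \<open>l = 0\<close> for a variable is a ring homomorphism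
  to a domain, and its kernel consists of the multiples of \<open>l\<close>.\<close>

lemma linform_prime:
  fixes F G :: S
  assumes "\<exists>v. a v \<noteq> 0" and d: "linform a dvd F * G"
  shows "linform a dvd F \<or> linform a dvd G"
proof -
  obtain v0 where a: "a v0 \<noteq> 0" using assms(1) by blast
  define y where "y = (\<lambda>v. if v = v0 then Var v0 - Cst (1 / a v0) * linform a else Var v)"
  have plane: "(\<Sum>v\<in>UNIV. a v * ev x (y v)) = 0" for x
  proof -
    have "(\<Sum>v\<in>UNIV. a v * ev x (y v)) = a v0 * ev x (y v0) + (\<Sum>v\<in>UNIV-{v0}. a v * ev x (y v))"
      by (subst sum.remove[of _ v0]) auto
    also have "\<dots> = a v0 * (x v0 - 1 / a v0 * (\<Sum>v\<in>UNIV. a v * x v)) + (\<Sum>v\<in>UNIV-{v0}. a v * x v)"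
      by (simp add: y_def)
    also have "(\<Sum>v\<in>UNIV. a v * x v) = a v0 * x v0 + (\<Sum>v\<in>UNIV-{v0}. a v * x v)"
      by (subst sum.remove[of _ v0]) auto
    also have "a v0 * (x v0 - 1 / a v0 * (a v0 * x v0 + (\<Sum>v\<in>UNIV-{v0}. a v * x v))) +
       (\<Sum>v\<in>UNIV-{v0}. a v * x v) = 0" using a by (simp add: field_simps)
    finally show ?thesis .
  qed
  have on: "ev x (y v) = x v" if "(\<Sum>v\<in>UNIV. a v * x v) = 0" for x v
    using that by (simp add: y_def)
  have iff: "linform a dvd H \<longleftrightarrow> mpeval Cst y H = 0" for H :: S
    unfolding linform_dvd_iff[of a v0, OF a]
  proof
    assume "\<forall>x. (\<Sum>v\<in>UNIV. a v * x v) = 0 \<longrightarrow> ev x H = 0"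
    then show "mpeval Cst y H = 0" by (intro mpol_eq_0I) (simp add: ev_subst plane)
  next
    assume z: "mpeval Cst y H = 0"
    show "\<forall>x. (\<Sum>v\<in>UNIV. a v * x v) = 0 \<longrightarrow> ev x H = 0"
    proof (intro allI impI)
      fix x assume "(\<Sum>v\<in>UNIV. a v * x v) = 0"
      then have "(\<lambda>v. ev x (y v)) = x" using on by blast
      then show "ev x H = 0" using ev_subst[of x y H] z by simp
    qed
  qed
  show ?thesis using d unfolding iff by simp
qed

lemma linform_dvd_Cst:
  fixes a :: "3 \<Rightarrow> complex"
  assumes "linform a dvd Cst c" shows "c = 0"
proof -
  from assms obtain k where "Cst c = linform a * k" by (elim dvdE)
  then have "ev (\<lambda>_ :: 3. 0) (Cst c) = ev (\<lambda>_. 0) (linform a * k)" by (simp only:)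
  then show ?thesis by simp
qed

lemma linform_dvd_prod:
  fixes F :: "nat \<Rightarrow> S"
  assumes a: "\<exists>v. a v \<noteq> 0" and d: "linform a dvd (\<Prod>i<n. F i)"
  shows "\<exists>i<n. linform a dvd F i"
  using d
proof (induction n)
  case 0
  then show ?case using linform_dvd_Cst[of a 1] by simp
next
  case (Suc n)
  then have "linform a dvd (\<Prod>i<n. F i) \<or> linform a dvd F n"
    using linform_prime[OF a] by simp
  then show ?case using Suc.IH less_Suc_eq by auto
qed

text \<open>Linear forms are prime, so the lines of an arrangement are the linear factors of its
  equation. In particular the equation determines the set of lines.\<close>

lemma mem_set_iff_dvd:
  assumes Ls: "Ls \<in> tuples d" and P: "P \<in> PS 1"
  shows "P \<in> set Ls \<longleftrightarrow> rep P dvd rep (psi Ls)"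
proof -
  have len: "length Ls = d" and PS: "\<And>i. i < d \<Longrightarrow> Ls ! i \<in> PS 1" using Ls by (auto simp: tuples_def)
  obtain c where c: "c \<noteq> 0" "rep (psi Ls) = Cst c * (\<Prod>i<d. linform (lf (Ls ! i)))"
    by (rule rep_psi[OF Ls])
  note v0 = lf_nonzero[OF P]
  show ?thesis
  proof
    assume "P \<in> set Ls"
    then obtain i where "i < d" "P = Ls ! i" using len by (metis in_set_conv_nth)
    then have "rep P dvd (\<Prod>i<d. linform (lf (Ls ! i)))"
      using dvd_prodI[of "{..<d}" i "\<lambda>i. linform (lf (Ls ! i))"] unfolding rep_linform[OF P] by simp
    then show "rep P dvd rep (psi Ls)" unfolding c(2) by (rule dvd_mult)
  next
    assume "rep P dvd rep (psi Ls)"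
    then have "linform (lf P) dvd Cst c * (\<Prod>i<d. linform (lf (Ls ! i)))"
      unfolding c(2) rep_linform[OF P] .
    then have "linform (lf P) dvd (\<Prod>i<d. linform (lf (Ls ! i)))"
      using linform_prime[OF v0] linform_dvd_Cst c(1) by blast
    then obtain i where i: "i < d" "linform (lf P) dvd linform (lf (Ls ! i))"
      using linform_dvd_prod[OF v0] by blast
    have "line P \<subseteq> line (Ls ! i)"
    proof
      fix q assume "q \<in> line P"
      then have q: "q \<in> P2" "dot3 (lf P) (($) (rep q)) = 0" using line_iff[OF P] by auto
      obtain k where "linform (lf (Ls ! i)) = linform (lf P) * k" using i(2) by (elim dvdE)
      then have "ev (($) (rep q)) (linform (lf (Ls ! i))) = ev (($) (rep q)) (linform (lf P) * k)" by simp
      then have "dot3 (lf (Ls ! i)) (($) (rep q)) = 0" using q(2) by (simp add: dot3_def sum_3)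
      then show "q \<in> line (Ls ! i)" using line_iff[OF PS[OF i(1)]] q(1) by simp
    qed
    then have "P = Ls ! i" by (rule line_subset_imp_eq[OF P PS[OF i(1)]])
    then show "P \<in> set Ls" using i(1) len by simp
  qed
qed

lemma psi_eq_imp_set_eq:
  assumes "Ls \<in> tuples d" "Ms \<in> tuples d" "psi Ls = psi Ms"
  shows "set Ls = set Ms"
proof -
  have "set Ls \<subseteq> PS 1" "set Ms \<subseteq> PS 1" using assms by (auto simp: tuples_def)
  then show ?thesis using mem_set_iff_dvd[OF assms(1)] mem_set_iff_dvd[OF assms(2)] assms(3) by auto
qed

section \<open>Strata as differences of closed sets\<close>

definition cube :: "nat \<Rightarrow> (nat \<times> nat \<times> nat) set" where
  "cube d = {..<d} \<times> {..<d} \<times> {..<d}"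

lemma finite_cube [simp]: "finite (cube d)" by (simp add: cube_def)

lemma dep_cube: "length Ls = d \<Longrightarrow> dep Ls \<subseteq> cube d" by (auto simp: dep_def cube_def)

lemma card_dep:
  assumes "distinct Ls"
  shows "card (dep Ls) = card {(P, Q, R). P \<in> set Ls \<and> Q \<in> set Ls \<and> R \<in> set Ls \<and> det3 (lf P) (lf Q) (lf R) = 0}"
proof -
  let ?g = "\<lambda>(i, j, k). (Ls ! i, Ls ! j, Ls ! k)"
  have inj: "inj_on ?g (dep Ls)"
    using assms by (auto simp: inj_on_def dep_def nth_eq_iff_index_eq)
  have "?g ` dep Ls = {(P, Q, R). P \<in> set Ls \<and> Q \<in> set Ls \<and> R \<in> set Ls \<and> det3 (lf P) (lf Q) (lf R) = 0}"
  proof (intro equalityI subsetI)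
    fix x assume "x \<in> {(P, Q, R). P \<in> set Ls \<and> Q \<in> set Ls \<and> R \<in> set Ls \<and> det3 (lf P) (lf Q) (lf R) = 0}"
    then obtain P Q R where x: "x = (P, Q, R)" "P \<in> set Ls" "Q \<in> set Ls" "R \<in> set Ls" "det3 (lf P) (lf Q) (lf R) = 0"
      by auto
    then obtain i j k where "i < length Ls" "P = Ls ! i" "j < length Ls" "Q = Ls ! j" "k < length Ls" "R = Ls ! k"
      by (metis in_set_conv_nth)
    then show "x \<in> ?g ` dep Ls" using x by (intro image_eqI[of _ _ "(i, j, k)"]) (auto simp: dep_def)
  qed (auto simp: dep_def)
  then show ?thesis using card_image[OF inj] by simp
qed

definition concurrent :: "(nat \<times> nat \<times> nat) set \<Rightarrow> (nat \<Rightarrow> 3 \<Rightarrow> complex) \<Rightarrow> bool" where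
  "concurrent T l \<longleftrightarrow> (\<forall>t\<in>T. det3 (l (fst t)) (l (fst (snd t))) (l (snd (snd t))) = 0)"

text \<open>The set to be taken away: tuples with a repeated line or with more than \<open>n\<close>
  dependent triples. Counting the triples makes the condition invariant under permutations of the
  lines, unlike the condition that a triple outside of a given set is dependent.\<close>

definition degenerate :: "nat \<Rightarrow> nat \<Rightarrow> (nat \<Rightarrow> 3 \<Rightarrow> complex) \<Rightarrow> bool" where
  "degenerate d n l \<longleftrightarrow>
     (\<exists>p\<in>{p \<in> {..<d} \<times> {..<d}. fst p \<noteq> snd p}. \<forall>v\<in>UNIV. crossp (l (fst p)) (l (snd p)) v = 0) \<or>
     (\<exists>T\<in>{T \<in> Pow (cube d). n < card T}. concurrent T l)"

lemma concurrent_vclosed: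
  assumes "T \<subseteq> cube d" shows "vclosed (Lc d) (\<lambda>_. True) (concurrent T)"
proof -
  have c: "pfun (Lc d) (\<lambda>l. l i v)" if "i < d" for i v
    using pfun_coord[of "Lc d" "(i, v)"] that by (simp add: Lc_def)
  have "vclosed (Lc d) (\<lambda>_. True) (\<lambda>l. \<forall>t\<in>T. det3 (l (fst t)) (l (fst (snd t))) (l (snd (snd t))) = 0)"
  proof (intro vclosed_All vclosed_eq)
    fix t assume "t \<in> T"
    then have "fst t < d" "fst (snd t) < d" "snd (snd t) < d" using assms by (auto simp: cube_def)
    then show "pfun (Lc d) (\<lambda>l. det3 (l (fst t)) (l (fst (snd t))) (l (snd (snd t))))"
      unfolding det3_def by (intro pfun_add pfun_mult pfun_diff c)
  qed
  then show ?thesis by (simp add: concurrent_def[abs_def])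
qed

lemma degenerate_vclosed: "vclosed (Lc d) (\<lambda>_. True) (degenerate d n)"
proof -
  have c: "pfun (Lc d) (\<lambda>l. l i v)" if "i < d" for i v
    using pfun_coord[of "Lc d" "(i, v)"] that by (simp add: Lc_def)
  have cr: "pfun (Lc d) (\<lambda>l. crossp (l i) (l j) v)" if "i < d" "j < d" for i j v
    using exhaust_3[of v] that by (auto intro!: pfun_diff pfun_mult c)
  have "vclosed (Lc d) (\<lambda>_. True) (\<lambda>l. (\<exists>p\<in>{p \<in> {..<d} \<times> {..<d}. fst p \<noteq> snd p}.
        \<forall>v\<in>UNIV. crossp (l (fst p)) (l (snd p)) v = 0) \<or> (\<exists>T\<in>{T \<in> Pow (cube d). n < card T}. concurrent T l))"
    by (intro vclosed_disj vclosed_Ex vclosed_All vclosed_eq cr concurrent_vclosed) auto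
  then show ?thesis by (simp add: degenerate_def[abs_def])
qed

lemma concurrent_scale:
  assumes "T \<subseteq> cube d" "concurrent T l" shows "concurrent T (\<lambda>i v. c i * l i v)"
  using assms(2) by (simp add: concurrent_def det3_scale)

lemma degenerate_scale:
  assumes "degenerate d n l" shows "degenerate d n (\<lambda>i v. c i * l i v)"
proof -
  have cr: "crossp (\<lambda>v. x * a v) (\<lambda>v. y * b v) v = x * y * crossp a b v" for x y a b v
    using exhaust_3[of v] by (auto simp: algebra_simps)
  have co: "concurrent T (\<lambda>i v. c i * l i v)" if "concurrent T l" for T
    using that by (simp add: concurrent_def det3_scale)
  show ?thesis using assms unfolding degenerate_def
  proof (elim disjE)
    assume "\<exists>p\<in>{p \<in> {..<d} \<times> {..<d}. fst p \<noteq> snd p}. \<forall>v\<in>UNIV. crossp (l (fst p)) (l (snd p)) v = 0"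
    then show "(\<exists>p\<in>{p \<in> {..<d} \<times> {..<d}. fst p \<noteq> snd p}.
        \<forall>v\<in>UNIV. crossp (\<lambda>v. c (fst p) * l (fst p) v) (\<lambda>v. c (snd p) * l (snd p) v) v = 0) \<or>
        (\<exists>T\<in>{T \<in> Pow (cube d). n < card T}. concurrent T (\<lambda>i v. c i * l i v))"
      by (intro disjI1) (elim bexE, rule bexI, simp_all add: cr)
  next
    assume "\<exists>T\<in>{T \<in> Pow (cube d). n < card T}. concurrent T l"
    then show "(\<exists>p\<in>{p \<in> {..<d} \<times> {..<d}. fst p \<noteq> snd p}.
        \<forall>v\<in>UNIV. crossp (\<lambda>v. c (fst p) * l (fst p) v) (\<lambda>v. c (snd p) * l (snd p) v) v = 0) \<or>
        (\<exists>T\<in>{T \<in> Pow (cube d). n < card T}. concurrent T (\<lambda>i v. c i * l i v))"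
      using co by blast
  qed
qed

section \<open>The Zariski topology on tuples\<close>

text \<open>The degree of a monomial in the variables of the \<open>i\<close>-th block.\<close>

definition wt :: "nat \<Rightarrow> (nat \<times> 'w) monom \<Rightarrow> nat" where
  "wt i m = (\<Sum>v\<in>{v \<in> supp m. fst v = i}. coef m v)"

lemma wt_superset: "finite A \<Longrightarrow> supp m \<subseteq> A \<Longrightarrow> wt i m = (\<Sum>v\<in>{v \<in> A. fst v = i}. coef m v)"
  unfolding wt_def by (rule sum.mono_neutral_left) (auto simp: in_keys_iff)

lemma wt_add: "wt i (m + n) = wt i m + wt i n"
proof -
  let ?A = "supp m \<union> supp n"
  have "supp (m + n) \<subseteq> ?A" by (rule Poly_Mapping.keys_add)
  then show ?thesis using wt_superset[of ?A "m + n"] wt_superset[of ?A m] wt_superset[of ?A n]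
    by (simp add: lookup_add sum.distrib)
qed

lemma multihomogeneous_graded: "multihomogeneous F \<longleftrightarrow> (\<forall>i. \<exists>e. graded (wt i) e F)"
  by (simp add: multihomogeneous_def graded_def wt_def)

text \<open>The \<open>v\<close>-th coefficient of the \<open>i\<close>-th linear form as a variable
  of the multihomogeneous coordinate ring.\<close>

definition Vm :: "nat \<Rightarrow> 3 \<Rightarrow> (nat \<times> 3 monom) mpol" where "Vm i v = Var (i, term_of v 1)"

lemma graded_Vm: "graded (wt a) (if a = i then 1 else 0) (Vm i v)"
proof -
  have "{w \<in> supp (term_of x (1 :: nat)). fst w = a} = (if a = fst x then {x} else {})" for x :: "nat \<times> 3 monom"
    by auto
  then have "wt a (term_of x 1) = (if a = fst x then 1 else 0)" for x :: "nat \<times> 3 monom"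
    by (simp only: wt_def) (simp split: if_splits)
  then show ?thesis unfolding Vm_def Var_def by (intro graded_single) simp
qed

definition coords :: "nat \<Rightarrow> (S set) list \<Rightarrow> nat \<times> 3 monom \<Rightarrow> complex" where
  "coords d Ls = (\<lambda>(i, m). if i < d then coef (rep (Ls ! i)) m else 0)"

lemma ev_Vm: "i < d \<Longrightarrow> ev (coords d Ls) (Vm i v) = lf (Ls ! i) v"
  by (simp add: Vm_def coords_def lf_def)

lemma topspace_zariski_tuples [simp]: "topspace (zariski_tuples d) = tuples d"
proof -
  have "multihomogeneous 1" by (simp add: multihomogeneous_def)
  moreover have "{Ls \<in> tuples d. mpeval id (\<lambda>(i, m). if i < d then coef (rep (Ls ! i)) m else 0) 1 \<noteq> 0} = tuples d"
    by simp
  ultimately have "tuples d \<in> {{Ls \<in> tuples d. mpeval id (\<lambda>(i, m). if i < d then coef (rep (Ls ! i)) m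
       else 0) F \<noteq> 0} | F :: (nat \<times> 3 monom) mpol. multihomogeneous F}"
    by (intro CollectI exI[of _ 1]) simp
  then show ?thesis unfolding zariski_tuples_def topology_generated_by_topspace
    by (intro equalityI Union_least Union_upper) auto
qed

lemma closedin_tuples_zero:
  assumes "\<And>a. \<exists>e. graded (wt a) e F"
  shows "closedin (zariski_tuples d) {Ls \<in> tuples d. ev (coords d Ls) F = 0}"
proof -
  have "openin (zariski_tuples d) {Ls \<in> tuples d. ev (coords d Ls) F \<noteq> 0}"
    unfolding zariski_tuples_def ev_def coords_def
    by (rule topology_generated_by_Basis) (use assms multihomogeneous_graded in blast)
  moreover have "tuples d - {Ls \<in> tuples d. ev (coords d Ls) F = 0} = {Ls \<in> tuples d. ev (coords d Ls) F \<noteq> 0}" by auto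
  ultimately show ?thesis unfolding closedin_def by auto
qed

lemma closedin_Collect_All:
  assumes "closedin X S" "\<And>t. t \<in> T \<Longrightarrow> closedin X {x \<in> S. p t x}"
  shows "closedin X {x \<in> S. \<forall>t\<in>T. p t x}"
proof -
  have "closedin X (\<Inter>(insert S ((\<lambda>t. {x \<in> S. p t x}) ` T)))"
    by (rule closedin_Inter) (use assms in auto)
  moreover have "\<Inter>(insert S ((\<lambda>t. {x \<in> S. p t x}) ` T)) = {x \<in> S. \<forall>t\<in>T. p t x}" by auto
  ultimately show ?thesis by simp
qed

lemma closedin_Collect_Ex:
  assumes "finite T" "\<And>t. t \<in> T \<Longrightarrow> closedin X {x \<in> S. p t x}"
  shows "closedin X {x \<in> S. \<exists>t\<in>T. p t x}"
proof -
  have "closedin X (\<Union>((\<lambda>t. {x \<in> S. p t x}) ` T))"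
    by (rule closedin_Union) (use assms in auto)
  moreover have "\<Union>((\<lambda>t. {x \<in> S. p t x}) ` T) = {x \<in> S. \<exists>t\<in>T. p t x}" by auto
  ultimately show ?thesis by simp
qed

lemma closed_tuples: "closedin (zariski_tuples d) (tuples d)"
  using closedin_topspace[of "zariski_tuples d"] by simp

lemma graded_Vm_mult:
  "graded (wt a) e F \<Longrightarrow> graded (wt a) ((if a = i then 1 else 0) + e) (Vm i v * F)"
  by (intro graded_mult wt_add graded_Vm)

lemma concurrent_closed:
  assumes "T \<subseteq> cube d"
  shows "closedin (zariski_tuples d) {Ls \<in> tuples d. concurrent T (\<lambda>i. lf (Ls ! i))}"
  unfolding concurrent_def
proof (rule closedin_Collect_All[OF closed_tuples])
  fix t assume t: "t \<in> T"
  obtain i j k where ijk: "t = (i, j, k)" by (cases t) auto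
  then have lt: "i < d" "j < d" "k < d" using t assms by (auto simp: cube_def)
  define F where "F = Vm i 1 * (Vm j 2 * Vm k 3 - Vm j 3 * Vm k 2) + Vm i 2 * (Vm j 3 * Vm k 1 - Vm j 1 * Vm k 3)
    + Vm i 3 * (Vm j 1 * Vm k 2 - Vm j 2 * Vm k 1)"
  have "\<exists>e. graded (wt a) e F" for a
    unfolding F_def
    by (rule exI[of _ "(if a = i then 1 else 0) + ((if a = j then 1 else 0) + (if a = k then 1 else 0))"])
      (intro graded_add graded_diff graded_Vm_mult graded_Vm)
  from closedin_tuples_zero[OF this, of d]
  show "closedin (zariski_tuples d) {Ls \<in> tuples d. det3 (lf (Ls ! fst t)) (lf (Ls ! fst (snd t))) (lf (Ls ! snd (snd t))) = 0}"
    using lt by (simp add: F_def ev_Vm det3_def ijk)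
qed

lemma degenerate_closed: "closedin (zariski_tuples d) {Ls \<in> tuples d. degenerate d n (\<lambda>i. lf (Ls ! i))}"
proof -
  have cr: "closedin (zariski_tuples d) {Ls \<in> tuples d. crossp (lf (Ls ! i)) (lf (Ls ! j)) v = 0}"
    if "i < d" "j < d" for i j v
  proof -
    have "closedin (zariski_tuples d) {Ls \<in> tuples d. ev (coords d Ls) (Vm i u * Vm j w - Vm i w * Vm j u) = 0}" for u w
    proof (rule closedin_tuples_zero)
      show "\<exists>e. graded (wt a) e (Vm i u * Vm j w - Vm i w * Vm j u)" for a
        by (rule exI[of _ "(if a = i then 1 else 0) + (if a = j then 1 else 0)"])
          (intro graded_diff graded_Vm_mult graded_Vm)
    qed
    then have "closedin (zariski_tuples d) {Ls \<in> tuples d. lf (Ls ! i) u * lf (Ls ! j) w - lf (Ls ! i) w * lf (Ls ! j) u = 0}" for u w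
      using that by (simp add: ev_Vm)
    then show ?thesis using exhaust_3[of v] by (elim disjE) (simp_all only: crossp_simps)
  qed
  have "closedin (zariski_tuples d) ({Ls \<in> tuples d. \<exists>p\<in>{p \<in> {..<d} \<times> {..<d}. fst p \<noteq> snd p}.
        \<forall>v\<in>UNIV. crossp (lf (Ls ! fst p)) (lf (Ls ! snd p)) v = 0}
      \<union> {Ls \<in> tuples d. \<exists>T\<in>{T \<in> Pow (cube d). n < card T}. concurrent T (\<lambda>i. lf (Ls ! i))})"
    by (intro closedin_Un closedin_Collect_Ex closedin_Collect_All[OF closed_tuples] cr concurrent_closed) auto
  also have "\<dots> = {Ls \<in> tuples d. degenerate d n (\<lambda>i. lf (Ls ! i))}" unfolding degenerate_def by blast
  finally show ?thesis .
qed

section \<open>Constructibility of the strata\<close>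

lemma degenerate_iff:
  assumes Ls: "Ls \<in> tuples d"
  shows "degenerate d n (\<lambda>i. lf (Ls ! i)) \<longleftrightarrow> \<not> distinct Ls \<or> n < card (dep Ls)"
proof -
  have len: "length Ls = d" and PS: "\<And>i. i < d \<Longrightarrow> Ls ! i \<in> PS 1" using Ls by (auto simp: tuples_def)
  have eq: "(\<forall>v. crossp (lf (Ls ! i)) (lf (Ls ! j)) v = 0) \<longleftrightarrow> Ls ! i = Ls ! j" if "i < d" "j < d" for i j
  proof
    assume "\<forall>v. crossp (lf (Ls ! i)) (lf (Ls ! j)) v = 0"
    then show "Ls ! i = Ls ! j" using crossp_nonzero[OF PS[OF that(1)] PS[OF that(2)]] by blast
  next
    assume "Ls ! i = Ls ! j"
    then show "\<forall>v. crossp (lf (Ls ! i)) (lf (Ls ! j)) v = 0"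
      by (metis (no_types, lifting) crossp_simps exhaust_3 mult.commute cancel_comm_monoid_add_class.diff_cancel)
  qed
  have conc: "concurrent T (\<lambda>i. lf (Ls ! i)) \<longleftrightarrow> T \<subseteq> dep Ls" if "T \<subseteq> cube d" for T
    using that len by (auto simp: concurrent_def dep_def cube_def)
  have "(\<exists>p\<in>{p \<in> {..<d} \<times> {..<d}. fst p \<noteq> snd p}. \<forall>v\<in>UNIV. crossp (lf (Ls ! fst p)) (lf (Ls ! snd p)) v = 0)
      \<longleftrightarrow> (\<exists>i<d. \<exists>j<d. i \<noteq> j \<and> Ls ! i = Ls ! j)"
  proof
    assume "\<exists>p\<in>{p \<in> {..<d} \<times> {..<d}. fst p \<noteq> snd p}. \<forall>v\<in>UNIV. crossp (lf (Ls ! fst p)) (lf (Ls ! snd p)) v = 0"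
    then obtain i j where "i < d" "j < d" "i \<noteq> j" "\<forall>v. crossp (lf (Ls ! i)) (lf (Ls ! j)) v = 0" by auto
    then show "\<exists>i<d. \<exists>j<d. i \<noteq> j \<and> Ls ! i = Ls ! j" using eq by blast
  next
    assume "\<exists>i<d. \<exists>j<d. i \<noteq> j \<and> Ls ! i = Ls ! j"
    then obtain i j where "i < d" "j < d" "i \<noteq> j" "Ls ! i = Ls ! j" by blast
    then show "\<exists>p\<in>{p \<in> {..<d} \<times> {..<d}. fst p \<noteq> snd p}. \<forall>v\<in>UNIV. crossp (lf (Ls ! fst p)) (lf (Ls ! snd p)) v = 0"
      using eq[of i j] by (intro bexI[of _ "(i, j)"]) simp_all
  qed
  also have "\<dots> \<longleftrightarrow> \<not> distinct Ls" using len by (auto simp: distinct_conv_nth)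
  finally have 1: "(\<exists>p\<in>{p \<in> {..<d} \<times> {..<d}. fst p \<noteq> snd p}. \<forall>v\<in>UNIV. crossp (lf (Ls ! fst p)) (lf (Ls ! snd p)) v = 0)
      \<longleftrightarrow> \<not> distinct Ls" .
  have fin: "finite (dep Ls)" using dep_cube[OF len] finite_cube finite_subset by blast
  have "(\<exists>T\<in>{T \<in> Pow (cube d). n < card T}. concurrent T (\<lambda>i. lf (Ls ! i))) \<longleftrightarrow> n < card (dep Ls)"
  proof
    assume "\<exists>T\<in>{T \<in> Pow (cube d). n < card T}. concurrent T (\<lambda>i. lf (Ls ! i))"
    then obtain T where T: "T \<subseteq> dep Ls" "n < card T" using conc by blast
    then show "n < card (dep Ls)" using card_mono[OF fin T(1)] by linarith
  next
    assume "n < card (dep Ls)"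
    then show "\<exists>T\<in>{T \<in> Pow (cube d). n < card T}. concurrent T (\<lambda>i. lf (Ls ! i))"
      using conc[OF dep_cube[OF len]] dep_cube[OF len] by (intro bexI[of _ "dep Ls"]) auto
  qed
  with 1 show ?thesis unfolding degenerate_def by blast
qed

lemma stratum_diff:
  assumes T: "T \<subseteq> cube d"
  shows "{Ls \<in> X_space d. dep Ls = T}
    = {Ls \<in> tuples d. concurrent T (\<lambda>i. lf (Ls ! i))} - {Ls \<in> tuples d. degenerate d (card T) (\<lambda>i. lf (Ls ! i))}"
proof -
  have "dep Ls = T \<longleftrightarrow> concurrent T (\<lambda>i. lf (Ls ! i)) \<and> \<not> card T < card (dep Ls)" if "Ls \<in> tuples d" for Ls
  proof -
    have len: "length Ls = d" using that by (simp add: tuples_def)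
    have fin: "finite (dep Ls)" using dep_cube[OF len] finite_cube finite_subset by blast
    have "concurrent T (\<lambda>i. lf (Ls ! i)) \<longleftrightarrow> T \<subseteq> dep Ls"
      using T len by (auto simp: concurrent_def dep_def cube_def)
    then show ?thesis using card_seteq[OF fin, of T] by auto
  qed
  then show ?thesis using degenerate_iff unfolding X_space_def by blast
qed

text \<open>The image of a difference is the difference of the images if no tuple in the stratum has
  the same product as a degenerate one. Two tuples with the same product have the same set of lines,
  hence both consist of distinct lines and have the same number of dependent triples.\<close>

lemma psi_stratum:
  assumes T: "T \<subseteq> cube d"
  shows "psi ` {Ls \<in> X_space d. dep Ls = T}
    = psi ` {Ls \<in> tuples d. concurrent T (\<lambda>i. lf (Ls ! i))} - psi ` {Ls \<in> tuples d. degenerate d (card T) (\<lambda>i. lf (Ls ! i))}"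
proof -
  have sat: "\<not> degenerate d (card T) (\<lambda>i. lf (Ms ! i))"
    if Ls: "Ls \<in> X_space d" "dep Ls = T" and Ms: "Ms \<in> tuples d" "psi Ls = psi Ms" for Ls Ms
  proof -
    have tup: "Ls \<in> tuples d" "distinct Ls" using Ls(1) by (auto simp: X_space_def)
    have set: "set Ls = set Ms" by (rule psi_eq_imp_set_eq[OF tup(1) Ms])
    have "length Ms = card (set Ms)" using set X_spaceD(4)[OF Ls(1)] Ms(1) by (simp add: tuples_def)
    then have "distinct Ms" by (metis card_distinct)
    moreover from this have "card (dep Ms) = card (dep Ls)" using card_dep[of Ms] card_dep[OF tup(2)] set by simp
    ultimately show ?thesis using degenerate_iff[OF Ms(1)] Ls(2) by simp
  qed
  show ?thesis
  proof (intro equalityI subsetI DiffI)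
    fix P assume "P \<in> psi ` {Ls \<in> X_space d. dep Ls = T}"
    then obtain Ls where Ls: "Ls \<in> X_space d" "dep Ls = T" "P = psi Ls" by blast
    then show "P \<in> psi ` {Ls \<in> tuples d. concurrent T (\<lambda>i. lf (Ls ! i))}" using stratum_diff[OF T] by blast
    show "P \<notin> psi ` {Ls \<in> tuples d. degenerate d (card T) (\<lambda>i. lf (Ls ! i))}"
      using sat[OF Ls(1,2)] Ls(3) by blast
  next
    fix P assume P: "P \<in> psi ` {Ls \<in> tuples d. concurrent T (\<lambda>i. lf (Ls ! i))}
      - psi ` {Ls \<in> tuples d. degenerate d (card T) (\<lambda>i. lf (Ls ! i))}"
    then obtain Ls where Ls: "Ls \<in> tuples d" "concurrent T (\<lambda>i. lf (Ls ! i))" "P = psi Ls" by blast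
    then have "\<not> degenerate d (card T) (\<lambda>i. lf (Ls ! i))" using P by blast
    then have "Ls \<in> {Ls \<in> X_space d. dep Ls = T}" using Ls unfolding stratum_diff[OF T] by blast
    then show "P \<in> psi ` {Ls \<in> X_space d. dep Ls = T}" using Ls(3) by blast
  qed
qed

lemma constructible_UN:
  assumes "finite I" "\<And>i. i \<in> I \<Longrightarrow> closedin X (Z i)" "\<And>i. i \<in> I \<Longrightarrow> closedin X (W i)"
  shows "constructible_in X (\<Union>i\<in>I. Z i - W i)"
  unfolding constructible_in_def
proof (intro exI[of _ "(\<lambda>i. Z i - W i) ` I"] conjI ballI)
  fix B assume "B \<in> (\<lambda>i. Z i - W i) ` I"
  then obtain i where i: "i \<in> I" "B = Z i - W i" by blast
  have "openin X (topspace X - W i)" using assms(3)[OF i(1)] by blast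
  moreover have "B = (topspace X - W i) \<inter> Z i" using i(2) closedin_subset[OF assms(2)[OF i(1)]] by blast
  ultimately show "\<exists>U Z. openin X U \<and> closedin X Z \<and> B = U \<inter> Z" using assms(2)[OF i(1)] by blast
qed (use assms(1) in auto)

text \<open>The strata with a given set of dependent triples are finitely many, since all these sets
  are subsets of \<open>cube d\<close>.\<close>

lemma strata_constructible:
  assumes L: "L \<in> lattices d"
  shows "constructible_in (zariski_tuples d) (X_lat d L)" "constructible_in (zariski_forms d) (A_lat d L)"
proof -
  define I where "I = dep ` X_lat d L"
  have sub: "T \<subseteq> cube d" if "T \<in> I" for T
    using that dep_cube X_spaceD(1) by (auto simp: I_def X_lat_def)
  have fin: "finite I" using sub by (intro finite_subset[of I "Pow (cube d)"]) auto
  have X: "X_lat d L = (\<Union>T\<in>I. {Ls \<in> X_space d. dep Ls = T})"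
  proof (intro equalityI subsetI)
    fix Ms assume "Ms \<in> (\<Union>T\<in>I. {Ls \<in> X_space d. dep Ls = T})"
    then obtain Ls where Ls: "Ls \<in> X_lat d L" "Ms \<in> X_space d" "dep Ls = dep Ms" by (auto simp: I_def)
    have "lattice_iso (intersection_lattice Ls) (intersection_lattice Ms)"
      by (rule dep_eq_imp_iso) (use Ls in \<open>auto simp: X_lat_def\<close>)
    then show "Ms \<in> X_lat d L" unfolding X_lat_eq[OF L Ls(1)] using Ls(2) by simp
  qed (auto simp: I_def X_lat_def)
  define Z where "Z T = {Ls \<in> tuples d. concurrent T (\<lambda>i. lf (Ls ! i))}" for T
  define W where "W T = {Ls \<in> tuples d. degenerate d (card T) (\<lambda>i. lf (Ls ! i))}" for T :: "(nat \<times> nat \<times> nat) set"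
  have "X_lat d L = (\<Union>T\<in>I. Z T - W T)" unfolding X Z_def W_def using stratum_diff sub by auto
  moreover have "constructible_in (zariski_tuples d) (\<Union>T\<in>I. Z T - W T)"
    by (rule constructible_UN[OF fin]) (auto simp: Z_def W_def intro: concurrent_closed[OF sub] degenerate_closed)
  ultimately show "constructible_in (zariski_tuples d) (X_lat d L)" by simp
  have "A_lat d L = (\<Union>T\<in>I. psi ` Z T - psi ` W T)"
    unfolding A_lat_def X image_UN Z_def W_def using psi_stratum sub by (intro SUP_cong) auto
  moreover have "constructible_in (zariski_forms d) (\<Union>T\<in>I. psi ` Z T - psi ` W T)"
  proof (rule constructible_UN[OF fin])
    show "closedin (zariski_forms d) (psi ` Z T)" if "T \<in> I" for T
      unfolding Z_def using concurrent_vclosed[OF sub[OF that]] concurrent_scale[OF sub[OF that]]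
      by (rule psi_closed)
    show "closedin (zariski_forms d) (psi ` W T)" for T
      unfolding W_def using degenerate_vclosed degenerate_scale by (rule psi_closed)
  qed
  ultimately show "constructible_in (zariski_forms d) (A_lat d L)" by simp
qed

section \<open>Two arrangements of nine lines with the same lattice\<close>

text \<open>Lines with integral coordinates, so that incidences can be decided by
  computation.\<close>

definition cv :: "int \<times> int \<times> int \<Rightarrow> 3 \<Rightarrow> complex" where
  "cv p = (\<lambda>v. if v = 1 then of_int (fst p) else if v = 2 then of_int (fst (snd p)) else of_int (snd (snd p)))"

definition idet :: "int \<times> int \<times> int \<Rightarrow> int \<times> int \<times> int \<Rightarrow> int \<times> int \<times> int \<Rightarrow> int" where
  "idet p q r = fst p * (fst (snd q) * snd (snd r) - snd (snd q) * fst (snd r))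
     + fst (snd p) * (snd (snd q) * fst r - fst q * snd (snd r))
     + snd (snd p) * (fst q * fst (snd r) - fst (snd q) * fst r)"

definition independent_pair :: "int \<times> int \<times> int \<Rightarrow> int \<times> int \<times> int \<Rightarrow> bool" where
  "independent_pair p q \<longleftrightarrow> fst p * fst (snd q) \<noteq> fst (snd p) * fst q
     \<or> fst p * snd (snd q) \<noteq> snd (snd p) * fst q \<or> fst (snd p) * snd (snd q) \<noteq> snd (snd p) * fst (snd q)"

definition arrangement :: "(int \<times> int \<times> int) list \<Rightarrow> S set list" where
  "arrangement Zs = map (\<lambda>p. pl (cv p)) Zs"

definition form :: "(int \<times> int \<times> int) list \<Rightarrow> S" where
  "form Zs = prod_list (map (\<lambda>p. linform (cv p)) Zs)"

lemma det3_cv: "det3 (cv p) (cv q) (cv r) = of_int (idet p q r)"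
  by (simp add: det3_def cv_def idet_def)

lemma psi_arrangement: "psi (arrangement Zs) = pclass (form Zs)"
proof -
  have "arrangement Zs = map pclass (map (\<lambda>p. linform (cv p)) Zs)" by (simp add: arrangement_def pl_def)
  then show ?thesis unfolding form_def by (simp only: psi_pclass)
qed

lemma independent_pair_nonzero:
  assumes "independent_pair p q" shows "\<exists>v. cv p v \<noteq> 0"
proof (rule ccontr)
  assume "\<not> ?thesis"
  then have "cv p 1 = 0" "cv p 2 = 0" "cv p 3 = 0" by blast+
  then show False using assms by (simp add: cv_def independent_pair_def)
qed

lemma independent_pair_pl:
  assumes "independent_pair p q" "independent_pair q p" shows "pl (cv p) \<noteq> pl (cv q)"
proof
  assume eq: "pl (cv p) = pl (cv q)"
  obtain c where c: "c \<noteq> 0" "lf (pl (cv p)) = (\<lambda>v. c * cv p v)"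
    using lf_pl[OF independent_pair_nonzero[OF assms(1)]] by blast
  obtain e where e: "e \<noteq> 0" "lf (pl (cv q)) = (\<lambda>v. e * cv q v)"
    using lf_pl[OF independent_pair_nonzero[OF assms(2)]] by blast
  have k: "c * cv p v = e * cv q v" for v using c(2) e(2) eq by metis
  have cr: "cv p v * cv q w = cv p w * cv q v" for v w
  proof -
    have "c * (cv p v * cv q w) = c * (cv p w * cv q v)"
      using k[of v] k[of w] by algebra
    then show ?thesis using c(1) by simp
  qed
  have "of_int (fst p * fst (snd q)) = (of_int (fst (snd p) * fst q) :: complex)"
    "of_int (fst p * snd (snd q)) = (of_int (snd (snd p) * fst q) :: complex)"
    "of_int (fst (snd p) * snd (snd q)) = (of_int (snd (snd p) * fst (snd q)) :: complex)"
    using cr[of 1 2] cr[of 1 3] cr[of 2 3] by (simp_all add: cv_def)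
  then show False using assms(1) unfolding of_int_eq_iff by (simp add: independent_pair_def)
qed

lemma arrangement_X_space:
  assumes "\<forall>i<length Zs. \<forall>j<length Zs. i \<noteq> j \<longrightarrow> independent_pair (Zs ! i) (Zs ! j)" "length Zs \<ge> 2"
  shows "arrangement Zs \<in> X_space (length Zs)"
proof -
  have "pl (cv (Zs ! i)) \<in> PS 1" if "i < length Zs" for i
  proof -
    obtain j where "j < length Zs" "i \<noteq> j"
      using assms(2) by (metis Suc_le_lessD less_le_trans numeral_2_eq_2 zero_less_Suc zero_neq_one One_nat_def lessI)
    then show ?thesis using assms(1) that by (intro pl_PS independent_pair_nonzero[of _ "Zs ! j"]) blast
  qed
  then have "set (arrangement Zs) \<subseteq> PS 1"
    unfolding arrangement_def by (metis (no_types, lifting) in_set_conv_nth length_map nth_map subsetI)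
  moreover have "distinct (arrangement Zs)"
    unfolding distinct_conv_nth arrangement_def using assms(1) independent_pair_pl by auto
  ultimately show ?thesis by (auto simp: X_space_def tuples_def arrangement_def)
qed

lemma dep_arrangement:
  assumes X: "arrangement Zs \<in> X_space (length Zs)" and "length Zs \<ge> 2"
    and ind: "\<forall>i<length Zs. \<forall>j<length Zs. i \<noteq> j \<longrightarrow> independent_pair (Zs ! i) (Zs ! j)"
  shows "dep (arrangement Zs) = {(i, j, k). i < length Zs \<and> j < length Zs \<and> k < length Zs
     \<and> idet (Zs ! i) (Zs ! j) (Zs ! k) = 0}"
proof -
  have "\<exists>c. c \<noteq> 0 \<and> lf (arrangement Zs ! i) = (\<lambda>v. c * cv (Zs ! i) v)" if "i < length Zs" for i
  proof -
    obtain j where "j < length Zs" "i \<noteq> j"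
      using assms(2) by (metis Suc_le_lessD less_le_trans numeral_2_eq_2 zero_less_Suc zero_neq_one One_nat_def lessI)
    then have "\<exists>v. cv (Zs ! i) v \<noteq> 0" using ind that independent_pair_nonzero by blast
    then show ?thesis using lf_pl[of "cv (Zs ! i)"] that by (simp add: arrangement_def) metis
  qed
  then obtain c where c: "\<And>i. i < length Zs \<Longrightarrow> c i \<noteq> 0"
    "\<And>i. i < length Zs \<Longrightarrow> lf (arrangement Zs ! i) = (\<lambda>v. c i * cv (Zs ! i) v)" by metis
  have "det3 (lf (arrangement Zs ! i)) (lf (arrangement Zs ! j)) (lf (arrangement Zs ! k)) = 0
      \<longleftrightarrow> idet (Zs ! i) (Zs ! j) (Zs ! k) = 0"
    if "i < length Zs" "j < length Zs" "k < length Zs" for i j k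
    unfolding c(2)[OF that(1)] c(2)[OF that(2)] c(2)[OF that(3)] det3_scale det3_cv
    using c(1) that by simp
  then show ?thesis unfolding dep_def by (auto simp: arrangement_def)
qed

text \<open>The lines \<open>z\<^sub>j y - y\<^sub>j z\<close>, \<open>x\<^sub>j z - z\<^sub>j
  x\<close> and \<open>y\<^sub>j x - x\<^sub>j y\<close> that join the coordinate points to the
  three points \<open>(1, -2, -1)\<close>, \<open>(2, 1, 3)\<close>, \<open>(2, -1, -1)\<close>. The
  six points are on a conic, because \<open>\<alpha>/x + \<beta>/y + \<gamma>/z = 0\<close> has a
  nontrivial solution at the three points.\<close>

definition conical :: "(int \<times> int \<times> int) list" where
  "conical = [(0, -1, 2), (0, 3, -1), (0, -1, 1), (1, 0, 1), (-3, 0, 2), (1, 0, 2), (-2, -1, 0), (1, -2, 0), (-1, -2, 0)]"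

text \<open>The same construction for the points \<open>(1, -2, -1)\<close>, \<open>(1, -3,
  1)\<close>, \<open>(2, -1, -1)\<close>, which are not on a conic with the coordinate
  points.\<close>

definition generic :: "(int \<times> int \<times> int) list" where
  "generic = [(0, -1, 2), (0, 1, 3), (0, -1, 1), (1, 0, 1), (-1, 0, 1), (1, 0, 2), (-2, -1, 0), (-3, -1, 0), (-1, -2, 0)]"

lemma all_less_9: "(\<forall>i<9. P i) \<longleftrightarrow> list_all P [0, 1, 2, 3, 4, 5, 6, 7, 8 :: nat]"
proof -
  have "{..<9 :: nat} = set [0, 1, 2, 3, 4, 5, 6, 7, 8]" by (auto simp: set_eq_iff)
  moreover have "(\<forall>i<9. P i) \<longleftrightarrow> (\<forall>i\<in>{..<9}. P i)" by (simp only: lessThan_iff Ball_def)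
  ultimately show ?thesis by (simp only: list_all_iff)
qed

lemma length_9: "length conical = 9" "length generic = 9"
  by (simp_all add: conical_def generic_def)

lemma independent_lines:
  "\<forall>i<9. \<forall>j<9. i \<noteq> j \<longrightarrow> independent_pair (conical ! i) (conical ! j)"
  "\<forall>i<9. \<forall>j<9. i \<noteq> j \<longrightarrow> independent_pair (generic ! i) (generic ! j)"
  unfolding all_less_9 by code_simp+

lemma same_triples:
  "\<forall>i<9. \<forall>j<9. \<forall>k<9. idet (conical ! i) (conical ! j) (conical ! k) = 0
     \<longleftrightarrow> idet (generic ! i) (generic ! j) (generic ! k) = 0"
  unfolding all_less_9 by code_simp

lemma arrangements_X_space: "arrangement conical \<in> X_space 9" "arrangement generic \<in> X_space 9"
  using arrangement_X_space[of conical] arrangement_X_space[of generic] independent_lines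
  by (simp_all add: length_9)

lemma same_lattice:
  "lattice_iso (intersection_lattice (arrangement conical)) (intersection_lattice (arrangement generic))"
proof (rule dep_eq_imp_iso[OF arrangements_X_space])
  have "dep (arrangement conical) = {(i, j, k). i < 9 \<and> j < 9 \<and> k < 9
      \<and> idet (conical ! i) (conical ! j) (conical ! k) = 0}"
    by (rule dep_arrangement[of conical, unfolded length_9, OF arrangements_X_space(1) _ independent_lines(1)]) simp
  moreover have "dep (arrangement generic) = {(i, j, k). i < 9 \<and> j < 9 \<and> k < 9
      \<and> idet (generic ! i) (generic ! j) (generic ! k) = 0}"
    by (rule dep_arrangement[of generic, unfolded length_9, OF arrangements_X_space(2) _ independent_lines(2)]) simp
  ultimately show "dep (arrangement conical) = dep (arrangement generic)"
    using same_triples by (simp add: set_eq_iff cong: conj_cong)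
qed

section \<open>A syzygy of degree five\<close>

text \<open>The derivation \<open>a \<partial>\<^sub>x + b \<partial>\<^sub>y + c
  \<partial>\<^sub>z\<close>; syzygies of the partial derivatives of \<open>f\<close> are the
  derivations that annihilate \<open>f\<close>.\<close>

definition dvn :: "S \<Rightarrow> S \<Rightarrow> S \<Rightarrow> S \<Rightarrow> S" where
  "dvn a b c f = a * pderivative 1 f + b * pderivative 2 f + c * pderivative 3 f"

lemma dvn_mult: "dvn a b c (F * G) = dvn a b c F * G + F * dvn a b c G"
  by (simp add: dvn_def pd_mult algebra_simps)

lemma dvn_prod_list:
  assumes "list_all2 (\<lambda>l h. dvn a b c l = h * l) ls hs"
  shows "dvn a b c (prod_list ls) = sum_list hs * prod_list ls"
  using assms
proof induction
  case Nil
  show ?case by (simp add: dvn_def)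
next
  case (Cons l h ls hs)
  then show ?case by (simp add: dvn_mult algebra_simps)
qed

lemma dvn_linform: "dvn a b c (linform e) = Cst (e 1) * a + Cst (e 2) * b + Cst (e 3) * c"
  by (simp add: dvn_def pd_linform mult.commute)

lemma Cst_of_int: "Cst (of_int n) = of_int n"
  by (cases n rule: int_cases2) (simp_all add: of_nat_Cst Cst_minus)

lemma linform_cv: "linform (cv (p, q, r)) = of_int p * Var 1 + of_int q * Var 2 + of_int r * Var 3"
  by (simp add: linform_def sum_3 cv_def Cst_of_int)

lemma dvn_cv: "dvn a b c (linform (cv (p, q, r))) = of_int p * a + of_int q * b + of_int r * c"
  by (simp add: dvn_linform cv_def Cst_of_int)

text \<open>The derivation \<open>\<theta>\<close> with the coefficients \<open>thetaA, thetaB,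
  thetaC\<close> arises as follows. Let \<open>P(y, z)\<close>, \<open>Q(z, x)\<close>, \<open>R(x,
  y)\<close> be the products of the lines through the three coordinate points. The conic provides
  cubics \<open>U, V, W\<close> with \<open>x P U + y Q V + z R W = 0\<close>. The curl of the field
  \<open>(P U, Q V, R W)\<close> has degree 5 and is tangent to all nine lines, so it multiplies
  \<open>f = P Q R\<close> by some \<open>g\<close>; and \<open>\<theta>\<close> is \<open>9\<close>
  times this field minus \<open>g\<close> times the Euler field. All monomials are written with
  three exponents, to be recognized as homogeneous of degree 5.\<close>

definition thetaA :: "'a::comm_ring_1 \<Rightarrow> 'a \<Rightarrow> 'a \<Rightarrow> 'a" where
  "thetaA x y z = 18 * x^5 * y^0 * z^0 + 56 * x^4 * y^0 * z^1 + 6 * x^3 * y^2 * z^0 + 138 * x^3 * y^0 * z^2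
     + 408 * x^2 * y^2 * z^1 + 184 * x^1 * y^3 * z^1 + 48 * x^1 * y^2 * z^2
     + 188 * x^1 * y^1 * z^3 + 216 * x^0 * y^3 * z^2 - 12 * x^4 * y^1 * z^0
     - 297 * x^3 * y^1 * z^1 - 354 * x^2 * y^3 * z^0 - 156 * x^2 * y^1 * z^2
     - 44 * x^2 * y^0 * z^3 - 144 * x^1 * y^4 * z^0 - 144 * x^1 * y^0 * z^4
     - 144 * x^0 * y^2 * z^3"

definition thetaB :: "'a::comm_ring_1 \<Rightarrow> 'a \<Rightarrow> 'a \<Rightarrow> 'a" where
  "thetaB x y z = 254 * x^3 * y^1 * z^1 + 168 * x^2 * y^3 * z^0 + 192 * x^2 * y^1 * z^2
     + 186 * x^1 * y^4 * z^0 + 330 * x^1 * y^2 * z^2 + 72 * x^0 * y^5 * z^0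
     + 476 * x^0 * y^2 * z^3 - 36 * x^4 * y^1 * z^0 - 147 * x^3 * y^2 * z^0
     - 108 * x^3 * y^0 * z^2 - 198 * x^2 * y^2 * z^1 - 72 * x^2 * y^0 * z^3
     - 384 * x^1 * y^3 * z^1 - 80 * x^1 * y^1 * z^3 - 212 * x^0 * y^4 * z^1
     - 168 * x^0 * y^3 * z^2 - 144 * x^0 * y^1 * z^4"

definition thetaC :: "'a::comm_ring_1 \<Rightarrow> 'a \<Rightarrow> 'a \<Rightarrow> 'a" where
  "thetaC x y z = 393 * x^3 * y^1 * z^1 + 162 * x^2 * y^3 * z^0 + 648 * x^2 * y^1 * z^2
     + 24 * x^1 * y^3 * z^1 + 156 * x^1 * y^2 * z^2 + 28 * x^1 * y^0 * z^4
     + 184 * x^0 * y^3 * z^2 + 264 * x^0 * y^2 * z^3 + 72 * x^0 * y^0 * z^5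
     - 36 * x^4 * y^0 * z^1 - 162 * x^3 * y^2 * z^0 - 232 * x^3 * y^0 * z^2
     - 480 * x^2 * y^2 * z^1 - 240 * x^2 * y^0 * z^3 - 156 * x^1 * y^1 * z^3
     - 144 * x^0 * y^4 * z^1 - 352 * x^0 * y^1 * z^4"

text \<open>The quotients of \<open>\<theta>(l)\<close> by \<open>l\<close> for the nine lines
  \<open>l\<close>. Their sum is the factor by which \<open>\<theta>\<close> multiplies the product
  of the lines.\<close>

definition cof0 :: "'a::comm_ring_1 \<Rightarrow> 'a \<Rightarrow> 'a \<Rightarrow> 'a" where
  "cof0 x y z = 177 * x^3 * y^1 * z^0 + 450 * x^2 * y^1 * z^1 + 186 * x^1 * y^3 * z^0
     + 28 * x^1 * y^0 * z^3 + 72 * x^0 * y^4 * z^0 + 220 * x^0 * y^3 * z^1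
     + 72 * x^0 * y^0 * z^4 - 36 * x^4 * y^0 * z^0 - 178 * x^3 * y^0 * z^1
     - 156 * x^2 * y^2 * z^0 - 204 * x^2 * y^0 * z^2 - 60 * x^1 * y^2 * z^1
     - 102 * x^1 * y^1 * z^2 - 96 * x^0 * y^2 * z^2 - 244 * x^0 * y^1 * z^3"

definition cof1 :: "'a::comm_ring_1 \<Rightarrow> 'a \<Rightarrow> 'a \<Rightarrow> 'a" where
  "cof1 x y z = 92 * x^3 * y^0 * z^1 + 114 * x^2 * y^2 * z^0 + 186 * x^1 * y^3 * z^0
     + 168 * x^1 * y^1 * z^2 + 28 * x^1 * y^0 * z^3 + 72 * x^0 * y^4 * z^0
     + 296 * x^0 * y^1 * z^3 + 72 * x^0 * y^0 * z^4 - 36 * x^4 * y^0 * z^0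
     - 93 * x^3 * y^1 * z^0 - 24 * x^2 * y^0 * z^2 - 330 * x^1 * y^2 * z^1
     - 140 * x^0 * y^3 * z^1 - 276 * x^0 * y^2 * z^2"

definition cof2 :: "'a::comm_ring_1 \<Rightarrow> 'a \<Rightarrow> 'a \<Rightarrow> 'a" where
  "cof2 x y z = 15 * x^3 * y^1 * z^0 + 6 * x^2 * y^2 * z^0 + 288 * x^2 * y^1 * z^1 + 186 * x^1 * y^3 * z^0
     + 28 * x^1 * y^0 * z^3 + 72 * x^0 * y^4 * z^0 + 4 * x^0 * y^3 * z^1
     + 72 * x^0 * y^0 * z^4 - 36 * x^4 * y^0 * z^0 - 124 * x^3 * y^0 * z^1
     - 168 * x^2 * y^0 * z^2 - 222 * x^1 * y^2 * z^1 - 48 * x^1 * y^1 * z^2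
     - 348 * x^0 * y^2 * z^2 - 136 * x^0 * y^1 * z^3"

definition cof3 :: "'a::comm_ring_1 \<Rightarrow> 'a \<Rightarrow> 'a \<Rightarrow> 'a" where
  "cof3 x y z = 18 * x^4 * y^0 * z^0 + 2 * x^3 * y^0 * z^1 + 108 * x^2 * y^1 * z^1 + 84 * x^1 * y^2 * z^1
     + 384 * x^1 * y^1 * z^2 + 400 * x^0 * y^3 * z^1 + 120 * x^0 * y^2 * z^2
     + 72 * x^0 * y^0 * z^4 - 12 * x^3 * y^1 * z^0 - 156 * x^2 * y^2 * z^0
     - 96 * x^2 * y^0 * z^2 - 192 * x^1 * y^3 * z^0 - 188 * x^1 * y^0 * z^3
     - 144 * x^0 * y^4 * z^0 - 352 * x^0 * y^1 * z^3"

definition cof4 :: "'a::comm_ring_1 \<Rightarrow> 'a \<Rightarrow> 'a \<Rightarrow> 'a" where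
  "cof4 x y z = 18 * x^4 * y^0 * z^0 + 92 * x^3 * y^0 * z^1 + 114 * x^2 * y^2 * z^0 + 354 * x^2 * y^0 * z^2
     + 804 * x^1 * y^2 * z^1 + 352 * x^1 * y^0 * z^3 + 480 * x^0 * y^2 * z^2
     + 72 * x^0 * y^0 * z^4 - 12 * x^3 * y^1 * z^0 - 567 * x^2 * y^1 * z^1
     - 462 * x^1 * y^3 * z^0 - 966 * x^1 * y^1 * z^2 - 144 * x^0 * y^4 * z^0
     - 140 * x^0 * y^3 * z^1 - 352 * x^0 * y^1 * z^3"

definition cof5 :: "'a::comm_ring_1 \<Rightarrow> 'a \<Rightarrow> 'a \<Rightarrow> 'a" where
  "cof5 x y z = 18 * x^4 * y^0 * z^0 + 513 * x^2 * y^1 * z^1 + 84 * x^1 * y^2 * z^1 + 114 * x^1 * y^1 * z^2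
     + 292 * x^0 * y^3 * z^1 + 192 * x^0 * y^2 * z^2 + 72 * x^0 * y^0 * z^4
     - 12 * x^3 * y^1 * z^0 - 52 * x^3 * y^0 * z^1 - 318 * x^2 * y^2 * z^0
     - 222 * x^2 * y^0 * z^2 - 30 * x^1 * y^3 * z^0 - 80 * x^1 * y^0 * z^3
     - 144 * x^0 * y^4 * z^0 - 352 * x^0 * y^1 * z^3"

definition cof6 :: "'a::comm_ring_1 \<Rightarrow> 'a \<Rightarrow> 'a \<Rightarrow> 'a" where
  "cof6 x y z = 18 * x^4 * y^0 * z^0 + 56 * x^3 * y^0 * z^1 + 84 * x^2 * y^0 * z^2 + 408 * x^1 * y^2 * z^1
     + 72 * x^0 * y^4 * z^0 + 264 * x^0 * y^2 * z^2 + 188 * x^0 * y^1 * z^3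
     - 39 * x^3 * y^1 * z^0 - 48 * x^2 * y^2 * z^0 - 198 * x^2 * y^1 * z^1
     - 246 * x^1 * y^3 * z^0 - 102 * x^1 * y^1 * z^2 - 80 * x^1 * y^0 * z^3
     - 212 * x^0 * y^3 * z^1 - 144 * x^0 * y^0 * z^4"

definition cof7 :: "'a::comm_ring_1 \<Rightarrow> 'a \<Rightarrow> 'a \<Rightarrow> 'a" where
  "cof7 x y z = 18 * x^4 * y^0 * z^0 + 96 * x^3 * y^1 * z^0 + 56 * x^3 * y^0 * z^1 + 492 * x^2 * y^2 * z^0
     + 354 * x^2 * y^0 * z^2 + 294 * x^1 * y^3 * z^0 + 168 * x^1 * y^1 * z^2
     + 100 * x^1 * y^0 * z^3 + 72 * x^0 * y^4 * z^0 + 548 * x^0 * y^1 * z^3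
     - 693 * x^2 * y^1 * z^1 - 582 * x^1 * y^2 * z^1 - 212 * x^0 * y^3 * z^1
     - 276 * x^0 * y^2 * z^2 - 144 * x^0 * y^0 * z^4"

definition cof8 :: "'a::comm_ring_1 \<Rightarrow> 'a \<Rightarrow> 'a \<Rightarrow> 'a" where
  "cof8 x y z = 18 * x^4 * y^0 * z^0 + 56 * x^3 * y^0 * z^1 + 99 * x^2 * y^1 * z^1 + 78 * x^1 * y^3 * z^0
     + 384 * x^1 * y^1 * z^2 + 72 * x^0 * y^4 * z^0 + 404 * x^0 * y^1 * z^3
     - 120 * x^3 * y^1 * z^0 - 48 * x^2 * y^2 * z^0 - 78 * x^2 * y^0 * z^2
     - 186 * x^1 * y^2 * z^1 - 188 * x^1 * y^0 * z^3 - 212 * x^0 * y^3 * z^1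
     - 60 * x^0 * y^2 * z^2 - 144 * x^0 * y^0 * z^4"

lemmas cof_defs = cof0_def cof1_def cof2_def cof3_def cof4_def cof5_def cof6_def cof7_def cof8_def

lemma theta_line0: "of_int (0) * thetaA x y z + of_int (-1) * thetaB x y z + of_int (2) * thetaC x y z
    = cof0 x y z * (of_int (0) * x + of_int (-1) * y + of_int (2) * z)"
  unfolding thetaA_def thetaB_def thetaC_def cof0_def by (simp add: algebra_simps power_numeral_reduce)

lemma theta_line1: "of_int (0) * thetaA x y z + of_int (3) * thetaB x y z + of_int (-1) * thetaC x y z
    = cof1 x y z * (of_int (0) * x + of_int (3) * y + of_int (-1) * z)"
  unfolding thetaA_def thetaB_def thetaC_def cof1_def by (simp add: algebra_simps power_numeral_reduce)

lemma theta_line2: "of_int (0) * thetaA x y z + of_int (-1) * thetaB x y z + of_int (1) * thetaC x y z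
    = cof2 x y z * (of_int (0) * x + of_int (-1) * y + of_int (1) * z)"
  unfolding thetaA_def thetaB_def thetaC_def cof2_def by (simp add: algebra_simps power_numeral_reduce)

lemma theta_line3: "of_int (1) * thetaA x y z + of_int (0) * thetaB x y z + of_int (1) * thetaC x y z
    = cof3 x y z * (of_int (1) * x + of_int (0) * y + of_int (1) * z)"
  unfolding thetaA_def thetaB_def thetaC_def cof3_def by (simp add: algebra_simps power_numeral_reduce)

lemma theta_line4: "of_int (-3) * thetaA x y z + of_int (0) * thetaB x y z + of_int (2) * thetaC x y z
    = cof4 x y z * (of_int (-3) * x + of_int (0) * y + of_int (2) * z)"
  unfolding thetaA_def thetaB_def thetaC_def cof4_def by (simp add: algebra_simps power_numeral_reduce)

lemma theta_line5: "of_int (1) * thetaA x y z + of_int (0) * thetaB x y z + of_int (2) * thetaC x y z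
    = cof5 x y z * (of_int (1) * x + of_int (0) * y + of_int (2) * z)"
  unfolding thetaA_def thetaB_def thetaC_def cof5_def by (simp add: algebra_simps power_numeral_reduce)

lemma theta_line6: "of_int (-2) * thetaA x y z + of_int (-1) * thetaB x y z + of_int (0) * thetaC x y z
    = cof6 x y z * (of_int (-2) * x + of_int (-1) * y + of_int (0) * z)"
  unfolding thetaA_def thetaB_def thetaC_def cof6_def by (simp add: algebra_simps power_numeral_reduce)

lemma theta_line7: "of_int (1) * thetaA x y z + of_int (-2) * thetaB x y z + of_int (0) * thetaC x y z
    = cof7 x y z * (of_int (1) * x + of_int (-2) * y + of_int (0) * z)"
  unfolding thetaA_def thetaB_def thetaC_def cof7_def by (simp add: algebra_simps power_numeral_reduce)

lemma theta_line8: "of_int (-1) * thetaA x y z + of_int (-2) * thetaB x y z + of_int (0) * thetaC x y z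
    = cof8 x y z * (of_int (-1) * x + of_int (-2) * y + of_int (0) * z)"
  unfolding thetaA_def thetaB_def thetaC_def cof8_def by (simp add: algebra_simps power_numeral_reduce)

lemma cof_sum: "cof0 x y z + cof1 x y z + cof2 x y z + cof3 x y z + cof4 x y z + cof5 x y z + cof6 x y z + cof7 x y z + cof8 x y z = 0"
  unfolding cof_defs by (simp add: algebra_simps)

lemma hom_monomial:
  "i + j + k = r \<Longrightarrow> homogeneous r (numeral n * Var 1 ^ i * Var 2 ^ j * Var 3 ^ k :: S)"
proof -
  have v: "homogeneous i (Var w ^ i :: S)" for w i using hom_power[OF hom_Var, of i w] by simp
  assume "i + j + k = r"
  then show ?thesis
    using hom_mult[OF hom_mult[OF hom_Cst_mult[OF v[of i 1], of "numeral n"] v[of j 2]] v[of k 3]]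
    by (simp add: Cst_numeral)
qed

lemma theta_hom:
  "thetaA (Var 1) (Var 2) (Var 3) \<in> S_deg 5" "thetaB (Var 1) (Var 2) (Var 3) \<in> S_deg 5"
  "thetaC (Var 1) (Var 2) (Var 3) \<in> S_deg 5"
  unfolding thetaA_def thetaB_def thetaC_def S_deg_def mem_Collect_eq
  by ((intro hom_add hom_diff hom_monomial; simp)+)

lemma conical_syzygy: "syz 5 (form conical)"
proof -
  let ?x = "Var 1 :: S" and ?y = "Var 2 :: S" and ?z = "Var 3 :: S"
  let ?A = "thetaA ?x ?y ?z" and ?B = "thetaB ?x ?y ?z" and ?C = "thetaC ?x ?y ?z"
  have "dvn ?A ?B ?C (form conical)
    = sum_list [cof0 ?x ?y ?z, cof1 ?x ?y ?z, cof2 ?x ?y ?z, cof3 ?x ?y ?z, cof4 ?x ?y ?z, cof5 ?x ?y ?z, cof6 ?x ?y ?z, cof7 ?x ?y ?z, cof8 ?x ?y ?z] * form conical"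
    unfolding form_def
    by (rule dvn_prod_list) (simp only: conical_def list.map list_all2_Cons list_all2_Nil
        dvn_cv[unfolded linform_cv] linform_cv theta_line0 theta_line1 theta_line2 theta_line3 theta_line4 theta_line5 theta_line6 theta_line7 theta_line8 simp_thms list.rel_inject list_all2_Nil2 list.rel_map)
  also have "sum_list [cof0 ?x ?y ?z, cof1 ?x ?y ?z, cof2 ?x ?y ?z, cof3 ?x ?y ?z, cof4 ?x ?y ?z, cof5 ?x ?y ?z, cof6 ?x ?y ?z, cof7 ?x ?y ?z, cof8 ?x ?y ?z] = 0"
    using cof_sum[of ?x ?y ?z] by (simp add: add.assoc)
  finally have "dvn ?A ?B ?C (form conical) = 0" by simp
  moreover have "?A \<noteq> 0"
  proof
    assume "?A = 0"
    then have "ev (\<lambda>v. if v = 1 then 1 else 0) ?A = 0" by simp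
    then show False unfolding thetaA_def by simp
  qed
  ultimately show ?thesis unfolding syz_def dvn_def using theta_hom by blast
qed

section \<open>No syzygy of degree five\<close>

text \<open>If \<open>\<theta>\<close> annihilates the product of the lines then it is tangent to
  every line: by the product rule \<open>l\<close> divides \<open>\<theta>(l)\<close> times the
  other lines.\<close>

lemma dvn_divides:
  assumes X: "Ls \<in> X_space d" and z: "dvn a b c (\<Prod>i<d. linform (lf (Ls ! i))) = 0" and i: "i < d"
  shows "linform (lf (Ls ! i)) dvd dvn a b c (linform (lf (Ls ! i)))"
proof -
  have len: "length Ls = d" and PS: "\<And>i. i < d \<Longrightarrow> Ls ! i \<in> PS 1"
    and ne: "\<And>i j. i < d \<Longrightarrow> j < d \<Longrightarrow> Ls ! i = Ls ! j \<longleftrightarrow> i = j"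
    using X_spaceD[OF X] by (auto simp: nth_eq_iff_index_eq)
  let ?l = "\<lambda>i. linform (lf (Ls ! i))"
  note v0 = lf_nonzero[OF PS[OF i]]
  define F where "F = (\<Prod>j\<in>{..<d} - {i}. ?l j)"
  have prod: "(\<Prod>i<d. ?l i) = ?l i * F" unfolding F_def using i by (intro prod.remove) auto
  have "dvn a b c (?l i) * F = ?l i * (- dvn a b c F)"
    using z unfolding prod dvn_mult by (simp add: eq_neg_iff_add_eq_0)
  then have "?l i dvd dvn a b c (?l i) * F" by simp
  moreover have "\<not> ?l i dvd F"
  proof
    assume "?l i dvd F"
    have ex: "\<exists>j\<in>A. ?l i dvd ?l j" if "finite A" "?l i dvd (\<Prod>j\<in>A. ?l j)" for A
      using that
    proof (induction A rule: finite_induct)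
      case empty
      then show ?case using linform_dvd_Cst[of "lf (Ls ! i)" 1] by simp
    next
      case (insert k A)
      then have "?l i dvd ?l k * (\<Prod>j\<in>A. ?l j)" by simp
      then show ?case using linform_prime[OF v0] insert.IH by blast
    qed
    have "\<exists>j\<in>{..<d} - {i}. ?l i dvd ?l j"
      by (rule ex) (use \<open>?l i dvd F\<close> in \<open>simp_all only: F_def finite_Diff finite_lessThan\<close>)
    then obtain j where j: "j < d" "j \<noteq> i" "?l i dvd ?l j" by blast
    have "line (Ls ! i) \<subseteq> line (Ls ! j)"
    proof
      fix q assume "q \<in> line (Ls ! i)"
      then have q: "q \<in> P2" "dot3 (lf (Ls ! i)) (($) (rep q)) = 0" using line_iff[OF PS[OF i]] by auto
      obtain k where "?l j = ?l i * k" using j(3) by (elim dvdE)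
      then have "ev (($) (rep q)) (?l j) = ev (($) (rep q)) (?l i * k)" by simp
      then have "dot3 (lf (Ls ! j)) (($) (rep q)) = 0" using q(2) by (simp add: dot3_def sum_3)
      then show "q \<in> line (Ls ! j)" using line_iff[OF PS[OF j(1)]] q(1) by simp
    qed
    then have "Ls ! i = Ls ! j" by (rule line_subset_imp_eq[OF PS[OF i] PS[OF j(1)]])
    then show False using ne[OF i j(1)] j(2) by simp
  qed
  ultimately show ?thesis using linform_prime[OF v0] by blast
qed

lemma cv_dvd_cv:
  assumes "independent_pair p q" "independent_pair q p" shows "\<not> linform (cv p) dvd linform (cv q)"
proof
  assume d: "linform (cv p) dvd linform (cv q)"
  have P: "pl (cv p) \<in> PS 1" "pl (cv q) \<in> PS 1"
    using independent_pair_nonzero[OF assms(1)] independent_pair_nonzero[OF assms(2)] pl_PS by blast+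
  obtain c where c: "c \<noteq> 0" "lf (pl (cv p)) = (\<lambda>v. c * cv p v)"
    using lf_pl[OF independent_pair_nonzero[OF assms(1)]] by blast
  obtain e where e: "e \<noteq> 0" "lf (pl (cv q)) = (\<lambda>v. e * cv q v)"
    using lf_pl[OF independent_pair_nonzero[OF assms(2)]] by blast
  have "line (pl (cv p)) \<subseteq> line (pl (cv q))"
  proof
    fix t assume "t \<in> line (pl (cv p))"
    then have t: "t \<in> P2" "c * dot3 (cv p) (($) (rep t)) = 0"
      using line_iff[OF P(1)] c(2) by (auto simp: dot3_def distrib_left mult.assoc)
    obtain k where "linform (cv q) = linform (cv p) * k" using d by (elim dvdE)
    then have "ev (($) (rep t)) (linform (cv q)) = ev (($) (rep t)) (linform (cv p) * k)" by simp
    then have "dot3 (cv q) (($) (rep t)) = 0" using t(2) c(1) by (simp add: dot3_def sum_3)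
    then have "e * dot3 (cv q) (($) (rep t)) = 0" by simp
    then show "t \<in> line (pl (cv q))" using line_iff[OF P(2)] t(1) e(2) by (simp add: dot3_def distrib_left mult.assoc)
  qed
  then have "pl (cv p) = pl (cv q)" by (rule line_subset_imp_eq[OF P])
  then show False using independent_pair_pl[OF assms] by simp
qed

lemma three_lines_dvd:
  assumes ind: "independent_pair p q" "independent_pair q p" "independent_pair p r" "independent_pair r p"
     "independent_pair q r" "independent_pair r q"
    and d: "linform (cv p) dvd F" "linform (cv q) dvd F" "linform (cv r) dvd F"
  shows "linform (cv p) * linform (cv q) * linform (cv r) dvd F"
proof -
  note v = independent_pair_nonzero[OF ind(2)] independent_pair_nonzero[OF ind(4)]
  obtain G where G: "F = linform (cv p) * G" using d(1) by (elim dvdE)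
  have "linform (cv q) dvd G"
    using linform_prime[OF v(1)] d(2) cv_dvd_cv[OF ind(2,1)] unfolding G by blast
  then obtain H where H: "G = linform (cv q) * H" by (elim dvdE)
  have "linform (cv r) dvd linform (cv p) * linform (cv q) * H" using d(3) unfolding G H by (simp only: mult.assoc)
  then have "linform (cv r) dvd H"
    using linform_prime[OF v(2)] cv_dvd_cv[OF ind(4,3)] cv_dvd_cv[OF ind(6,5)] by blast
  then show ?thesis unfolding G H by (simp only: mult.assoc mult_dvd_mono dvd_refl)
qed

lemma hom_cancel:
  assumes "homogeneous (k + e) (F * G)" "homogeneous e G" "G \<noteq> 0"
  shows "homogeneous k (F :: S)"
  unfolding homogeneous_def
proof
  fix m assume m: "m \<in> supp F"
  show "mdegree m = k"
  proof (rule ccontr)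
    assume "mdegree m \<noteq> k"
    have "part mdegree (mdegree m + e) (F * G) = part mdegree (mdegree m) F * G"
      by (rule part_mult) (use assms(2) in \<open>simp_all add: mdegree_add homogeneous_graded\<close>)
    moreover have "part mdegree (mdegree m + e) (F * G) = 0"
      using part_graded[of mdegree "k + e" "F * G" "mdegree m + e"] assms(1) \<open>mdegree m \<noteq> k\<close>
      by (simp add: homogeneous_graded)
    ultimately have "part mdegree (mdegree m) F = 0" using assms(3) by simp
    then have "coef (part mdegree (mdegree m) F) m = 0" by simp
    then show False using m by (simp add: coef_part in_keys_iff)
  qed
qed

definition mn :: "nat \<Rightarrow> nat \<Rightarrow> nat \<Rightarrow> 3 monom" where
  "mn i j k = term_of 1 i + term_of 2 j + term_of 3 k"

lemma coef_mn [simp]: "coef (mn i j k) 1 = i" "coef (mn i j k) 2 = j" "coef (mn i j k) 3 = k"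
  by (simp_all add: mn_def lookup_add lookup_single)

lemma mn_eq: "m = mn (coef m 1) (coef m 2) (coef m 3)"
proof (rule poly_mapping_eqI)
  fix v show "coef m v = coef (mn (coef m 1) (coef m 2) (coef m 3)) v" using exhaust_3[of v] by auto
qed

lemma mn_add: "mn i j k + mn a b c = mn (i + a) (j + b) (k + c)"
  by (simp add: mn_def single_add ac_simps)

lemma mdegree_mn: "mdegree (mn i j k) = i + j + k" by (simp add: mn_def mdegree_add)

definition mt :: "complex \<Rightarrow> nat \<Rightarrow> nat \<Rightarrow> nat \<Rightarrow> S" where "mt c i j k = term_of (mn i j k) c"

lemma mt_alt: "mt c i j k = Cst c * Var 1 ^ i * Var 2 ^ j * Var 3 ^ k"
  by (simp add: mt_def term_eq_prod mn_def monom_val_add mult.assoc)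

lemma coef_mt_mult: "coef (mt c i j k * F) (mn a b e)
  = (if i \<le> a \<and> j \<le> b \<and> k \<le> e then c * coef F (mn (a - i) (b - j) (e - k)) else 0)"
proof (cases "i \<le> a \<and> j \<le> b \<and> k \<le> e")
  case True
  then have "mn a b e = mn i j k + mn (a - i) (b - j) (e - k)" by (simp add: mn_add)
  then show ?thesis using True by (simp only: mt_def coef_term_mult) simp
next
  case False
  have "\<nexists>m. mn a b e = mn i j k + m"
  proof
    assume "\<exists>m. mn a b e = mn i j k + m"
    then obtain m where m: "mn a b e = mn i j k + m" ..
    have "coef (mn a b e) v = coef (mn i j k) v + coef m v" for v unfolding m by (simp add: lookup_add)
    from this[of 1] this[of 2] this[of 3] False show False by simp
  qed
  then have "coef (mt c i j k * F) (mn a b e) = 0" unfolding mt_def by (rule coef_term_mult_eq_0)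
  then show ?thesis using False by (simp only: if_False)
qed

text \<open>What is left of the system for the coefficients of \<open>U, V, W\<close> in
  \<open>cubic_relation_trivial\<close> once the obvious consequences of the equations with one or
  two terms have been used. It has full rank because the six points are not on a conic.\<close>

lemma linear_system:
  fixes a b g p q r s t w :: real
  assumes "-7 * r + 12 * q + 2 * s - 11 * a = 0"
    and "-14 * q + a - 11 * b = 0"
    and "r + b - 2 * t = 0"
    and "6 * w - 3 * r - 12 * p - 17 * a = 0"
    and "-7 * w + s - 17 * b - 11 * g = 0"
    and "-2 * a + g - 11 * t = 0"
    and "w - 2 * b - 11 * q - 2 * p = 0"
    and "-7 * a + 6 * r - 6 * p - 17 * g = 0"
    and "-7 * b - 2 * s - 17 * t = 0"
    and "-2 * g - 17 * q - 11 * p = 0"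
    and "-7 * g + 3 * r + 12 * p - 6 * t = 0"
    and "s + 6 * q + 17 * p = 0"
  shows "a = 0 \<and> b = 0 \<and> g = 0 \<and> p = 0 \<and> q = 0 \<and> r = 0 \<and> s = 0 \<and> t = 0 \<and> w = 0"
  using assms by (intro conjI; linarith)

lemma linear_system_complex:
  fixes a b g p q r s t w :: complex
  assumes "-7 * r + 12 * q + 2 * s - 11 * a = 0"
    and "-14 * q + a - 11 * b = 0"
    and "r + b - 2 * t = 0"
    and "6 * w - 3 * r - 12 * p - 17 * a = 0"
    and "-7 * w + s - 17 * b - 11 * g = 0"
    and "-2 * a + g - 11 * t = 0"
    and "w - 2 * b - 11 * q - 2 * p = 0"
    and "-7 * a + 6 * r - 6 * p - 17 * g = 0"
    and "-7 * b - 2 * s - 17 * t = 0"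
    and "-2 * g - 17 * q - 11 * p = 0"
    and "-7 * g + 3 * r + 12 * p - 6 * t = 0"
    and "s + 6 * q + 17 * p = 0"
  shows "a = 0 \<and> b = 0 \<and> g = 0 \<and> p = 0 \<and> q = 0 \<and> r = 0 \<and> s = 0 \<and> t = 0 \<and> w = 0"
proof -
  have part: "G a = 0 \<and> G b = 0 \<and> G g = 0 \<and> G p = 0 \<and> G q = 0 \<and> G r = 0 \<and> G s = 0 \<and> G t = 0 \<and> G w = 0"
    if G: "\<And>x y. G (x + y) = G x + G y" "\<And>x y. G (x - y) = G x - G y" "\<And>x. G (- x) = - G x"
      "\<And>n x. G (numeral n * x) = numeral n * G x"
      "\<And>n x. G (- numeral n * x) = - numeral n * G x" "G 0 = 0" for G :: "complex \<Rightarrow> real"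
    by (rule linear_system[OF assms[THEN arg_cong[of _ _ G], unfolded G]])
  show ?thesis using part[of Re] part[of Im] by (simp add: complex_eq_iff)
qed

lemma S_deg_3_eq_0:
  assumes F: "homogeneous 3 F" and z: "\<And>i j k. i + j + k = 3 \<Longrightarrow> coef F (mn i j k) = 0"
  shows "F = 0"
proof (rule poly_mapping_eqI)
  fix m
  have "coef F m = 0" if "m \<in> supp F"
  proof -
    have "mdegree m = 3" using F that by (simp add: homogeneous_def)
    then have "coef m 1 + coef m 2 + coef m 3 = 3" using mdegree_mn mn_eq by metis
    then show ?thesis using z mn_eq by metis
  qed
  then show "coef F m = coef 0 m" by (auto simp: in_keys_iff)
qed

lemma cubic_exponents:
  assumes "i + j + k = (3::nat)"
  shows "(i, j, k) \<in> {(0,0,3), (0,1,2), (0,2,1), (0,3,0), (1,0,2), (1,1,1), (1,2,0), (2,0,1), (2,1,0), (3,0,0)}"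
proof -
  have "i = 0 \<or> i = 1 \<or> i = 2 \<or> i = 3" "j = 0 \<or> j = 1 \<or> j = 2 \<or> j = 3" "k = 3 - (i + j)"
    using assms by linarith+
  then show ?thesis using assms by (elim disjE) simp_all
qed

lemma triple_products:
  "Var 1 * (linform (cv (0, -1, 2)) * linform (cv (0, 1, 3)) * linform (cv (0, -1, 1)))
    = mt 1 1 3 0 + mt (-7) 1 1 2 + mt 6 1 0 3"
  "Var 2 * (linform (cv (1, 0, 1)) * linform (cv (-1, 0, 1)) * linform (cv (1, 0, 2)))
    = mt (-1) 3 1 0 + mt (-2) 2 1 1 + mt 1 1 1 2 + mt 2 0 1 3"
  "Var 3 * (linform (cv (-2, -1, 0)) * linform (cv (-3, -1, 0)) * linform (cv (-1, -2, 0)))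
    = mt (-6) 3 0 1 + mt (-17) 2 1 1 + mt (-11) 1 2 1 + mt (-2) 0 3 1"
  unfolding linform_cv mt_alt by (simp_all add: Cst_numeral Cst_minus algebra_simps power2_eq_square power3_eq_cube)

text \<open>Comparing coefficients gives a linear system with 30 unknowns. The factors are the
  products \<open>x P\<close>, \<open>y Q\<close> and \<open>z R\<close> for \<open>generic\<close>,
  see \<open>triple_products\<close>.\<close>

lemma cubic_relation_trivial:
  assumes hom: "homogeneous 3 U" "homogeneous 3 V" "homogeneous 3 W"
    and rel: "(mt 1 1 3 0 + mt (-7) 1 1 2 + mt 6 1 0 3) * U
      + (mt (-1) 3 1 0 + mt (-2) 2 1 1 + mt 1 1 1 2 + mt 2 0 1 3) * V
      + (mt (-6) 3 0 1 + mt (-17) 2 1 1 + mt (-11) 1 2 1 + mt (-2) 0 3 1) * W = 0"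
  shows "U = 0" "V = 0" "W = 0"
proof -
  have E: "coef ((mt 1 1 3 0 + mt (-7) 1 1 2 + mt 6 1 0 3) * U
      + (mt (-1) 3 1 0 + mt (-2) 2 1 1 + mt 1 1 1 2 + mt 2 0 1 3) * V
      + (mt (-6) 3 0 1 + mt (-17) 2 1 1 + mt (-11) 1 2 1 + mt (-2) 0 3 1) * W) (mn a b e) = 0" for a b e
    unfolding rel by simp
  define u v w where "u = (\<lambda>i j k. coef U (mn i j k))" and "v = (\<lambda>i j k. coef V (mn i j k))"
    and "w = (\<lambda>i j k. coef W (mn i j k))"
  have coefs: "coef U (mn i j k) = u i j k" "coef V (mn i j k) = v i j k" "coef W (mn i j k) = w i j k" for i j k
    by (simp_all only: u_def v_def w_def)
  note E' = E[unfolded distrib_right lookup_add coef_mt_mult coefs]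
  note [simp] = One_nat_def[symmetric]
  have z0: "v 3 0 0 = 0" using E'[of 6 1 0] by simp
  have z1: "w 3 0 0 = 0" using E'[of 6 0 1] by simp
  have z2: "v 2 1 0 = 0" using E'[of 5 2 0] by simp
  have z3: "w 2 0 1 = 0" using E'[of 5 0 2] by simp
  have z4: "u 1 2 0 = 0" using E'[of 2 5 0] by simp
  have z5: "u 1 0 2 = 0" using E'[of 2 0 5] by simp
  have z6: "u 0 3 0 = 0" using E'[of 1 6 0] by simp
  have z7: "u 0 0 3 = 0" using E'[of 1 0 6] by simp
  have z8: "w 0 3 0 = 0" using E'[of 0 6 1] z6 by simp
  have z9: "w 0 2 1 = 0" using E'[of 0 5 2] by simp
  have z10: "v 0 1 2 = 0" using E'[of 0 2 5] by simp
  have z11: "v 0 0 3 = 0" using E'[of 0 1 6] by simp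
  note z = z0 z1 z2 z3 z4 z5 z6 z7 z8 z9 z10 z11
  have p0: "v 0 2 1 = w 0 0 3" using E'[of 0 3 4] by (simp add: z)
  have p1: "v 0 3 0 = w 0 1 2" using E'[of 0 4 3] by (simp add: z)
  have p2: "u 2 0 1 = w 0 0 3" using E'[of 3 0 4] by (simp add: z)
  have p3: "u 2 1 0 = v 0 3 0" using E'[of 3 4 0] by (simp add: z)
  have p4: "u 3 0 0 = w 1 0 2" using E'[of 4 0 3] by (simp add: z)
  have p5: "u 3 0 0 = v 1 2 0" using E'[of 4 3 0] by (simp add: z)
  have p6: "v 2 0 1 = - 6 * w 2 1 0" using E'[of 5 1 1] by (simp add: z; algebra)
  have p7: "u 0 2 1 = 2 * w 1 2 0" using E'[of 1 5 1] by (simp add: z; algebra)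
  have p8: "v 1 0 2 = - 3 * u 0 1 2" using E'[of 1 1 5] by (simp add: z; algebra)
  have p: "u 2 1 0 = w 0 1 2" "v 1 2 0 = w 1 0 2" using p1 p3 p4 p5 by simp_all
  note ps = p0 p1 p2 p4 p6 p7 p8 p
  have e0: "-7 * u 0 1 2 + 12 * w 1 2 0 + 2 * v 1 1 1 - 11 * w 0 0 3 = 0" using E'[of 1 2 4]
    by (simp add: z ps; algebra)
  have e1: "-14 * w 1 2 0 + w 0 0 3 - 11 * w 0 1 2 = 0" using E'[of 1 3 3]
    by (simp add: z ps; algebra)
  have e2: "u 0 1 2 + w 0 1 2 - 2 * w 1 1 1 = 0" using E'[of 1 4 2]
    by (simp add: z ps; algebra)
  have e3: "6 * u 1 1 1 - 3 * u 0 1 2 - 12 * w 2 1 0 - 17 * w 0 0 3 = 0" using E'[of 2 1 4]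
    by (simp add: z ps; algebra)
  have e4: "-7 * u 1 1 1 + v 1 1 1 - 17 * w 0 1 2 - 11 * w 1 0 2 = 0" using E'[of 2 2 3]
    by (simp add: z ps; algebra)
  have e5: "-2 * w 0 0 3 + w 1 0 2 - 11 * w 1 1 1 = 0" using E'[of 2 3 2]
    by (simp add: z ps; algebra)
  have e6: "u 1 1 1 - 2 * w 0 1 2 - 11 * w 1 2 0 - 2 * w 2 1 0 = 0" using E'[of 2 4 1]
    by (simp add: z ps; algebra)
  have e7: "-7 * w 0 0 3 + 6 * u 0 1 2 - 6 * w 2 1 0 - 17 * w 1 0 2 = 0" using E'[of 3 1 3]
    by (simp add: z ps; algebra)
  have e8: "-7 * w 0 1 2 - 2 * v 1 1 1 - 17 * w 1 1 1 = 0" using E'[of 3 2 2]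
    by (simp add: z ps; algebra)
  have e9: "-2 * w 1 0 2 - 17 * w 1 2 0 - 11 * w 2 1 0 = 0" using E'[of 3 3 1]
    by (simp add: z ps; algebra)
  have e10: "-7 * w 1 0 2 + 3 * u 0 1 2 + 12 * w 2 1 0 - 6 * w 1 1 1 = 0" using E'[of 4 1 2]
    by (simp add: z ps; algebra)
  have "-1 * v 1 1 1 + (-6 * w 1 2 0 + -17 * w 2 1 0) = 0" using E'[of 4 2 1] by (simp add: z ps)
  then have e11: "v 1 1 1 + 6 * w 1 2 0 + 17 * w 2 1 0 = 0" by algebra
  note zero = linear_system_complex[OF e0 e1 e2 e3 e4 e5 e6 e7 e8 e9 e10 e11]
  show "U = 0" by (rule S_deg_3_eq_0[OF hom(1)]) (drule cubic_exponents, use zero z ps in \<open>auto simp: coefs\<close>)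
  show "V = 0" by (rule S_deg_3_eq_0[OF hom(2)]) (drule cubic_exponents, use zero z ps in \<open>auto simp: coefs\<close>)
  show "W = 0" by (rule S_deg_3_eq_0[OF hom(3)]) (drule cubic_exponents, use zero z ps in \<open>auto simp: coefs\<close>)
qed

text \<open>Let \<open>\<theta> = (a, b, c)\<close> annihilate \<open>f\<close>. A line \<open>l = q
  y + r z\<close> through the first coordinate point divides \<open>\<theta>(l) = q b + r c\<close>,
  hence it also divides \<open>z b - y c\<close>. So the cross product of \<open>(x, y, z)\<close>
  with \<open>\<theta>\<close> is, up to sign, \<open>(P U, Q V, R W)\<close> with cubics \<open>U,
  V, W\<close>, and \<open>x P U + y Q V + z R W = 0\<close>. As this relation is trivial,
  \<open>\<theta>\<close> is proportional to the Euler field, which multiplies \<open>f\<close> by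
  \<open>9\<close>; so \<open>\<theta> = 0\<close>.\<close>

lemma generic_no_syzygy: "\<not> syz 5 (form generic)"
proof
  assume "syz 5 (form generic)"
  then obtain a b c where abc: "a \<in> S_deg 5" "b \<in> S_deg 5" "c \<in> S_deg 5" "(a, b, c) \<noteq> (0, 0, 0)"
    "dvn a b c (form generic) = 0" unfolding syz_def dvn_def by blast
  let ?x = "Var 1 :: S" and ?y = "Var 2 :: S" and ?z = "Var 3 :: S"
  have f0: "form generic \<noteq> 0"
  proof -
    have "linform (cv p) \<noteq> 0" if "p \<in> set generic" for p
    proof -
      have "\<exists>v. cv p v \<noteq> 0"
        using that by (auto simp: generic_def cv_def intro: exI[of _ 1] exI[of _ 2])
      then show ?thesis unfolding linform_eq_0_iff by simp
    qed
    then show ?thesis unfolding form_def prod_list_eq_0_iff' set_map by (metis imageE)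
  qed
  have fh: "homogeneous 9 (form generic)"
    unfolding form_def using hom_prod_list[of "map (\<lambda>p. linform (cv p)) generic"] hom_linform
    by (simp add: length_9 image_iff) blast
  have div: "linform (cv p) dvd dvn a b c (linform (cv p))" if p: "p \<in> set generic" for p
  proof -
    obtain i where i: "i < 9" "p = generic ! i" using p length_9 by (metis in_set_conv_nth)
    obtain k where k: "k \<noteq> 0" "rep (psi (arrangement generic)) = Cst k * (\<Prod>i<9. linform (lf (arrangement generic ! i)))"
      using rep_psi X_space_tuples arrangements_X_space(2) by blast
    obtain k' where k': "k' \<noteq> 0" "rep (psi (arrangement generic)) = Cst k' * form generic"
      unfolding psi_arrangement by (rule rep_pclass)
    have dc: "dvn a b c (Cst e * F) = Cst e * dvn a b c F" for e F
      unfolding dvn_def pd_Cst_mult by (simp add: algebra_simps)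
    have "Cst k * dvn a b c (\<Prod>i<9. linform (lf (arrangement generic ! i))) = 0"
      unfolding dc[symmetric] k(2)[symmetric] k'(2) dc abc(5) by simp
    then have "dvn a b c (\<Prod>i<9. linform (lf (arrangement generic ! i))) = 0" using k(1) by simp
    from dvn_divides[OF arrangements_X_space(2) this i(1)]
    have d: "linform (lf (arrangement generic ! i)) dvd dvn a b c (linform (lf (arrangement generic ! i)))" .
    have "\<exists>v. cv p v \<noteq> 0"
      using p by (auto simp: generic_def cv_def intro: exI[of _ 1] exI[of _ 2])
    then obtain e where e: "e \<noteq> 0" "lf (pl (cv p)) = (\<lambda>v. e * cv p v)" using lf_pl by blast
    have "lf (arrangement generic ! i) = (\<lambda>v. e * cv p v)"
      using e(2) i length_9 by (simp add: arrangement_def)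
    then have d2: "Cst e * linform (cv p) dvd Cst e * dvn a b c (linform (cv p))"
      using d by (simp only: linform_scale dc)
    have "Cst e \<noteq> (0 :: S)" using e(1) by simp
    then show ?thesis using d2 by (simp only: dvd_mult_cancel_left) blast
  qed
  define wU wV wW where "wU = ?z * b - ?y * c" and "wV = ?x * c - ?z * a" and "wW = ?y * a - ?x * b"
  have lin: "linform (cv (p, q, r)) dvd F"
    if "(p, q, r) \<in> set generic" "of_int n * F = G * dvn a b c (linform (cv (p, q, r))) + H * linform (cv (p, q, r))"
      "n \<noteq> 0" for p q r n F G H
  proof -
    have "linform (cv (p, q, r)) dvd Cst (of_int n) * F"
      unfolding Cst_of_int that(2) using div[OF that(1)] by simp
    then have "linform (cv (p, q, r)) dvd Cst (1 / of_int n) * (Cst (of_int n) * F)" by (rule dvd_mult)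
    then show ?thesis using that(3) by (subst (asm) Cst_mult_cancel) simp_all
  qed

  have d00: "linform (cv (0, -1, 2)) dvd wU"
    by (rule lin[where n = "-1" and G = "?z" and H = "- c"])
      (simp_all only: dvn_cv, simp_all add: generic_def linform_cv wU_def algebra_simps)
  have d01: "linform (cv (0, 1, 3)) dvd wU"
    by (rule lin[where n = "1" and G = "?z" and H = "- c"])
      (simp_all only: dvn_cv, simp_all add: generic_def linform_cv wU_def algebra_simps)
  have d02: "linform (cv (0, -1, 1)) dvd wU"
    by (rule lin[where n = "-1" and G = "?z" and H = "- c"])
      (simp_all only: dvn_cv, simp_all add: generic_def linform_cv wU_def algebra_simps)
  have d10: "linform (cv (1, 0, 1)) dvd wV"
    by (rule lin[where n = "1" and G = "?x" and H = "- a"])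
      (simp_all only: dvn_cv, simp_all add: generic_def linform_cv wV_def algebra_simps)
  have d11: "linform (cv (-1, 0, 1)) dvd wV"
    by (rule lin[where n = "1" and G = "?x" and H = "- a"])
      (simp_all only: dvn_cv, simp_all add: generic_def linform_cv wV_def algebra_simps)
  have d12: "linform (cv (1, 0, 2)) dvd wV"
    by (rule lin[where n = "2" and G = "?x" and H = "- a"])
      (simp_all only: dvn_cv, simp_all add: generic_def linform_cv wV_def algebra_simps)
  have d20: "linform (cv (-2, -1, 0)) dvd wW"
    by (rule lin[where n = "-2" and G = "?y" and H = "- b"])
      (simp_all only: dvn_cv, simp_all add: generic_def linform_cv wW_def algebra_simps)
  have d21: "linform (cv (-3, -1, 0)) dvd wW"
    by (rule lin[where n = "-3" and G = "?y" and H = "- b"])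
      (simp_all only: dvn_cv, simp_all add: generic_def linform_cv wW_def algebra_simps)
  have d22: "linform (cv (-1, -2, 0)) dvd wW"
    by (rule lin[where n = "-1" and G = "?y" and H = "- b"])
      (simp_all only: dvn_cv, simp_all add: generic_def linform_cv wW_def algebra_simps)
  have "linform (cv (0, -1, 2)) * linform (cv (0, 1, 3)) * linform (cv (0, -1, 1)) dvd wU"
    by (rule three_lines_dvd[OF _ _ _ _ _ _ d00 d01 d02]) (simp_all add: independent_pair_def)
  then obtain U where U: "wU = U * (linform (cv (0, -1, 2)) * linform (cv (0, 1, 3)) * linform (cv (0, -1, 1)))" by (metis dvd_def mult.commute)
  have "linform (cv (1, 0, 1)) * linform (cv (-1, 0, 1)) * linform (cv (1, 0, 2)) dvd wV"
    by (rule three_lines_dvd[OF _ _ _ _ _ _ d10 d11 d12]) (simp_all add: independent_pair_def)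
  then obtain V where V: "wV = V * (linform (cv (1, 0, 1)) * linform (cv (-1, 0, 1)) * linform (cv (1, 0, 2)))" by (metis dvd_def mult.commute)
  have "linform (cv (-2, -1, 0)) * linform (cv (-3, -1, 0)) * linform (cv (-1, -2, 0)) dvd wW"
    by (rule three_lines_dvd[OF _ _ _ _ _ _ d20 d21 d22]) (simp_all add: independent_pair_def)
  then obtain W where W: "wW = W * (linform (cv (-2, -1, 0)) * linform (cv (-3, -1, 0)) * linform (cv (-1, -2, 0)))" by (metis dvd_def mult.commute)
  have hw: "homogeneous 6 wU" "homogeneous 6 wV" "homogeneous 6 wW"
  proof -
    have "homogeneous 6 (Var v * F)" if "F \<in> S_deg 5" for v and F :: S
      using hom_mult[OF hom_Var[of v], of 5 F] that by (simp add: S_deg_def)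
    then show "homogeneous 6 wU" "homogeneous 6 wV" "homogeneous 6 wW"
      unfolding wU_def wV_def wW_def using abc(1-3) by (auto intro: hom_diff)
  qed
  have three: "homogeneous 3 (linform (cv p) * linform (cv q) * linform (cv r))" for p q r
    using hom_mult[OF hom_mult[OF hom_linform hom_linform] hom_linform, of "cv p" "cv q" "cv r"] by simp
  have nz: "linform (cv p) \<noteq> 0" if "p \<in> set generic" for p
    using f0 that unfolding form_def prod_list_eq_0_iff' by force
  have hU: "homogeneous 3 U" and hV: "homogeneous 3 V" and hW: "homogeneous 3 W"
    by (rule hom_cancel[where e = 3, OF _ three], use hw(1) U in simp, use nz in \<open>simp add: generic_def\<close>)
      (rule hom_cancel[where e = 3, OF _ three], use hw(2) V in simp, use nz in \<open>simp add: generic_def\<close>,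
       rule hom_cancel[where e = 3, OF _ three], use hw(3) W in simp, use nz in \<open>simp add: generic_def\<close>)
  have "?x * wU + ?y * wV + ?z * wW = 0" unfolding wU_def wV_def wW_def by (simp add: algebra_simps)
  then have rel: "(?x * (linform (cv (0, -1, 2)) * linform (cv (0, 1, 3)) * linform (cv (0, -1, 1)))) * U
      + (?y * (linform (cv (1, 0, 1)) * linform (cv (-1, 0, 1)) * linform (cv (1, 0, 2)))) * V
      + (?z * (linform (cv (-2, -1, 0)) * linform (cv (-3, -1, 0)) * linform (cv (-1, -2, 0)))) * W = 0"
    unfolding U V W by (simp only: ac_simps)
  note zero = cubic_relation_trivial[OF hU hV hW rel[unfolded triple_products]]
  have w0: "wU = 0" "wV = 0" "wW = 0" using U V W zero by simp_all
  have eul: "?x * pderivative 1 (form generic) + ?y * pderivative 2 (form generic) + ?z * pderivative 3 (form generic)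
      = of_nat 9 * form generic"
    using euler[OF fh] by (simp add: sum_3)
  have zb: "?z * b = ?y * c" and xc: "?x * c = ?z * a" and ya: "?y * a = ?x * b"
    using w0 by (simp_all add: wU_def wV_def wW_def)
  have key: "of_nat 9 * form generic * g = 0"
    if "?x * g = v * a" "?y * g = v * b" "?z * g = v * c" for g v
  proof -
    have "of_nat 9 * form generic * g = (?x * g) * pderivative 1 (form generic)
        + (?y * g) * pderivative 2 (form generic) + (?z * g) * pderivative 3 (form generic)"
      unfolding eul[symmetric] by (simp only: algebra_simps)
    also have "\<dots> = v * dvn a b c (form generic)" unfolding that dvn_def by (simp only: algebra_simps)
    finally have "of_nat 9 * form generic * g = v * dvn a b c (form generic)" .
    then show ?thesis using abc(5) by simp
  qed
  have nine: "of_nat 9 * form generic \<noteq> 0" using f0 by simp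
  have "a = 0" using key[of a ?x] ya xc nine by (simp add: mult.commute)
  moreover have "b = 0" using key[of b ?y] ya zb nine by (simp add: mult.commute)
  moreover have "c = 0" using key[of c ?z] xc zb nine by (simp add: mult.commute)
  ultimately show False using abc(4) by simp
qed

section \<open>Different minimal values within one stratum\<close>

lemma syz_mono:
  assumes "syz r f" "r \<le> s" shows "syz s f"
proof -
  obtain a b c where abc: "a \<in> S_deg r" "b \<in> S_deg r" "c \<in> S_deg r" "(a, b, c) \<noteq> (0, 0, 0)"
    "a * pderivative 1 f + b * pderivative 2 f + c * pderivative 3 f = 0" using assms(1) unfolding syz_def by blast
  let ?t = "Var 1 ^ (s - r) :: S"
  have t: "F * ?t \<in> S_deg s" if "F \<in> S_deg r" for F
    using hom_mult[of r F "(s - r) * 1" ?t] hom_power[OF hom_Var, of "s - r" 1] that assms(2) by (simp add: S_deg_def)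
  have "Var 1 \<noteq> (0 :: S)" by (simp add: Var_def) (metis lookup_single_eq lookup_zero zero_neq_one)
  then have "(a * ?t, b * ?t, c * ?t) \<noteq> (0, 0, 0)" using abc(4) by simp
  moreover have "a * ?t * pderivative 1 f + b * ?t * pderivative 2 f + c * ?t * pderivative 3 f
      = (a * pderivative 1 f + b * pderivative 2 f + c * pderivative 3 f) * ?t" by (simp add: algebra_simps)
  ultimately show ?thesis unfolding syz_def using t abc by (metis mult_zero_left)
qed

text \<open>The conic arrangement has the smaller \<open>mdr\<close>, so the other one is not in the
  minimal locus. For \<open>m\<^sub>1\<^sub>3\<close> it is the opposite: a syzygy of degree 5
  lowers the rank of the partial derivatives in degree 13.\<close>

lemma invariants_vary:
  "\<exists>L\<in>lattices 9. mdr_locus 9 L \<noteq> A_lat 9 L \<and> milnor_locus 13 9 L \<noteq> A_lat 9 L"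
proof -
  let ?I = "intersection_lattice"
  let ?C = "arrangement conical" and ?G = "arrangement generic"
  define L where "L = {\<Lambda> \<in> ?I ` X_space 9. lattice_iso (?I ?C) \<Lambda>}"
  have L: "L \<in> lattices 9" unfolding L_def by (rule lattice_class_in_lattices[OF arrangements_X_space(1)])
  have mem: "psi ?C \<in> A_lat 9 L" "psi ?G \<in> A_lat 9 L"
    using arrangements_X_space same_lattice lattice_iso_refl[of "?I ?C"] unfolding A_lat_def X_lat_def L_def by blast+
  have PS: "psi ?C \<in> PS 9" "psi ?G \<in> PS 9" using mem A_lat_PS by blast+
  define f g where "f = rep (psi ?C)" and "g = rep (psi ?G)"
  have fg: "f \<in> S_deg 9" "g \<in> S_deg 9" unfolding f_def g_def using PS PS_rep(1) by blast+
  have sf: "syz 5 f"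
  proof -
    obtain c where "c \<noteq> 0" "f = Cst c * form conical" unfolding f_def psi_arrangement by (rule rep_pclass)
    then show ?thesis using conical_syzygy unfolding syz_iff by (simp add: jindep_scale)
  qed
  have sg: "\<not> syz 5 g"
  proof -
    obtain c where "c \<noteq> 0" "g = Cst c * form generic" unfolding g_def psi_arrangement by (rule rep_pclass)
    then show ?thesis using generic_no_syzygy unfolding syz_iff by (simp add: jindep_scale)
  qed
  have f5: "mdr f \<le> 5" unfolding mdr_Least by (rule Least_le[of "\<lambda>r. syz r f", OF sf])
  have g5: "\<not> mdr g \<le> 5"
  proof
    assume "mdr g \<le> 5"
    moreover have "syz (mdr g) g" unfolding mdr_Least using syz_exists[OF fg(2)] by (rule LeastI_ex)
    ultimately show False using syz_mono sg by blast
  qed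
  have "psi ?G \<notin> mdr_locus 9 L"
  proof
    assume "psi ?G \<in> mdr_locus 9 L"
    then have "mdr g \<le> mdr f" using mem(1) unfolding mdr_locus_def min_locus_def f_def g_def by blast
    then show False using f5 g5 by simp
  qed
  moreover have "psi ?C \<notin> milnor_locus 13 9 L"
  proof -
    have J: "Jset 9 13 = UNIV \<times> Mon 5" unfolding Jset_def Mon_def by (intro arg_cong2[of _ _ _ _ "(\<times>)"]) auto
    obtain J0 where J0: "J0 \<subseteq> Jset 9 13" "jindep J0 f" "milnor_dim 13 f + card J0 = card (Mon 13 :: 3 monom set)"
      using milnor_dim_rank[OF fg(1), of 13] by blast
    obtain J1 where J1: "J1 \<subseteq> Jset 9 13 \<and> jindep J1 g \<and> milnor_dim 13 g + card J1 = card (Mon 13 :: 3 monom set)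
      \<and> (\<forall>J. J \<subseteq> Jset 9 13 \<longrightarrow> jindep J g \<longrightarrow> card J \<le> card J1)"
      using milnor_dim_rank[OF fg(2), of 13] by (elim exE)
    have "J0 \<noteq> Jset 9 13" using J0(2) sf unfolding syz_iff J by auto
    then have "card J0 < card (Jset 9 13)" using J0(1) by (intro psubset_card_mono) auto
    also have "\<dots> \<le> card J1" using J1 sg unfolding syz_iff J by blast
    finally have less: "milnor_dim 13 g < milnor_dim 13 f" using J0(3) J1 by linarith
    show ?thesis
    proof
      assume "psi ?C \<in> milnor_locus 13 9 L"
      then have "milnor_dim 13 f \<le> milnor_dim 13 g"
        using mem(2) unfolding milnor_locus_def min_locus_def f_def g_def by blast
      then show False using less by simp
    qed
  qed
  ultimately show ?thesis using L mem by (intro bexI[OF _ L]) auto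
qed

theorem proposition4p1:
  shows
    "(\<forall>d\<ge>4. \<forall>L\<in>lattices d.
        (constructible_in (zariski_tuples d) (X_lat d L) \<and>
         constructible_in (zariski_forms d) (A_lat d L) \<and>
         G_invariant_tuples (X_lat d L) \<and> G_invariant_forms (A_lat d L) \<and>
         Galois_invariant_tuples (X_lat d L) \<and> Galois_invariant_forms (A_lat d L)) \<and>
        (X_lat d L \<subseteq> X_tau d (tau_lat L) \<and> A_lat d L \<subseteq> A_tau d (tau_lat L)) \<and>
        (mdr_locus d L \<noteq> {} \<and>
         closedin (subtopology (zariski_forms d) (A_lat d L)) (mdr_locus d L)) \<and>
        (\<forall>k. milnor_locus k d L \<noteq> {} \<and>
             openin (subtopology (zariski_forms d) (A_lat d L)) (milnor_locus k d L)))
     \<and> (\<exists>d\<ge>4. \<exists>L\<in>lattices d. mdr_locus d L \<noteq> A_lat d L)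
     \<and> (\<exists>d\<ge>4. \<exists>L\<in>lattices d. \<exists>k. milnor_locus k d L \<noteq> A_lat d L)"
proof (intro conjI allI impI ballI)
  fix d L assume "d \<ge> (4 :: nat)" and L: "L \<in> lattices d"
  then have "d \<ge> 2" by simp
  show "constructible_in (zariski_tuples d) (X_lat d L)" "constructible_in (zariski_forms d) (A_lat d L)"
    by (rule strata_constructible[OF L])+
  show "G_invariant_tuples (X_lat d L)" "G_invariant_forms (A_lat d L)"
    "Galois_invariant_tuples (X_lat d L)" "Galois_invariant_forms (A_lat d L)"
    by (rule strata_group_invariant[OF L])+
  show "X_lat d L \<subseteq> X_tau d (tau_lat L)" "A_lat d L \<subseteq> A_tau d (tau_lat L)"
    by (rule strata_tau[OF L \<open>d \<ge> 2\<close>])+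
  have "A_lat d L \<noteq> {}" using X_lat_nonempty[OF L] by (simp add: A_lat_def)
  then show "mdr_locus d L \<noteq> {}" "milnor_locus k d L \<noteq> {}" for k
    unfolding mdr_locus_def milnor_locus_def by (rule min_locus_nonempty)+
  show "closedin (subtopology (zariski_forms d) (A_lat d L)) (mdr_locus d L)"
    unfolding mdr_locus_def by (rule mdr_min_locus_closed[OF A_lat_PS])
  show "openin (subtopology (zariski_forms d) (A_lat d L)) (milnor_locus k d L)" for k
    unfolding milnor_locus_def by (rule milnor_min_locus_open[OF A_lat_PS])
next
  show "\<exists>d\<ge>4. \<exists>L\<in>lattices d. mdr_locus d L \<noteq> A_lat d L"
    using invariants_vary by (intro exI[of _ 9]) auto
  show "\<exists>d\<ge>4. \<exists>L\<in>lattices d. \<exists>k. milnor_locus k d L \<noteq> A_lat d L"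
    using invariants_vary by (intro exI[of _ 9]) auto
qed

end
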